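(* Let $\lambda=(\lambda_1,\lambda_2)\in P^+$ and $N\in\mathbb Z_{>0}$. Let $\lambda_2=qN+m$, $0\le m<N$, be the Euclidean division of $\lambda_2$ by $N$. For every $\kappa_1,\dots,\kappa_N\in\mathbb C$ such that $\kappa_1+\dots+\kappa_N=\lambda_1$ (and, if $q=0$, such that $\kappa_1=\dots=\kappa_{N-m}=0$) and pairwise-distinct $z_1,\dots,z_N\in\mathbb C$, there is an isomorphism of $\mathfrak g[t]$-modules $$W(\lambda,N)\cong K(\kappa_1,q)^{z_1}*\dots*K(\kappa_{N-m},q)^{z_{N-m}}*K(\kappa_{N-m+1},q+1)^{z_{N-m+1}}*\dots*K(\kappa_N,q+1)^{z_N}.$$
   Context: All vector spaces are over $\mathbb C$. $\mathfrak g=\mathfrak{sl}(1|2)$ is the Lie superalgebra of $3\times 3$ complex matrices $A=(a_{ij})$ with $a_{11}-a_{22}-a_{33}=0$; the even part consists of block-diagonal matrices (blocks of size $1$ and $2$), the odd part of block-off-diagonal matrices, and $[A,B]=AB-(-1)^{\bar i\bar j}BA$ for $A,B$ of parity $\bar i,\bar j$. Let $E_{i,j}$ be the matrix units, $x_1=E_{1,2}$, $x_2=E_{2,3}$, $x_3=E_{1,3}$, $y_i=x_i^t$, $h_1=E_{1,1}+E_{2,2}$, $h_2=E_{2,2}-E_{3,3}$, $\mathfrak h=\mathrm{span}\{h_1,h_2\}$, $\mathfrak n^+=\mathrm{span}\{y_1,x_2,x_3\}$. A weight $\lambda\in\mathfrak h^*$ is identified with $(\lambda_1,\lambda_2)=(\lambda(h_1),\lambda(h_2))$,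 and $P^+=\{\lambda\in\mathfrak h^*\mid\lambda_2\in\mathbb Z_{\ge1}\}\cup\{0\}$. Modules are $\mathbb Z_2$-graded; homomorphisms are linear maps commuting with the action and need not preserve parity. $\mathfrak g[t]=\mathfrak g\otimes\mathbb C[t]$, $x(m):=x\otimes t^m$, $[x(m),y(n)]=[x,y](m+n)$; $x=x(0)$. For $\mu\in P^+$, the generalized Kac module $K(\mu)$ is the quotient of $\mathbf U(\mathfrak g)$ by the left ideal generated by $\mathfrak n^+$, $h-\mu(h)$ ($h\in\mathfrak h$), $y_2^{\mu_2+1}$; $k_\mu$ is the image of $1$ ($K(0,0)$ is the trivial module). For $\lambda\in P^+$ and $N\in\mathbb Z_{\ge0}$, the truncated local Weyl module $W(\lambda,N)$ is the quotient of $\mathbf U(\mathfrak g[t])$ by the left ideal generated by $\mathfrak n^+[t]$, $h(r)-\lambda(h)\delta_{r,0}$ ($h\in\mathfrak h$, $r\in\mathbb Z_{\ge0}$), $y_2^{\lambda_2+1}$ and $\mathfrak g\otimes t^N\mathbb C[t]$. For a $\mathfrak g$-module $V$ and $z\in\mathbb C$, $V^z$ is the $\mathfrak g[t]$-module $V$ with $x(a)v=z^a\,xv$. Grade $\mathbf U(\mathfrak g[t])=\bigoplus_{s\ge0}\mathbf U(\mathfrak g[t])[s]$ by degree in $t$. For a $\mathfrak g[t]$-module $V$ with cyclic vector $v$, put $V^{\le n}=\sum_{i=0}^n\mathbf U(\mathfrak g[t])[i]v$ and let $\mathrm{Gr}_v(V)=\bigoplus_{n\ge0}V^{\le n}/V^{\le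 n-1}$ (with $V^{\le-1}=0$) be the associated graded $\mathfrak g[t]$-module. For cyclic $\mathfrak g$-modules $V_1,\dots,V_n$ with cyclic homogeneous even vectors $v_1,\dots,v_n$ and pairwise-distinct $z_1,\dots,z_n\in\mathbb C$, the fusion product is $V_1^{z_1}*\dots*V_n^{z_n}:=\mathrm{Gr}_{v_1\otimes\dots\otimes v_n}(V_1^{z_1}\otimes\dots\otimes V_n^{z_n})$. For generalized Kac modules the cyclic vector used is $k_\mu$. *)

theory Defs
  imports
    "HOL-Analysis.Cartesian_Space"
    "HOL-Computational_Algebra.Polynomial"
    "HOL-Library.Poly_Mapping"
    "HOL-Library.Z2"
    "HOL-Algebra.AbelCoset"
    "HOL-Algebra.Module"
begin

section \<open>Complex vector spaces as a type class\<close>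

class complex_vector = ab_group_add +
  fixes scaleC :: "complex \<Rightarrow> 'a \<Rightarrow> 'a" (infixr "*\<^sub>C" 75)
  assumes scaleC_right_distrib: "c *\<^sub>C (x + y) = c *\<^sub>C x + c *\<^sub>C y"
    and scaleC_left_distrib: "(c + d) *\<^sub>C x = c *\<^sub>C x + d *\<^sub>C x"
    and scaleC_scaleC: "c *\<^sub>C d *\<^sub>C x = (c * d) *\<^sub>C x"
    and scaleC_one: "1 *\<^sub>C x = x"

global_interpretation cvs: vector_space "scaleC :: complex \<Rightarrow> 'a \<Rightarrow> 'a :: complex_vector"
  defines cspan = cvs.span
  by unfold_locales
    (simp_all add: scaleC_right_distrib scaleC_left_distrib scaleC_scaleC scaleC_one)

instantiation complex :: complex_vector
begin
definition scaleC_complex :: "complex \<Rightarrow> complex \<Rightarrow> complex" where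
  "scaleC_complex = (*)"
instance by standard (simp_all add: scaleC_complex_def algebra_simps)
end

instantiation vec :: (complex_vector, finite) complex_vector
begin
definition scaleC_vec :: "complex \<Rightarrow> 'a ^ 'b \<Rightarrow> 'a ^ 'b" where
  "scaleC_vec c v = (\<chi> i. c *\<^sub>C (v $ i))"
instance
  by standard (simp_all add: scaleC_vec_def vec_eq_iff scaleC_right_distrib
      scaleC_left_distrib scaleC_scaleC scaleC_one)
end

instantiation poly_mapping :: (type, complex_vector) complex_vector
begin
lift_definition scaleC_poly_mapping :: "complex \<Rightarrow> ('a \<Rightarrow>\<^sub>0 'b) \<Rightarrow> ('a \<Rightarrow>\<^sub>0 'b)"
  is "\<lambda>c f x. c *\<^sub>C f x"
  by (erule finite_subset[rotated]) auto
instance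
  by standard (rule poly_mapping_eqI; simp add: scaleC_poly_mapping.rep_eq lookup_add
      scaleC_right_distrib scaleC_left_distrib scaleC_scaleC scaleC_one)+
end

instantiation poly :: (complex_vector) complex_vector
begin
lift_definition scaleC_poly :: "complex \<Rightarrow> 'a poly \<Rightarrow> 'a poly"
  is "\<lambda>c f n. c *\<^sub>C f n"
  by (erule MOST_rev_mp) simp
instance
  by standard (rule poly_eqI; simp add: scaleC_poly.rep_eq
      scaleC_right_distrib scaleC_left_distrib scaleC_scaleC scaleC_one)+
end


section \<open>Lie superalgebras\<close>

definition ksign :: "bit \<Rightarrow> complex" where
  "ksign b = (if b = 0 then 1 else - 1)"

text \<open>\<^term>\<open>hcomp i x\<close> is the component of parity \<^term>\<open>i\<close> of \<^term>\<open>x\<close>, so that the elements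
  of the form \<^term>\<open>hcomp i x\<close> are exactly the homogeneous elements of parity \<^term>\<open>i\<close>.\<close>

class lie_superalgebra = complex_vector +
  fixes hcomp :: "bit \<Rightarrow> 'a \<Rightarrow> 'a"
    and bracket :: "'a \<Rightarrow> 'a \<Rightarrow> 'a"
  assumes hcomp_add: "hcomp i (x + y) = hcomp i x + hcomp i y"
    and hcomp_scaleC: "hcomp i (c *\<^sub>C x) = c *\<^sub>C hcomp i x"
    and hcomp_hcomp: "hcomp i (hcomp j x) = (if i = j then hcomp i x else 0)"
    and hcomp_decomp: "hcomp 0 x + hcomp 1 x = x"
    and bracket_add_left: "bracket (x + y) z = bracket x z + bracket y z"
    and bracket_add_right: "bracket z (x + y) = bracket z x + bracket z y"
    and bracket_scaleC_left: "bracket (c *\<^sub>C x) y = c *\<^sub>C bracket x y"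
    and bracket_scaleC_right: "bracket x (c *\<^sub>C y) = c *\<^sub>C bracket x y"
    and bracket_parity:
      "hcomp (i + j) (bracket (hcomp i x) (hcomp j y)) = bracket (hcomp i x) (hcomp j y)"
    and bracket_skew:
      "bracket (hcomp i x) (hcomp j y) = - (ksign (i * j) *\<^sub>C bracket (hcomp j y) (hcomp i x))"
    and bracket_jacobi:
      "bracket (hcomp i x) (bracket (hcomp j y) z) =
         bracket (bracket (hcomp i x) (hcomp j y)) z +
         ksign (i * j) *\<^sub>C bracket (hcomp j y) (bracket (hcomp i x) z)"
begin

lemma bracket_zero_left: "bracket 0 y = 0"
  using bracket_add_left[of 0 0 y] by simp

lemma bracket_zero_right: "bracket y 0 = 0"
  using bracket_add_right[of y 0 0] by simp

lemma hcomp_zero: "hcomp i 0 = 0"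
  using hcomp_add[of i 0 0] by simp

end


subsection \<open>The current superalgebra \<open>\<gg>[t]\<close>, realised on polynomials with coefficients in \<open>\<gg>\<close>\<close>

lemma poly_monom_induct [case_names add monom]:
  assumes "\<And>p q. P p \<Longrightarrow> P q \<Longrightarrow> P (p + q)" and "\<And>a n. P (monom a n)"
  shows "P (p :: 'a :: ab_group_add poly)"
proof -
  have "P (\<Sum>i\<in>A. monom (coeff p i) i)" if "finite A" for A
    using that
  proof induction
    case empty
    show ?case using assms(2)[of 0 0] by simp
  next
    case (insert i A)
    then show ?case using assms by simp
  qed
  from this[of "{..degree p}"] show ?thesis
    by (simp add: poly_as_sum_of_monoms)
qed

instantiation poly :: (lie_superalgebra) lie_superalgebra
begin

lift_definition hcomp_poly :: "bit \<Rightarrow> 'a poly \<Rightarrow> 'a poly" is "\<lambda>i f n. hcomp i (f n)"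
  by (erule MOST_rev_mp) (simp add: hcomp_zero)

lift_definition bracket_poly :: "'a poly \<Rightarrow> 'a poly \<Rightarrow> 'a poly"
  is "\<lambda>f g n. \<Sum>i\<le>n. bracket (f i) (g (n - i))"
proof -
  fix f g :: "nat \<Rightarrow> 'a"
  assume "\<forall>\<^sub>\<infinity>n. f n = 0" and "\<forall>\<^sub>\<infinity>n. g n = 0"
  then obtain k l where k: "\<And>n. n > k \<Longrightarrow> f n = 0" and l: "\<And>n. n > l \<Longrightarrow> g n = 0"
    unfolding MOST_nat by blast
  have "(\<Sum>i\<le>n. bracket (f i) (g (n - i))) = 0" if "n > k + l" for n
  proof (rule sum.neutral, rule ballI)
    fix i assume "i \<in> {..n}"
    show "bracket (f i) (g (n - i)) = 0"
    proof (cases "i > k")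
      case True
      then show ?thesis using k by (simp add: bracket_zero_left)
    next
      case False
      then have "n - i > l" using that by auto
      then show ?thesis using l by (simp add: bracket_zero_right)
    qed
  qed
  then show "\<forall>\<^sub>\<infinity>n. (\<Sum>i\<le>n. bracket (f i) (g (n - i))) = 0"
    unfolding MOST_nat by blast
qed

lemma hcomp_monom: "hcomp i (monom a n) = monom (hcomp i a) n"
  by transfer (auto simp: fun_eq_iff hcomp_zero)

lemma scaleC_monom: "c *\<^sub>C monom (a :: 'a) n = monom (c *\<^sub>C a) n"
  by transfer (auto simp: fun_eq_iff)

lemma bracket_monom: "bracket (monom a m) (monom b n) = monom (bracket a b) (m + n)"
proof (rule poly_eqI)
  fix k
  have "coeff (bracket (monom a m) (monom b n)) k =
      (\<Sum>i\<le>k. bracket (if m = i then a else 0) (if n = k - i then b else 0))"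
    by (simp add: bracket_poly.rep_eq)
  also have "\<dots> = (\<Sum>i\<le>k. if i = m then (if n = k - m then bracket a b else 0) else 0)"
    by (rule sum.cong) (auto simp: bracket_zero_left bracket_zero_right)
  also have "\<dots> = coeff (monom (bracket a b) (m + n)) k"
    by (auto simp: sum.delta)
  finally show "coeff (bracket (monom a m) (monom b n)) k = coeff (monom (bracket a b) (m + n)) k" .
qed

instance
proof
  fix i j :: bit and x y z :: "'a poly" and c :: complex
  note coeffs = poly_eq_iff hcomp_poly.rep_eq bracket_poly.rep_eq scaleC_poly.rep_eq
  show add: "hcomp i (x + y) = hcomp i x + hcomp i y" for i and x y :: "'a poly"
    by (simp add: coeffs hcomp_add)
  show scale: "hcomp i (c *\<^sub>C x) = c *\<^sub>C hcomp i x"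
    by (simp add: coeffs hcomp_scaleC)
  show "hcomp i (hcomp j x) = (if i = j then hcomp i x else 0)"
    by (simp add: coeffs hcomp_hcomp)
  show "hcomp 0 x + hcomp 1 x = x"
    by (simp add: coeffs hcomp_decomp)
  show left: "bracket (x + y) z = bracket x z + bracket y z" for x y z :: "'a poly"
    by (simp add: coeffs bracket_add_left sum.distrib)
  show right: "bracket z (x + y) = bracket z x + bracket z y" for x y z :: "'a poly"
    by (simp add: coeffs bracket_add_right sum.distrib)
  show "bracket (c *\<^sub>C x) y = c *\<^sub>C bracket x y"
    by (simp add: coeffs bracket_scaleC_left cvs.scale_sum_right)
  show "bracket x (c *\<^sub>C y) = c *\<^sub>C bracket x y"
    by (simp add: coeffs bracket_scaleC_right cvs.scale_sum_right)
  show "hcomp (i + j) (bracket (hcomp i x) (hcomp j y)) = bracket (hcomp i x) (hcomp j y)"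
  proof (induction x rule: poly_monom_induct)
    case (monom a m)
    show ?case
      by (induction y rule: poly_monom_induct)
        (simp_all only: add right hcomp_monom bracket_monom bracket_parity)
  qed (simp add: add left)
  show "bracket (hcomp i x) (hcomp j y) = - (ksign (i * j) *\<^sub>C bracket (hcomp j y) (hcomp i x))"
  proof (induction x rule: poly_monom_induct)
    case (monom a m)
    show ?case
    proof (induction y rule: poly_monom_induct)
      case (monom b n)
      show ?case
        by (simp add: hcomp_monom bracket_monom scaleC_monom minus_monom add.commute[of n m]
            bracket_skew[of i a j b])
    qed (simp add: add left right scaleC_right_distrib)
  qed (simp add: add left right scaleC_right_distrib)
  show "bracket (hcomp i x) (bracket (hcomp j y) z) =
      bracket (bracket (hcomp i x) (hcomp j y)) z +
      ksign (i * j) *\<^sub>C bracket (hcomp j y) (bracket (hcomp i x) z)"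
  proof (induction x rule: poly_monom_induct)
    case (monom a m)
    show ?case
    proof (induction y rule: poly_monom_induct)
      case (monom b n)
      show ?case
      proof (induction z rule: poly_monom_induct)
        case (monom c k)
        show ?case
          by (simp add: hcomp_monom bracket_monom scaleC_monom add_monom add_ac
              bracket_jacobi[of i a j b c])
      qed (simp add: right scaleC_right_distrib)
    qed (simp add: add left right scaleC_right_distrib)
  qed (simp add: add left right scaleC_right_distrib)
qed

end


section \<open>The Lie superalgebra \<open>\<ss>\<ll>(1|2)\<close>\<close>

text \<open>Rows and columns are indexed by the type \<open>3\<close>, whose elements are \<open>1\<close>, \<open>2\<close> and \<open>3 = 0\<close>.\<close>

definition mat_hcomp :: "bit \<Rightarrow> complex ^ 3 ^ 3 \<Rightarrow> complex ^ 3 ^ 3" where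
  "mat_hcomp b A = (\<chi> i j. if (b = 0) = ((i = 1) = (j = 1)) then A $ i $ j else 0)"

definition mat_bracket :: "complex ^ 3 ^ 3 \<Rightarrow> complex ^ 3 ^ 3 \<Rightarrow> complex ^ 3 ^ 3" where
  "mat_bracket A B = (\<Sum>i\<in>{0, 1}. \<Sum>j\<in>{0, 1}.
     mat_hcomp i A ** mat_hcomp j B - ksign (i * j) *\<^sub>C (mat_hcomp j B ** mat_hcomp i A))"

typedef sl12 = "{A :: complex ^ 3 ^ 3. A $ 1 $ 1 - A $ 2 $ 2 - A $ 3 $ 3 = 0}"
  morphisms sl12_mat sl12_of_mat
  by (rule exI[of _ 0]) simp

setup_lifting type_definition_sl12

lemma scaleC_mat_nth: "(c *\<^sub>C (A :: complex ^ 3 ^ 3)) $ i $ j = c * A $ i $ j"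
  by (simp add: scaleC_vec_def scaleC_complex_def)

lemma mat_hcomp_nth:
  "mat_hcomp b A $ i $ j = (if (b = 0) = ((i = 1) = (j = 1)) then A $ i $ j else 0)"
  by (simp add: mat_hcomp_def)

lemma mat_mult_nth: "(A ** B) $ i $ j = (\<Sum>k\<in>UNIV. A $ i $ k * (B :: complex ^ 3 ^ 3) $ k $ j)"
  by (simp add: matrix_matrix_mult_def)

lemma mat_hcomp_add: "mat_hcomp i (A + B) = mat_hcomp i A + mat_hcomp i B"
  by (simp add: vec_eq_iff mat_hcomp_nth forall_3)

lemma mat_hcomp_scaleC: "mat_hcomp i (c *\<^sub>C A) = c *\<^sub>C mat_hcomp i A"
  by (simp add: vec_eq_iff mat_hcomp_nth scaleC_mat_nth forall_3)

lemma mat_hcomp_hcomp: "mat_hcomp i (mat_hcomp j A) = (if i = j then mat_hcomp i A else 0)"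
  by (cases i; cases j) (simp_all add: vec_eq_iff mat_hcomp_nth forall_3)

lemma mat_mult_scaleC:
  "(c *\<^sub>C A) ** B = c *\<^sub>C (A ** B)" "A ** (c *\<^sub>C B) = c *\<^sub>C (A ** B)"
  for A B :: "complex ^ 3 ^ 3"
  by (simp_all add: vec_eq_iff mat_mult_nth scaleC_mat_nth sum_distrib_left mult_ac)

lemma mat_mult_add:
  "(A + A') ** B = A ** B + A' ** B" "A ** (B + B') = A ** B + A ** B'"
  for A B :: "complex ^ 3 ^ 3"
  by (simp_all add: vec_eq_iff mat_mult_nth sum.distrib algebra_simps)

lemma mat_bracket_add:
  "mat_bracket (A + A') B = mat_bracket A B + mat_bracket A' B"
  "mat_bracket A (B + B') = mat_bracket A B + mat_bracket A B'"
  by (simp_all add: mat_bracket_def mat_hcomp_add mat_mult_add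
      scaleC_right_distrib)

lemma mat_bracket_scaleC:
  "mat_bracket (c *\<^sub>C A) B = c *\<^sub>C mat_bracket A B"
  "mat_bracket A (c *\<^sub>C B) = c *\<^sub>C mat_bracket A B"
  by (simp_all add: mat_bracket_def mat_hcomp_scaleC mat_mult_scaleC scaleC_scaleC
      scaleC_right_distrib cvs.scale_right_diff_distrib mult.commute)

lemma mat_bracket_hom:
  "mat_bracket (mat_hcomp i A) (mat_hcomp j B) =
     mat_hcomp i A ** mat_hcomp j B - ksign (i * j) *\<^sub>C (mat_hcomp j B ** mat_hcomp i A)"
  by (cases i; cases j)
    (simp_all add: mat_bracket_def mat_hcomp_hcomp vec_eq_iff mat_mult_nth scaleC_mat_nth)

lemma mat_hcomp_mult:
  "mat_hcomp (i + j) (mat_hcomp i A ** mat_hcomp j B) = mat_hcomp i A ** mat_hcomp j B"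
  by (cases i; cases j) (simp_all add: vec_eq_iff mat_hcomp_nth mat_mult_nth sum_3 forall_3)

lemma mat_bracket_parity:
  "mat_hcomp (i + j) (mat_bracket (mat_hcomp i A) (mat_hcomp j B)) =
     mat_bracket (mat_hcomp i A) (mat_hcomp j B)"
proof -
  have *: "mat_hcomp (i + j) (A - c *\<^sub>C B) = mat_hcomp (i + j) A - c *\<^sub>C mat_hcomp (i + j) B"
    for A B c
    using mat_hcomp_add[of "i + j" "A - c *\<^sub>C B" "c *\<^sub>C B"]
    by (simp only: diff_add_cancel mat_hcomp_scaleC eq_diff_eq)
  show ?thesis
    unfolding mat_bracket_hom *
    by (simp only: mat_hcomp_mult) (simp only: add.commute[of i j] mat_hcomp_mult)
qed

lemma mat_bracket_skew:
  "mat_bracket (mat_hcomp i A) (mat_hcomp j B) =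
     - (ksign (i * j) *\<^sub>C mat_bracket (mat_hcomp j B) (mat_hcomp i A))"
  unfolding mat_bracket_hom
  by (cases i; cases j) (simp_all add: ksign_def vec_eq_iff scaleC_mat_nth)

lemma mat_bracket_diff:
  "mat_bracket (A - A') B = mat_bracket A B - mat_bracket A' B"
  "mat_bracket A (B - B') = mat_bracket A B - mat_bracket A B'"
  using mat_bracket_add(1)[of "A - A'" A' B] mat_bracket_add(2)[of A "B - B'" B']
  by (simp_all only: diff_add_cancel eq_diff_eq)

lemma mat_bracket_hom_mult:
  "mat_bracket (mat_hcomp i A) (mat_hcomp j B ** mat_hcomp k C) =
     mat_hcomp i A ** (mat_hcomp j B ** mat_hcomp k C) -
     ksign (i * (j + k)) *\<^sub>C ((mat_hcomp j B ** mat_hcomp k C) ** mat_hcomp i A)"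
  "mat_bracket (mat_hcomp j B ** mat_hcomp k C) (mat_hcomp i A) =
     (mat_hcomp j B ** mat_hcomp k C) ** mat_hcomp i A -
     ksign ((j + k) * i) *\<^sub>C (mat_hcomp i A ** (mat_hcomp j B ** mat_hcomp k C))"
  using mat_bracket_hom[of i A "j + k" "mat_hcomp j B ** mat_hcomp k C"]
    mat_bracket_hom[of "j + k" "mat_hcomp j B ** mat_hcomp k C" i A]
  by (simp_all only: mat_hcomp_mult)

lemma mat_bracket_jacobi:
  "mat_bracket (mat_hcomp i A) (mat_bracket (mat_hcomp j B) C) =
     mat_bracket (mat_bracket (mat_hcomp i A) (mat_hcomp j B)) C +
     ksign (i * j) *\<^sub>C mat_bracket (mat_hcomp j B) (mat_bracket (mat_hcomp i A) C)"
proof -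
  have *: "mat_bracket (mat_hcomp i A) (mat_bracket (mat_hcomp j B) (mat_hcomp k C)) =
     mat_bracket (mat_bracket (mat_hcomp i A) (mat_hcomp j B)) (mat_hcomp k C) +
     ksign (i * j) *\<^sub>C mat_bracket (mat_hcomp j B) (mat_bracket (mat_hcomp i A) (mat_hcomp k C))"
    for k
    unfolding mat_bracket_hom mat_bracket_diff mat_bracket_scaleC mat_bracket_hom_mult
      matrix_mul_assoc
    by (cases i; cases j; cases k)
      (simp_all add: ksign_def vec_eq_iff scaleC_mat_nth)
  have C: "C = mat_hcomp 0 C + mat_hcomp 1 C"
    by (simp add: vec_eq_iff mat_hcomp_nth)
  show ?thesis
    by (subst (1 2 3) C) (simp only: mat_bracket_add * scaleC_right_distrib add_ac)
qed

instantiation sl12 :: lie_superalgebra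
begin

lift_definition zero_sl12 :: sl12 is 0 by simp
lift_definition plus_sl12 :: "sl12 \<Rightarrow> sl12 \<Rightarrow> sl12" is "(+)" by (simp add: algebra_simps)
lift_definition minus_sl12 :: "sl12 \<Rightarrow> sl12 \<Rightarrow> sl12" is "(-)" by (simp add: algebra_simps)
lift_definition uminus_sl12 :: "sl12 \<Rightarrow> sl12" is "uminus" by (simp add: algebra_simps)
lift_definition scaleC_sl12 :: "complex \<Rightarrow> sl12 \<Rightarrow> sl12" is "scaleC"
  by (simp add: scaleC_mat_nth flip: right_diff_distrib)
lift_definition hcomp_sl12 :: "bit \<Rightarrow> sl12 \<Rightarrow> sl12" is mat_hcomp
  by (simp add: mat_hcomp_nth)
lift_definition bracket_sl12 :: "sl12 \<Rightarrow> sl12 \<Rightarrow> sl12" is mat_bracket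
  by (simp add: mat_bracket_def mat_hcomp_nth mat_mult_nth scaleC_mat_nth ksign_def sum_3)

instance
proof
  fix i j :: bit and x y z :: sl12 and c d :: complex
  show "x + y + z = x + (y + z)" by transfer (rule add.assoc)
  show "x + y = y + x" by transfer (rule add.commute)
  show "0 + x = x" by transfer simp
  show "- x + x = 0" by transfer simp
  show "x - y = x + - y" by transfer simp
  show "c *\<^sub>C (x + y) = c *\<^sub>C x + c *\<^sub>C y" by transfer (rule scaleC_right_distrib)
  show "(c + d) *\<^sub>C x = c *\<^sub>C x + d *\<^sub>C x" by transfer (rule scaleC_left_distrib)
  show "c *\<^sub>C d *\<^sub>C x = (c * d) *\<^sub>C x" by transfer (rule scaleC_scaleC)
  show "1 *\<^sub>C x = x" by transfer (rule scaleC_one)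
  show "hcomp i (x + y) = hcomp i x + hcomp i y"
    by transfer (rule mat_hcomp_add)
  show "hcomp i (c *\<^sub>C x) = c *\<^sub>C hcomp i x"
    by transfer (rule mat_hcomp_scaleC)
  show "hcomp i (hcomp j x) = (if i = j then hcomp i x else 0)"
    by transfer (rule mat_hcomp_hcomp)
  show "hcomp 0 x + hcomp 1 x = x"
    by transfer (simp add: vec_eq_iff mat_hcomp_nth)
  show "bracket (x + y) z = bracket x z + bracket y z"
    by transfer (rule mat_bracket_add)
  show "bracket z (x + y) = bracket z x + bracket z y"
    by transfer (rule mat_bracket_add)
  show "bracket (c *\<^sub>C x) y = c *\<^sub>C bracket x y"
    by transfer (rule mat_bracket_scaleC)
  show "bracket x (c *\<^sub>C y) = c *\<^sub>C bracket x y"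
    by transfer (rule mat_bracket_scaleC)
  show "hcomp (i + j) (bracket (hcomp i x) (hcomp j y)) = bracket (hcomp i x) (hcomp j y)"
    by transfer (rule mat_bracket_parity)
  show "bracket (hcomp i x) (hcomp j y) = - (ksign (i * j) *\<^sub>C bracket (hcomp j y) (hcomp i x))"
    by transfer (rule mat_bracket_skew)
  show "bracket (hcomp i x) (bracket (hcomp j y) z) =
      bracket (bracket (hcomp i x) (hcomp j y)) z +
      ksign (i * j) *\<^sub>C bracket (hcomp j y) (bracket (hcomp i x) z)"
    by transfer (rule mat_bracket_jacobi)
qed

end


section \<open>The universal enveloping algebra\<close>

text \<open>
  The free associative algebra on the letters \<open>x \<in> L\<close> is the monoid algebra of the free monoid
  on \<open>L\<close>, i.e. of lists under concatenation. \<open>\<^bold>U(L)\<close> is its quotient by the two-sided ideal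
  generated by the relations that make the letters linear (which yields the tensor algebra of
  \<open>L\<close>) together with \<open>xy - (-1)\<^bsup>ij\<^esup>yx = [x,y]\<close> for \<open>x\<close>, \<open>y\<close> of parity \<open>i\<close>, \<open>j\<close>.
\<close>

instantiation list :: (type) monoid_add
begin
definition zero_list :: "'a list" where "0 = []"
definition plus_list :: "'a list \<Rightarrow> 'a list \<Rightarrow> 'a list" where "xs + ys = xs @ ys"
instance by standard (simp_all add: zero_list_def plus_list_def)
end

type_synonym 'a free_alg = "'a list \<Rightarrow>\<^sub>0 complex"

definition letter :: "'a \<Rightarrow> 'a free_alg" where
  "letter x = Poly_Mapping.single [x] 1"

definition uea_relators :: "'a :: lie_superalgebra free_alg set" where
  "uea_relators =
     {letter (x + y) - letter x - letter y | x y. True} \<union>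
     {letter (c *\<^sub>C x) - c *\<^sub>C letter x | c x. True} \<union>
     {letter (hcomp i x) * letter (hcomp j y)
        - ksign (i * j) *\<^sub>C (letter (hcomp j y) * letter (hcomp i x))
        - letter (bracket (hcomp i x) (hcomp j y)) | i j x y. True}"

definition uea_ideal :: "'a :: lie_superalgebra free_alg set" where
  "uea_ideal = cspan {a * r * b | a r b. r \<in> uea_relators}"

definition uea_rel :: "'a :: lie_superalgebra free_alg \<Rightarrow> 'a free_alg \<Rightarrow> bool" where
  "uea_rel p q \<longleftrightarrow> p - q \<in> uea_ideal"

lemma scaleC_free_alg: "c *\<^sub>C p = Poly_Mapping.single 0 c * (p :: 'a free_alg)"
  by (simp flip: mult_map_scale_conv_mult)
    (rule poly_mapping_eqI, simp add: scaleC_poly_mapping.rep_eq scaleC_complex_def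
      Poly_Mapping.map.rep_eq when_def)

lemma scaleC_mult_left: "(c *\<^sub>C p) * q = c *\<^sub>C (p * q :: 'a free_alg)"
  by (simp add: scaleC_free_alg mult.assoc)

lemma scaleC_mult_right: "p * (c *\<^sub>C q) = c *\<^sub>C (p * q :: 'a free_alg)"
proof -
  have "p * Poly_Mapping.single 0 c = Poly_Mapping.single 0 c * p"
  proof (induction p rule: update_induct)
    case const
    then show ?case by simp
  next
    case (update f a b)
    have "Poly_Mapping.update a b f = f + Poly_Mapping.single a b"
      using update.hyps
      by (intro poly_mapping_eqI) (auto simp: lookup_update lookup_add lookup_single
          not_in_keys_iff_lookup_eq_zero when_def)
    with update.IH show ?case
      by (simp add: distrib_left distrib_right mult_single mult.commute)
  qed
  then show ?thesis by (simp add: scaleC_free_alg flip: mult.assoc)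
qed

lemma uea_ideal_mult:
  assumes "r \<in> uea_ideal"
  shows "p * r * q \<in> uea_ideal"
  using assms unfolding uea_ideal_def
proof (induction r rule: cvs.span_induct_alt)
  case base
  show ?case by (simp add: cvs.span_zero)
next
  case (step c x y)
  then obtain a r b where x: "x = a * r * b" and r: "r \<in> uea_relators"
    by blast
  have "p * x * q = (p * a) * r * (b * q)"
    by (simp add: x mult.assoc)
  with r have "p * x * q \<in> cspan {a * r * b | a r b. r \<in> uea_relators}"
    by (intro cvs.span_base) blast
  then show ?case
    using step.IH by (simp add: distrib_left distrib_right scaleC_mult_left scaleC_mult_right
        cvs.span_add cvs.span_scale)
qed

lemma uea_ideal_closed:
  "0 \<in> uea_ideal"
  "p \<in> uea_ideal \<Longrightarrow> q \<in> uea_ideal \<Longrightarrow> p + q \<in> uea_ideal"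
  "p \<in> uea_ideal \<Longrightarrow> q \<in> uea_ideal \<Longrightarrow> p - q \<in> uea_ideal"
  "p \<in> uea_ideal \<Longrightarrow> - p \<in> uea_ideal"
  "p \<in> uea_ideal \<Longrightarrow> c *\<^sub>C p \<in> uea_ideal"
  by (simp_all add: uea_ideal_def cvs.span_zero cvs.span_add cvs.span_diff cvs.span_neg
      cvs.span_scale)

quotient_type (overloaded) 'a uea = "'a :: lie_superalgebra free_alg" / uea_rel
proof (rule equivpI)
  show "reflp uea_rel"
    by (simp add: reflp_def uea_rel_def uea_ideal_closed)
  show "symp uea_rel"
    using uea_ideal_closed(4) by (fastforce simp: symp_def uea_rel_def)
  show "transp uea_rel"
    using uea_ideal_closed(2) by (fastforce simp: transp_def uea_rel_def)
qed

instantiation uea :: (lie_superalgebra) "{ring, monoid_mult, complex_vector}"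
begin

lift_definition zero_uea :: "'a uea" is 0 .
lift_definition one_uea :: "'a uea" is 1 .
lift_definition plus_uea :: "'a uea \<Rightarrow> 'a uea \<Rightarrow> 'a uea" is "(+)"
  unfolding uea_rel_def
  by (drule (1) uea_ideal_closed(2)) (simp add: algebra_simps)
lift_definition minus_uea :: "'a uea \<Rightarrow> 'a uea \<Rightarrow> 'a uea" is "(-)"
  unfolding uea_rel_def
  by (drule (1) uea_ideal_closed(3)) (simp add: algebra_simps)
lift_definition uminus_uea :: "'a uea \<Rightarrow> 'a uea" is uminus
  unfolding uea_rel_def
  by (drule uea_ideal_closed(4)) (simp add: algebra_simps)
lift_definition scaleC_uea :: "complex \<Rightarrow> 'a uea \<Rightarrow> 'a uea" is scaleC
  unfolding uea_rel_def
  by (drule uea_ideal_closed(5)) (simp add: cvs.scale_right_diff_distrib)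
lift_definition times_uea :: "'a uea \<Rightarrow> 'a uea \<Rightarrow> 'a uea" is "(*)"
  unfolding uea_rel_def
proof -
  fix p p' q q' :: "'a free_alg"
  assume "p - p' \<in> uea_ideal" and "q - q' \<in> uea_ideal"
  then have "1 * (p - p') * q + p' * (q - q') * 1 \<in> uea_ideal"
    by (intro uea_ideal_closed(2) uea_ideal_mult)
  then show "p * q - p' * q' \<in> uea_ideal"
    by (simp add: algebra_simps)
qed

instance
  by standard (transfer; simp add: uea_rel_def uea_ideal_closed algebra_simps
      scaleC_right_distrib scaleC_left_distrib scaleC_scaleC scaleC_one)+

end

lift_definition uea_of :: "'a :: lie_superalgebra \<Rightarrow> 'a uea" is letter .

definition left_ideal :: "'a :: lie_superalgebra uea set \<Rightarrow> 'a uea set" where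
  "left_ideal S = cspan {u * s | u s. s \<in> S}"

definition uea_hpart :: "bit \<Rightarrow> 'a :: lie_superalgebra uea set" where
  "uea_hpart b = cspan {prod_list (map (\<lambda>(i, x). uea_of (hcomp i x)) w) | w.
     sum_list (map fst w) = b}"

text \<open>The grading of \<open>\<^bold>U(\<gg>[t])\<close> by degree in \<open>t\<close>.\<close>

definition uea_deg :: "nat \<Rightarrow> 'a :: lie_superalgebra poly uea set" where
  "uea_deg s = cspan {prod_list (map (\<lambda>(x, m). uea_of (monom x m)) w) | w.
     sum_list (map snd w) = s}"


section \<open>Graded modules over a Lie superalgebra\<close>

text \<open>
  The fields \<open>\<otimes>\<close> and \<open>\<one>\<close> inherited from the records of \<open>HOL-Algebra\<close> carry no meaning here.
\<close>

record ('a, 'v) smodule = "(complex, 'v) module" +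
  act :: "'a \<Rightarrow> 'v \<Rightarrow> 'v"
  hpart :: "bit \<Rightarrow> 'v set"

definition smodule_iso :: "('a, 'v) smodule \<Rightarrow> ('a, 'w) smodule \<Rightarrow> ('v \<Rightarrow> 'w) set" where
  "smodule_iso M N = {f \<in> iso (add_monoid M) (add_monoid N).
     (\<forall>c. \<forall>v\<in>carrier M. f (c \<odot>\<^bsub>M\<^esub> v) = c \<odot>\<^bsub>N\<^esub> f v) \<and>
     (\<forall>x. \<forall>v\<in>carrier M. f (act M x v) = act N x (f v))}"

definition smodule_isomorphic ::
    "('a, 'v) smodule \<Rightarrow> ('a, 'w) smodule \<Rightarrow> bool" (infix "\<cong>\<^sub>s" 50) where
  "M \<cong>\<^sub>s N \<longleftrightarrow> smodule_iso M N \<noteq> {}"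

definition quot_smodule :: "('a, 'v) smodule \<Rightarrow> 'v set \<Rightarrow> ('a, 'v set) smodule" where
  "quot_smodule M S = \<lparr>
     carrier = a_rcosets\<^bsub>M\<^esub> S,
     mult = undefined, one = undefined,
     zero = S, add = set_add M,
     smult = \<lambda>c X. \<Union>v\<in>X. S +>\<^bsub>M\<^esub> (c \<odot>\<^bsub>M\<^esub> v),
     act = \<lambda>x X. \<Union>v\<in>X. S +>\<^bsub>M\<^esub> act M x v,
     hpart = \<lambda>b. (\<lambda>v. S +>\<^bsub>M\<^esub> v) ` hpart M b\<rparr>"

definition regular_smodule :: "('a :: lie_superalgebra, 'a uea) smodule" where
  "regular_smodule = \<lparr>
     carrier = UNIV,
     mult = undefined, one = undefined,
     zero = 0, add = (+), smult = scaleC,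
     act = \<lambda>x u. uea_of x * u,
     hpart = uea_hpart\<rparr>"

abbreviation uea_quot :: "'a :: lie_superalgebra uea set \<Rightarrow> ('a, 'a uea set) smodule" where
  "uea_quot S \<equiv> quot_smodule regular_smodule (left_ideal S)"

text \<open>The action of \<open>\<^bold>U(L)\<close> on an \<open>L\<close>-module; the result does not depend on the chosen
  representative in the free algebra.\<close>

definition uea_act :: "('a :: lie_superalgebra, 'v) smodule \<Rightarrow> 'a uea \<Rightarrow> 'v \<Rightarrow> 'v" where
  "uea_act M u v = (let p = rep_uea u in
     \<Oplus>\<^bsub>M\<^esub>w\<in>Poly_Mapping.keys p. Poly_Mapping.lookup p w \<odot>\<^bsub>M\<^esub> foldr (act M) w v)"


subsection \<open>Tensor products\<close>

text \<open>\<open>koszul M b v\<close> is \<open>(-1)\<^bsup>b|v|\<^esup>v\<close>, extended linearly to non-homogeneous \<open>v\<close>.\<close>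

definition koszul :: "('a, 'v) smodule \<Rightarrow> bit \<Rightarrow> 'v \<Rightarrow> 'v" where
  "koszul M b v = (THE w. \<exists>v0\<in>hpart M 0. \<exists>v1\<in>hpart M 1.
     v = v0 \<oplus>\<^bsub>M\<^esub> v1 \<and> w = v0 \<oplus>\<^bsub>M\<^esub> (ksign b \<odot>\<^bsub>M\<^esub> v1))"

definition tensor_tuples :: "('a, 'v) smodule list \<Rightarrow> 'v list set" where
  "tensor_tuples Ms = {vs. length vs = length Ms \<and> (\<forall>i < length Ms. vs ! i \<in> carrier (Ms ! i))}"

definition tensor_relators :: "('a, 'v) smodule list \<Rightarrow> ('v list \<Rightarrow>\<^sub>0 complex) set" where
  "tensor_relators Ms =
     {Poly_Mapping.single (vs[i := u \<oplus>\<^bsub>Ms ! i\<^esub> w]) 1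
        - Poly_Mapping.single (vs[i := u]) 1 - Poly_Mapping.single (vs[i := w]) 1 | vs i u w.
        vs \<in> tensor_tuples Ms \<and> i < length Ms \<and> u \<in> carrier (Ms ! i) \<and> w \<in> carrier (Ms ! i)} \<union>
     {Poly_Mapping.single (vs[i := c \<odot>\<^bsub>Ms ! i\<^esub> u]) 1
        - c *\<^sub>C Poly_Mapping.single (vs[i := u]) 1 | vs i c u.
        vs \<in> tensor_tuples Ms \<and> i < length Ms \<and> u \<in> carrier (Ms ! i)}"

text \<open>
  \<open>x(v\<^sub>1 \<otimes> \<dots> \<otimes> v\<^sub>n) = \<Sum>\<^sub>i (-1)\<^bsup>|x|(|v\<^sub>1| + \<dots> + |v\<^sub>i\<^sub>-\<^sub>1|)\<^esup> v\<^sub>1 \<otimes> \<dots> \<otimes> x v\<^sub>i \<otimes> \<dots> \<otimes> v\<^sub>n\<close>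
\<close>

definition tensor_tuple_act ::
    "('a :: lie_superalgebra, 'v) smodule list \<Rightarrow> 'a \<Rightarrow> 'v list \<Rightarrow> ('v list \<Rightarrow>\<^sub>0 complex)" where
  "tensor_tuple_act Ms x vs = (\<Sum>b\<in>{0, 1}. \<Sum>i<length Ms. Poly_Mapping.single
     (map (\<lambda>k. if k < i then koszul (Ms ! k) b (vs ! k)
               else if k = i then act (Ms ! i) (hcomp b x) (vs ! i)
               else vs ! k) [0..<length Ms]) 1)"

text \<open>The free vector space on all tuples; the action on it and its parts only become
  meaningful modulo \<^const>\<open>tensor_relators\<close>.\<close>

definition free_tensor ::
    "('a :: lie_superalgebra, 'v) smodule list \<Rightarrow> ('a, 'v list \<Rightarrow>\<^sub>0 complex) smodule" where
  "free_tensor Ms = \<lparr>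
     carrier = {p. Poly_Mapping.keys p \<subseteq> tensor_tuples Ms},
     mult = undefined, one = undefined,
     zero = 0, add = (+), smult = scaleC,
     act = \<lambda>x p. \<Sum>vs\<in>Poly_Mapping.keys p.
       Poly_Mapping.lookup p vs *\<^sub>C tensor_tuple_act Ms x vs,
     hpart = \<lambda>b. cspan {Poly_Mapping.single vs 1 | vs bs.
       length vs = length Ms \<and> length bs = length Ms \<and>
       (\<forall>i < length Ms. vs ! i \<in> hpart (Ms ! i) (bs ! i)) \<and> sum_list bs = b}\<rparr>"

type_synonym 'v tensor = "('v list \<Rightarrow>\<^sub>0 complex) set"

definition tensor_smodule ::
    "('a :: lie_superalgebra, 'v) smodule list \<Rightarrow> ('a, 'v tensor) smodule" where
  "tensor_smodule Ms = quot_smodule (free_tensor Ms) (cspan (tensor_relators Ms))"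

definition pure_tensor ::
    "('a :: lie_superalgebra, 'v) smodule list \<Rightarrow> 'v list \<Rightarrow> 'v tensor" where
  "pure_tensor Ms vs = cspan (tensor_relators Ms) +>\<^bsub>free_tensor Ms\<^esub> Poly_Mapping.single vs 1"


section \<open>Modules over the current superalgebra\<close>

text \<open>The \<open>\<gg>[t]\<close>-module \<open>V\<^sup>z\<close>\<close>

definition eval_smodule ::
    "complex \<Rightarrow> ('a :: lie_superalgebra, 'v) smodule \<Rightarrow> ('a poly, 'v) smodule" where
  "eval_smodule z V = \<lparr>
     carrier = carrier V, mult = undefined, one = undefined,
     zero = zero V, add = add V, smult = smult V,
     act = \<lambda>p v. \<Oplus>\<^bsub>V\<^esub>k\<in>{..degree p}. z ^ k \<odot>\<^bsub>V\<^esub> act V (coeff p k) v,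
     hpart = hpart V\<rparr>"

text \<open>\<open>V\<^bsup>\<le>n\<^esup>\<close>, and \<open>V\<^bsup>\<le>n-1\<^esup>\<close> with \<open>V\<^bsup>\<le>-1\<^esup> = 0\<close>\<close>

definition filt :: "('a :: lie_superalgebra poly, 'v) smodule \<Rightarrow> 'v \<Rightarrow> nat \<Rightarrow> 'v set" where
  "filt V v n = {\<Oplus>\<^bsub>V\<^esub>i\<in>{..n}. uea_act V (u i) v | u. \<forall>i\<le>n. u i \<in> uea_deg i}"

definition filt_prev :: "('a :: lie_superalgebra poly, 'v) smodule \<Rightarrow> 'v \<Rightarrow> nat \<Rightarrow> 'v set" where
  "filt_prev V v n = (case n of 0 \<Rightarrow> {\<zero>\<^bsub>V\<^esub>} | Suc k \<Rightarrow> filt V v k)"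

text \<open>The component \<open>V\<^bsup>\<le>n\<^esup> / V\<^bsup>\<le>n-1\<^esup>\<close>, of which only the structure of a graded vector space is used\<close>

definition gr_part ::
    "('a :: lie_superalgebra poly, 'v) smodule \<Rightarrow> 'v \<Rightarrow> nat \<Rightarrow> ('a poly, 'v set) smodule" where
  "gr_part V v n = quot_smodule
     (V\<lparr>carrier := filt V v n, hpart := \<lambda>b. hpart V b \<inter> filt V v n\<rparr>) (filt_prev V v n)"

text \<open>
  \<open>x \<otimes> t\<^sup>s\<close> maps the class of \<open>w \<in> V\<^bsup>\<le>n\<^esup>\<close> modulo \<open>V\<^bsup>\<le>n-1\<^esup>\<close> to the class of \<open>(x \<otimes> t\<^sup>s)w \<in> V\<^bsup>\<le>n+s\<^esup>\<close>
  modulo \<open>V\<^bsup>\<le>n+s-1\<^esup>\<close>.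
\<close>

definition gr_smodule ::
    "('a :: lie_superalgebra poly, 'v) smodule \<Rightarrow> 'v \<Rightarrow> ('a poly, nat \<Rightarrow> 'v set) smodule" where
  "gr_smodule V v = (let
       C = {f. (\<forall>n. f n \<in> carrier (gr_part V v n)) \<and> finite {n. f n \<noteq> \<zero>\<^bsub>gr_part V v n\<^esub>}}
     in \<lparr>
     carrier = C,
     mult = undefined, one = undefined,
     zero = \<lambda>n. \<zero>\<^bsub>gr_part V v n\<^esub>,
     add = \<lambda>f g n. f n \<oplus>\<^bsub>gr_part V v n\<^esub> g n,
     smult = \<lambda>c f n. c \<odot>\<^bsub>gr_part V v n\<^esub> f n,
     act = \<lambda>p f n. \<Oplus>\<^bsub>gr_part V v n\<^esub>s\<in>{..n}.
       \<Union>w\<in>f (n - s). filt_prev V v n +>\<^bsub>V\<^esub> act V (monom (coeff p s) s) w,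
     hpart = \<lambda>b. {f \<in> C. \<forall>n. f n \<in> hpart (gr_part V v n) b}\<rparr>)"

text \<open>The fusion product of cyclic modules \<open>V\<^sub>i\<close> with cyclic vectors \<open>v\<^sub>i\<close> at the points \<open>z\<^sub>i\<close>, given
  as a list of triples \<open>(V\<^sub>i, v\<^sub>i, z\<^sub>i)\<close>\<close>

definition fusion_product ::
    "(('a :: lie_superalgebra, 'v) smodule \<times> 'v \<times> complex) list \<Rightarrow>
       ('a poly, nat \<Rightarrow> 'v tensor set) smodule" where
  "fusion_product Vs = (let Ms = map (\<lambda>(V, v, z). eval_smodule z V) Vs in
     gr_smodule (tensor_smodule Ms) (pure_tensor Ms (map (\<lambda>(V, v, z). v) Vs)))"


section \<open>Generalized Kac modules and truncated local Weyl modules for \<open>\<ss>\<ll>(1|2)\<close>\<close>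

definition mat_unit :: "3 \<Rightarrow> 3 \<Rightarrow> complex ^ 3 ^ 3" where
  "mat_unit k l = (\<chi> i j. if i = k \<and> j = l then 1 else 0)"

lift_definition x1 :: sl12 is "mat_unit 1 2" by (simp add: mat_unit_def)
lift_definition x2 :: sl12 is "mat_unit 2 3" by (simp add: mat_unit_def)
lift_definition x3 :: sl12 is "mat_unit 1 3" by (simp add: mat_unit_def)
lift_definition y1 :: sl12 is "transpose (mat_unit 1 2)" by (simp add: mat_unit_def transpose_def)
lift_definition y2 :: sl12 is "transpose (mat_unit 2 3)" by (simp add: mat_unit_def transpose_def)
lift_definition y3 :: sl12 is "transpose (mat_unit 1 3)" by (simp add: mat_unit_def transpose_def)
lift_definition h1 :: sl12 is "mat_unit 1 1 + mat_unit 2 2" by (simp add: mat_unit_def)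
lift_definition h2 :: sl12 is "mat_unit 2 2 - mat_unit 3 3" by (simp add: mat_unit_def)

definition nplus :: "sl12 set" where
  "nplus = cspan {y1, x2, x3}"

text \<open>A weight \<open>\<lambda> \<in> \<hh>\<^sup>*\<close> is given by the pair \<open>(\<lambda>(h\<^sub>1), \<lambda>(h\<^sub>2))\<close>; hence \<open>\<lambda>(a h\<^sub>1 + b h\<^sub>2)\<close> is
  \<open>a \<lambda>\<^sub>1 + b \<lambda>\<^sub>2\<close>.\<close>

type_synonym weight = "complex \<times> complex"

definition Pplus :: "weight set" where
  "Pplus = {mu. \<exists>n :: nat. n \<ge> 1 \<and> snd mu = of_nat n} \<union> {(0, 0)}"

text \<open>The exponent \<open>n + 1\<close> is \<open>\<mu>\<^sub>2 + 1\<close>, with \<open>\<mu>\<^sub>2\<close> a natural number for \<open>\<mu> \<in> P\<^sup>+\<close>.\<close>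

definition kac_relators :: "weight \<Rightarrow> sl12 uea set" where
  "kac_relators mu =
     uea_of ` nplus \<union>
     {uea_of (a *\<^sub>C h1 + b *\<^sub>C h2) - (a * fst mu + b * snd mu) *\<^sub>C 1 | a b. True} \<union>
     {uea_of y2 ^ (n + 1) | n. of_nat n = snd mu}"

definition kac :: "weight \<Rightarrow> (sl12, sl12 uea set) smodule" where
  "kac mu = uea_quot (kac_relators mu)"

definition kac_vec :: "weight \<Rightarrow> sl12 uea set" where
  "kac_vec mu = left_ideal (kac_relators mu) +>\<^bsub>regular_smodule\<^esub> 1"

text \<open>The factor \<open>K(\<mu>)\<^sup>z\<close> of a fusion product, with its cyclic vector \<open>k\<^sub>\<mu>\<close>\<close>

definition kac_factor :: "weight \<Rightarrow> complex \<Rightarrow>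
    (sl12, sl12 uea set) smodule \<times> sl12 uea set \<times> complex" where
  "kac_factor mu z = (kac mu, kac_vec mu, z)"

definition weyl_relators :: "weight \<Rightarrow> nat \<Rightarrow> sl12 poly uea set" where
  "weyl_relators la N =
     uea_of ` {p. \<forall>r. coeff p r \<in> nplus} \<union>
     {uea_of (monom (a *\<^sub>C h1 + b *\<^sub>C h2) r)
        - (if r = 0 then a * fst la + b * snd la else 0) *\<^sub>C 1 | a b r. True} \<union>
     {uea_of (monom y2 0) ^ (n + 1) | n. of_nat n = snd la} \<union>
     uea_of ` {p. \<forall>r<N. coeff p r = 0}"

definition weyl :: "weight \<Rightarrow> nat \<Rightarrow> (sl12 poly, sl12 poly uea set) smodule" where
  "weyl la N = uea_quot (weyl_relators la N)"

end

theory Submission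
  imports Defs "HOL-Library.Multiset"
begin

text \<open>
Write \<open>U\<close> for the enveloping algebra of the current superalgebra, \<open>L\<close> for the left ideal that defines
the truncated Weyl module, \<open>v\<close> for the tensor product of the highest weight vectors of the Kac modules,
and \<open>K\<close> for its annihilator in \<open>U\<close>. The associated graded module of the tensor product is the quotient
of \<open>U\<close> by the left ideal \<open>G\<close> of all \<open>u\<close> each of whose components of degree \<open>n\<close> agrees modulo \<open>K\<close> with an
element of degree less than \<open>n\<close>. The theorem says \<open>L = G\<close>.

The inclusion of \<open>L\<close> in \<open>G\<close> is a check of relations (\<open>weyl_relators_gann\<close>). An element of positive degree
in the Cartan part acts on \<open>v\<close> by a scalar, hence vanishes in the graded module; the power of
\<open>y\<^sub>2\<close> dies because its exponent exceeds the sum of the exponents allowed in the factors; and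
\<open>t^r\<close> with \<open>r \<ge> N\<close> may be completed by lower terms to a polynomial that vanishes at all \<open>N\<close>
evaluation points.

The converse is a count of dimensions (\<open>gann_eqI\<close>). Put \<open>D\<close> for the product of the numbers
\<open>kac_dim\<close> over the factors, that is \<open>4n\<close> for \<open>n > 0\<close> and \<open>1\<close> for \<open>n = 0\<close>.

Lower bound: an explicit module shows that each Kac module has at least \<open>kac_dim n\<close> independent vectors
(\<open>kac_coordinates\<close>), and Lagrange interpolation in \<open>t\<close> lets one act on one tensor slot at
a time, so that \<open>v\<close> generates the tensor product and \<open>U\<close> modulo \<open>K\<close> contains \<open>D\<close> independent
elements (\<open>tensor_coordinates\<close>).

Upper bound: \<open>U\<close> is spanned modulo \<open>L\<close> by at most \<open>D\<close> homogeneous elements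
(\<open>weyl_spanning_set\<close>). By the PBW filtration only words in the commuting operators \<open>y\<^sub>2 t^i\<close> and
the anticommuting operators \<open>x\<^sub>1 t^i\<close> and \<open>y\<^sub>3 t^i\<close> with \<open>i < N\<close> matter. Garland's argument, applied with the
indices reversed, bounds below the order in \<open>s\<close> at which the coefficients of powers of the generating
function of \<open>y\<^sub>2\<close> can be nonzero. This order is
the sum over the factors of the positive parts of \<open>r - \<eta>\<^sub>j\<close>, where \<open>\<eta>\<close> lists \<open>q\<close> and \<open>q + 1\<close> with
their multiplicities. From this single piece of information an induction counts
the words: with the even current alone the bound is the product of the \<open>\<eta>\<^sub>j + 1\<close> (\<open>even_phase\<close>), and an
odd current either kills the vector or lowers one \<open>\<eta>\<^sub>j\<close> by one, which replaces each factor \<open>\<phi>(\<eta>\<^sub>j)\<close> by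
\<open>\<phi>(\<eta>\<^sub>j) + \<phi>(\<eta>\<^sub>j - 1)\<close> (\<open>odd_phase\<close>). Two odd currents turn
\<open>\<eta>\<^sub>j + 1\<close> into \<open>4\<eta>\<^sub>j\<close> if \<open>\<eta>\<^sub>j > 0\<close>.
\<close>

section \<open>Linear maps and cyclic subspaces\<close>

definition clin :: "('v::complex_vector \<Rightarrow> 'w::complex_vector) \<Rightarrow> bool" where
  "clin f \<longleftrightarrow> (\<forall>x y. f (x + y) = f x + f y) \<and> (\<forall>c x. f (c *\<^sub>C x) = c *\<^sub>C f x)"

lemma clinI: "(\<And>x y. f (x + y) = f x + f y) \<Longrightarrow> (\<And>c x. f (c *\<^sub>C x) = c *\<^sub>C f x) \<Longrightarrow> clin f"
  by (simp add: clin_def)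

lemma clin_add: "clin f \<Longrightarrow> f (x + y) = f x + f y"
  and clin_scale: "clin f \<Longrightarrow> f (c *\<^sub>C x) = c *\<^sub>C f x"
  by (simp_all add: clin_def)

lemma clin_zero: "clin f \<Longrightarrow> f 0 = 0"
  using clin_scale[of f 0 0] by simp

lemma clin_minus: "clin f \<Longrightarrow> f (- x) = - f x"
  using clin_scale[of f "-1" x] by simp

lemma clin_diff: "clin f \<Longrightarrow> f (x - y) = f x - f y"
  using clin_add[of f x "- y"] clin_minus[of f y] by simp

lemma clin_sum: "clin f \<Longrightarrow> f (sum g A) = (\<Sum>i\<in>A. f (g i))"
  by (induction A rule: infinite_finite_induct) (simp_all add: clin_zero clin_add)

lemma clin_comp: "clin f \<Longrightarrow> clin g \<Longrightarrow> clin (\<lambda>x. f (g x))"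
  by (simp add: clin_def)

lemma clin_sum_fun: "(\<And>i. i \<in> A \<Longrightarrow> clin (f i)) \<Longrightarrow> clin (\<lambda>x. \<Sum>i\<in>A. f i x)"
  by (simp add: clin_def sum.distrib cvs.scale_sum_right)

lemma clin_scaleC: "clin f \<Longrightarrow> clin (\<lambda>x. c *\<^sub>C f x)"
  by (simp add: clin_def scaleC_right_distrib scaleC_scaleC mult.commute)

lemma clin_vimage_subspace: "clin f \<Longrightarrow> cvs.subspace S \<Longrightarrow> cvs.subspace {x. f x \<in> S}"
  by (simp add: cvs.subspace_def clin_add clin_scale clin_zero)

lemma cspan_induct_clin:
  assumes "x \<in> cspan B" "clin f" "cvs.subspace S" "\<And>b. b \<in> B \<Longrightarrow> f b \<in> S"
  shows "f x \<in> S"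
proof -
  have "cspan B \<subseteq> {x. f x \<in> S}"
    by (rule cvs.span_minimal) (use assms clin_vimage_subspace in auto)
  then show ?thesis using assms(1) by auto
qed

subsection \<open>Cyclic subspaces modulo an invariant subspace\<close>

inductive_set words :: "('v \<Rightarrow> 'v) set \<Rightarrow> 'v \<Rightarrow> 'v set" for Op e where
  base: "e \<in> words Op e"
| step: "f \<in> Op \<Longrightarrow> v \<in> words Op e \<Longrightarrow> f v \<in> words Op e"

definition orb :: "('v::complex_vector \<Rightarrow> 'v) set \<Rightarrow> 'v \<Rightarrow> 'v set" where
  "orb Op e = cspan (words Op e)"

definition invariant :: "('v::complex_vector \<Rightarrow> 'v) set \<Rightarrow> 'v set \<Rightarrow> bool" where
  "invariant Op T \<longleftrightarrow> cvs.subspace T \<and> (\<forall>f\<in>Op. \<forall>v\<in>T. f v \<in> T)"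

definition adjoin :: "('v::complex_vector \<Rightarrow> 'v) set \<Rightarrow> 'v set \<Rightarrow> 'v \<Rightarrow> 'v set" where
  "adjoin Op T e = cspan (T \<union> words Op e)"

text \<open>The spanning family consists of words, not just of vectors in the orbit, because words in
homogeneous operators are homogeneous; the comparison with the graded module needs that.\<close>

definition bounded_mod :: "('v::complex_vector \<Rightarrow> 'v) set \<Rightarrow> 'v \<Rightarrow> 'v set \<Rightarrow> nat \<Rightarrow> bool" where
  "bounded_mod Op e T n \<longleftrightarrow>
     (\<exists>F. finite F \<and> card F \<le> n \<and> F \<subseteq> words Op e \<and> orb Op e \<subseteq> cspan (F \<union> T))"

lemma words_trans: "v \<in> words Op e' \<Longrightarrow> e' \<in> words Op e \<Longrightarrow> v \<in> words Op e"
  by (induction rule: words.induct) (auto intro: words.step)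

lemma invariant_subspace: "invariant Op T \<Longrightarrow> cvs.subspace T"
  by (simp add: invariant_def)

lemma invariantD: "invariant Op T \<Longrightarrow> f \<in> Op \<Longrightarrow> v \<in> T \<Longrightarrow> f v \<in> T"
  by (simp add: invariant_def)

lemma words_in_invariant: "v \<in> words Op e \<Longrightarrow> invariant Op T \<Longrightarrow> e \<in> T \<Longrightarrow> v \<in> T"
  by (induction rule: words.induct) (auto simp: invariant_def)

lemma orb_in_invariant: "invariant Op T \<Longrightarrow> e \<in> T \<Longrightarrow> orb Op e \<subseteq> T"
  unfolding orb_def by (rule cvs.span_minimal) (auto simp: invariant_subspace words_in_invariant)

lemma invariant_cspan:
  assumes "\<And>f. f \<in> Op \<Longrightarrow> clin f" "\<And>f b. f \<in> Op \<Longrightarrow> b \<in> B \<Longrightarrow> f b \<in> cspan B"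
  shows "invariant Op (cspan B)"
  unfolding invariant_def using assms
  by (auto intro: cspan_induct_clin[of _ B])

lemma invariant_adjoin:
  assumes "\<And>f. f \<in> Op \<Longrightarrow> clin f" "invariant Op T"
  shows "invariant Op (adjoin Op T e)"
  unfolding adjoin_def using assms
  by (intro invariant_cspan) (auto intro!: cvs.span_base intro: words.step simp: invariant_def)

lemma adjoin_sup: "T \<subseteq> adjoin Op T e" and adjoin_self: "e \<in> adjoin Op T e"
  by (auto simp: adjoin_def intro: cvs.span_base words.base)

text \<open>Additivity of dimension along the submodule generated by \<open>e'\<close>: every count below is a repeated
application of this splitting.\<close>

lemma bounded_mod_split:
  assumes e': "e' \<in> words Op e"
    and 1: "bounded_mod Op e (adjoin Op T e') n1" and 2: "bounded_mod Op e' T n2"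
  shows "bounded_mod Op e T (n1 + n2)"
proof -
  obtain F1 where F1: "finite F1" "card F1 \<le> n1" "F1 \<subseteq> words Op e"
      "orb Op e \<subseteq> cspan (F1 \<union> adjoin Op T e')"
    using 1 by (auto simp: bounded_mod_def)
  obtain F2 where F2: "finite F2" "card F2 \<le> n2" "F2 \<subseteq> words Op e'" "orb Op e' \<subseteq> cspan (F2 \<union> T)"
    using 2 by (auto simp: bounded_mod_def)
  have "adjoin Op T e' \<subseteq> cspan (F2 \<union> T)"
    unfolding adjoin_def
  proof (rule cvs.span_minimal)
    show "T \<union> words Op e' \<subseteq> cspan (F2 \<union> T)"
      using F2(4) by (auto simp: orb_def intro: cvs.span_base)
  qed simp
  also have "\<dots> \<subseteq> cspan (F1 \<union> F2 \<union> T)" by (rule cvs.span_mono) auto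
  finally have "cspan (F1 \<union> adjoin Op T e') \<subseteq> cspan (F1 \<union> F2 \<union> T)"
    by (intro cvs.span_minimal) (auto intro: cvs.span_base)
  then have "orb Op e \<subseteq> cspan ((F1 \<union> F2) \<union> T)" using F1(4) by auto
  moreover have "card (F1 \<union> F2) \<le> n1 + n2"
    using F1 F2 card_Un_le[of F1 F2] by linarith
  moreover have "F1 \<union> F2 \<subseteq> words Op e" using F1(3) F2(3) words_trans[OF _ e'] by auto
  ultimately show ?thesis using F1(1) F2(1) unfolding bounded_mod_def by blast
qed

lemma bounded_mod_0: "invariant Op T \<Longrightarrow> e \<in> T \<Longrightarrow> bounded_mod Op e T n"
  unfolding bounded_mod_def using orb_in_invariant[of Op T e] cvs.span_superset[of T]
  by (intro exI[of _ "{}"]) auto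

lemma bounded_mod_1:
  assumes "invariant Op T" "\<And>f. f \<in> Op \<Longrightarrow> f e \<in> T"
  shows "bounded_mod Op e T 1"
proof -
  have "v \<in> insert e T" if "v \<in> words Op e" for v
    using that by induction (use assms in \<open>auto simp: invariant_def\<close>)
  then have "orb Op e \<subseteq> cspan ({e} \<union> T)"
    unfolding orb_def by (intro cvs.span_mono) auto
  then show ?thesis unfolding bounded_mod_def
    by (intro exI[of _ "{e}"]) (auto intro: words.base)
qed

subsection \<open>Powers of currents\<close>

text \<open>The coefficient of \<open>u\<^sup>s\<close> in the \<open>r\<close>-th power of the generating function \<open>\<Sum>\<^sub>i Z\<^sub>i u\<^sup>i\<close>.\<close>

primrec cur :: "(nat \<Rightarrow> 'v \<Rightarrow> 'v) \<Rightarrow> nat \<Rightarrow> nat \<Rightarrow> 'v \<Rightarrow> 'v::complex_vector" where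
  "cur Z 0 s v = (if s = 0 then v else 0)"
| "cur Z (Suc r) s v = (\<Sum>i\<le>s. Z i (cur Z r (s - i) v))"

lemma sum_triangle_swap:
  fixes f :: "nat \<Rightarrow> nat \<Rightarrow> 'a::comm_monoid_add"
  shows "(\<Sum>i\<le>s. \<Sum>j\<le>s - i. f i j) = (\<Sum>j\<le>s. \<Sum>i\<le>s - j. f i j)"
proof -
  have *: "(\<Sum>j\<le>s - i. g j) = (\<Sum>j\<le>s. if i + j \<le> s then g j else 0)" if "i \<le> s"
    for g :: "nat \<Rightarrow> 'a" and i
    using that by (intro sum.mono_neutral_cong_left) auto
  have "(\<Sum>i\<le>s. \<Sum>j\<le>s - i. f i j) = (\<Sum>i\<le>s. \<Sum>j\<le>s. if i + j \<le> s then f i j else 0)"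
    by (intro sum.cong refl *) auto
  also have "\<dots> = (\<Sum>j\<le>s. \<Sum>i\<le>s. if j + i \<le> s then f i j else 0)"
    by (subst sum.swap) (simp add: add.commute)
  also have "\<dots> = (\<Sum>j\<le>s. \<Sum>i\<le>s - j. f i j)"
    by (intro sum.cong refl *[symmetric]) auto
  finally show ?thesis .
qed

lemma clin_cur: "(\<And>i. clin (Z i)) \<Longrightarrow> clin (cur Z r s)"
proof (induction r arbitrary: s)
  case 0
  then show ?case by (auto simp: clin_def)
next
  case (Suc r)
  have "clin (\<lambda>v. \<Sum>i\<le>s. Z i (cur Z r (s - i) v))"
    by (rule clin_sum_fun, rule clin_comp[OF Suc.prems Suc.IH[OF Suc.prems]])
  then show ?case by (simp add: clin_def)
qed

lemma cur_commute:
  assumes "clin f" "\<And>i v. f (Z i v) = Z i (f v)"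
  shows "f (cur Z r s v) = cur Z r s (f v)"
  by (induction r arbitrary: s) (simp_all add: clin_zero[OF assms(1)] clin_sum[OF assms(1)] assms(2))

lemma cur_invariant:
  assumes "cvs.subspace W" "\<And>i v. v \<in> W \<Longrightarrow> Z i v \<in> W" "v \<in> W"
  shows "cur Z r s v \<in> W"
  by (induction r arbitrary: s) (auto intro!: cvs.subspace_sum simp: assms cvs.subspace_0)

lemma cur_Suc_right:
  assumes "\<And>i. clin (Z i)" "\<And>i j v. Z i (Z j v) = Z j (Z i v)"
  shows "cur Z (Suc r) s v = (\<Sum>i\<le>s. cur Z r (s - i) (Z i v))"
  by (simp add: cur_commute[of "Z _" Z, OF assms])

text \<open>Compare coefficients in \<open>u d/du Z(u)\<^sup>r\<^sup>+\<^sup>1 = (r + 1) Z(u)\<^sup>r u dZ/du\<close>, which holds because the \<open>Z\<^sub>i\<close> commute.\<close>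

lemma cur_euler:
  assumes lin: "\<And>i. clin (Z i)" and comm: "\<And>i j v. Z i (Z j v) = Z j (Z i v)"
  shows "(\<Sum>i\<le>s. of_nat i *\<^sub>C Z i (cur Z r (s - i) v)) =
     (of_nat s / of_nat (Suc r)) *\<^sub>C cur Z (Suc r) s v"
proof (induction r arbitrary: s)
  case 0
  have "(\<Sum>i\<le>s. of_nat i *\<^sub>C Z i (cur Z 0 (s - i) v)) =
      (\<Sum>i\<le>s. if i = s then of_nat s *\<^sub>C Z s v else 0)"
    by (intro sum.cong) (auto simp: clin_zero[OF lin])
  moreover have "cur Z (Suc 0) s v = (\<Sum>i\<le>s. if i = s then Z s v else 0)"
    by (simp del: sum.delta) (intro sum.cong, auto simp: clin_zero[OF lin])
  ultimately show ?case by simp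
next
  case (Suc r)
  let ?D = "\<Sum>i\<le>s. of_nat i *\<^sub>C Z i (cur Z (Suc r) (s - i) v)"
  let ?c = "cur Z (Suc (Suc r)) s v"
  have "?D = (\<Sum>i\<le>s. \<Sum>j\<le>s - i. of_nat i *\<^sub>C Z i (Z j (cur Z r (s - i - j) v)))"
    by (simp add: clin_sum[OF lin] cvs.scale_sum_right)
  also have "\<dots> = (\<Sum>j\<le>s. \<Sum>i\<le>s - j. of_nat i *\<^sub>C Z i (Z j (cur Z r (s - i - j) v)))"
    by (rule sum_triangle_swap)
  also have "\<dots> = (\<Sum>j\<le>s. Z j (\<Sum>i\<le>s - j. of_nat i *\<^sub>C Z i (cur Z r (s - j - i) v)))"
    unfolding clin_sum[OF lin] clin_scale[OF lin]
    by (intro sum.cong refl) (simp add: comm[of _ _ "cur Z r _ v"] add.commute)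
  also have "\<dots> = (\<Sum>j\<le>s. (of_nat (s - j) / of_nat (Suc r)) *\<^sub>C Z j (cur Z (Suc r) (s - j) v))"
    by (simp only: Suc clin_scale[OF lin])
  also have "\<dots> = (\<Sum>j\<le>s. (of_nat s / of_nat (Suc r)) *\<^sub>C Z j (cur Z (Suc r) (s - j) v)
       - (1 / of_nat (Suc r)) *\<^sub>C (of_nat j *\<^sub>C Z j (cur Z (Suc r) (s - j) v)))"
    by (intro sum.cong refl)
      (simp add: of_nat_diff diff_divide_distrib cvs.scale_left_diff_distrib scaleC_scaleC del: cur.simps of_nat_Suc)
  also have "\<dots> = (of_nat s / of_nat (Suc r)) *\<^sub>C ?c - (1 / of_nat (Suc r)) *\<^sub>C ?D"
    by (simp add: sum_subtractf cvs.scale_sum_right)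
  finally have "?D = (of_nat s / of_nat (Suc r)) *\<^sub>C ?c - (1 / of_nat (Suc r)) *\<^sub>C ?D" .
  then have "(of_nat (Suc r) :: complex) *\<^sub>C ?D = of_nat (Suc r) *\<^sub>C ((of_nat s / of_nat (Suc r)) *\<^sub>C ?c - (1 / of_nat (Suc r)) *\<^sub>C ?D)"
    by simp
  also have "\<dots> = of_nat s *\<^sub>C ?c - ?D"
    by (simp add: cvs.scale_right_diff_distrib scaleC_scaleC del: cur.simps of_nat_Suc)
  finally have "of_nat (Suc r) *\<^sub>C ?D + ?D = of_nat s *\<^sub>C ?c" by (simp del: cur.simps of_nat_Suc)
  then have *: "(of_nat (Suc (Suc r)) :: complex) *\<^sub>C ?D = of_nat s *\<^sub>C ?c"
    unfolding of_nat_Suc[of "Suc r"] scaleC_left_distrib scaleC_one by (simp only: add.commute)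
  have "?D = (1 / of_nat (Suc (Suc r))) *\<^sub>C ((of_nat (Suc (Suc r)) :: complex) *\<^sub>C ?D)"
    unfolding scaleC_scaleC by (simp del: cur.simps of_nat_Suc)
  also have "\<dots> = (of_nat s / of_nat (Suc (Suc r))) *\<^sub>C ?c"
    unfolding * by (simp add: scaleC_scaleC del: cur.simps of_nat_Suc)
  finally show ?case .
qed

subsection \<open>Functions with double zeros on lines\<close>

text \<open>The two line conditions say that the generating polynomial of \<open>T\<close> has a double zero at \<open>1\<close> in each of its \<open>m\<close>
variables. A polynomial with that property that has total degree less than \<open>2m\<close> must be zero.\<close>

lemma double_zero:
  fixes T :: "nat list \<Rightarrow> 'v::complex_vector"
  assumes W: "cvs.subspace W" and B: "2 * m \<le> B"
    and supp: "\<And>is. length is = m \<Longrightarrow> 2 * m \<le> sum_list is \<Longrightarrow> T is \<in> W"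
    and line0: "\<And>xs ys. length xs + length ys + 1 = m \<Longrightarrow> (\<Sum>i<B. T (xs @ i # ys)) \<in> W"
    and line1: "\<And>xs ys. length xs + length ys + 1 = m \<Longrightarrow>
                  (\<Sum>i<B. of_nat i *\<^sub>C T (xs @ i # ys)) \<in> W"
    and len: "length is = m"
  shows "T is \<in> W"
  using B supp line0 line1 len
proof (induction m arbitrary: T "is")
  case 0
  then show ?case by simp
next
  case (Suc m)
  have big: "T (e # ys) \<in> W" if "2 \<le> e" "length ys = m" for e ys
  proof (rule Suc.IH[where T = "\<lambda>ys. T (e # ys)"])
    show "T (e # js) \<in> W" if "length js = m" "2 * m \<le> sum_list js" for js
      using that \<open>2 \<le> e\<close> by (intro Suc.prems(2)) auto
    show "(\<Sum>i<B. T (e # xs @ i # zs)) \<in> W" if "length xs + length zs + 1 = m" for xs zs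
      using Suc.prems(3)[of "e # xs" zs] that by simp
    show "(\<Sum>i<B. of_nat i *\<^sub>C T (e # xs @ i # zs)) \<in> W" if "length xs + length zs + 1 = m" for xs zs
      using Suc.prems(4)[of "e # xs" zs] that by simp
  qed (use Suc.prems(1) that in auto)
  obtain i0 ys where is_eq: "is = i0 # ys" and ys: "length ys = m"
    using Suc.prems(5) by (cases "is") auto
  define B' where "B' = B - 2"
  have B': "B = Suc (Suc B')"
    using Suc.prems(1) by (simp add: B'_def)
  have split: "(\<Sum>i<B. f i) = f 0 + (f 1 + (\<Sum>i<B'. f (Suc (Suc i))))" for f :: "nat \<Rightarrow> 'v"
    by (simp only: B' sum.lessThan_Suc_shift One_nat_def)
  have r0: "(\<Sum>i<B'. T (Suc (Suc i) # ys)) \<in> W"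
    by (rule cvs.subspace_sum[OF W], rule big[OF _ ys]) simp
  have r1: "(\<Sum>i<B'. of_nat (Suc (Suc i)) *\<^sub>C T (Suc (Suc i) # ys)) \<in> W"
    by (rule cvs.subspace_sum[OF W], rule cvs.subspace_scale[OF W], rule big[OF _ ys]) simp
  have "T (1 # ys) + (\<Sum>i<B'. of_nat (Suc (Suc i)) *\<^sub>C T (Suc (Suc i) # ys)) \<in> W"
    using Suc.prems(4)[of "[]" ys] ys split[of "\<lambda>i. of_nat i *\<^sub>C T (i # ys)"]
    by (simp only: append_Nil of_nat_0 of_nat_1 cvs.scale_zero_left scaleC_one add_0_left list.size add_Suc add_0 Suc_eq_plus1)
  from cvs.subspace_diff[OF W this r1] have T1: "T (1 # ys) \<in> W" by simp
  have "T (0 # ys) + (T (1 # ys) + (\<Sum>i<B'. T (Suc (Suc i) # ys))) \<in> W"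
    using Suc.prems(3)[of "[]" ys] ys split[of "\<lambda>i. T (i # ys)"] by simp
  from cvs.subspace_diff[OF W this cvs.subspace_add[OF W T1 r0]] have T0: "T (0 # ys) \<in> W" by simp
  have "i0 = 0 \<or> i0 = 1 \<or> 2 \<le> i0" by linarith
  then show ?case
    unfolding is_eq using T0 T1 big[OF _ ys, of i0] by blast
qed

section \<open>Vanishing of monomials in an even current\<close>

lemma foldr_commute:
  "(\<And>i j v. Z i (Z j v) = Z j (Z i v)) \<Longrightarrow> foldr Z xs (Z i v) = Z i (foldr Z xs v)"
  by (induction xs) auto

lemma foldr_move:
  "(\<And>i j v. Z i (Z j v) = Z j (Z i v)) \<Longrightarrow> foldr Z (xs @ i # ys) v = foldr Z (xs @ ys) (Z i v)"
  using foldr_commute[of Z "xs @ ys" i v] by (induction xs) (auto simp: foldr_commute)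

lemma clin_foldr: "(\<And>i. clin (Z i)) \<Longrightarrow> clin (foldr Z xs)"
  by (induction xs) (auto simp: clin_def)

lemma cur_commute_self:
  assumes "\<And>i. clin (Z i)" "\<And>i j v. Z i (Z j v) = Z j (Z i v)"
  shows "Z i (cur Z r s v) = cur Z r s (Z i v)"
  by (rule cur_commute[where f = "Z i"]) (simp_all add: assms)

text \<open>A monomial in \<open>m\<close> of the operators times a coefficient of the remaining power is treated as a function of the \<open>m\<close>
indices, shifted by \<open>k\<close>. Summing over one index reproduces the situation with \<open>m - 1\<close> indices, and so does
summing with weight given by the index, by the Euler identity; both vanish by induction. Thus the function has
double zeros on lines, and the bound on \<open>D\<close> puts its support in degrees below \<open>2m\<close>.\<close>

lemma gordon_vanishing:
  assumes lin: "\<And>i. clin (Z i)" and comm: "\<And>i j v. Z i (Z j v) = Z j (Z i v)"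
    and W: "cvs.subspace W" and Winv: "\<And>i v. v \<in> W \<Longrightarrow> Z i v \<in> W"
    and low: "\<And>i. i < k \<Longrightarrow> Z i e \<in> W"
    and ord: "\<And>r s. s < G r \<Longrightarrow> cur Z r s e \<in> W"
    and D: "\<And>m. m \<le> M \<Longrightarrow> D < G (n - m) + m * k + 2 * m" and "M \<le> n"
    and "m \<le> M" "length is = m" "sum_list is + s = D"
  shows "foldr Z is (cur Z (n - m) s e) \<in> W"
  using assms(9-11)
proof (induction m arbitrary: "is" s)
  case 0
  then show ?case using ord[of s n] D[of 0] by simp
next
  case (Suc m)
  have P_in: "foldr Z xs v \<in> W" if "v \<in> W" for xs v
    using that by (induction xs) (auto intro: Winv)
  have curZ: "Z i (cur Z r t v) = cur Z r t (Z i v)" for i r t v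
    by (rule cur_commute_self[OF lin comm])
  have mv: "foldr Z (xs @ i # ys) v = foldr Z (xs @ ys) (Z i v)" for xs i ys v
    by (rule foldr_move) (rule comm)
  have cur_in: "cur Z r t v \<in> W" if "v \<in> W" for r t v
    by (rule cur_invariant[OF W Winv that])
  define r0 where "r0 = n - Suc m"
  have nm: "n - m = Suc r0" using Suc.prems(1) \<open>M \<le> n\<close> by (simp add: r0_def)
  define T where "T js = (if sum_list js + Suc m * k \<le> D
      then foldr Z (map (\<lambda>j. j + k) js) (cur Z r0 (D - (sum_list js + Suc m * k)) e) else 0)" for js
  have T_in: "T js \<in> W" if "length js = Suc m" for js
  proof (rule double_zero[OF W, where m = "Suc m" and B = "D + 2 * Suc m + 1"])
    fix js assume "length js = Suc m" "2 * Suc m \<le> sum_list js"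
    then show "T js \<in> W"
      unfolding T_def using D[of "Suc m"] Suc.prems(1) cvs.subspace_0[OF W]
      by (auto simp: r0_def intro!: P_in ord)
  next
    fix xs ys :: "nat list" assume len: "length xs + length ys + 1 = Suc m"
    let ?B = "D + 2 * Suc m + 1"
    define c where "c = sum_list xs + sum_list ys + Suc m * k"
    define P where "P = foldr Z (map (\<lambda>j. j + k) (xs @ ys))"
    define d where "d = D - c"
    have linP: "clin P" unfolding P_def by (rule clin_foldr[OF lin])
    have PW: "P v \<in> W" if "v \<in> W" for v unfolding P_def by (rule P_in[OF that])
    define S where "S f = (\<Sum>i\<le>d. f i *\<^sub>C Z (i + k) (cur Z r0 (d - i) e))" for f :: "nat \<Rightarrow> complex"
    have TS: "(\<Sum>i<?B. f i *\<^sub>C T (xs @ i # ys)) = (if c \<le> D then P (S f) else 0)" for f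
    proof (cases "c \<le> D")
      case True
      have "(\<Sum>i<?B. f i *\<^sub>C T (xs @ i # ys)) = (\<Sum>i\<le>d. f i *\<^sub>C T (xs @ i # ys))"
        using True by (intro sum.mono_neutral_right) (auto simp: T_def d_def c_def)
      also have "\<dots> = (\<Sum>i\<le>d. f i *\<^sub>C P (Z (i + k) (cur Z r0 (d - i) e)))"
      proof (rule sum.cong[OF refl])
        fix i assume "i \<in> {..d}"
        then have "sum_list (xs @ i # ys) + Suc m * k \<le> D"
          and eq: "D - (sum_list (xs @ i # ys) + Suc m * k) = d - i"
          using True by (auto simp: d_def c_def)
        then have "T (xs @ i # ys) = foldr Z (map (\<lambda>j. j + k) (xs @ i # ys)) (cur Z r0 (d - i) e)"
          unfolding T_def eq by (simp del: sum_list_append)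
        also have "\<dots> = P (Z (i + k) (cur Z r0 (d - i) e))"
          unfolding P_def map_append list.map by (rule mv)
        finally show "f i *\<^sub>C T (xs @ i # ys) = f i *\<^sub>C P (Z (i + k) (cur Z r0 (d - i) e))" by simp
      qed
      also have "\<dots> = P (S f)"
        by (simp add: S_def clin_sum[OF linP] clin_scale[OF linP])
      finally show ?thesis using True by simp
    next
      case False
      then show ?thesis by (auto simp: T_def c_def intro!: sum.neutral)
    qed
    have full: "P (cur Z (Suc r0) (d + k) e) \<in> W" if "c \<le> D"
    proof -
      have "sum_list (map (\<lambda>j. j + k) zs) = sum_list zs + length zs * k" for zs
        by (induction zs) auto
      then have "foldr Z (map (\<lambda>j. j + k) (xs @ ys)) (cur Z (n - m) (d + k) e) \<in> W"
        using len that Suc.prems(1)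
        by (intro Suc.IH) (auto simp: d_def c_def algebra_simps simp flip: add_mult_distrib)
      then show ?thesis by (simp add: P_def nm)
    qed
    have splitk: "(\<Sum>a\<le>d + k. h a) = (\<Sum>a<k. h a) + (\<Sum>i\<le>d. h (i + k))" for h :: "nat \<Rightarrow> 'a"
    proof -
      have "(\<Sum>a\<le>d + k. h a) = (\<Sum>a<k + Suc d. h a)"
        by (intro sum.cong) auto
      also have "(\<Sum>a<k + n. h a) = (\<Sum>a<k. h a) + (\<Sum>i<n. h (k + i))" for n
        by (induction n) (simp_all add: add.assoc)
      finally show ?thesis by (simp add: lessThan_Suc_atMost add.commute)
    qed
    have lowsum: "(\<Sum>a<k. f a *\<^sub>C Z a (cur Z r0 (d + k - a) e)) \<in> W" for f
      by (rule cvs.subspace_sum[OF W], rule cvs.subspace_scale[OF W])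
        (simp add: curZ low cur_in)
    have S0: "P (S (\<lambda>_. 1)) \<in> W" if "c \<le> D"
    proof -
      have "cur Z (Suc r0) (d + k) e = (\<Sum>a<k. 1 *\<^sub>C Z a (cur Z r0 (d + k - a) e)) + S (\<lambda>_. 1)"
        by (simp add: splitk S_def scaleC_one)
      then have "P (S (\<lambda>_. 1)) = P (cur Z (Suc r0) (d + k) e)
          - P (\<Sum>a<k. 1 *\<^sub>C Z a (cur Z r0 (d + k - a) e))"
        by (simp add: clin_add[OF linP] del: cur.simps)
      then show ?thesis
        using cvs.subspace_diff[OF W full[OF that] PW[OF lowsum[of "\<lambda>_. 1"]]] by simp
    qed
    have S1: "P (S of_nat) \<in> W" if "c \<le> D"
    proof -
      let ?c = "of_nat (d + k) / of_nat (Suc r0) :: complex"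
      have "?c *\<^sub>C cur Z (Suc r0) (d + k) e
          = (\<Sum>a<k. of_nat a *\<^sub>C Z a (cur Z r0 (d + k - a) e)) + (S of_nat + of_nat k *\<^sub>C S (\<lambda>_. 1))"
        unfolding cur_euler[OF lin comm, symmetric] splitk
        by (simp add: S_def scaleC_left_distrib sum.distrib cvs.scale_sum_right scaleC_one)
      then have "P (S of_nat) = ?c *\<^sub>C P (cur Z (Suc r0) (d + k) e)
          - P (\<Sum>a<k. of_nat a *\<^sub>C Z a (cur Z r0 (d + k - a) e)) - of_nat k *\<^sub>C P (S (\<lambda>_. 1))"
        by (simp only: clin_add[OF linP] flip: clin_scale[OF linP]) (simp add: clin_scale[OF linP])
      then show ?thesis
        using cvs.subspace_diff[OF W cvs.subspace_diff[OF W cvs.subspace_scale[OF W full[OF that], of ?c]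
            PW[OF lowsum[of of_nat]]] cvs.subspace_scale[OF W S0[OF that], of "of_nat k"]]
        by (simp del: cur.simps of_nat_Suc of_nat_add)
    qed
    show "(\<Sum>i<?B. T (xs @ i # ys)) \<in> W"
      using TS[of "\<lambda>_. 1"] S0 cvs.subspace_0[OF W] by (auto simp: scaleC_one)
    show "(\<Sum>i<?B. of_nat i *\<^sub>C T (xs @ i # ys)) \<in> W"
      using TS[of of_nat] S1 cvs.subspace_0[OF W] by auto
  qed (use that in auto)
  show ?case
  proof (cases "\<exists>a\<in>set is. a < k")
    case True
    then obtain a xs ys where a: "a < k" "is = xs @ a # ys" by (meson split_list)
    show ?thesis
      unfolding a(2) mv curZ by (intro P_in cur_in low a)
  next
    case False
    define js where "js = map (\<lambda>j. j - k) is"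
    have map: "map (\<lambda>j. j + k) js = is"
      using False unfolding js_def map_map by (intro map_idI) auto
    have len: "length js = Suc m" using Suc.prems by (simp add: js_def)
    have "sum_list (map (\<lambda>j. j + k) zs) = sum_list zs + length zs * k" for zs
      by (induction zs) auto
    from this[of js] have "sum_list is = sum_list js + Suc m * k" unfolding map len .
    then have "D - (sum_list js + Suc m * k) = s" "sum_list js + Suc m * k \<le> D"
      using Suc.prems(3) by simp_all
    then have "T js = foldr Z is (cur Z (n - Suc m) s e)"
      unfolding T_def map r0_def by presburger
    then show ?thesis using T_in[OF len] by simp
  qed
qed

lemma cur_from_lists:
  assumes lin: "\<And>i. clin (Z i)" and comm: "\<And>i j v. Z i (Z j v) = Z j (Z i v)"
    and W: "cvs.subspace W"
    and "\<And>is. length is = r \<Longrightarrow> sum_list is = s \<Longrightarrow> foldr Z is v \<in> W"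
  shows "cur Z r s v \<in> W"
  using assms(4)
proof (induction r arbitrary: s v)
  case 0
  then show ?case using cvs.subspace_0[OF W] by auto
next
  case (Suc r)
  show ?case
    unfolding cur_Suc_right[OF lin comm]
  proof (rule cvs.subspace_sum[OF W], rule Suc.IH)
    fix i js assume "i \<in> {..s}" "length js = r" "sum_list js = s - i"
    then show "foldr Z js (Z i v) \<in> W" using Suc.prems[of "js @ [i]"] by simp
  qed
qed

text \<open>If the first \<open>k\<close> operators kill \<open>e\<close>, only products of operators with index at least \<open>k\<close> survive, so the
lowest coefficient of the \<open>r\<close>-th power is the \<open>r\<close>-th power of \<open>Z\<^sub>k\<close>.\<close>

lemma cur_low:
  assumes lin: "\<And>i. clin (Z i)" and comm: "\<And>i j v. Z i (Z j v) = Z j (Z i v)"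
    and W: "cvs.subspace W" and Winv: "\<And>i v. v \<in> W \<Longrightarrow> Z i v \<in> W"
    and low: "\<And>i. i < k \<Longrightarrow> Z i e \<in> W"
  shows "s < r * k \<Longrightarrow> cur Z r s e \<in> W" and "cur Z r (r * k) e - (Z k ^^ r) e \<in> W"
proof (induction r arbitrary: s)
  case 0
  { case 1 then show ?case by simp next case 2 then show ?case using W by (simp add: cvs.subspace_0) }
next
  case (Suc r)
  have curZ: "Z i (cur Z r t v) = cur Z r t (Z i v)" for i r t v
    by (rule cur_commute_self[OF lin comm])
  have small: "Z i (cur Z r t e) \<in> W" if "i < k" for i t
    unfolding curZ by (rule cur_invariant[OF W Winv low[OF that]])
  { case 1
    have "Z i (cur Z r (s - i) e) \<in> W" if "i \<le> s" for i
      using small[of i] Winv[OF Suc.IH(1)[of "s - i"], of i] 1 that by (cases "i < k") auto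
    then show ?case by (auto intro: cvs.subspace_sum[OF W])
  next
    case 2
    let ?s = "Suc r * k"
    have 1: "Z i (cur Z r (?s - i) e) \<in> W" if "i \<in> {..?s} - {k}" for i
      using small[of i] Winv[OF Suc.IH(1)[of "?s - i"], of i] that by (cases "i < k") auto
    have "cur Z (Suc r) ?s e = Z k (cur Z r (?s - k) e) + (\<Sum>i\<in>{..?s} - {k}. Z i (cur Z r (?s - i) e))"
      unfolding cur.simps by (rule sum.remove) auto
    then have "cur Z (Suc r) ?s e - (Z k ^^ Suc r) e = Z k (cur Z r (r * k) e - (Z k ^^ r) e)
        + (\<Sum>i\<in>{..?s} - {k}. Z i (cur Z r (?s - i) e))"
      by (simp add: clin_diff[OF lin])
    also have "\<dots> \<in> W"
      by (intro cvs.subspace_add[OF W] Winv Suc.IH(2) cvs.subspace_sum[OF W] 1)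
    finally show ?case . }
qed

section \<open>Counting with one even current\<close>

text \<open>The vanishing order of the \<open>r\<close>-th power of the current when \<open>k\<close> factors carry the exponent \<open>0\<close> and the
others the exponents in \<open>\<xi>\<close>.\<close>

definition vorder :: "nat \<Rightarrow> nat multiset \<Rightarrow> nat \<Rightarrow> nat" where
  "vorder k \<xi> r = r * k + (\<Sum>x\<in>#\<xi>. r - x)"

locale even_current =
  fixes Op :: "('v::complex_vector \<Rightarrow> 'v) set" and Z :: "nat \<Rightarrow> 'v \<Rightarrow> 'v" and N :: nat
  assumes Op_clin: "f \<in> Op \<Longrightarrow> clin f"
    and Z_Op: "Z i \<in> Op"
    and Z_central: "f \<in> Op \<Longrightarrow> f (Z i v) = Z i (f v)"
    and Z_ge: "i \<ge> N \<Longrightarrow> Z i v = 0"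
begin

lemma Z_clin: "clin (Z i)" and Z_comm: "Z i (Z j v) = Z j (Z i v)"
  using Op_clin Z_Op Z_central by blast+

lemma cur_Z: "Z i (cur Z r s v) = cur Z r s (Z i v)"
  by (rule cur_commute_self) (simp_all add: Z_clin Z_comm)

lemmas cur_Suc_Z = cur_Suc_right[of Z, OF Z_clin Z_comm]

lemmas cur_low_Z = cur_low[of Z, OF Z_clin Z_comm]

lemma Z_pow_commute: "f \<in> Op \<Longrightarrow> f ((Z k ^^ b) v) = (Z k ^^ b) (f v)"
  by (induction b) (simp_all add: Z_central)

lemma Z_pow_words: "(Z k ^^ b) e \<in> words Op e"
  by (induction b) (auto intro: words.intros Z_Op)

lemma Z_invariant: "invariant Op T \<Longrightarrow> v \<in> T \<Longrightarrow> Z i v \<in> T"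
  by (rule invariantD[OF _ Z_Op])

lemma invariant_adjoin': "invariant Op T \<Longrightarrow> invariant Op (adjoin Op T e)"
  by (rule invariant_adjoin[OF Op_clin])

lemma Z_pow_invariant: "invariant Op T \<Longrightarrow> v \<in> T \<Longrightarrow> (Z k ^^ b) v \<in> T"
  by (induction b) (auto intro: Z_invariant)

lemma cur_head:
  assumes T: "invariant Op T"
  shows "(\<And>i. i < k \<Longrightarrow> Z i e \<in> T) \<Longrightarrow> s + b \<le> r * Suc k \<Longrightarrow>
    cur Z r s e \<in> adjoin Op T ((Z k ^^ b) e)"
proof (induction r arbitrary: s b e)
  case 0
  then show ?case using adjoin_self[of e Op T] by simp
next
  case (Suc r)
  let ?A = "adjoin Op T ((Z k ^^ b) e)"
  have A: "invariant Op ?A" by (rule invariant_adjoin'[OF T])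
  note sub = invariant_subspace[OF A]
  have curA: "cur Z r s v \<in> ?A" if "v \<in> ?A" for r s v
    using sub Z_invariant[OF A] that by (rule cur_invariant)
  show ?case
  proof (cases b)
    case 0
    then have "e \<in> ?A" using adjoin_self[of e Op T] by simp
    then show ?thesis by (rule curA)
  next
    case (Suc b')
    have "cur Z r (s - i) (Z i e) \<in> ?A" if "i \<le> s" for i
    proof (rule linorder_cases[of i k])
      assume "i < k"
      then have "Z i e \<in> ?A" using Suc.prems(1) adjoin_sup by blast
      then show ?thesis by (rule curA)
    next
      assume i: "i = k"
      have "cur Z r (s - i) (Z k e) \<in> adjoin Op T ((Z k ^^ b') (Z k e))"
      proof (rule Suc.IH)
        show "Z j (Z k e) \<in> T" if "j < k" for j
          using Z_invariant[OF T Suc.prems(1)[OF that], of k] by (simp add: Z_comm)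
      qed (use Suc.prems(2) i that Suc in auto)
      then show ?thesis by (simp add: i Suc funpow_swap1)
    next
      assume i: "k < i"
      have "cur Z r (s - i) e \<in> ?A"
        by (rule Suc.IH) (use Suc.prems i that in auto)
      then show ?thesis
        unfolding cur_Z[symmetric] by (rule Z_invariant[OF A])
    qed
    then show ?thesis
      unfolding cur_Suc_Z by (intro cvs.subspace_sum[OF sub]) auto
  qed
qed

text \<open>After \<open>b\<close> applications of \<open>Z\<^sub>k\<close> the pair of exponents \<open>b \<le> a\<close> behaves like the pair \<open>0, a - b\<close>:
the fusion of the two smallest exponents. The extra vanishing comes from the double zeros that symmetric functions
acquire when variables collide.\<close>

lemma fused_pair:
  assumes T: "invariant Op T" and low: "\<And>i. i < k \<Longrightarrow> Z i e \<in> T"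
    and ord: "\<And>r s. s < vorder k (\<rho> + {#a, b#}) r \<Longrightarrow> cur Z r s e \<in> T"
    and ba: "b \<le> a" and s: "s < vorder (Suc k) (\<rho> + {#a - b#}) r"
  shows "cur Z r s ((Z k ^^ b) e) \<in> T"
proof -
  note sub = invariant_subspace[OF T]
  define n where "n = r + b"
  define D where "D = s + b * k"
  define M where "M = min b r"
  have gordon: "foldr Z is (cur Z (n - m) t e) \<in> T"
    if "m \<le> M" "length is = m" "sum_list is + t = D" for m "is" t
  proof (rule gordon_vanishing[where Z = Z and k = k and G = "vorder k (\<rho> + {#a, b#})" and M = M, OF Z_clin Z_comm sub _ low ord])
    fix j assume "j \<le> M"
    then have j: "j \<le> b" "j \<le> r" by (auto simp: M_def)
    have "(\<Sum>x\<in>#\<rho>. r - x) \<le> (\<Sum>x\<in>#\<rho>. (n - j) - x)"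
      using j by (intro sum_mset_mono) (auto simp: n_def)
    moreover have "(n - j) * k + j * k = n * k"
      using j by (simp add: n_def flip: add_mult_distrib)
    moreover have "r + (r - (a - b)) \<le> ((n - j) - a) + ((n - j) - b) + 2 * j"
      using j ba by (simp add: n_def)
    moreover have "n * k = r * k + b * k" by (simp add: n_def add_mult_distrib)
    ultimately show "D < vorder k (\<rho> + {#a, b#}) (n - j) + j * k + 2 * j"
      using s by (simp add: vorder_def D_def)
  qed (use that Z_invariant[OF T] in \<open>auto simp: M_def n_def\<close>)
  show ?thesis
  proof (cases "b \<le> r")
    case True
    have "foldr Z (replicate b k) v = (Z k ^^ b) v" for v by (induction b) auto
    moreover have "(Z k ^^ b) (cur Z r s e) = cur Z r s ((Z k ^^ b) e)"
      by (induction b) (simp_all add: cur_Z)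
    ultimately show ?thesis
      using gordon[of b "replicate b k" s] True by (simp add: M_def n_def D_def sum_list_replicate)
  next
    case False
    show ?thesis
    proof (rule cur_from_lists[of Z, OF Z_clin Z_comm sub])
      fix js :: "nat list" assume js: "length js = r" "sum_list js = s"
      have inT: "foldr Z js v \<in> T" if "v \<in> T" for v
        using that by (induction js) (auto intro: Z_invariant[OF T])
      have "foldr Z js (cur Z b (b * k) e) \<in> T"
        using gordon[of r js "b * k"] js False by (simp add: M_def n_def D_def)
      moreover have "foldr Z js (cur Z b (b * k) e - (Z k ^^ b) e) \<in> T"
        by (rule inT) (rule cur_low_Z[OF sub Z_invariant[OF T] low])
      ultimately have "foldr Z js (cur Z b (b * k) e)
          - foldr Z js (cur Z b (b * k) e - (Z k ^^ b) e) \<in> T"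
        by (rule cvs.subspace_diff[OF sub])
      then show "foldr Z js ((Z k ^^ b) e) \<in> T"
        by (simp add: clin_diff[OF clin_foldr[of Z, OF Z_clin]])
    qed
  qed
qed

text \<open>Let \<open>b\<close> be the smallest exponent and \<open>a\<close> the next one. Modulo the submodule generated by the \<open>b\<close>-th power of
\<open>Z\<^sub>k\<close> the pair becomes \<open>b - 1, a + 1\<close>, and on that submodule it becomes \<open>0, a - b\<close>. The identity
\<open>(a + 1)(b + 1) = (a + 2) b + (a - b + 1)\<close> shows that the two bounds add up.\<close>

lemma even_phase:
  defines "ms \<equiv> measures [size, \<lambda>\<xi> :: nat multiset. Min (set_mset \<xi>)]"
  assumes "invariant Op T" "\<And>f. f \<in> Op \<Longrightarrow> f \<in> range Z \<or> f e \<in> T"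
    "\<And>r s. s < vorder k \<xi> r \<Longrightarrow> cur Z r s e \<in> T" "k + size \<xi> = N"
  shows "bounded_mod Op e T (\<Prod>x\<in>#\<xi>. Suc x)"
proof -
  have wf: "wf ms" by (simp add: ms_def)
  show ?thesis
  using wf assms(2-)
proof (induction \<xi> arbitrary: k e T rule: wf_induct_rule)
  case (less \<xi>)
  note T = less.prems(1) and other = less.prems(2) and ord = less.prems(3) and N = less.prems(4)
  note sub = invariant_subspace[OF T]
  have cur1: "cur Z 1 i v = Z i v" for i v
  proof -
    have "cur Z 1 i v = (\<Sum>j\<le>i. if j = i then Z i v else 0)"
      unfolding One_nat_def cur.simps by (intro sum.cong) (auto simp: clin_zero[OF Z_clin])
    then show ?thesis by simp
  qed
  have low: "Z i e \<in> T" if "i < k" for i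
    using ord[of i 1] that cur1[of i e] by (simp add: vorder_def)
  have other': "f \<in> range Z \<or> f ((Z j ^^ b) e) \<in> T" if "f \<in> Op" for f j b
    using other[OF that] Z_pow_commute[OF that] Z_pow_invariant[OF T] by auto
  show ?case
  proof (cases "\<xi> = {#}")
    case True
    have "f e \<in> T" if "f \<in> Op" for f
      using other[OF that]
    proof
      assume "f \<in> range Z"
      then obtain i where "f = Z i" by blast
      then show ?thesis
        using low[of i] Z_ge[of i e] N True cvs.subspace_0[OF sub] by (cases "i < k") auto
    qed
    then show ?thesis using bounded_mod_1[OF T] True by simp
  next
    case False
    define b where "b = Min (set_mset \<xi>)"
    have "b \<in># \<xi>" using False by (simp add: b_def)
    then obtain \<xi>' where \<xi>: "\<xi> = add_mset b \<xi>'" by (meson multi_member_split)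
    have bmin: "b \<le> x" if "x \<in># \<xi>'" for x unfolding b_def using that \<xi> by (intro Min_le) auto
    show ?thesis
    proof (cases "b = 0")
      case True
      have "bounded_mod Op e T (\<Prod>x\<in>#\<xi>'. Suc x)"
        by (rule less.IH[where k = "Suc k"]) (use T other N ord True in \<open>auto simp: ms_def \<xi> vorder_def\<close>)
      then show ?thesis by (simp add: \<xi> True)
    next
      case False
      then have b: "b > 0" by simp
      let ?e = "(Z k ^^ b) e"
      let ?T = "adjoin Op T ?e"
      have T': "invariant Op ?T" by (rule invariant_adjoin'[OF T])
      have otherT: "f \<in> range Z \<or> f e \<in> ?T" if "f \<in> Op" for f
        using other[OF that] adjoin_sup by blast
      show ?thesis
      proof (cases "\<xi>' = {#}")
        case True
        have ord1: "cur Z r s e \<in> ?T" if "s < vorder k {#b - 1#} r" for r s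
        proof (cases "s < vorder k \<xi> r")
          case True then show ?thesis using ord adjoin_sup by blast
        next
          case False
          then show ?thesis using that b
            by (intro cur_head[OF T low]) (auto simp: vorder_def \<xi> True)
        qed
        have "bounded_mod Op e ?T (\<Prod>x\<in>#{#b - 1#}. Suc x)"
          by (rule less.IH[where k = k]) (use T' otherT ord1 N b in \<open>auto simp: ms_def \<xi> True\<close>)
        then have br1: "bounded_mod Op e ?T b" using b by simp
        have low': "Z i ?e \<in> T" if "i < Suc k" for i
        proof (cases "i < k")
          case True
          then show ?thesis unfolding Z_pow_commute[OF Z_Op] by (intro Z_pow_invariant[OF T] low)
        next
          case False
          have "cur Z (Suc b) (Suc b * k) e \<in> T" by (rule ord) (simp add: vorder_def \<xi> True)
          moreover have "cur Z (Suc b) (Suc b * k) e - (Z k ^^ Suc b) e \<in> T"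
            by (rule cur_low_Z(2)[OF sub Z_invariant[OF T] low])
          ultimately have "cur Z (Suc b) (Suc b * k) e
              - (cur Z (Suc b) (Suc b * k) e - (Z k ^^ Suc b) e) \<in> T"
            by (rule cvs.subspace_diff[OF sub])
          then show ?thesis using False that by (simp add: less_Suc_eq del: cur.simps)
        qed
        have "bounded_mod Op ?e T (\<Prod>x\<in>#{#}. Suc x)"
          using cur_low_Z(1)[OF sub Z_invariant[OF T] low']
          by (intro less.IH[where k = "Suc k"] T other') (use N in \<open>auto simp: ms_def \<xi> True vorder_def\<close>)
        from bounded_mod_split[OF Z_pow_words br1 this] show ?thesis by (simp add: \<xi> True)
      next
        case False
        define a where "a = Min (set_mset \<xi>')"
        have "a \<in># \<xi>'" using False by (simp add: a_def)
        then obtain \<rho> where \<rho>: "\<xi>' = add_mset a \<rho>" by (meson multi_member_split)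
        have amin: "a \<le> x" if "x \<in># \<rho>" for x unfolding a_def using that \<rho> by (intro Min_le) auto
        have ba: "b \<le> a" using bmin[of a] \<rho> by simp
        have ord1: "cur Z r s e \<in> ?T" if s: "s < vorder k (\<rho> + {#a + 1, b - 1#}) r" for r s
        proof (cases "s < vorder k \<xi> r")
          case True then show ?thesis using ord adjoin_sup by blast
        next
          case False
          have r: "r \<le> a" "b \<le> r"
            using False s b by (auto simp: vorder_def \<xi> \<rho>)
          then have "(\<Sum>x\<in>#\<rho>. r - x) = 0" using amin by fastforce
          moreover have "vorder k (\<rho> + {#a + 1, b - 1#}) r =
              r * k + (\<Sum>x\<in>#\<rho>. r - x) + (r - (a + 1)) + (r - (b - 1))"
            by (simp add: vorder_def)
          ultimately have "s + b \<le> r * k + r" using s r b by linarith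
          then show ?thesis by (intro cur_head[OF T low]) auto
        qed
        have "Min (set_mset (\<rho> + {#a + 1, b - 1#})) < Min (set_mset \<xi>)"
          using b Min_le[of "set_mset (\<rho> + {#a + 1, b - 1#})" "b - 1"] by (simp add: b_def[symmetric])
        then have br1: "bounded_mod Op e ?T (\<Prod>x\<in>#\<rho> + {#a + 1, b - 1#}. Suc x)"
          by (intro less.IH[where k = k]) (use T' otherT ord1 N b in \<open>auto simp: ms_def \<xi> \<rho>\<close>)
        have ord2: "cur Z r s ?e \<in> T" if "s < vorder (Suc k) (\<rho> + {#a - b#}) r" for r s
          by (rule fused_pair[OF T low _ ba that], assumption, rule ord)
            (simp add: \<xi> \<rho> add_mset_commute)
        have "bounded_mod Op ?e T (\<Prod>x\<in>#\<rho> + {#a - b#}. Suc x)"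
          by (intro less.IH[where k = "Suc k"] T other' ord2) (use N in \<open>auto simp: ms_def \<xi> \<rho>\<close>)
        from bounded_mod_split[OF Z_pow_words br1 this]
        have "bounded_mod Op e T ((\<Prod>x\<in>#\<rho>. Suc x) * ((a + 2) * b + (a - b + 1)))"
          using b by (simp add: algebra_simps)
        also have "(a + 2) * b + (a - b + 1) = Suc a * Suc b"
          using ba by (simp add: algebra_simps)
        finally show ?thesis by (simp add: \<xi> \<rho> algebra_simps)
      qed
    qed
  qed
qed
qed

end

section \<open>Adding an odd current\<close>

text \<open>The vanishing order for a list of exponents. The exponents are integers, since an odd operator lowers an exponent
and may make it negative.\<close>

definition iorder :: "int list \<Rightarrow> nat \<Rightarrow> nat" where
  "iorder \<eta> r = (\<Sum>x\<leftarrow>\<eta>. nat (int r - x))"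

lemma iorder_append: "iorder (xs @ ys) r = iorder xs r + iorder ys r"
  by (simp add: iorder_def)

lemma iorder_mono: "r \<le> r' \<Longrightarrow> iorder xs r \<le> iorder xs r'"
  unfolding iorder_def by (intro sum_list_mono) auto

lemma iorder_slope: "(\<And>x. x \<in> set xs \<Longrightarrow> x \<le> int r) \<Longrightarrow> iorder xs (Suc r) = iorder xs r + length xs"
proof (induction xs)
  case (Cons a xs)
  then have "a \<le> int r" by simp
  then have "nat (int (Suc r) - a) = Suc (nat (int r - a))" by (simp add: nat_eq_iff)
  then show ?case using Cons by (simp add: iorder_def)
qed (simp add: iorder_def)

lemma eq_neg_self_iff_zero:
  assumes "v = - v"
  shows "v = (0 :: 'v::complex_vector)"
proof -
  have "(2::complex) *\<^sub>C v = v + v"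
    using scaleC_left_distrib[of 1 1 v] by (simp add: scaleC_one)
  also have "\<dots> = 0" using assms by (metis add.right_inverse)
  finally show ?thesis by simp
qed

text \<open>The operators \<open>X\<^sub>0, X\<^sub>1, \<dots>\<close> are used up in order: \<open>pre\<close> holds the exponents of the slots
whose operator already kills \<open>e\<close>. For the next index \<open>p\<close>, either one passes to the submodule generated by
\<open>X\<^sub>p e\<close>, where the exponent with index \<open>p\<close> is lowered by one, or one divides by it, and \<open>X\<^sub>p\<close> kills
\<open>e\<close> as well. The members of \<open>Qs\<close> are the families of operators whose vanishing order is tracked, and \<open>C\<close> is
whatever side information has to be carried along to the case in which no \<open>X\<^sub>i\<close> acts (premise \<open>final\<close>).\<close>

lemma odd_phase:
  fixes X :: "nat \<Rightarrow> 'v::complex_vector \<Rightarrow> 'v" and Qs :: "(nat \<Rightarrow> nat \<Rightarrow> 'v \<Rightarrow> 'v) set"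
    and \<phi> :: "int \<Rightarrow> nat" and C :: "'v \<Rightarrow> 'v set \<Rightarrow> bool"
  assumes Op_clin: "\<And>f. f \<in> Op \<Longrightarrow> clin f" and X_Op: "\<And>i. X i \<in> Op"
    and X_anti: "\<And>i j v. X i (X j v) = - X j (X i v)"
    and Q_clin: "\<And>Q r s. Q \<in> Qs \<Longrightarrow> clin (Q r s)"
    and Q_inv: "\<And>Q r s T v. Q \<in> Qs \<Longrightarrow> invariant Op T \<Longrightarrow> v \<in> T \<Longrightarrow> Q r s v \<in> T"
    and E: "invariant Op E"
    and QX: "\<And>Q. Q \<in> Qs \<Longrightarrow> \<exists>c. c \<noteq> 0 \<and>
       (\<forall>i r s. \<forall>v\<in>E. X i (Q r s v) - c *\<^sub>C Q r s (X i v) \<in> T0)"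
    and C_mono: "\<And>e T T'. C e T \<Longrightarrow> T \<subseteq> T' \<Longrightarrow> C e T'"
    and C_X: "\<And>e T i. invariant Op T \<Longrightarrow> T0 \<subseteq> T \<Longrightarrow> e \<in> E \<Longrightarrow> C e T \<Longrightarrow> C (X i e) T"
    and final: "\<And>e T \<eta>. invariant Op T \<Longrightarrow> T0 \<subseteq> T \<Longrightarrow> e \<in> E \<Longrightarrow> C e T \<Longrightarrow> length \<eta> = N \<Longrightarrow>
       (\<And>i. i < N \<Longrightarrow> X i e \<in> T) \<Longrightarrow>
       (\<And>Q r s. Q \<in> Qs \<Longrightarrow> s < iorder \<eta> r \<Longrightarrow> Q r s e \<in> T) \<Longrightarrow>
       bounded_mod Op e T (\<Prod>x\<leftarrow>\<eta>. \<phi> x)"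
    and T: "invariant Op T" "T0 \<subseteq> T" and e: "e \<in> E" "C e T"
    and len: "length pre + length suf = N" and sorted: "sorted suf"
    and pre: "\<And>x y. x \<in> set pre \<Longrightarrow> y \<in> set suf \<Longrightarrow> x \<le> y"
    and low: "\<And>i. i < length pre \<Longrightarrow> X i e \<in> T"
    and alpha: "\<And>Q r s. Q \<in> Qs \<Longrightarrow> s < iorder (pre @ suf) r \<Longrightarrow> Q r s e \<in> T"
    and beta: "\<And>Q r s. Q \<in> Qs \<Longrightarrow> s < iorder (pre @ suf) (Suc r) \<Longrightarrow>
       (\<Sum>i\<in>{length pre..s}. Q r (s - i) (X i e)) \<in> T"
  shows "bounded_mod Op e T ((\<Prod>x\<leftarrow>pre. \<phi> x) * (\<Prod>x\<leftarrow>suf. \<phi> x + \<phi> (x - 1)))"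
  using T e len sorted pre low alpha beta
proof (induction suf arbitrary: pre e T)
  case Nil
  then show ?case using final[of T e pre] by simp
next
  case (Cons h suf)
  note T = Cons.prems(1) and T0 = Cons.prems(2) and eO = Cons.prems(3) and Ce = Cons.prems(4)
    and low = Cons.prems(8) and alpha = Cons.prems(9) and beta = Cons.prems(10)
  note sub = invariant_subspace[OF T]
  define p where "p = length pre"
  define g where "g = iorder (pre @ h # suf)"
  have X_in: "X i v \<in> T" if "v \<in> T" for i v using invariantD[OF T X_Op that] .
  have X_O: "X i v \<in> E" if "v \<in> E" for i v using invariantD[OF E X_Op that] .
  have X_lin: "clin (X i)" for i by (rule Op_clin[OF X_Op])
  have XX: "X i (X i v) = 0" for i v
    by (rule eq_neg_self_iff_zero) (rule X_anti)
  \<comment> \<open>the relations of a vector are inherited by its images under the odd operators\<close>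
  have transport: "(\<Sum>i\<in>I. Q r (t i) (X j (u i))) \<in> T"
    if Q: "Q \<in> Qs" and u: "\<And>i. i \<in> I \<Longrightarrow> u i \<in> E" and s: "(\<Sum>i\<in>I. Q r (t i) (u i)) \<in> T" for Q I r t j u
  proof -
    obtain c where c: "c \<noteq> 0"
        "\<And>i r s v. v \<in> E \<Longrightarrow> X i (Q r s v) - c *\<^sub>C Q r s (X i v) \<in> T0"
      using QX[OF Q] by blast
    have "(\<Sum>i\<in>I. X j (Q r (t i) (u i)) - c *\<^sub>C Q r (t i) (X j (u i))) \<in> T"
      using c(2) u T0 by (intro cvs.subspace_sum[OF sub]) auto
    from cvs.subspace_diff[OF sub X_in[OF s, of j] this]
    have "c *\<^sub>C (\<Sum>i\<in>I. Q r (t i) (X j (u i))) \<in> T"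
      by (simp add: clin_sum[OF X_lin] sum_subtractf cvs.scale_sum_right)
    from cvs.subspace_scale[OF sub this, of "inverse c"] show ?thesis
      using c(1) by (simp add: scaleC_scaleC scaleC_one)
  qed
  have transport1: "Q r t (X j v) \<in> T" if "Q \<in> Qs" "v \<in> E" "Q r t v \<in> T" for Q r t j v
    using transport[of Q "{0::nat}" "\<lambda>_. v" r "\<lambda>_. t" j] that by simp
  let ?e = "X p e"
  have eO': "?e \<in> E" by (rule X_O[OF eO])
  have words: "?e \<in> words Op e" by (rule words.step[OF X_Op words.base])
  \<comment> \<open>branch 1: the quotient by \<open>X p e\<close>\<close>
  let ?T = "adjoin Op T ?e"
  have T': "invariant Op ?T" by (rule invariant_adjoin[OF Op_clin T])
  have sub': "cvs.subspace ?T" by (rule invariant_subspace[OF T'])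
  have TT': "v \<in> ?T" if "v \<in> T" for v using that adjoin_sup by blast
  have eT': "?e \<in> ?T" by (rule adjoin_self)
  have "bounded_mod Op e ?T ((\<Prod>x\<leftarrow>pre @ [h]. \<phi> x) * (\<Prod>x\<leftarrow>suf. \<phi> x + \<phi> (x - 1)))"
  proof (rule Cons.IH)
    show "X i e \<in> ?T" if "i < length (pre @ [h])" for i
      using that low[of i] TT' eT' by (auto simp: less_Suc_eq p_def)
    show "Q r s e \<in> ?T" if "Q \<in> Qs" "s < iorder ((pre @ [h]) @ suf) r" for Q r s
      using alpha[of Q s r] that TT' by simp
    show "(\<Sum>i\<in>{length (pre @ [h])..s}. Q r (s - i) (X i e)) \<in> ?T"
      if "Q \<in> Qs" "s < iorder ((pre @ [h]) @ suf) (Suc r)" for Q r s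
    proof (cases "p \<le> s")
      case True
      have "(\<Sum>i\<in>{p..s}. Q r (s - i) (X i e)) \<in> ?T"
        using beta[of Q s r] that TT' by (simp add: p_def)
      moreover have "(\<Sum>i\<in>{p..s}. Q r (s - i) (X i e))
          = Q r (s - p) ?e + (\<Sum>i\<in>{length (pre @ [h])..s}. Q r (s - i) (X i e))"
        using True by (simp add: sum.atLeast_Suc_atMost p_def)
      ultimately show ?thesis
        using cvs.subspace_diff[OF sub' _ Q_inv[OF that(1) T' eT']] by (metis add_diff_cancel_left')
    next
      case False
      then show ?thesis using cvs.subspace_0[OF sub'] by (simp add: p_def)
    qed
  qed (use T' T0 TT' eO Ce C_mono[OF Ce adjoin_sup] Cons.prems in auto)
  then have br1: "bounded_mod Op e ?T ((\<Prod>x\<leftarrow>pre. \<phi> x) * \<phi> h * (\<Prod>x\<leftarrow>suf. \<phi> x + \<phi> (x - 1)))"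
    by (simp add: mult_ac)
  \<comment> \<open>branch 2: the submodule generated by \<open>X p e\<close>\<close>
  have g': "iorder ((pre @ [h - 1]) @ suf) r = g r + (if h \<le> int r then 1 else 0)" for r
    by (auto simp: g_def iorder_append) (auto simp: iorder_def nat_diff_distrib)
  have slope: "g r + p < g (Suc r)" if "h \<le> int r" for r
  proof -
    have "iorder (pre @ [h]) (Suc r) = iorder (pre @ [h]) r + length (pre @ [h])"
      using Cons.prems(7) that by (intro iorder_slope) force
    moreover have "iorder suf r \<le> iorder suf (Suc r)" by (rule iorder_mono) simp
    ultimately show ?thesis
      using iorder_append[of "pre @ [h]" suf r] iorder_append[of "pre @ [h]" suf "Suc r"]
      by (simp add: g_def p_def)
  qed
  have "bounded_mod Op ?e T ((\<Prod>x\<leftarrow>pre @ [h - 1]. \<phi> x) * (\<Prod>x\<leftarrow>suf. \<phi> x + \<phi> (x - 1)))"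
  proof (rule Cons.IH)
    show "X i ?e \<in> T" if "i < length (pre @ [h - 1])" for i
    proof (cases "i = p")
      case True
      then show ?thesis using cvs.subspace_0[OF sub] by (simp add: XX)
    next
      case False
      then have "X i e \<in> T" using that by (intro low) (simp add: p_def)
      then show ?thesis
        unfolding X_anti[of i p] by (rule cvs.subspace_neg[OF sub X_in])
    qed
  next
    fix Q r s assume Q: "Q \<in> Qs" and s: "s < iorder ((pre @ [h - 1]) @ suf) r"
    show "Q r s ?e \<in> T"
    proof (cases "s < g r")
      case True
      then have "Q r s e \<in> T" using alpha Q by (simp add: g_def)
      then show ?thesis by (rule transport1[OF Q eO])
    next
      case False
      then have s: "s = g r" "h \<le> int r" using s unfolding g' by (auto split: if_splits)
      have "(\<Sum>i\<in>{p..s + p}. Q r (s + p - i) (X i e)) \<in> T"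
        unfolding p_def using slope[OF s(2)] s by (intro beta[OF Q]) (simp add: p_def g_def)
      moreover have "(\<Sum>i\<in>{p..s + p}. Q r (s + p - i) (X i e))
          = Q r s ?e + (\<Sum>i\<in>{Suc p..s + p}. Q r (s + p - i) (X i e))"
        by (simp add: sum.atLeast_Suc_atMost)
      moreover have "(\<Sum>i\<in>{Suc p..s + p}. Q r (s + p - i) (X i e)) \<in> T"
      proof (rule cvs.subspace_sum[OF sub], rule transport1[OF Q eO])
        fix i assume "i \<in> {Suc p..s + p}"
        then have "s + p - i < g r" using s(1) by auto
        then show "Q r (s + p - i) e \<in> T" by (intro alpha[OF Q]) (simp add: g_def)
      qed
      ultimately show ?thesis using cvs.subspace_diff[OF sub] by (metis add_diff_cancel_right')
    qed
  next
    fix Q r s assume Q: "Q \<in> Qs" and s: "s < iorder ((pre @ [h - 1]) @ suf) (Suc r)"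
    then have s: "s \<le> g (Suc r)" unfolding g' by (auto split: if_splits)
    note Ql = Q_clin[OF Q]
    define A where "A i j = (if i + j \<le> s + p then Q r (s + p - (i + j)) (X i (X j e)) else 0)" for i j
    have anti: "A i j = - A j i" for i j
      by (simp add: A_def add.commute X_anti[of i j] clin_minus[OF Ql])
    have "(\<Sum>i\<in>{p..s}. \<Sum>j\<in>{p..s}. A i j) = (\<Sum>i\<in>{p..s}. \<Sum>j\<in>{p..s}. A j i)"
      by (rule sum.swap)
    also have "\<dots> = (\<Sum>i\<in>{p..s}. \<Sum>j\<in>{p..s}. - A i j)"
      by (intro sum.cong refl anti)
    also have "\<dots> = - (\<Sum>i\<in>{p..s}. \<Sum>j\<in>{p..s}. A i j)"
      by (simp add: sum_negf)
    finally have tot: "(\<Sum>i\<in>{p..s}. \<Sum>j\<in>{p..s}. A i j) = 0"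
      by (rule eq_neg_self_iff_zero)
    have row: "(\<Sum>j\<in>{p..s}. A i j) \<in> T" if i: "i \<in> {Suc p..s}" for i
    proof -
      have "(\<Sum>j\<in>{p..s}. A i j) = (\<Sum>j\<in>{p..s + p - i}. Q r (s + p - i - j) (X i (X j e)))"
        using i by (intro sum.mono_neutral_cong_right) (auto simp: A_def)
      also have "\<dots> \<in> T"
      proof (rule transport[OF Q X_O[OF eO]])
        have "s + p - i < g (Suc r)" using i s by auto
        then show "(\<Sum>j\<in>{p..s + p - i}. Q r (s + p - i - j) (X j e)) \<in> T"
          unfolding p_def g_def by (rule beta[OF Q])
      qed
      finally show ?thesis .
    qed
    show "(\<Sum>i\<in>{length (pre @ [h - 1])..s}. Q r (s - i) (X i ?e)) \<in> T"
    proof (cases "p \<le> s")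
      case True
      have "(\<Sum>j\<in>{p..s}. A p j) = (\<Sum>i\<in>{p..s}. \<Sum>j\<in>{p..s}. A i j) - (\<Sum>i\<in>{Suc p..s}. \<Sum>j\<in>{p..s}. A i j)"
        using True by (simp add: sum.atLeast_Suc_atMost[of p s "\<lambda>i. sum (A i) _"])
      also have "\<dots> \<in> T"
        unfolding tot by (intro cvs.subspace_diff[OF sub] cvs.subspace_0[OF sub] cvs.subspace_sum[OF sub] row)
      finally have "(\<Sum>j\<in>{p..s}. A p j) \<in> T" .
      moreover have "(\<Sum>j\<in>{p..s}. A p j) = (\<Sum>j\<in>{Suc p..s}. A p j)"
        using True by (simp add: sum.atLeast_Suc_atMost A_def XX clin_zero[OF Ql])
      moreover have "(\<Sum>j\<in>{Suc p..s}. A p j) = - (\<Sum>j\<in>{Suc p..s}. Q r (s - j) (X j ?e))"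
        unfolding sum_negf[symmetric]
        by (intro sum.cong refl) (auto simp: A_def X_anti[of p] clin_minus[OF Ql])
      ultimately show ?thesis using cvs.subspace_neg[OF sub] by (fastforce simp: p_def)
    next
      case False
      then show ?thesis using cvs.subspace_0[OF sub] by (simp add: p_def)
    qed
  qed (use T T0 eO' C_X[OF T T0 eO Ce] Cons.prems in \<open>force+\<close>)
  then have br2: "bounded_mod Op ?e T ((\<Prod>x\<leftarrow>pre. \<phi> x) * \<phi> (h - 1) * (\<Prod>x\<leftarrow>suf. \<phi> x + \<phi> (x - 1)))"
    by (simp add: mult_ac)
  from bounded_mod_split[OF words br1 br2] show ?case
    by (simp add: algebra_simps)
qed

section \<open>The enveloping algebra as operators\<close>

subsection \<open>Linear extension from a basis\<close>

definition linext :: "('k \<Rightarrow> 'v::complex_vector) \<Rightarrow> ('k \<Rightarrow>\<^sub>0 complex) \<Rightarrow> 'v" where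
  "linext f p = (\<Sum>k\<in>Poly_Mapping.keys p. Poly_Mapping.lookup p k *\<^sub>C f k)"

lemma linext_superset:
  "finite A \<Longrightarrow> Poly_Mapping.keys p \<subseteq> A \<Longrightarrow>
     linext f p = (\<Sum>k\<in>A. Poly_Mapping.lookup p k *\<^sub>C f k)"
  unfolding linext_def by (rule sum.mono_neutral_left) (auto simp: in_keys_iff)

lemma linext_single: "linext f (Poly_Mapping.single k c) = c *\<^sub>C f k"
  by (subst linext_superset[of "{k}"]) auto

lemma lookup_scaleC: "Poly_Mapping.lookup (c *\<^sub>C p) k = c *\<^sub>C Poly_Mapping.lookup p k"
  by (simp add: scaleC_poly_mapping.rep_eq)

lemma scaleC_single: "c *\<^sub>C Poly_Mapping.single k v = Poly_Mapping.single k (c *\<^sub>C v)"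
  by (rule poly_mapping_eqI) (simp add: lookup_scaleC lookup_single when_def)

lemma clin_linext: "clin (linext f)"
proof (rule clinI)
  fix p q :: "'a \<Rightarrow>\<^sub>0 complex" and c :: complex
  let ?A = "Poly_Mapping.keys p \<union> Poly_Mapping.keys q"
  have "linext f (p + q) = (\<Sum>k\<in>?A. Poly_Mapping.lookup (p + q) k *\<^sub>C f k)"
    using Poly_Mapping.keys_add[of p q] by (intro linext_superset) auto
  also have "\<dots> = linext f p + linext f q"
    by (simp add: linext_superset[of ?A p] linext_superset[of ?A q] lookup_add
        scaleC_left_distrib sum.distrib)
  finally show "linext f (p + q) = linext f p + linext f q" .
  have "linext f (c *\<^sub>C p) = (\<Sum>k\<in>Poly_Mapping.keys p. Poly_Mapping.lookup (c *\<^sub>C p) k *\<^sub>C f k)"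
    by (intro linext_superset) (auto simp: in_keys_iff lookup_scaleC scaleC_complex_def)
  then show "linext f (c *\<^sub>C p) = c *\<^sub>C linext f p"
    by (simp add: linext_def lookup_scaleC cvs.scale_sum_right scaleC_scaleC scaleC_complex_def)
qed

lemma linext_basis: "linext (\<lambda>k. Poly_Mapping.single k 1) p = p"
proof (rule poly_mapping_eqI)
  fix k
  have "Poly_Mapping.lookup (linext (\<lambda>k. Poly_Mapping.single k 1) p) k =
      (\<Sum>j\<in>Poly_Mapping.keys p. if j = k then Poly_Mapping.lookup p j else 0)"
    unfolding linext_def lookup_sum
    by (intro sum.cong) (auto simp: lookup_scaleC lookup_single when_def scaleC_complex_def)
  then show "Poly_Mapping.lookup (linext (\<lambda>k. Poly_Mapping.single k 1) p) k = Poly_Mapping.lookup p k"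
    by (simp add: in_keys_iff)
qed

lemma clin_linext_commute: "clin F \<Longrightarrow> F (linext f p) = linext (\<lambda>k. F (f k)) p"
  by (simp add: linext_def clin_sum clin_scale)

lemma clin_eqI_single:
  assumes "clin F" "clin G" "\<And>k. F (Poly_Mapping.single k 1) = G (Poly_Mapping.single k 1)"
  shows "F p = G (p :: 'k \<Rightarrow>\<^sub>0 complex)"
proof -
  have "F (linext (\<lambda>k. Poly_Mapping.single k 1) p) = G (linext (\<lambda>k. Poly_Mapping.single k 1) p)"
    by (simp add: clin_linext_commute assms)
  then show ?thesis by (simp add: linext_basis)
qed

subsection \<open>The enveloping algebra as an algebra of operators\<close>

lemma clin_mult_free: "clin (\<lambda>q. p * q :: 'a free_alg)" "clin (\<lambda>q. q * p :: 'a free_alg)"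
  by (auto simp: clin_def distrib_left distrib_right scaleC_mult_left scaleC_mult_right)

definition free_act :: "('a \<Rightarrow> 'v \<Rightarrow> 'v) \<Rightarrow> 'a free_alg \<Rightarrow> 'v \<Rightarrow> 'v::complex_vector" where
  "free_act A p v = linext (\<lambda>w. foldr A w v) p"

lemma clin_foldr_fun: "(\<And>x. clin (A x)) \<Longrightarrow> clin (foldr A w)"
  by (induction w) (auto simp: clin_def)

lemma clin_free_act: "clin (\<lambda>p. free_act A p v)"
  unfolding free_act_def by (rule clin_linext)

lemma clin_free_act_right: "(\<And>x. clin (A x)) \<Longrightarrow> clin (free_act A p)"
  unfolding free_act_def linext_def
  by (intro clin_sum_fun clin_scaleC clin_foldr_fun)

lemma free_act_single: "free_act A (Poly_Mapping.single w 1) v = foldr A w v"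
  by (simp add: free_act_def linext_single scaleC_one)

lemma free_act_letter: "free_act A (letter x) v = A x v"
  by (simp add: letter_def free_act_single)

lemma single_Nil: "Poly_Mapping.single [] 1 = (1 :: 'a free_alg)"
  by (metis single_one zero_list_def)

lemma free_act_one: "free_act A 1 v = v"
  using free_act_single[of A "[]" v] by (simp add: single_Nil)

lemma free_act_mult:
  assumes "\<And>x. clin (A x)"
  shows "free_act A (p * q) v = free_act A p (free_act A q v)"
proof -
  have "free_act A (Poly_Mapping.single w 1 * q) v = free_act A (Poly_Mapping.single w 1) (free_act A q v)" for w
  proof (rule clin_eqI_single[where p = q])
    show "clin (\<lambda>q. free_act A (Poly_Mapping.single w 1 * q) v)"
      by (rule clin_comp[OF clin_free_act clin_mult_free(1)])
    show "clin (\<lambda>q. free_act A (Poly_Mapping.single w 1) (free_act A q v))"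
      by (rule clin_comp[OF clin_free_act_right clin_free_act]) (rule assms)
  qed (simp add: mult_single free_act_single plus_list_def)
  then show ?thesis
    by (rule clin_eqI_single[where p = p,
          OF clin_comp[OF clin_free_act clin_mult_free(2)] clin_free_act])
qed

lemma free_act_in:
  "(\<And>x v. v \<in> C \<Longrightarrow> A x v \<in> C) \<Longrightarrow> cvs.subspace C \<Longrightarrow> v \<in> C \<Longrightarrow> free_act A p v \<in> C"
proof -
  assume *: "\<And>x v. v \<in> C \<Longrightarrow> A x v \<in> C" "cvs.subspace C" "v \<in> C"
  have "foldr A w v \<in> C" for w by (induction w) (simp_all add: *)
  then show ?thesis
    unfolding free_act_def linext_def by (intro cvs.subspace_sum cvs.subspace_scale *)
qed

lemma uea_abs_rep: "abs_uea (rep_uea u) = u"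
  by (rule Quotient3_abs_rep[OF Quotient3_uea])

lemma uea_exists_abs: "\<exists>p. u = abs_uea p"
  using uea_abs_rep by metis

lemma clin_abs_uea: "clin abs_uea"
  by (simp add: clin_def plus_uea.abs_eq scaleC_uea.abs_eq)

lemma uea_scaleC_mult:
  "(c *\<^sub>C u) * v = c *\<^sub>C (u * v :: 'a::lie_superalgebra uea)" "u * (c *\<^sub>C v) = c *\<^sub>C (u * v)"
  by (transfer, simp add: scaleC_mult_left scaleC_mult_right uea_rel_def uea_ideal_closed)+

lemma clin_uea_mult: "clin (\<lambda>v. u * v :: 'a::lie_superalgebra uea)" "clin (\<lambda>v. v * u :: 'a uea)"
  by (auto simp: clin_def distrib_left distrib_right uea_scaleC_mult)

lemma uea_rel_ideal: "r \<in> uea_relators \<Longrightarrow> r \<in> uea_ideal"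
proof -
  assume "r \<in> uea_relators"
  then have "1 * r * 1 \<in> {a * r * b | a r b. r \<in> uea_relators}" by blast
  then show "r \<in> uea_ideal" unfolding uea_ideal_def by (intro cvs.span_base) simp
qed

lemma uea_relI: "p - q \<in> uea_relators \<Longrightarrow> uea_rel p q"
  by (simp add: uea_rel_def uea_rel_ideal)

lemma uea_relators_intros:
  "letter (x + y) - (letter x + letter y) \<in> uea_relators"
  "letter (c *\<^sub>C x) - c *\<^sub>C letter x \<in> uea_relators"
  "letter (hcomp i x) * letter (hcomp j y)
     - (ksign (i * j) *\<^sub>C (letter (hcomp j y) * letter (hcomp i x))
        + letter (bracket (hcomp i x) (hcomp j y))) \<in> uea_relators"
  unfolding uea_relators_def diff_diff_eq[symmetric] by blast+

lemma clin_uea_of: "clin uea_of"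
proof (rule clinI)
  fix x y :: 'a and c :: complex
  show "uea_of (x + y) = uea_of x + uea_of y"
    by transfer (rule uea_relI, rule uea_relators_intros)
  show "uea_of (c *\<^sub>C x) = c *\<^sub>C uea_of x"
    by transfer (rule uea_relI, rule uea_relators_intros)
qed

lemmas uea_of_add = clin_add[OF clin_uea_of]
  and uea_of_scaleC = clin_scale[OF clin_uea_of]
  and uea_of_zero = clin_zero[OF clin_uea_of]
  and uea_of_minus = clin_minus[OF clin_uea_of]
  and uea_of_diff = clin_diff[OF clin_uea_of]
  and uea_of_sum = clin_sum[OF clin_uea_of]

lemma uea_of_bracket:
  "uea_of (hcomp i x) * uea_of (hcomp j y) =
     ksign (i * j) *\<^sub>C (uea_of (hcomp j y) * uea_of (hcomp i x)) + uea_of (bracket (hcomp i x) (hcomp j y))"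
  by transfer (rule uea_relI, rule uea_relators_intros)

lemma abs_uea_single: "abs_uea (Poly_Mapping.single w 1) = prod_list (map uea_of w)"
proof (induction w)
  case Nil
  then show ?case by (simp add: single_Nil flip: one_uea.abs_eq)
next
  case (Cons x w)
  have "Poly_Mapping.single (x # w) (1::complex) = letter x * Poly_Mapping.single w 1"
    by (simp add: letter_def mult_single plus_list_def)
  then show ?case by (simp add: Cons times_uea.abs_eq[symmetric] uea_of.abs_eq[symmetric])
qed

lemma uea_left_induct:
  assumes S: "cvs.subspace S" and "1 \<in> S" and "\<And>x u. u \<in> S \<Longrightarrow> uea_of x * u \<in> S"
  shows "(u :: 'a::lie_superalgebra uea) \<in> S"
proof -
  have "prod_list (map uea_of w) \<in> S" for w :: "'a list"
    by (induction w) (use assms in auto)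
  moreover obtain p where "u = abs_uea p" using uea_exists_abs by blast
  moreover have "abs_uea p = linext (\<lambda>w. abs_uea (Poly_Mapping.single w 1)) p"
    using clin_linext_commute[OF clin_abs_uea, of "\<lambda>w. Poly_Mapping.single w 1" p]
    unfolding linext_basis .
  ultimately show ?thesis
    unfolding linext_def abs_uea_single by (auto intro!: cvs.subspace_sum[OF S] cvs.subspace_scale[OF S])
qed


text \<open>The operators of a tensor product satisfy the relations of the superalgebra only modulo the
relators of the tensor product, hence a representation on \<open>C\<close> modulo a subspace \<open>S\<close>.\<close>

locale rep_mod =
  fixes A :: "'a::lie_superalgebra \<Rightarrow> 'v::complex_vector \<Rightarrow> 'v" and C S :: "'v set"
  assumes A_clin: "clin (A x)"
    and C: "cvs.subspace C" and S: "cvs.subspace S"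
    and A_C: "v \<in> C \<Longrightarrow> A x v \<in> C" and A_S: "v \<in> S \<Longrightarrow> A x v \<in> S"
    and A_add: "v \<in> C \<Longrightarrow> A (x + y) v - A x v - A y v \<in> S"
    and A_scale: "v \<in> C \<Longrightarrow> A (c *\<^sub>C x) v - c *\<^sub>C A x v \<in> S"
    and A_bracket: "v \<in> C \<Longrightarrow> A (hcomp i x) (A (hcomp j y) v)
        - ksign (i * j) *\<^sub>C A (hcomp j y) (A (hcomp i x) v)
        - A (bracket (hcomp i x) (hcomp j y)) v \<in> S"
begin

lemma free_act_relators:
  assumes "r \<in> uea_relators" "v \<in> C"
  shows "free_act A r v \<in> S"
  using assms A_add A_scale A_bracket unfolding uea_relators_def
  by (auto simp: clin_diff[OF clin_free_act] clin_scale[OF clin_free_act] free_act_letter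
      free_act_mult[OF A_clin])

lemma free_act_S: "v \<in> S \<Longrightarrow> free_act A p v \<in> S"
  using A_S S by (rule free_act_in)

lemma free_act_C: "v \<in> C \<Longrightarrow> free_act A p v \<in> C"
  using A_C C by (rule free_act_in)

lemma free_act_ideal:
  assumes "p \<in> uea_ideal" "v \<in> C"
  shows "free_act A p v \<in> S"
  using assms(1) unfolding uea_ideal_def
proof (rule cspan_induct_clin[OF _ clin_free_act S])
  fix b assume "b \<in> {a * r * b | a r b. r \<in> (uea_relators :: 'a free_alg set)}"
  then obtain p r q where b: "b = p * r * q" and r: "r \<in> uea_relators" by blast
  have "free_act A r (free_act A q v) \<in> S"
    by (rule free_act_relators[OF r free_act_C[OF assms(2)]])
  then show "free_act A b v \<in> S"
    unfolding b free_act_mult[OF A_clin] by (rule free_act_S)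
qed

definition uact :: "'a uea \<Rightarrow> 'v \<Rightarrow> 'v" where
  "uact u v = free_act A (rep_uea u) v"

lemma uact_C: "v \<in> C \<Longrightarrow> uact u v \<in> C"
  unfolding uact_def by (rule free_act_C)

lemma uact_clin: "clin (uact u)"
  unfolding uact_def by (rule clin_free_act_right[OF A_clin])

lemma uact_S: "v \<in> S \<Longrightarrow> uact u v \<in> S"
  unfolding uact_def by (rule free_act_S)

lemma uact_abs: "v \<in> C \<Longrightarrow> uact (abs_uea p) v - free_act A p v \<in> S"
proof -
  have "uea_rel (rep_uea (abs_uea p)) p"
    using uea_abs_rep[of "abs_uea p"] by (simp add: uea.abs_eq_iff)
  then have "rep_uea (abs_uea p) - p \<in> uea_ideal" by (simp add: uea_rel_def)
  then show "v \<in> C \<Longrightarrow> uact (abs_uea p) v - free_act A p v \<in> S"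
    unfolding uact_def clin_diff[OF clin_free_act, symmetric] by (rule free_act_ideal)
qed

lemma uact_add: "v \<in> C \<Longrightarrow> uact (u + u') v - (uact u v + uact u' v) \<in> S"
  using uact_abs[of v "rep_uea u + rep_uea u'"]
  by (simp add: plus_uea.abs_eq[symmetric] uea_abs_rep clin_add[OF clin_free_act]) (simp add: uact_def)

lemma uact_scaleC: "v \<in> C \<Longrightarrow> uact (c *\<^sub>C u) v - c *\<^sub>C uact u v \<in> S"
  using uact_abs[of v "c *\<^sub>C rep_uea u"]
  by (simp add: scaleC_uea.abs_eq[symmetric] uea_abs_rep clin_scale[OF clin_free_act]) (simp add: uact_def)

lemma uact_mult: "v \<in> C \<Longrightarrow> uact (u * u') v - uact u (uact u' v) \<in> S"
  using uact_abs[of v "rep_uea u * rep_uea u'"]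
  by (simp add: times_uea.abs_eq[symmetric] uea_abs_rep free_act_mult[OF A_clin]) (simp add: uact_def)

lemma uact_of: "v \<in> C \<Longrightarrow> uact (uea_of x) v - A x v \<in> S"
  using uact_abs[of v "letter x"] by (simp add: uea_of.abs_eq free_act_letter)

lemma uact_one: "v \<in> C \<Longrightarrow> uact 1 v - v \<in> S"
  using uact_abs[of v 1] by (simp add: one_uea.abs_eq[symmetric] free_act_one)

lemma uact_of_mult: "v \<in> C \<Longrightarrow> uact (uea_of x * u) v - A x (uact u v) \<in> S"
  using cvs.subspace_add[OF S uact_mult[of v "uea_of x" u] uact_of[OF uact_C, of v x u]] by simp

end

section \<open>Counting with one even and two odd currents\<close>

definition dim_even :: "int \<Rightarrow> nat" where "dim_even x = nat (x + 1)"
definition dim_odd :: "int \<Rightarrow> nat" where "dim_odd x = dim_even x + dim_even (x - 1)"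
definition dim_full :: "int \<Rightarrow> nat" where "dim_full x = dim_odd x + dim_odd (x - 1)"

locale super_currents =
  fixes Z X Y :: "nat \<Rightarrow> 'v::complex_vector \<Rightarrow> 'v" and N :: nat and E T0 :: "'v set"
  assumes lin: "clin (Z i)" "clin (X i)" "clin (Y i)"
    and ZZ: "Z i (Z j v) = Z j (Z i v)"
    and XZ: "X i (Z j v) = Z j (X i v)" and YZ: "Y i (Z j v) = Z j (Y i v)"
    and XX: "X i (X j v) = - X j (X i v)" and YY: "Y i (Y j v) = - Y j (Y i v)"
    and ge: "i \<ge> N \<Longrightarrow> Z i v = 0" "i \<ge> N \<Longrightarrow> X i v = 0" "i \<ge> N \<Longrightarrow> Y i v = 0"
    and E: "invariant (range Z \<union> range X \<union> range Y) E"
    and T0: "invariant (range Z \<union> range X \<union> range Y) T0"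
    and XY: "v \<in> E \<Longrightarrow> X i (Y j v) + Y j (X i v) \<in> T0"
begin

abbreviation Op where "Op \<equiv> range Z \<union> range X \<union> range Y"

lemma Op_clin: "f \<in> Op \<Longrightarrow> clin f"
  using lin by auto

lemma Z_central: "f \<in> Op \<Longrightarrow> f (Z i v) = Z i (f v)"
  using ZZ XZ YZ by auto

sublocale even_current Op Z N
  by unfold_locales (auto simp: Op_clin Z_central ge)

lemma cur_inv: "invariant Op T \<Longrightarrow> v \<in> T \<Longrightarrow> cur Z r s v \<in> T"
  using invariant_subspace Z_invariant by (rule cur_invariant)

lemma cur_Op: "f \<in> Op \<Longrightarrow> f (cur Z r s v) = cur Z r s (f v)"
  by (rule cur_commute[where Z = Z]) (auto simp: Op_clin Z_central)

lemma sum_list_sort: "(\<Sum>x\<leftarrow>sort xs. f x) = (\<Sum>x\<leftarrow>xs. (f x :: nat))"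
  by (simp flip: sum_mset_sum_list)

lemma prod_list_sort: "(\<Prod>x\<leftarrow>sort xs. f x) = (\<Prod>x\<leftarrow>xs. (f x :: nat))"
  by (simp flip: prod_mset_prod_list)

text \<open>A negative exponent forces the vector into \<open>T\<close> already at \<open>r = 0\<close>, in agreement with \<open>dim_even\<close> being zero there.\<close>

lemma bounded_even:
  assumes T: "invariant Op T" and low: "\<And>i. X i e \<in> T" "\<And>i. Y i e \<in> T" and len: "length \<eta> = N"
    and \<alpha>: "\<And>r s. s < iorder \<eta> r \<Longrightarrow> cur Z r s e \<in> T"
  shows "bounded_mod Op e T (\<Prod>x\<leftarrow>\<eta>. dim_even x)"
proof (cases "\<exists>x\<in>set \<eta>. x < 0")
  case True
  then obtain x where x: "x \<in> set \<eta>" "x < 0" by blast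
  have "nat (int 0 - x) \<le> iorder \<eta> 0"
    unfolding iorder_def using x by (intro member_le_sum_list) auto
  then have "iorder \<eta> 0 > 0" using x by simp
  then have "e \<in> T" using \<alpha>[of 0 0] by simp
  then show ?thesis by (rule bounded_mod_0[OF T])
next
  case False
  define \<xi> where "\<xi> = mset (map nat \<eta>)"
  have ord: "vorder 0 \<xi> r = iorder \<eta> r" for r
  proof -
    have "vorder 0 \<xi> r = (\<Sum>x\<leftarrow>\<eta>. r - nat x)"
      by (simp add: vorder_def \<xi>_def sum_mset_sum_list image_mset.compositionality comp_def flip: mset_map)
    also have "\<dots> = iorder \<eta> r"
      unfolding iorder_def using False by (intro arg_cong[where f = sum_list] map_cong refl) auto
    finally show ?thesis .
  qed
  have "bounded_mod Op e T (\<Prod>x\<in>#\<xi>. Suc x)"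
  proof (rule even_phase[where k = 0])
    show "f \<in> range Z \<or> f e \<in> T" if "f \<in> Op" for f using that low by auto
    show "cur Z r s e \<in> T" if "s < vorder 0 \<xi> r" for r s using \<alpha> that by (simp add: ord)
  qed (use T len in \<open>auto simp: \<xi>_def\<close>)
  also have "(\<Prod>x\<in>#\<xi>. Suc x) = (\<Prod>x\<leftarrow>\<eta>. Suc (nat x))"
    by (simp add: \<xi>_def prod_mset_prod_list image_mset.compositionality comp_def flip: mset_map)
  also have "\<dots> = (\<Prod>x\<leftarrow>\<eta>. dim_even x)"
    using False by (intro arg_cong[where f = prod_list] map_cong refl) (auto simp: dim_even_def)
  finally show ?thesis .
qed

lemma bounded_odd:
  assumes T: "invariant Op T" "T0 \<subseteq> T" and e: "e \<in> E" and low: "\<And>i. X i e \<in> T" and len: "length \<eta> = N"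
    and \<alpha>: "\<And>r s. s < iorder \<eta> r \<Longrightarrow> cur Z r s e \<in> T"
    and \<beta>: "\<And>r s. s < iorder \<eta> (Suc r) \<Longrightarrow> (\<Sum>i\<le>s. cur Z r (s - i) (Y i e)) \<in> T"
  shows "bounded_mod Op e T (\<Prod>x\<leftarrow>\<eta>. dim_odd x)"
proof -
  have sort: "iorder (sort \<eta>) = iorder \<eta>" by (auto simp: iorder_def sum_list_sort)
  have "bounded_mod Op e T ((\<Prod>x\<leftarrow>[]. dim_even x) * (\<Prod>x\<leftarrow>sort \<eta>. dim_even x + dim_even (x - 1)))"
  proof (rule odd_phase[where X = Y and Qs = "{cur Z}" and E = E and ?T0.0 = T0 and N = N
        and C = "\<lambda>e T. \<forall>i. X i e \<in> T", OF Op_clin])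
    show "\<exists>c. c \<noteq> 0 \<and> (\<forall>i r s. \<forall>v\<in>E. Y i (Q r s v) - c *\<^sub>C Q r s (Y i v) \<in> T0)"
      if "Q \<in> {cur Z}" for Q
      using that cvs.subspace_0[OF invariant_subspace[OF T0]]
      by (intro exI[of _ 1]) (auto simp: cur_Op scaleC_one)
    show "\<forall>j. X j (Y i e) \<in> T"
      if T: "invariant Op T" "T0 \<subseteq> T" and e: "e \<in> E" and c: "\<forall>j. X j e \<in> T" for e T i
    proof
      fix j
      have "Y i (X j e) \<in> T" by (rule invariantD[OF T(1)]) (use c in auto)
      from cvs.subspace_diff[OF invariant_subspace[OF T(1)] subsetD[OF T(2) XY[OF e, of j i]] this]
      show "X j (Y i e) \<in> T" by simp
    qed
    show "bounded_mod Op e T (\<Prod>x\<leftarrow>\<eta>. dim_even x)"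
      if "invariant Op T" "\<forall>i. X i e \<in> T" "length \<eta> = N" "\<And>i. i < N \<Longrightarrow> Y i e \<in> T"
         "\<And>Q r s. Q \<in> {cur Z} \<Longrightarrow> s < iorder \<eta> r \<Longrightarrow> Q r s e \<in> T" for e T \<eta>
    proof (rule bounded_even)
      show "Y i e \<in> T" for i
        using that(4)[of i] ge(3)[of i e] cvs.subspace_0[OF invariant_subspace[OF that(1)]]
        by (cases "i < N") auto
    qed (use that in auto)
    show "Y i (Y j v) = - Y j (Y i v)" for i j v by (rule YY)
  qed (use T e low len \<alpha> \<beta> E cur_inv in \<open>auto simp: sort atLeast0AtMost clin_cur lin\<close>)
  then show ?thesis by (simp add: prod_list_sort dim_odd_def)
qed

definition Ycur :: "nat \<Rightarrow> nat \<Rightarrow> 'v \<Rightarrow> 'v" where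
  "Ycur r s v = (case r of 0 \<Rightarrow> 0 | Suc r' \<Rightarrow> \<Sum>j\<le>s. cur Z r' (s - j) (Y j v))"

text \<open>The odd currents are removed one after the other. While \<open>X\<close> is being removed, the information about \<open>Y\<close>
is carried along as the family \<open>Ycur\<close>, whose index is shifted so that it has the same vanishing order as the powers of
the even current.\<close>

lemma bounded_full:
  assumes T: "invariant Op T" "T0 \<subseteq> T" and e: "e \<in> E" and len: "length \<eta> = N"
    and \<alpha>: "\<And>r s. s < iorder \<eta> r \<Longrightarrow> cur Z r s e \<in> T"
    and \<beta>X: "\<And>r s. s < iorder \<eta> (Suc r) \<Longrightarrow> (\<Sum>i\<le>s. cur Z r (s - i) (X i e)) \<in> T"
    and \<beta>Y: "\<And>r s. s < iorder \<eta> (Suc r) \<Longrightarrow> (\<Sum>i\<le>s. cur Z r (s - i) (Y i e)) \<in> T"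
    and \<gamma>: "\<And>r s. s < iorder \<eta> (Suc (Suc r)) \<Longrightarrow>
       (\<Sum>i\<le>s. \<Sum>j\<le>s - i. cur Z r (s - i - j) (Y j (X i e))) \<in> T"
  shows "bounded_mod Op e T (\<Prod>x\<leftarrow>\<eta>. dim_full x)"
proof -
  have sort: "iorder (sort \<eta>) = iorder \<eta>" by (auto simp: iorder_def sum_list_sort)
  have Ycur_in: "Ycur r s v \<in> T" if T: "invariant Op T" and v: "v \<in> T" for T r s v
  proof (cases r)
    case 0
    then show ?thesis using cvs.subspace_0[OF invariant_subspace[OF T]] by (simp add: Ycur_def)
  next
    case (Suc r')
    have "Y j v \<in> T" for j by (rule invariantD[OF T _ v]) simp
    then show ?thesis
      unfolding Ycur_def Suc nat.case
      by (intro cvs.subspace_sum[OF invariant_subspace[OF T]] cur_inv[OF T])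
  qed
  have Ycur_clin: "clin (Ycur r s)" for r s
  proof (cases r)
    case 0
    then show ?thesis by (simp add: clin_def Ycur_def)
  next
    case (Suc r')
    have "clin (\<lambda>v. \<Sum>j\<le>s. cur Z r' (s - j) (Y j v))"
      by (rule clin_sum_fun, rule clin_comp[OF clin_cur[OF lin(1)] lin(3)])
    then show ?thesis by (simp add: clin_def Ycur_def Suc)
  qed
  have XYcur: "X i (Ycur r s v) - (-1) *\<^sub>C Ycur r s (X i v) \<in> T0" if v: "v \<in> E" for i r s v
  proof (cases r)
    case 0
    then show ?thesis
      using cvs.subspace_0[OF invariant_subspace[OF T0]] by (simp add: Ycur_def clin_zero[OF lin(2)])
  next
    case (Suc r')
    have "X i (Ycur r s v) - (-1) *\<^sub>C Ycur r s (X i v)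
        = (\<Sum>j\<le>s. cur Z r' (s - j) (X i (Y j v) + Y j (X i v)))"
      by (simp add: Ycur_def Suc clin_sum[OF lin(2)] cur_Op clin_add[OF clin_cur[of Z, OF lin(1)]]
          sum.distrib)
    also have "\<dots> \<in> T0"
      by (intro cvs.subspace_sum[OF invariant_subspace[OF T0]] cur_inv[OF T0] XY[OF v])
    finally show ?thesis .
  qed
  have "bounded_mod Op e T ((\<Prod>x\<leftarrow>[]. dim_odd x) * (\<Prod>x\<leftarrow>sort \<eta>. dim_odd x + dim_odd (x - 1)))"
  proof (rule odd_phase[where X = X and Qs = "{cur Z, Ycur}" and E = E and ?T0.0 = T0 and N = N
        and C = "\<lambda>e T. True", OF Op_clin])
    show "\<exists>c. c \<noteq> 0 \<and> (\<forall>i r s. \<forall>v\<in>E. X i (Q r s v) - c *\<^sub>C Q r s (X i v) \<in> T0)"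
      if "Q \<in> {cur Z, Ycur}" for Q
    proof (cases "Q = cur Z")
      case True
      then show ?thesis using cvs.subspace_0[OF invariant_subspace[OF T0]]
        by (intro exI[of _ 1]) (auto simp: cur_Op scaleC_one)
    next
      case False
      then show ?thesis using that XYcur by (intro exI[of _ "-1"]) auto
    qed
    show "bounded_mod Op e T (\<Prod>x\<leftarrow>\<eta>. dim_odd x)"
      if T: "invariant Op T" "T0 \<subseteq> T" "e \<in> E" "length \<eta> = N" "\<And>i. i < N \<Longrightarrow> X i e \<in> T"
        and Q: "\<And>Q r s. Q \<in> {cur Z, Ycur} \<Longrightarrow> s < iorder \<eta> r \<Longrightarrow> Q r s e \<in> T" for e T \<eta>
    proof (rule bounded_odd)
      show "X i e \<in> T" for i
        using T(5)[of i] ge(2)[of i e] cvs.subspace_0[OF invariant_subspace[OF T(1)]]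
        by (cases "i < N") auto
      show "(\<Sum>i\<le>s. cur Z r (s - i) (Y i e)) \<in> T" if "s < iorder \<eta> (Suc r)" for r s
        using Q[of Ycur s "Suc r"] that by (simp add: Ycur_def)
    qed (use T Q in auto)
    show "Q r s e \<in> T" if "Q \<in> {cur Z, Ycur}" "s < iorder ([] @ sort \<eta>) r" for Q r s
      using that \<alpha> \<beta>Y cvs.subspace_0[OF invariant_subspace[OF T(1)]]
      by (auto simp: sort Ycur_def split: nat.splits)
    show "(\<Sum>i\<in>{length []..s}. Q r (s - i) (X i e)) \<in> T"
      if "Q \<in> {cur Z, Ycur}" "s < iorder ([] @ sort \<eta>) (Suc r)" for Q r s
    proof (cases "Q = cur Z")
      case True
      then show ?thesis using that \<beta>X by (simp add: sort atLeast0AtMost)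
    next
      case False
      then have Q: "Q = Ycur" using that by simp
      show ?thesis
      proof (cases r)
        case 0
        then show ?thesis
          using cvs.subspace_0[OF invariant_subspace[OF T(1)]] by (simp add: Q Ycur_def)
      next
        case (Suc r')
        then show ?thesis using \<gamma>[of s r'] that(2) by (simp add: Q Ycur_def sort atLeast0AtMost)
      qed
    qed
    show "X i (X j v) = - X j (X i v)" for i j v by (rule XX)
  qed (use T e len E cur_inv Ycur_in Ycur_clin in \<open>auto simp: clin_cur lin\<close>)
  then show ?thesis by (simp add: prod_list_sort dim_full_def)
qed

end

section \<open>Parametrized modules and their quotients\<close>

text \<open>The modules at hand live on sets of cosets of cosets. A surjection \<open>\<pi>\<close> from a subspace of a
typed vector space with kernel \<open>S\<close> carries their operations back to that vector space, and this description is
stable under quotients and under passing to an orbit.\<close>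

locale lin_param =
  fixes M :: "('a, 'v) smodule" and C S :: "'e::complex_vector set" and \<pi> :: "'e \<Rightarrow> 'v"
  assumes C: "cvs.subspace C" and S: "cvs.subspace S" and S_C: "S \<subseteq> C"
    and carrier: "carrier M = \<pi> ` C" and zero: "\<zero>\<^bsub>M\<^esub> = \<pi> 0"
    and add: "a \<in> C \<Longrightarrow> b \<in> C \<Longrightarrow> \<pi> a \<oplus>\<^bsub>M\<^esub> \<pi> b = \<pi> (a + b)"
    and smult: "a \<in> C \<Longrightarrow> c \<odot>\<^bsub>M\<^esub> \<pi> a = \<pi> (c *\<^sub>C a)"
    and eq: "a \<in> C \<Longrightarrow> b \<in> C \<Longrightarrow> \<pi> a = \<pi> b \<longleftrightarrow> a - b \<in> S"
begin

lemmas C_ops = cvs.subspace_0[OF C] cvs.subspace_add[OF C] cvs.subspace_diff[OF C]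
  cvs.subspace_scale[OF C] cvs.subspace_neg[OF C] cvs.subspace_sum[OF C]

lemma abelian_monoid: "abelian_monoid M"
proof (rule abelian_monoidI)
  fix x y z assume "x \<in> carrier M" "y \<in> carrier M" "z \<in> carrier M"
  then obtain a b c where "a \<in> C" "b \<in> C" "c \<in> C" "x = \<pi> a" "y = \<pi> b" "z = \<pi> c"
    by (auto simp: carrier)
  then show "x \<oplus>\<^bsub>M\<^esub> y \<in> carrier M" "x \<oplus>\<^bsub>M\<^esub> y \<oplus>\<^bsub>M\<^esub> z = x \<oplus>\<^bsub>M\<^esub> (y \<oplus>\<^bsub>M\<^esub> z)"
      "\<zero>\<^bsub>M\<^esub> \<oplus>\<^bsub>M\<^esub> x = x" "x \<oplus>\<^bsub>M\<^esub> y = y \<oplus>\<^bsub>M\<^esub> x"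
    by (auto simp: add carrier zero C_ops add_ac)
qed (auto simp: carrier zero C_ops)

lemma finsum:
  assumes "finite I" "\<And>i. i \<in> I \<Longrightarrow> f i \<in> C"
  shows "(\<Oplus>\<^bsub>M\<^esub>i\<in>I. \<pi> (f i)) = \<pi> (\<Sum>i\<in>I. f i)"
  using assms
proof (induction I)
  case empty
  then show ?case using abelian_monoid by (simp add: abelian_monoid.finsum_empty zero)
next
  case (insert i I)
  then have "(\<Oplus>\<^bsub>M\<^esub>i\<in>insert i I. \<pi> (f i)) = \<pi> (f i) \<oplus>\<^bsub>M\<^esub> (\<Oplus>\<^bsub>M\<^esub>i\<in>I. \<pi> (f i))"
    by (intro abelian_monoid.finsum_insert[OF abelian_monoid]) (auto simp: carrier)
  with insert show ?case by (simp add: add C_ops)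
qed

lemma finsum_cong':
  assumes "finite I" "\<And>i. i \<in> I \<Longrightarrow> f i \<in> C" "\<And>i. i \<in> I \<Longrightarrow> g i = \<pi> (f i)"
  shows "(\<Oplus>\<^bsub>M\<^esub>i\<in>I. g i) = \<pi> (\<Sum>i\<in>I. f i)"
proof -
  have "(\<Oplus>\<^bsub>M\<^esub>i\<in>I. g i) = (\<Oplus>\<^bsub>M\<^esub>i\<in>I. \<pi> (f i))"
    using assms by (intro abelian_monoid.finsum_cong'[OF abelian_monoid]) (auto simp: carrier)
  with finsum[OF assms(1,2)] show ?thesis by simp
qed

lemma mem_coset:
  assumes T: "cvs.subspace T" "S \<subseteq> T" "T \<subseteq> C" and a: "a \<in> C"
  shows "x \<in> \<pi> ` T +>\<^bsub>M\<^esub> \<pi> a \<longleftrightarrow> (\<exists>b\<in>C. x = \<pi> b \<and> b - a \<in> T)"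
proof -
  have "x \<in> \<pi> ` T +>\<^bsub>M\<^esub> \<pi> a \<longleftrightarrow> (\<exists>t\<in>T. x = \<pi> t \<oplus>\<^bsub>M\<^esub> \<pi> a)"
    by (auto simp: a_r_coset_def r_coset_def)
  also have "\<dots> \<longleftrightarrow> (\<exists>t\<in>T. x = \<pi> (t + a))"
    using T a by (auto simp: add subset_iff)
  also have "\<dots> \<longleftrightarrow> (\<exists>b\<in>C. x = \<pi> b \<and> b - a \<in> T)"
  proof safe
    fix t assume "t \<in> T"
    then show "\<exists>b\<in>C. \<pi> (t + a) = \<pi> b \<and> b - a \<in> T"
      using T a by (intro bexI[of _ "t + a"]) (auto simp: C_ops)
  next
    fix b assume "b \<in> C" "b - a \<in> T"
    then show "\<exists>t\<in>T. \<pi> b = \<pi> (t + a)" by (intro bexI[of _ "b - a"]) auto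
  qed
  finally show ?thesis .
qed

lemma coset_eq:
  assumes T: "cvs.subspace T" "S \<subseteq> T" "T \<subseteq> C" and "a \<in> C" "b \<in> C"
  shows "\<pi> ` T +>\<^bsub>M\<^esub> \<pi> a = \<pi> ` T +>\<^bsub>M\<^esub> \<pi> b \<longleftrightarrow> a - b \<in> T"
proof
  assume "\<pi> ` T +>\<^bsub>M\<^esub> \<pi> a = \<pi> ` T +>\<^bsub>M\<^esub> \<pi> b"
  moreover have "\<pi> a \<in> \<pi> ` T +>\<^bsub>M\<^esub> \<pi> a"
    using assms by (subst mem_coset) (auto intro!: bexI[of _ a] simp: cvs.subspace_0)
  ultimately obtain c where c: "c \<in> C" "\<pi> a = \<pi> c" "c - b \<in> T"
    using assms by (auto simp: mem_coset[OF T])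
  have "a - c \<in> T" using eq[OF \<open>a \<in> C\<close> c(1)] c(2) T by auto
  from cvs.subspace_add[OF T(1) this c(3)] show "a - b \<in> T" by simp
next
  assume ab: "a - b \<in> T"
  have "c - a \<in> T \<longleftrightarrow> c - b \<in> T" for c
    using cvs.subspace_add[OF T(1) _ ab, of "c - a"] cvs.subspace_diff[OF T(1) _ ab, of "c - b"] by auto
  then show "\<pi> ` T +>\<^bsub>M\<^esub> \<pi> a = \<pi> ` T +>\<^bsub>M\<^esub> \<pi> b"
    using assms by (auto simp: mem_coset[OF T])
qed

text \<open>The operations of a quotient are defined as unions over representatives; the union is a
single value as soon as all representatives give the same one.\<close>

lemma union_coset:
  assumes T: "cvs.subspace T" "S \<subseteq> T" "T \<subseteq> C" and a: "a \<in> C"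
    and F: "\<And>b. b \<in> C \<Longrightarrow> b - a \<in> T \<Longrightarrow> F (\<pi> b) = X"
  shows "(\<Union>v\<in>\<pi> ` T +>\<^bsub>M\<^esub> \<pi> a. F v) = X"
proof -
  have "\<pi> a \<in> \<pi> ` T +>\<^bsub>M\<^esub> \<pi> a"
    using assms by (subst mem_coset) (auto intro!: bexI[of _ a] simp: cvs.subspace_0)
  moreover have "F v = X" if "v \<in> \<pi> ` T +>\<^bsub>M\<^esub> \<pi> a" for v
    using that a F by (auto simp: mem_coset[OF T])
  ultimately show ?thesis by auto
qed

lemma quotient:
  assumes T: "cvs.subspace T" "S \<subseteq> T" "T \<subseteq> C"
  shows "lin_param (quot_smodule M (\<pi> ` T)) C T (\<lambda>a. \<pi> ` T +>\<^bsub>M\<^esub> \<pi> a)"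
proof
  show "carrier (quot_smodule M (\<pi> ` T)) = (\<lambda>a. \<pi> ` T +>\<^bsub>M\<^esub> \<pi> a) ` C"
    by (auto simp: quot_smodule_def A_RCOSETS_def RCOSETS_def a_r_coset_def carrier)
  show "\<zero>\<^bsub>quot_smodule M (\<pi> ` T)\<^esub> = \<pi> ` T +>\<^bsub>M\<^esub> \<pi> 0"
  proof -
    have "x \<in> \<pi> ` T +>\<^bsub>M\<^esub> \<pi> 0 \<longleftrightarrow> x \<in> \<pi> ` T" for x
      using T by (subst mem_coset) (auto simp: C_ops)
    then show ?thesis by (auto simp: quot_smodule_def)
  qed
  fix a b c assume a: "a \<in> C"
  show "c \<odot>\<^bsub>quot_smodule M (\<pi> ` T)\<^esub> (\<pi> ` T +>\<^bsub>M\<^esub> \<pi> a) = \<pi> ` T +>\<^bsub>M\<^esub> \<pi> (c *\<^sub>C a)"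
  proof -
    have "\<pi> ` T +>\<^bsub>M\<^esub> (c \<odot>\<^bsub>M\<^esub> \<pi> b) = \<pi> ` T +>\<^bsub>M\<^esub> \<pi> (c *\<^sub>C a)" if "b \<in> C" "b - a \<in> T" for b
      using that a T cvs.subspace_scale[OF T(1), of "b - a" c]
      by (simp add: smult coset_eq C_ops cvs.scale_right_diff_distrib)
    with union_coset[OF T a, of "\<lambda>v. \<pi> ` T +>\<^bsub>M\<^esub> (c \<odot>\<^bsub>M\<^esub> v)"]
    show ?thesis by (simp add: quot_smodule_def)
  qed
  assume b: "b \<in> C"
  show "\<pi> ` T +>\<^bsub>M\<^esub> \<pi> a = \<pi> ` T +>\<^bsub>M\<^esub> \<pi> b \<longleftrightarrow> a - b \<in> T"
    by (rule coset_eq[OF T a b])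
  show "(\<pi> ` T +>\<^bsub>M\<^esub> \<pi> a) \<oplus>\<^bsub>quot_smodule M (\<pi> ` T)\<^esub> (\<pi> ` T +>\<^bsub>M\<^esub> \<pi> b) = \<pi> ` T +>\<^bsub>M\<^esub> \<pi> (a + b)"
    (is "?l = ?r")
  proof -
    have "?l = {x \<oplus>\<^bsub>M\<^esub> y | x y. x \<in> \<pi> ` T +>\<^bsub>M\<^esub> \<pi> a \<and> y \<in> \<pi> ` T +>\<^bsub>M\<^esub> \<pi> b}"
      by (auto simp: quot_smodule_def set_add_def set_mult_def)
    also have "\<dots> = ?r"
    proof (intro Set.set_eqI iffI)
      fix x assume "x \<in> {x \<oplus>\<^bsub>M\<^esub> y | x y. x \<in> \<pi> ` T +>\<^bsub>M\<^esub> \<pi> a \<and> y \<in> \<pi> ` T +>\<^bsub>M\<^esub> \<pi> b}"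
      then obtain a' b' where "a' \<in> C" "b' \<in> C" "a' - a \<in> T" "b' - b \<in> T" "x = \<pi> a' \<oplus>\<^bsub>M\<^esub> \<pi> b'"
        using a b by (auto simp: mem_coset[OF T])
      then show "x \<in> ?r"
        using cvs.subspace_add[OF T(1), of "a' - a" "b' - b"] a b
        by (auto simp: mem_coset[OF T] C_ops add algebra_simps intro!: bexI[of _ "a' + b'"])
    next
      fix x assume "x \<in> ?r"
      then obtain c where c: "c \<in> C" "x = \<pi> c" "c - (a + b) \<in> T"
        using a b by (auto simp: mem_coset[OF T] C_ops)
      have "x = \<pi> (c - b) \<oplus>\<^bsub>M\<^esub> \<pi> b" using c b by (simp add: add C_ops)
      moreover have "\<pi> (c - b) \<in> \<pi> ` T +>\<^bsub>M\<^esub> \<pi> a" "\<pi> b \<in> \<pi> ` T +>\<^bsub>M\<^esub> \<pi> b"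
        unfolding mem_coset[OF T a] mem_coset[OF T b] using c b cvs.subspace_0[OF T(1)]
        by (intro bexI[of _ "c - b"] bexI[of _ b]; simp add: C_ops algebra_simps)+
      ultimately show "x \<in> {x \<oplus>\<^bsub>M\<^esub> y | x y. x \<in> \<pi> ` T +>\<^bsub>M\<^esub> \<pi> a \<and> y \<in> \<pi> ` T +>\<^bsub>M\<^esub> \<pi> b}"
        by blast
    qed
    finally show ?thesis .
  qed
qed (use C T in auto)

lemma quotient_act:
  assumes T: "cvs.subspace T" "S \<subseteq> T" "T \<subseteq> C" and a: "a \<in> C"
    and A: "clin A" "\<And>b. b \<in> C \<Longrightarrow> A b \<in> C" "\<And>b. b \<in> T \<Longrightarrow> A b \<in> T"
    and act: "\<And>b. b \<in> C \<Longrightarrow> act M x (\<pi> b) = \<pi> (A b)"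
  shows "act (quot_smodule M (\<pi> ` T)) x (\<pi> ` T +>\<^bsub>M\<^esub> \<pi> a) = \<pi> ` T +>\<^bsub>M\<^esub> \<pi> (A a)"
proof -
  have "\<pi> ` T +>\<^bsub>M\<^esub> act M x (\<pi> b) = \<pi> ` T +>\<^bsub>M\<^esub> \<pi> (A a)" if "b \<in> C" "b - a \<in> T" for b
    using that a A(3)[of "b - a"] by (simp add: act coset_eq[OF T] A(2) clin_diff[OF A(1)])
  with union_coset[OF T a, of "\<lambda>v. \<pi> ` T +>\<^bsub>M\<^esub> act M x v"]
  show ?thesis by (simp add: quot_smodule_def)
qed

lemma pullback:
  fixes \<tau> :: "'u::complex_vector \<Rightarrow> 'e"
  assumes \<tau>: "\<And>u. \<tau> u \<in> C" "\<And>u u'. \<tau> (u + u') - (\<tau> u + \<tau> u') \<in> S"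
      "\<And>c u. \<tau> (c *\<^sub>C u) - c *\<^sub>C \<tau> u \<in> S"
    and U: "cvs.subspace U"
  shows "lin_param (M\<lparr>carrier := (\<lambda>u. \<pi> (\<tau> u)) ` U, hpart := h\<rparr>) U {u \<in> U. \<tau> u \<in> S} (\<lambda>u. \<pi> (\<tau> u))"
proof
  have add': "\<pi> (\<tau> u) \<oplus>\<^bsub>M\<^esub> \<pi> (\<tau> u') = \<pi> (\<tau> (u + u'))" for u u'
  proof -
    have "\<pi> (\<tau> (u + u')) = \<pi> (\<tau> u + \<tau> u')"
      by (subst eq) (auto simp: \<tau> C_ops)
    then show ?thesis by (simp add: add \<tau>)
  qed
  have scale': "c \<odot>\<^bsub>M\<^esub> \<pi> (\<tau> u) = \<pi> (\<tau> (c *\<^sub>C u))" for c u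
  proof -
    have "\<pi> (\<tau> (c *\<^sub>C u)) = \<pi> (c *\<^sub>C \<tau> u)"
      by (subst eq) (auto simp: \<tau> C_ops)
    then show ?thesis by (simp add: smult \<tau>)
  qed
  have zero': "\<tau> 0 \<in> S" using \<tau>(3)[of 0 0] by simp
  have iff: "\<tau> (u - u') \<in> S \<longleftrightarrow> \<tau> u - \<tau> u' \<in> S" for u u'
    using cvs.subspace_add[OF S _ \<tau>(2)[of "u - u'" u'], of "\<tau> (u - u')"]
      cvs.subspace_diff[OF S _ \<tau>(2)[of "u - u'" u'], of "\<tau> u - \<tau> u'"] by (auto simp: algebra_simps)
  have plus: "\<tau> (u + u') \<in> S \<longleftrightarrow> \<tau> u + \<tau> u' \<in> S" for u u'
    using cvs.subspace_add[OF S _ \<tau>(2)[of u u'], of "\<tau> u + \<tau> u'"]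
      cvs.subspace_diff[OF S _ \<tau>(2)[of u u'], of "\<tau> (u + u')"] by (auto simp: algebra_simps)
  have scl: "\<tau> (c *\<^sub>C u) \<in> S" if "\<tau> u \<in> S" for c u
    using cvs.subspace_add[OF S \<tau>(3)[of c u] cvs.subspace_scale[OF S that, of c]] by simp
  show "cvs.subspace {u \<in> U. \<tau> u \<in> S}"
    unfolding cvs.subspace_def
    using zero' plus scl cvs.subspace_add[OF S] U by (auto simp: cvs.subspace_def)
  show "\<zero>\<^bsub>M\<lparr>carrier := (\<lambda>u. \<pi> (\<tau> u)) ` U, hpart := h\<rparr>\<^esub> = \<pi> (\<tau> 0)"
    by (simp add: zero, subst eq) (auto simp: C_ops \<tau> zero' cvs.subspace_neg[OF S])
  show "\<pi> (\<tau> a) = \<pi> (\<tau> b) \<longleftrightarrow> a - b \<in> {u \<in> U. \<tau> u \<in> S}" if "a \<in> U" "b \<in> U" for a b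
    using that by (subst eq) (auto simp: \<tau> iff cvs.subspace_diff[OF U])
  show "\<pi> (\<tau> a) \<oplus>\<^bsub>M\<lparr>carrier := (\<lambda>u. \<pi> (\<tau> u)) ` U, hpart := h\<rparr>\<^esub> \<pi> (\<tau> b) = \<pi> (\<tau> (a + b))" for a b
    by (simp add: add')
  show "c \<odot>\<^bsub>M\<lparr>carrier := (\<lambda>u. \<pi> (\<tau> u)) ` U, hpart := h\<rparr>\<^esub> \<pi> (\<tau> a) = \<pi> (\<tau> (c *\<^sub>C a))" for a c
    by (simp add: scale')
qed (use U in auto)

end

section \<open>Lowering operators and the PBW filtration\<close>

subsection \<open>Brackets\<close>

lemmas sl12_calc = mat_bracket_def mat_hcomp_nth mat_mult_nth mat_unit_def transpose_def ksign_def
  scaleC_mat_nth sum_3 forall_3 vec_eq_iff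

lemma sl12_parity:
  "hcomp 0 h1 = h1" "hcomp 0 h2 = h2" "hcomp 0 x2 = x2" "hcomp 0 y2 = y2"
  "hcomp 1 x1 = x1" "hcomp 1 x3 = x3" "hcomp 1 y1 = y1" "hcomp 1 y3 = y3"
  by (transfer, simp add: sl12_calc)+

lemma sl12_brackets:
  "bracket y2 y2 = 0" "bracket x1 y2 = 0" "bracket y3 y2 = 0"
  "bracket x1 x1 = 0" "bracket y3 y3 = 0" "bracket x1 y3 = y2"
  "bracket x2 y2 = h2" "bracket h2 y2 = (-2) *\<^sub>C y2"
  "bracket x3 y2 = x1" "bracket y1 y2 = - y3" "bracket y1 x1 = h1"
  by (transfer, simp add: sl12_calc)+

definition borel :: "sl12 set" where "borel = cspan {h1, h2, x2, x3, y1}"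

lemma sl12_decomp:
  "\<exists>b\<in>borel. \<exists>c1 c2 c3. g = b + (c1 *\<^sub>C x1 + (c2 *\<^sub>C y2 + c3 *\<^sub>C y3))"
proof -
  let ?m = "\<lambda>i j. sl12_mat g $ i $ j"
  have "g = (?m 1 1 *\<^sub>C h1 + ((- ?m 3 3) *\<^sub>C h2 + (?m 2 3 *\<^sub>C x2 + (?m 1 3 *\<^sub>C x3 + ?m 2 1 *\<^sub>C y1))))
      + (?m 1 2 *\<^sub>C x1 + (?m 3 2 *\<^sub>C y2 + ?m 3 1 *\<^sub>C y3))"
    by transfer (simp add: sl12_calc algebra_simps)
  moreover have "?m 1 1 *\<^sub>C h1 + ((- ?m 3 3) *\<^sub>C h2 + (?m 2 3 *\<^sub>C x2 + (?m 1 3 *\<^sub>C x3 + ?m 2 1 *\<^sub>C y1))) \<in> borel"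
    unfolding borel_def by (intro cvs.span_add cvs.span_scale cvs.span_base) auto
  ultimately show ?thesis by blast
qed

text \<open>The positive part together with the Cartan subalgebra: on the cyclic vector such elements act by scalars.\<close>

lemma borel_split: "b \<in> borel \<Longrightarrow> \<exists>a c. \<exists>n\<in>nplus. b = (a *\<^sub>C h1 + c *\<^sub>C h2) + n"
proof -
  assume "b \<in> borel"
  moreover have "cspan {h1, h2, x2, x3, y1} \<subseteq> {b. \<exists>a c. \<exists>n\<in>nplus. b = (a *\<^sub>C h1 + c *\<^sub>C h2) + n}"
  proof (rule cvs.span_minimal)
    have n: "x2 \<in> nplus" "x3 \<in> nplus" "y1 \<in> nplus" "0 \<in> nplus"
      by (auto simp: nplus_def cvs.span_base cvs.span_zero)
    show "{h1, h2, x2, x3, y1} \<subseteq> {b. \<exists>a c. \<exists>n\<in>nplus. b = (a *\<^sub>C h1 + c *\<^sub>C h2) + n}"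
    proof -
      have "h1 = (1 *\<^sub>C h1 + 0 *\<^sub>C h2) + 0" "h2 = (0 *\<^sub>C h1 + 1 *\<^sub>C h2) + 0"
        "x2 = (0 *\<^sub>C h1 + 0 *\<^sub>C h2) + x2" "x3 = (0 *\<^sub>C h1 + 0 *\<^sub>C h2) + x3"
        "y1 = (0 *\<^sub>C h1 + 0 *\<^sub>C h2) + y1"
        by (simp_all add: scaleC_one)
      then show ?thesis using n by blast
    qed
    show "cvs.subspace {b. \<exists>a c. \<exists>n\<in>nplus. b = (a *\<^sub>C h1 + c *\<^sub>C h2) + n}"
    proof (unfold cvs.subspace_def, intro conjI ballI allI)
      show "0 \<in> {b. \<exists>a c. \<exists>n\<in>nplus. b = (a *\<^sub>C h1 + c *\<^sub>C h2) + n}"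
        using n(4) by (auto intro!: exI[of _ 0] bexI[of _ 0])
    next
      fix x y assume "x \<in> {b. \<exists>a c. \<exists>n\<in>nplus. b = (a *\<^sub>C h1 + c *\<^sub>C h2) + n}"
        "y \<in> {b. \<exists>a c. \<exists>n\<in>nplus. b = (a *\<^sub>C h1 + c *\<^sub>C h2) + n}"
      then obtain a c n a' c' n' where "n \<in> nplus" "n' \<in> nplus"
        "x = (a *\<^sub>C h1 + c *\<^sub>C h2) + n" "y = (a' *\<^sub>C h1 + c' *\<^sub>C h2) + n'" by blast
      then have "n + n' \<in> nplus" "x + y = ((a + a') *\<^sub>C h1 + (c + c') *\<^sub>C h2) + (n + n')"
        by (auto simp: nplus_def cvs.span_add scaleC_left_distrib)
      then show "x + y \<in> {b. \<exists>a c. \<exists>n\<in>nplus. b = (a *\<^sub>C h1 + c *\<^sub>C h2) + n}" by blast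
    next
      fix d x assume "x \<in> {b. \<exists>a c. \<exists>n\<in>nplus. b = (a *\<^sub>C h1 + c *\<^sub>C h2) + n}"
      then obtain a c n where "n \<in> nplus" "x = (a *\<^sub>C h1 + c *\<^sub>C h2) + n" by blast
      then have "d *\<^sub>C n \<in> nplus" "d *\<^sub>C x = ((d * a) *\<^sub>C h1 + (d * c) *\<^sub>C h2) + d *\<^sub>C n"
        by (auto simp: nplus_def cvs.span_scale scaleC_right_distrib scaleC_scaleC)
      then show "d *\<^sub>C x \<in> {b. \<exists>a c. \<exists>n\<in>nplus. b = (a *\<^sub>C h1 + c *\<^sub>C h2) + n}" by blast
    qed
  qed
  ultimately show ?thesis unfolding borel_def by blast
qed

lemma clin_hcomp: "clin (hcomp i :: 'a::lie_superalgebra \<Rightarrow> 'a)"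
  by (simp add: clin_def hcomp_add hcomp_scaleC)

lemma hcomp_cross: "hcomp i a = a \<Longrightarrow> hcomp j a = (if i = j then a else 0)"
  using hcomp_hcomp[of j i a] by auto

lemma hcomp_span:
  assumes "\<And>b. b \<in> B \<Longrightarrow> \<exists>i. hcomp i b = (b :: 'a::lie_superalgebra)" and "a \<in> cspan B"
  shows "hcomp j a \<in> cspan B"
  using assms(2) clin_hcomp cvs.subspace_span
proof (rule cspan_induct_clin)
  fix b assume "b \<in> B"
  with assms(1) obtain i where "hcomp i b = b" by blast
  then show "hcomp j b \<in> cspan B"
    using \<open>b \<in> B\<close> by (simp add: hcomp_cross[OF \<open>hcomp i b = b\<close>] cvs.span_base cvs.span_zero)
qed

lemma hcomp_borel: "b \<in> borel \<Longrightarrow> hcomp i b \<in> borel"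
  unfolding borel_def by (rule hcomp_span) (use sl12_parity in auto)

lemma hcomp_nplus: "b \<in> nplus \<Longrightarrow> hcomp i b \<in> nplus"
  unfolding nplus_def by (rule hcomp_span) (use sl12_parity in auto)

subsection \<open>Monomials\<close>

abbreviation mo :: "sl12 \<Rightarrow> nat \<Rightarrow> sl12 poly uea" where
  "mo a i \<equiv> uea_of (monom a i)"

lemma clin_monom: "clin (\<lambda>a :: 'a::lie_superalgebra. monom a n)"
  by (simp add: clin_def add_monom scaleC_monom)

lemma clin_mo: "clin (\<lambda>a. mo a n)"
  by (rule clin_comp[OF clin_uea_of clin_monom])

lemma mo_bracket:
  assumes "hcomp i a = a" "hcomp j b = b"
  shows "mo a m * mo b n = ksign (i * j) *\<^sub>C (mo b n * mo a m) + mo (bracket a b) (m + n)"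
  using uea_of_bracket[of i "monom a m" j "monom b n"] by (simp add: hcomp_monom bracket_monom assms)

abbreviation zU where "zU i \<equiv> mo y2 i"
abbreviation xU where "xU i \<equiv> mo x1 i"
abbreviation yU where "yU i \<equiv> mo y3 i"

lemma zU_comm: "zU i * zU j = zU j * zU i" "xU i * zU j = zU j * xU i" "yU i * zU j = zU j * yU i"
  using mo_bracket[of 0 y2 0 y2 i j] mo_bracket[of 1 x1 0 y2 i j] mo_bracket[of 1 y3 0 y2 i j]
  by (simp_all add: sl12_parity sl12_brackets uea_of_zero ksign_def scaleC_one)

lemma neg_one_scaleC: "(-1) *\<^sub>C v = - (v :: 'v::complex_vector)"
  using cvs.scale_minus_left[of 1 v] by (simp add: scaleC_one)

lemma odd_anticomm: "xU i * xU j = - (xU j * xU i)" "yU i * yU j = - (yU j * yU i)"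
    "xU i * yU j = - (yU j * xU i) + zU (i + j)"
  using mo_bracket[of 1 x1 1 x1 i j] mo_bracket[of 1 y3 1 y3 i j] mo_bracket[of 1 x1 1 y3 i j]
  by (simp_all add: sl12_parity sl12_brackets uea_of_zero ksign_def neg_one_scaleC)

subsection \<open>The left ideal of the truncated Weyl module\<close>

lemma left_ideal_subspace: "cvs.subspace (left_ideal S)"
  unfolding left_ideal_def by (rule cvs.subspace_span)

lemma left_ideal_base: "s \<in> S \<Longrightarrow> s \<in> left_ideal S"
  unfolding left_ideal_def by (rule cvs.span_base) (intro CollectI exI[of _ 1] exI[of _ s], simp)

lemma left_ideal_mult: "v \<in> left_ideal S \<Longrightarrow> u * v \<in> left_ideal S"
  unfolding left_ideal_def
proof (rule cspan_induct_clin[OF _ clin_uea_mult(1) cvs.subspace_span])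
  fix b assume "b \<in> {u * s | u s. s \<in> S}"
  then obtain w s where "s \<in> S" "b = w * s" by blast
  then have "u * b = (u * w) * s" by (simp add: mult.assoc)
  with \<open>s \<in> S\<close> show "u * b \<in> cspan {u * s | u s. s \<in> S}" by (intro cvs.span_base) blast
qed

lemmas left_ideal_add = cvs.subspace_add[OF left_ideal_subspace]
  and left_ideal_diff = cvs.subspace_diff[OF left_ideal_subspace]
  and left_ideal_scale = cvs.subspace_scale[OF left_ideal_subspace]
  and left_ideal_neg = cvs.subspace_neg[OF left_ideal_subspace]
  and left_ideal_sum = cvs.subspace_sum[OF left_ideal_subspace]
  and left_ideal_zero = cvs.subspace_0[OF left_ideal_subspace]

locale truncated_weyl =
  fixes la :: weight and N l :: nat
  assumes la: "snd la = of_nat l" and N: "N > 0"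
begin

definition L where "L = left_ideal (weyl_relators la N)"

lemmas L_mult = left_ideal_mult[of _ "weyl_relators la N", folded L_def]
lemmas L_subspace = left_ideal_subspace[of "weyl_relators la N", folded L_def]
lemmas L_ops = left_ideal_add[of _ "weyl_relators la N", folded L_def]
  left_ideal_diff[of _ "weyl_relators la N", folded L_def]
  left_ideal_scale[of _ "weyl_relators la N", folded L_def]
  left_ideal_neg[of _ "weyl_relators la N", folded L_def]
  left_ideal_zero[of "weyl_relators la N", folded L_def]
lemmas L_sum = left_ideal_sum[of _ _ "weyl_relators la N", folded L_def]
lemmas L_base = left_ideal_base[of _ "weyl_relators la N", folded L_def]

lemma L_nplus: "n \<in> nplus \<Longrightarrow> mo n r \<in> L"
  by (rule L_base) (auto simp: weyl_relators_def nplus_def cvs.span_zero)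

lemma L_cartan: "mo (a *\<^sub>C h1 + b *\<^sub>C h2) r - (if r = 0 then a * fst la + b * snd la else 0) *\<^sub>C 1 \<in> L"
  by (rule L_base) (unfold weyl_relators_def, blast)

lemma L_power: "zU 0 ^ (l + 1) \<in> L"
  by (rule L_base) (auto simp: weyl_relators_def la)

lemma L_trunc_base: "j \<ge> N \<Longrightarrow> mo g j \<in> L"
  by (rule L_base) (auto simp: weyl_relators_def)

lemma L_trunc: "j \<ge> N \<Longrightarrow> mo g j * u \<in> L"
proof -
  let ?S = "{u. \<forall>g j. j \<ge> N \<longrightarrow> mo g j * u \<in> L}"
  have "u \<in> ?S"
  proof (rule uea_left_induct)
    show "cvs.subspace ?S"
      by (auto simp: cvs.subspace_def distrib_left uea_scaleC_mult L_ops)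
    show "1 \<in> ?S" by (simp add: L_trunc_base)
    fix p :: "sl12 poly" and u assume u: "u \<in> ?S"
    show "uea_of p * u \<in> ?S"
    proof (intro CollectI allI impI)
      fix g j assume j: "j \<ge> N"
      have step: "mo (hcomp i g) j * (mo (hcomp k b) n * u) \<in> L" for i k b n
      proof -
        have "mo (hcomp i g) j * (mo (hcomp k b) n * u) =
            ksign (i * k) *\<^sub>C (mo (hcomp k b) n * (mo (hcomp i g) j * u))
            + mo (bracket (hcomp i g) (hcomp k b)) (j + n) * u"
          unfolding mult.assoc[symmetric] mo_bracket[of i "hcomp i g" k "hcomp k b" j n, simplified hcomp_hcomp]
          by (simp add: mo_bracket[of i "hcomp i g" k "hcomp k b" j n] hcomp_hcomp distrib_right uea_scaleC_mult mult.assoc)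
        also have "\<dots> \<in> L"
          by (rule L_ops(1)[OF L_ops(3)[OF L_mult]]) (use u j in auto)
        finally show ?thesis .
      qed
      have mo_split: "mo a n = mo (hcomp 0 a) n + mo (hcomp 1 a) n" for a n
        by (simp add: hcomp_decomp flip: clin_add[OF clin_mo])
      have mono: "mo g j * (mo b n * u) \<in> L" for b n
        unfolding mo_split[of g] mo_split[of b] distrib_left distrib_right by (intro L_ops step)
      show "mo g j * (uea_of p * u) \<in> L"
      proof (induction p rule: poly_monom_induct)
        case (add p q)
        then show ?case by (simp add: uea_of_add distrib_left distrib_right L_ops)
      qed (rule mono)
    qed
  qed
  then show "j \<ge> N \<Longrightarrow> mo g j * u \<in> L" by blast
qed

subsection \<open>The PBW filtration\<close>

definition lowering where "lowering = {mo b n | b n. b \<in> {x1, y2, y3} \<and> n < N}"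
definition pbw_words where "pbw_words d = {prod_list w | w. set w \<subseteq> lowering \<and> length w \<le> d}"
text \<open>Words of length at most \<open>d\<close> in the lowering operators, modulo the left ideal. Operators with \<open>t\<close>-degree at least \<open>N\<close> need
not be listed since the left ideal absorbs them.\<close>

definition pbw where "pbw d = cspan (pbw_words d \<union> L)"

lemma pbw_subspace: "cvs.subspace (pbw d)"
  unfolding pbw_def by (rule cvs.subspace_span)

lemmas pbw_ops = cvs.subspace_add[OF pbw_subspace] cvs.subspace_diff[OF pbw_subspace]
  cvs.subspace_scale[OF pbw_subspace] cvs.subspace_neg[OF pbw_subspace] cvs.subspace_0[OF pbw_subspace]
lemmas pbw_sum = cvs.subspace_sum[OF pbw_subspace]

lemma L_pbw: "u \<in> L \<Longrightarrow> u \<in> pbw d"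
  unfolding pbw_def by (rule cvs.span_base) simp

lemma pbw_mono: "d \<le> d' \<Longrightarrow> pbw d \<subseteq> pbw d'"
  unfolding pbw_def pbw_words_def by (rule cvs.span_mono) (use le_trans in blast)

lemma pbw_one: "1 \<in> pbw d"
  unfolding pbw_def pbw_words_def
  by (rule cvs.span_base) (auto intro!: exI[of _ "[]"])

lemma pbw_mult:
  assumes F: "\<And>w. set w \<subseteq> lowering \<Longrightarrow> length w \<le> d \<Longrightarrow> u * prod_list w \<in> pbw d'" and v: "v \<in> pbw d"
  shows "u * v \<in> pbw d'"
  using v unfolding pbw_def
  by (rule cspan_induct_clin[OF _ clin_uea_mult(1) pbw_subspace[unfolded pbw_def]])
    (use F L_pbw L_mult in \<open>auto simp: pbw_words_def pbw_def\<close>)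

lemma pbw_lowering: "b \<in> lowering \<Longrightarrow> v \<in> pbw d \<Longrightarrow> b * v \<in> pbw (Suc d)"
proof (rule pbw_mult)
  fix w assume b: "b \<in> lowering" and w: "set w \<subseteq> lowering" "length w \<le> d"
  then have "prod_list (b # w) \<in> pbw_words (Suc d)" unfolding pbw_words_def
    by (intro CollectI exI[of _ "b # w"]) auto
  then show "b * prod_list w \<in> pbw (Suc d)" by (simp add: pbw_def cvs.span_base)
qed

lemma mo_low: "b \<in> {x1, y2, y3} \<Longrightarrow> v \<in> pbw d \<Longrightarrow> mo b n * v \<in> pbw (Suc d)"
proof (cases "n < N")
  case True
  then show "b \<in> {x1, y2, y3} \<Longrightarrow> v \<in> pbw d \<Longrightarrow> mo b n * v \<in> pbw (Suc d)"
    by (intro pbw_lowering) (auto simp: lowering_def)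
qed (use L_trunc L_pbw in auto)

text \<open>Moving an element of the Borel part to the right past a word produces commutators, which shorten the word or keep
its length, until it meets the cyclic vector.\<close>

lemma pbw_nonlowering_word:
  assumes "g \<in> borel" "set w \<subseteq> lowering" "length w \<le> d"
  shows "mo g j * prod_list w \<in> pbw d"
  using assms
proof (induction w arbitrary: g j d)
  case Nil
  obtain a c n where n: "n \<in> nplus" and g: "g = (a *\<^sub>C h1 + c *\<^sub>C h2) + n"
    using borel_split[OF Nil(1)] by blast
  let ?k = "if j = 0 then a * fst la + c * snd la else 0"
  have "mo g j = (mo (a *\<^sub>C h1 + c *\<^sub>C h2) j - ?k *\<^sub>C 1) + ?k *\<^sub>C 1 + mo n j"
    by (simp add: g clin_add[OF clin_mo])
  also have "\<dots> \<in> pbw d"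
    by (rule pbw_ops(1)[OF pbw_ops(1)[OF L_pbw[OF L_cartan] pbw_ops(3)[OF pbw_one]] L_pbw[OF L_nplus[OF n]]])
  finally show ?case by simp
next
  case (Cons b1 w)
  obtain b n where b: "b \<in> {x1, y2, y3}" "n < N" and b1: "b1 = mo b n"
    using Cons.prems(2) by (auto simp: lowering_def)
  obtain k where k: "hcomp k b = b" using b(1) sl12_parity by blast
  obtain d' where d: "d = Suc d'" using Cons.prems(3) by (cases d) auto
  have w: "set w \<subseteq> lowering" "length w \<le> d'" using Cons.prems d by auto
  have wp: "prod_list w \<in> pbw d'"
    using w unfolding pbw_def pbw_words_def by (intro cvs.span_base) blast
  have step: "mo (hcomp i g) j * (mo b n * prod_list w) \<in> pbw d" for i
  proof -
    have br: "mo c t * prod_list w \<in> pbw d" for c t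
    proof -
      obtain e c1 c2 c3 where e: "e \<in> borel" "c = e + (c1 *\<^sub>C x1 + (c2 *\<^sub>C y2 + c3 *\<^sub>C y3))"
        using sl12_decomp by blast
      have "mo e t * prod_list w \<in> pbw d"
        using Cons.IH[OF e(1) w, of t] pbw_mono[of d' d] d by auto
      moreover have "mo x1 t * prod_list w \<in> pbw d" "mo y2 t * prod_list w \<in> pbw d"
          "mo y3 t * prod_list w \<in> pbw d"
        unfolding d by (rule mo_low[OF _ wp], simp)+
      ultimately show ?thesis
        unfolding e(2) clin_add[OF clin_mo] clin_scale[OF clin_mo] distrib_right uea_scaleC_mult
        by (intro pbw_ops(1,3))
    qed
    have "mo (hcomp i g) j * (mo b n * prod_list w) =
        ksign (i * k) *\<^sub>C (mo b n * (mo (hcomp i g) j * prod_list w))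
        + mo (bracket (hcomp i g) b) (j + n) * prod_list w"
      unfolding mult.assoc[symmetric] mo_bracket[of i "hcomp i g" k b j n, OF _ k, unfolded hcomp_hcomp, OF if_P[OF refl]]
      by (simp add: distrib_right uea_scaleC_mult)
    also have "\<dots> \<in> pbw d"
      unfolding d by (rule pbw_ops(1)[OF pbw_ops(3)[OF mo_low[OF b(1)
        Cons.IH[OF hcomp_borel[OF Cons.prems(1)] w]]] br[unfolded d]])
    finally show ?thesis .
  qed
  have "mo g j = mo (hcomp 0 g) j + mo (hcomp 1 g) j"
    by (simp add: hcomp_decomp flip: clin_add[OF clin_mo])
  then show ?case
    unfolding b1 by (simp add: distrib_right pbw_ops(1) step)
qed

lemma pbw_nonlowering: "g \<in> borel \<Longrightarrow> v \<in> pbw d \<Longrightarrow> mo g j * v \<in> pbw d"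
  by (rule pbw_mult) (auto intro: pbw_nonlowering_word)

lemma pbw_exhaustive: "\<exists>d. u \<in> pbw d"
proof -
  have "u \<in> {u. \<exists>d. u \<in> pbw d}"
  proof (rule uea_left_induct)
    have add: "\<exists>d. u + v \<in> pbw d" if uv: "\<exists>d. u \<in> pbw d" "\<exists>d. v \<in> pbw d" for u v
    proof -
      obtain d e where "u \<in> pbw d" "v \<in> pbw e" using uv by blast
      then have "u \<in> pbw (max d e)" "v \<in> pbw (max d e)"
        using pbw_mono[of d "max d e"] pbw_mono[of e "max d e"] by auto
      then show ?thesis using pbw_ops(1) by blast
    qed
    show "cvs.subspace {u. \<exists>d. u \<in> pbw d}"
      unfolding cvs.subspace_def using add pbw_ops(3,5) by blast
    show "1 \<in> {u. \<exists>d. u \<in> pbw d}" using pbw_one by blast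
    fix p :: "sl12 poly" and u assume "u \<in> {u. \<exists>d. u \<in> pbw d}"
    then obtain d where u: "u \<in> pbw d" by blast
    have "mo g n * u \<in> pbw (Suc d)" for g n
    proof -
      obtain e c1 c2 c3 where e: "e \<in> borel" "g = e + (c1 *\<^sub>C x1 + (c2 *\<^sub>C y2 + c3 *\<^sub>C y3))"
        using sl12_decomp by blast
      have "mo e n * u \<in> pbw (Suc d)"
        using pbw_nonlowering[OF e(1) u, of n] pbw_mono[of d "Suc d"] by auto
      moreover have "mo x1 n * u \<in> pbw (Suc d)" "mo y2 n * u \<in> pbw (Suc d)"
          "mo y3 n * u \<in> pbw (Suc d)"
        by (rule mo_low[OF _ u], simp)+
      ultimately show ?thesis
        unfolding e(2) clin_add[OF clin_mo] clin_scale[OF clin_mo] distrib_right uea_scaleC_mult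
        by (intro pbw_ops(1,3))
    qed
    then have "uea_of p * u \<in> pbw (Suc d)"
      by (induction p rule: poly_monom_induct) (simp_all add: uea_of_add distrib_right pbw_ops(1))
    then show "uea_of p * u \<in> {u. \<exists>d. u \<in> pbw d}" by blast
  qed
  then show ?thesis by blast
qed

end

section \<open>Relations of Garland type\<close>

subsection \<open>Products of currents in the enveloping algebra\<close>

primrec curs :: "(nat \<Rightarrow> 'a::{semiring_0,monoid_mult}) list \<Rightarrow> nat \<Rightarrow> 'a" where
  "curs [] s = (if s = 0 then 1 else 0)"
| "curs (b # bs) s = (\<Sum>i\<le>s. b i * curs bs (s - i))"

text \<open>Since \<open>t\<^sup>N\<close> acts by zero, the indices may be counted from \<open>N - 1\<close> downwards. This turns the
vanishing of high coefficients into a vanishing order at zero.\<close>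

definition rev_current :: "nat \<Rightarrow> (nat \<Rightarrow> 'a::zero) \<Rightarrow> nat \<Rightarrow> 'a" where
  "rev_current N b i = (if i < N then b (N - 1 - i) else 0)"

lemma curs_swap:
  fixes b :: "nat \<Rightarrow> 'a::{ring,monoid_mult}"
  shows "(\<Sum>i\<le>s. \<Sum>j\<le>s - i. b j * c i * curs bs (s - i - j))
     = (\<Sum>j\<le>s. b j * (\<Sum>i\<le>s - j. c i * curs bs (s - j - i)))"
proof -
  have "(\<Sum>i\<le>s. \<Sum>j\<le>s - i. b j * c i * curs bs (s - i - j))
      = (\<Sum>j\<le>s. \<Sum>i\<le>s - j. b j * c i * curs bs (s - i - j))"
    by (rule sum_triangle_swap)
  also have "\<dots> = (\<Sum>j\<le>s. b j * (\<Sum>i\<le>s - j. c i * curs bs (s - j - i)))"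
    by (simp add: sum_distrib_left mult.assoc add.commute)
  finally show ?thesis .
qed

context truncated_weyl
begin

abbreviation zc :: "nat \<Rightarrow> nat \<Rightarrow> sl12 poly uea" where
  "zc r \<equiv> curs (replicate r (mo y2))"

lemma zc_cur: "cur (\<lambda>i u. zU i * u) r s v = zc r s * v"
  by (induction r arbitrary: s) (simp_all add: sum_distrib_right mult.assoc)

text \<open>The Euler identity for the current of \<open>y\<^sub>2\<close> acting by left multiplication.\<close>

lemma zc_euler: "(\<Sum>i\<le>s. of_nat i *\<^sub>C (zU i * zc r (s - i))) = (of_nat s / of_nat (Suc r)) *\<^sub>C zc (Suc r) s"
proof -
  have "zU i * (zU j * v) = zU j * (zU i * v)" for i j v
    unfolding mult.assoc[symmetric] zU_comm(1)[of i j] ..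
  from cur_euler[where Z = "\<lambda>i u. zU i * u" and r = r and s = s and v = 1, OF clin_uea_mult(1) this]
  show ?thesis by (simp only: zc_cur mult_1_right)
qed

lemma zc_pbw: "zc r s \<in> pbw r"
  by (induction r arbitrary: s) (auto intro!: pbw_sum mo_low simp: pbw_one pbw_ops)


definition congr (infix "\<approx>" 50) where "u \<approx> v \<longleftrightarrow> u - v \<in> L"

lemma congr_refl: "u \<approx> u"
  by (simp add: congr_def L_ops)

lemma congr_trans [trans]: "u \<approx> v \<Longrightarrow> v \<approx> w \<Longrightarrow> u \<approx> w"
  unfolding congr_def using L_ops(1)[of "u - v" "v - w"] by simp

lemma congr_eq_trans [trans]: "u = v \<Longrightarrow> v \<approx> w \<Longrightarrow> u \<approx> w" "u \<approx> v \<Longrightarrow> v = w \<Longrightarrow> u \<approx> w"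
  by simp_all

lemma congr_sum: "(\<And>i. i \<in> I \<Longrightarrow> f i \<approx> g i) \<Longrightarrow> sum f I \<approx> sum g I"
  unfolding congr_def by (simp add: L_sum flip: sum_subtractf)

lemma congr_add: "u \<approx> v \<Longrightarrow> u' \<approx> v' \<Longrightarrow> u + u' \<approx> v + v'"
  unfolding congr_def using L_ops(1)[of "u - v" "u' - v'"] by (simp add: algebra_simps)

lemma congr_mult: "u \<approx> v \<Longrightarrow> w * u \<approx> w * v"
  unfolding congr_def using L_mult[of "u - v" w] by (simp add: algebra_simps)

lemma congr_L: "u \<approx> v \<Longrightarrow> u \<in> L \<longleftrightarrow> v \<in> L"
  unfolding congr_def using L_ops(1)[of "u - v" v] L_ops(2)[of u "u - v"] by auto

lemma mult_zc:
  assumes "\<And>i. e * zU i = zU i * e + f i" "\<And>i j. f i * zU j = zU j * f i"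
  shows "e * zc r s = zc r s * e + of_nat r *\<^sub>C (\<Sum>i\<le>s. f i * zc (r - 1) (s - i))"
proof (induction r arbitrary: s)
  case 0
  then show ?case by simp
next
  case (Suc r)
  have IH: "e * zc r t = zc r t * e + of_nat r *\<^sub>C (\<Sum>i\<le>t. f i * zc (r - 1) (t - i))" for t by (rule Suc)
  have comm: "(\<Sum>j\<le>s. zU j * (\<Sum>i\<le>s - j. f i * zc (r - 1) (s - j - i))) = (\<Sum>i\<le>s. f i * zc r (s - i))"
    if "r > 0"
  proof -
    have "(\<Sum>j\<le>s. zU j * (\<Sum>i\<le>s - j. f i * zc (r - 1) (s - j - i)))
        = (\<Sum>i\<le>s. \<Sum>j\<le>s - i. zU j * f i * zc (r - 1) (s - i - j))"
      by (rule curs_swap[symmetric])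
    also have "\<dots> = (\<Sum>i\<le>s. f i * zc r (s - i))"
      using that by (cases r) (simp_all add: sum_distrib_left mult.assoc[symmetric] assms(2))
    finally show ?thesis .
  qed
  have "e * zc (Suc r) s = (\<Sum>j\<le>s. (zU j * e + f j) * zc r (s - j))"
    by (simp add: sum_distrib_left mult.assoc[symmetric] assms(1))
  also have "\<dots> = (\<Sum>j\<le>s. zU j * (e * zc r (s - j))) + (\<Sum>j\<le>s. f j * zc r (s - j))"
    by (simp add: distrib_right sum.distrib mult.assoc)
  also have "(\<Sum>j\<le>s. zU j * (e * zc r (s - j))) = zc (Suc r) s * e
      + of_nat r *\<^sub>C (\<Sum>j\<le>s. zU j * (\<Sum>i\<le>s - j. f i * zc (r - 1) (s - j - i)))"
    unfolding IH by (simp add: distrib_left sum.distrib sum_distrib_right mult.assoc uea_scaleC_mult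
        flip: cvs.scale_sum_right)
  also have "of_nat r *\<^sub>C (\<Sum>j\<le>s. zU j * (\<Sum>i\<le>s - j. f i * zc (r - 1) (s - j - i)))
      = of_nat r *\<^sub>C (\<Sum>i\<le>s. f i * zc r (s - i))"
    using comm by (cases "r = 0") simp_all
  finally show ?case by (simp add: scaleC_left_distrib scaleC_one add_ac)
qed

lemma L_borel:
  "mo x2 j \<in> L" "mo x3 j \<in> L" "mo y1 j \<in> L" "j > 0 \<Longrightarrow> mo h2 j \<in> L"
proof -
  show "mo x2 j \<in> L" "mo x3 j \<in> L" "mo y1 j \<in> L"
    by (rule L_nplus, auto simp: nplus_def cvs.span_base)+
  show "j > 0 \<Longrightarrow> mo h2 j \<in> L" using L_cartan[of 0 1 j] by (simp add: scaleC_one)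
qed

text \<open>Raising with \<open>x\<^sub>2 t\<close> removes one operator and raises the \<open>t\<close>-degree by one; the Cartan element that appears on the way
acts by \<open>0\<close>, being of positive degree.\<close>

lemma garland_step: "mo x2 (Suc 0) * zc n s \<approx> (- of_nat n * of_nat (Suc s)) *\<^sub>C zc (n - 1) (Suc s)"
proof (induction n arbitrary: s)
  case 0
  show ?case using L_borel(1)[of "Suc 0"] by (auto simp: congr_def L_ops)
next
  case (Suc n)
  have h: "mo h2 j * zc n t \<approx> (- 2 * of_nat n) *\<^sub>C (\<Sum>b\<le>t. zU (j + b) * zc (n - 1) (t - b))" if "j > 0" for j t
  proof -
    have "mo h2 j * zU i = zU i * mo h2 j + (-2) *\<^sub>C zU (j + i)" for i
      using mo_bracket[of 0 h2 0 y2 j i]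
      by (simp add: sl12_parity sl12_brackets ksign_def scaleC_one clin_scale[OF clin_mo] clin_minus[OF clin_mo])
    then have "mo h2 j * zc n t = zc n t * mo h2 j
        + of_nat n *\<^sub>C (\<Sum>b\<le>t. ((-2) *\<^sub>C zU (j + b)) * zc (n - 1) (t - b))"
      by (intro mult_zc) (simp_all add: uea_scaleC_mult zU_comm(1))
    then have "mo h2 j * zc n t = zc n t * mo h2 j
        + (- 2 * of_nat n) *\<^sub>C (\<Sum>b\<le>t. zU (j + b) * zc (n - 1) (t - b))"
      by (simp add: uea_scaleC_mult cvs.scale_sum_right scaleC_scaleC mult.commute)
    then show ?thesis using L_mult[OF L_borel(4)[OF that], of "zc n t"] by (simp add: congr_def)
  qed
  have e: "mo x2 (Suc 0) * zU a = zU a * mo x2 (Suc 0) + mo h2 (Suc a)" for a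
    using mo_bracket[of 0 x2 0 y2 "Suc 0" a] by (simp add: sl12_parity sl12_brackets ksign_def scaleC_one)
  have "mo x2 (Suc 0) * zc (Suc n) s = (\<Sum>a\<le>s. zU a * (mo x2 (Suc 0) * zc n (s - a))) + (\<Sum>a\<le>s. mo h2 (Suc a) * zc n (s - a))"
    by (simp add: sum_distrib_left mult.assoc[symmetric] e distrib_right sum.distrib)
  also have "\<dots> \<approx> (\<Sum>a\<le>s. zU a * ((- of_nat n * of_nat (Suc (s - a))) *\<^sub>C zc (n - 1) (Suc (s - a))))
      + (\<Sum>a\<le>s. (- 2 * of_nat n) *\<^sub>C (\<Sum>b\<le>s - a. zU (Suc a + b) * zc (n - 1) (s - a - b)))"
    by (rule congr_add, rule congr_sum, rule congr_mult, rule Suc.IH, rule congr_sum, rule h, simp)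
  also have "\<dots> = (- of_nat (Suc n) * of_nat (Suc s)) *\<^sub>C zc (Suc n - 1) (Suc s)"
  proof (cases n)
    case 0
    then show ?thesis by simp
  next
    case n: (Suc n')
    let ?S = "of_nat (Suc s) :: complex"
    have E: "(\<Sum>k\<le>Suc s. of_nat k *\<^sub>C (zU k * zc n' (Suc s - k))) = (?S / of_nat n) *\<^sub>C zc n (Suc s)"
      using zc_euler[of n' "Suc s"] by (simp only: n)
    have zcn: "zc n (Suc s) = (\<Sum>k\<le>Suc s. zU k * zc n' (Suc s - k))" by (simp add: n)
    have "(\<Sum>a\<le>s. of_nat (Suc (s - a)) *\<^sub>C (zU a * zc n' (Suc (s - a))))
        = (\<Sum>a\<le>Suc s. of_nat (Suc s - a) *\<^sub>C (zU a * zc n' (Suc s - a)))"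
      by (simp add: Suc_diff_le add_diff_eq)
    also have "\<dots> = (\<Sum>a\<le>Suc s. ?S *\<^sub>C (zU a * zc n' (Suc s - a)) - of_nat a *\<^sub>C (zU a * zc n' (Suc s - a)))"
      by (intro sum.cong refl) (simp add: of_nat_diff cvs.scale_left_diff_distrib)
    also have "\<dots> = ?S *\<^sub>C zc n (Suc s) - (?S / of_nat n) *\<^sub>C zc n (Suc s)"
      by (simp only: sum_subtractf E zcn cvs.scale_sum_right)
    finally have 0: "(\<Sum>a\<le>s. of_nat (Suc (s - a)) *\<^sub>C (zU a * zc n' (Suc (s - a))))
        = ?S *\<^sub>C zc n (Suc s) - (?S / of_nat n) *\<^sub>C zc n (Suc s)" .
    have 1: "(\<Sum>a\<le>s. zU a * ((- of_nat n * of_nat (Suc (s - a))) *\<^sub>C zc (n - 1) (Suc (s - a))))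
        = (- of_nat n) *\<^sub>C (?S *\<^sub>C zc n (Suc s) - (?S / of_nat n) *\<^sub>C zc n (Suc s))"
      unfolding 0[symmetric] cvs.scale_sum_right
      by (intro sum.cong refl) (simp only: uea_scaleC_mult scaleC_scaleC n diff_Suc_1)
    have "(\<Sum>a\<le>s. \<Sum>b\<le>s - a. zU (Suc a + b) * zc n' (s - a - b))
        = (\<Sum>k\<le>s. of_nat (Suc k) *\<^sub>C (zU (Suc k) * zc n' (s - k)))"
    proof -
      have "(\<Sum>a\<le>s. \<Sum>b\<le>s - a. zU (Suc a + b) * zc n' (s - a - b))
          = (\<Sum>(a, b)\<in>(SIGMA a:{..s}. {..s - a}). zU (Suc (a + b)) * zc n' (s - (a + b)))"
        by (simp add: sum.Sigma)
      also have "\<dots> = (\<Sum>(k, a)\<in>(SIGMA k:{..s}. {..k}). zU (Suc k) * zc n' (s - k))"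
        by (rule sum.reindex_bij_witness[of _ "\<lambda>(k, a). (a, k - a)" "\<lambda>(a, b). (a + b, a)"]) auto
      also have "\<dots> = (\<Sum>k\<le>s. \<Sum>a\<le>k. zU (Suc k) * zc n' (s - k))"
        by (simp add: sum.Sigma)
      also have "\<dots> = (\<Sum>k\<le>s. of_nat (Suc k) *\<^sub>C (zU (Suc k) * zc n' (s - k)))"
      proof (intro sum.cong refl)
        have "(\<Sum>a\<le>k. v) = of_nat (Suc k) *\<^sub>C v" for k and v :: "sl12 poly uea"
          using cvs.sum_constant_scale[of v "{..k}"] by simp
        then show "(\<Sum>a\<le>k. zU (Suc k) * zc n' (s - k)) = of_nat (Suc k) *\<^sub>C (zU (Suc k) * zc n' (s - k))" for k .
      qed
      finally show ?thesis .
    qed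
    also have "\<dots> = (\<Sum>k\<le>Suc s. of_nat k *\<^sub>C (zU k * zc n' (Suc s - k)))"
      by (simp add: sum.atMost_Suc_shift del: of_nat_Suc sum.atMost_Suc)
    finally have 2: "(\<Sum>a\<le>s. (- 2 * of_nat n) *\<^sub>C (\<Sum>b\<le>s - a. zU (Suc a + b) * zc (n - 1) (s - a - b)))
        = (- 2 * of_nat n) *\<^sub>C ((?S / of_nat n) *\<^sub>C zc n (Suc s))"
      unfolding cvs.scale_sum_right[symmetric] n diff_Suc_1 by (simp only: E[unfolded n])
    have n0: "(of_nat n :: complex) \<noteq> 0" by (simp add: n del: of_nat_Suc)
    have "- of_nat n * (?S - ?S / of_nat n) + - 2 * of_nat n * (?S / of_nat n) = - of_nat (Suc n) * ?S"
      using n0 by (simp add: field_simps)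
    then show ?thesis
      unfolding 1 2 diff_Suc_1
      by (simp only: scaleC_scaleC cvs.scale_left_diff_distrib[symmetric] scaleC_left_distrib[symmetric])
  qed
  finally show ?case .
qed

lemma scale_L_cancel: "c \<noteq> 0 \<Longrightarrow> c *\<^sub>C u \<in> L \<Longrightarrow> u \<in> L"
  using L_ops(3)[of "c *\<^sub>C u" "inverse c"] by (simp add: scaleC_scaleC scaleC_one)

text \<open>Start from \<open>y\<^sub>2\<^sup>r\<close> with \<open>r > l\<close>, which is a relation, and raise repeatedly with \<open>x\<^sub>2 t\<close>. The scalars
in \<open>garland_step\<close> are nonzero and can be divided out.\<close>

lemma garland: "l < r + s \<Longrightarrow> zc r s \<in> L"
proof (induction s arbitrary: r)
  case 0
  have "zc r 0 = zU 0 ^ r" by (induction r) simp_all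
  also have "\<dots> = zU 0 ^ (r - (l + 1)) * zU 0 ^ (l + 1)" using 0 by (subst power_add[symmetric]) simp
  finally show ?case using L_mult[OF L_power] by simp
next
  case (Suc s)
  have "mo x2 (Suc 0) * zc (Suc r) s \<in> L" using Suc by (intro L_mult Suc.IH) simp
  then have "(- of_nat (Suc r) * of_nat (Suc s)) *\<^sub>C zc r (Suc s) \<in> L"
    using congr_L[OF garland_step[of "Suc r" s]] by (simp del: of_nat_Suc)
  then show ?case by (rule scale_L_cancel[rotated]) (simp del: of_nat_Suc)
qed

lemma scale_pbw_cancel: "c \<noteq> 0 \<Longrightarrow> c *\<^sub>C u \<in> pbw d \<Longrightarrow> u \<in> pbw d"
  using pbw_ops(3)[of "c *\<^sub>C u" d "inverse c"] by (simp add: scaleC_scaleC scaleC_one)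

lemma y1_zc: "mo y1 0 * zc r s = zc r s * mo y1 0 - of_nat r *\<^sub>C curs (mo y3 # replicate (r - 1) (mo y2)) s"
proof -
  have "mo y1 0 * zU i = zU i * mo y1 0 + - yU i" for i
    using mo_bracket[of 1 y1 0 y2 0 i]
    by (simp add: sl12_parity sl12_brackets ksign_def scaleC_one clin_minus[OF clin_mo])
  from mult_zc[of "mo y1 0" "\<lambda>i. - yU i" r s, OF this]
  show ?thesis by (simp add: zU_comm sum_negf)
qed

text \<open>Apply \<open>x\<^sub>3\<close> and \<open>y\<^sub>1\<close> to the even relation: both commute with \<open>y\<^sub>2\<close> up to an odd lowering operator.\<close>

lemma garland_odd:
  assumes "l < Suc r + s"
  shows "curs (mo x1 # replicate r (mo y2)) s \<in> L" "curs (mo y3 # replicate r (mo y2)) s \<in> L"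
proof -
  have "mo x3 0 * zU i = zU i * mo x3 0 + xU i" for i
    using mo_bracket[of 1 x3 0 y2 0 i] by (simp add: sl12_parity sl12_brackets ksign_def scaleC_one)
  from mult_zc[of "mo x3 0" xU "Suc r" s, OF this zU_comm(2)]
  have "mo x3 0 * zc (Suc r) s - zc (Suc r) s * mo x3 0 = of_nat (Suc r) *\<^sub>C curs (mo x1 # replicate r (mo y2)) s"
    by (simp del: replicate.simps of_nat_Suc)
  moreover have "mo x3 0 * zc (Suc r) s - zc (Suc r) s * mo x3 0 \<in> L"
    using assms by (intro L_ops(2) L_mult[OF garland] L_mult[OF L_borel(2)])
  ultimately show "curs (mo x1 # replicate r (mo y2)) s \<in> L"
    using scale_L_cancel[of "of_nat (Suc r)"] by (simp del: of_nat_Suc curs.simps)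
  have "of_nat (Suc r) *\<^sub>C curs (mo y3 # replicate r (mo y2)) s = zc (Suc r) s * mo y1 0 - mo y1 0 * zc (Suc r) s"
    using y1_zc[of "Suc r" s] by (simp del: replicate.simps curs.simps of_nat_Suc)
  also have "\<dots> \<in> L"
    using assms by (intro L_ops(2) L_mult[OF garland] L_mult[OF L_borel(3)])
  finally show "curs (mo y3 # replicate r (mo y2)) s \<in> L"
    using scale_L_cancel[of "of_nat (Suc r)"] by (simp del: of_nat_Suc curs.simps)
qed

text \<open>Apply \<open>y\<^sub>1\<close> to the relation for \<open>x\<^sub>1\<close>. The commutator of \<open>y\<^sub>1\<close> and \<open>x\<^sub>1\<close> lies in the
Cartan part and contributes words that are shorter by one; the relation therefore holds only modulo shorter words.\<close>

lemma garland_mixed: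
  assumes "l < Suc (Suc r) + s"
  shows "curs (mo y3 # mo x1 # replicate r (mo y2)) s \<in> pbw (Suc r)"
proof -
  let ?XZ = "curs (mo x1 # replicate (Suc r) (mo y2)) s"
  have 1: "mo y1 0 * ?XZ \<in> pbw (Suc r)"
    using assms by (intro L_pbw L_mult garland_odd) simp
  have "mo y1 0 * xU a = - (xU a * mo y1 0) + mo h1 a" for a
    using mo_bracket[of 1 y1 1 x1 0 a] by (simp add: sl12_parity sl12_brackets ksign_def neg_one_scaleC)
  then have "mo y1 0 * ?XZ = (\<Sum>a\<le>s. (- (xU a * mo y1 0) + mo h1 a) * zc (Suc r) (s - a))"
    by (simp add: sum_distrib_left mult.assoc[symmetric] del: replicate.simps)
  also have "\<dots> = (\<Sum>a\<le>s. mo h1 a * zc (Suc r) (s - a)) - (\<Sum>a\<le>s. xU a * (mo y1 0 * zc (Suc r) (s - a)))"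
    by (simp add: left_diff_distrib sum_subtractf mult.assoc del: replicate.simps curs.simps)
  also have "(\<Sum>a\<le>s. xU a * (mo y1 0 * zc (Suc r) (s - a)))
      = (\<Sum>a\<le>s. xU a * (zc (Suc r) (s - a) * mo y1 0))
        - of_nat (Suc r) *\<^sub>C (\<Sum>a\<le>s. xU a * curs (mo y3 # replicate r (mo y2)) (s - a))"
    unfolding y1_zc diff_Suc_1 by (simp add: right_diff_distrib sum_subtractf uea_scaleC_mult
        cvs.scale_sum_right del: replicate.simps of_nat_Suc curs.simps)
  finally have "of_nat (Suc r) *\<^sub>C (\<Sum>a\<le>s. xU a * curs (mo y3 # replicate r (mo y2)) (s - a))
      = mo y1 0 * ?XZ - (\<Sum>a\<le>s. mo h1 a * zc (Suc r) (s - a)) + (\<Sum>a\<le>s. xU a * (zc (Suc r) (s - a) * mo y1 0))"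
    by (simp del: replicate.simps of_nat_Suc curs.simps)
  also have "\<dots> \<in> pbw (Suc r)"
  proof (intro pbw_ops(1,2) 1 pbw_sum)
    show "mo h1 a * zc (Suc r) (s - a) \<in> pbw (Suc r)" for a
      by (rule pbw_nonlowering[OF _ zc_pbw]) (simp add: borel_def cvs.span_base)
    show "xU a * (zc (Suc r) (s - a) * mo y1 0) \<in> pbw (Suc r)" for a
      by (intro L_pbw L_mult L_borel)
  qed
  finally have XY: "(\<Sum>a\<le>s. xU a * curs (mo y3 # replicate r (mo y2)) (s - a)) \<in> pbw (Suc r)"
    by (rule scale_pbw_cancel[rotated]) (simp del: of_nat_Suc)
  have "(\<Sum>a\<le>s. xU a * curs (mo y3 # replicate r (mo y2)) (s - a))
      = (\<Sum>b\<le>s. \<Sum>a\<le>s - b. xU a * yU b * zc r (s - b - a))"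
    using curs_swap[where b = xU and c = yU and s = s and bs = "replicate r (mo y2)"] by simp
  also have "\<dots> = (\<Sum>b\<le>s. \<Sum>a\<le>s - b. zU (a + b) * zc r (s - b - a))
      - (\<Sum>b\<le>s. \<Sum>a\<le>s - b. yU b * (xU a * zc r (s - b - a)))"
    by (simp add: odd_anticomm(3) left_diff_distrib sum_subtractf mult.assoc)
  also have "(\<Sum>b\<le>s. \<Sum>a\<le>s - b. yU b * (xU a * zc r (s - b - a))) = curs (mo y3 # mo x1 # replicate r (mo y2)) s"
    by (simp add: sum_distrib_left)
  finally have "curs (mo y3 # mo x1 # replicate r (mo y2)) s
      = (\<Sum>b\<le>s. \<Sum>a\<le>s - b. zU (a + b) * zc r (s - b - a))
        - (\<Sum>a\<le>s. xU a * curs (mo y3 # replicate r (mo y2)) (s - a))"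
    by (simp del: curs.simps)
  also have "\<dots> \<in> pbw (Suc r)"
    by (intro pbw_ops(2) XY pbw_sum mo_low[OF _ zc_pbw]) simp
  finally show ?thesis .
qed

subsection \<open>Reversed currents\<close>

lemma curs_high:
  assumes "\<And>b. b \<in> set bs \<Longrightarrow> \<exists>g. b = mo g" "(N - 1) * length bs < s"
  shows "curs bs s \<in> L"
  using assms
proof (induction bs arbitrary: s)
  case Nil
  then show ?case by (auto simp: L_ops)
next
  case (Cons b bs)
  obtain g where b: "b = mo g" using Cons.prems(1) by auto
  have "mo g i * curs bs (s - i) \<in> L" if "i \<le> s" for i
  proof (cases "i < N")
    case True
    then show ?thesis using Cons.prems by (intro L_mult Cons.IH) auto
  qed (simp add: L_trunc)
  then show ?case by (auto simp: b intro: L_sum)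
qed

lemma curs_reverse:
  assumes "\<And>b. b \<in> set bs \<Longrightarrow> \<exists>g. b = mo g"
  shows "curs (map (rev_current N) bs) s \<approx>
    (if s \<le> (N - 1) * length bs then curs bs ((N - 1) * length bs - s) else 0)"
  using assms
proof (induction bs arbitrary: s)
  case Nil
  then show ?case by (simp add: congr_refl)
next
  case (Cons b bs)
  obtain g where b: "b = mo g" using Cons.prems by auto
  let ?M = "(N - 1) * length bs"
  let ?f = "\<lambda>t. if t \<le> ?M then curs bs (?M - t) else 0"
  have "curs (map (rev_current N) (b # bs)) s = (\<Sum>i\<le>s. rev_current N b i * curs (map (rev_current N) bs) (s - i))"
    by simp
  also have "\<dots> \<approx> (\<Sum>i\<le>s. rev_current N b i * ?f (s - i))"
    using Cons by (intro congr_sum congr_mult) auto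
  also have "\<dots> = (\<Sum>i\<in>{i. i < N \<and> i \<le> s \<and> s \<le> ?M + i}. mo g (N - 1 - i) * curs bs (?M + i - s))"
    by (intro sum.mono_neutral_cong_right) (auto simp: rev_current_def b)
  also have "\<dots> \<approx> (if s \<le> ?M + (N - 1) then curs (b # bs) (?M + (N - 1) - s) else 0)"
  proof (cases "s \<le> ?M + (N - 1)")
    case True
    let ?S = "?M + (N - 1) - s"
    let ?g = "\<lambda>a. mo g a * curs bs (?S - a)"
    have "(\<Sum>i\<in>{i. i < N \<and> i \<le> s \<and> s \<le> ?M + i}. mo g (N - 1 - i) * curs bs (?M + i - s))
        = (\<Sum>a\<in>{a. a < N \<and> a \<le> ?S \<and> N - 1 \<le> a + s}. ?g a)"
      using True N by (intro sum.reindex_bij_witness[of _ "\<lambda>a. N - 1 - a" "\<lambda>i. N - 1 - i"])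
        (auto intro!: arg_cong[of _ _ "curs bs"])
    also have "\<dots> \<approx> (\<Sum>a\<le>?S. ?g a)"
    proof -
      have "(\<Sum>a\<le>?S. ?g a) = (\<Sum>a\<in>{a. a < N \<and> a \<le> ?S \<and> N - 1 \<le> a + s}. ?g a)
          + (\<Sum>a\<in>{..?S} - {a. a < N \<and> a \<le> ?S \<and> N - 1 \<le> a + s}. ?g a)"
        by (subst sum.subset_diff[of "{a. a < N \<and> a \<le> ?S \<and> N - 1 \<le> a + s}"]) (auto simp: add.commute)
      moreover have "?g a \<in> L" if "a \<in> {..?S} - {a. a < N \<and> a \<le> ?S \<and> N - 1 \<le> a + s}" for a
      proof (cases "a < N")
        case True
        then show ?thesis using that Cons.prems by (intro L_mult curs_high) auto
      qed (simp add: L_trunc)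
      then have "- (\<Sum>a\<in>{..?S} - {a. a < N \<and> a \<le> ?S \<and> N - 1 \<le> a + s}. ?g a) \<in> L"
        by (intro L_ops(4) L_sum)
      ultimately show ?thesis
        by (simp only: congr_def diff_diff_eq[symmetric] diff_self diff_0)
    qed
    finally show ?thesis using True by (simp add: b)
  next
    case False
    then have "{i. i < N \<and> i \<le> s \<and> s \<le> ?M + i} = {}" by auto
    then show ?thesis using False by (simp only: sum.empty if_False congr_refl)
  qed
  also have "?M + (N - 1) = (N - 1) * length (b # bs)" by simp
  finally show ?case .
qed

text \<open>The number \<open>N r - l\<close> is the vanishing order in the reversed indexing: the coefficient of index \<open>s\<close>
is the coefficient of index \<open>(N - 1) r - s\<close> of the original currents.\<close>

lemma garland_reversed:
  assumes "s + l < N * r"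
  shows "curs (map (rev_current N) (replicate r (mo y2))) s \<in> L"
    and "r > 0 \<Longrightarrow> curs (map (rev_current N) (mo x1 # replicate (r - 1) (mo y2))) s \<in> L"
    and "r > 0 \<Longrightarrow> curs (map (rev_current N) (mo y3 # replicate (r - 1) (mo y2))) s \<in> L"
    and "r > 1 \<Longrightarrow> curs (map (rev_current N) (mo y3 # mo x1 # replicate (r - 2) (mo y2))) s \<in> pbw (r - 1)"
proof -
  have lr: "l < r + ((N - 1) * r - s)" if "s \<le> (N - 1) * r"
    using assms that N by (cases N) auto
  have rev: "curs (map (rev_current N) bs) s \<in> L"
    if "set bs \<subseteq> {mo x1, mo y2, mo y3}" "length bs = r" "s \<le> (N - 1) * r \<Longrightarrow> curs bs ((N - 1) * r - s) \<in> L" for bs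
  proof -
    have "\<exists>g. b = mo g" if "b \<in> set bs" for b using that \<open>set bs \<subseteq> {mo x1, mo y2, mo y3}\<close> by auto
    from congr_L[OF curs_reverse[OF this]] show ?thesis using that L_ops(5) by auto
  qed
  show "curs (map (rev_current N) (replicate r (mo y2))) s \<in> L"
  proof (rule rev)
    show "zc r ((N - 1) * r - s) \<in> L" if "s \<le> (N - 1) * r"
      by (rule garland[OF lr[OF that]])
  qed auto
  have odd: "curs (map (rev_current N) (mo g # replicate (r - 1) (mo y2))) s \<in> L"
    if "r > 0" "g \<in> {x1, y3}" for g
  proof (rule rev)
    show "curs (mo g # replicate (r - 1) (mo y2)) ((N - 1) * r - s) \<in> L" if "s \<le> (N - 1) * r"
      using garland_odd[of "r - 1" "(N - 1) * r - s"] lr[OF that] \<open>r > 0\<close> \<open>g \<in> {x1, y3}\<close>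
      by (auto simp del: curs.simps)
  qed (use that in auto)
  show "curs (map (rev_current N) (mo x1 # replicate (r - 1) (mo y2))) s \<in> L" if "r > 0"
    by (rule odd[OF that]) simp
  show "curs (map (rev_current N) (mo y3 # replicate (r - 1) (mo y2))) s \<in> L" if "r > 0"
    by (rule odd[OF that]) simp
  show "curs (map (rev_current N) (mo y3 # mo x1 # replicate (r - 2) (mo y2))) s \<in> pbw (r - 1)" if "r > 1"
  proof -
    define r' where "r' = r - 2"
    have r': "r = Suc (Suc r')" using that by (simp add: r'_def)
    have r'': "r - 1 = Suc r'" "r - 2 = r'" using r' by simp_all
    let ?bs = "mo y3 # mo x1 # replicate r' (mo y2)"
    let ?c = "if s \<le> (N - 1) * r then curs ?bs ((N - 1) * r - s) else 0"
    have "?c \<in> pbw (Suc r')"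
    proof (cases "s \<le> (N - 1) * r")
      case True
      have "l < Suc (Suc r') + ((N - 1) * r - s)" using lr[OF True] r' by simp
      from garland_mixed[OF this] show ?thesis unfolding if_P[OF True] .
    qed (simp add: pbw_ops(5))
    moreover have "curs (map (rev_current N) ?bs) s - ?c \<in> pbw (Suc r')"
    proof -
      have "\<exists>g. b = mo g" if "b \<in> set ?bs" for b using that by auto
      from curs_reverse[where bs = ?bs and s = s, OF this] have "curs (map (rev_current N) ?bs) s \<approx> ?c"
        by (simp only: r' list.size length_replicate add_Suc_right add_0_right)
      then show ?thesis unfolding congr_def by (rule L_pbw)
    qed
    ultimately have "(curs (map (rev_current N) ?bs) s - ?c) + ?c \<in> pbw (Suc r')" by (intro pbw_ops(1))
    then show ?thesis unfolding r'' diff_add_cancel .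
  qed
qed

end

section \<open>The upper bound for the truncated Weyl module\<close>

subsection \<open>The Rees module\<close>

lemma finite_shifted_support:
  fixes p :: "nat \<Rightarrow> 'a::mult_zero"
  assumes "finite {d. p d \<noteq> 0}"
  shows "finite {d. (if m \<le> d then b * p (d - m) else 0) \<noteq> 0}"
proof (rule finite_subset)
  show "{d. (if m \<le> d then b * p (d - m) else 0) \<noteq> 0} \<subseteq> (\<lambda>d. d + m) ` {d. p d \<noteq> 0}"
  proof
    fix d assume "d \<in> {d. (if m \<le> d then b * p (d - m) else 0) \<noteq> 0}"
    then have "m \<le> d" "p (d - m) \<noteq> 0" by (auto split: if_splits)
    then show "d \<in> (\<lambda>d. d + m) ` {d. p d \<noteq> 0}" by (intro image_eqI[of _ _ "d - m"]) auto
  qed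
qed (use assms in simp)

lift_definition shift_mult :: "nat \<Rightarrow> 'a::mult_zero \<Rightarrow> (nat \<Rightarrow>\<^sub>0 'a) \<Rightarrow> (nat \<Rightarrow>\<^sub>0 'a)"
  is "\<lambda>m b p d. if m \<le> d then b * p (d - m) else 0"
  by (rule finite_shifted_support)

lemmas lookup_shift_mult = shift_mult.rep_eq

lemma clin_shift_mult: "clin (shift_mult m (b :: 'a::lie_superalgebra uea))"
  by (auto simp: clin_def lookup_shift_mult lookup_add lookup_scaleC distrib_left uea_scaleC_mult
      intro!: poly_mapping_eqI)

lemma shift_mult_comp:
  "shift_mult m b (shift_mult n c p) = shift_mult (m + n) (b * c :: 'a::lie_superalgebra uea) p"
  by (auto simp: lookup_shift_mult mult.assoc intro!: poly_mapping_eqI)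

lemma shift_mult_add: "shift_mult m (b + c :: 'a::lie_superalgebra uea) p = shift_mult m b p + shift_mult m c p"
  and shift_mult_scaleC: "shift_mult m (k *\<^sub>C b :: 'a uea) p = k *\<^sub>C shift_mult m b p"
  and shift_mult_minus: "shift_mult m (- b :: 'a uea) p = - shift_mult m b p"
  and shift_mult_zero: "shift_mult m (0 :: 'a uea) p = 0"
  by (auto simp: lookup_shift_mult lookup_add lookup_scaleC distrib_right uea_scaleC_mult
      intro!: poly_mapping_eqI)

lemma shift_mult_single: "shift_mult m (b :: 'a::lie_superalgebra uea) (Poly_Mapping.single d u) = Poly_Mapping.single (m + d) (b * u)"
  by (auto simp: lookup_shift_mult lookup_single when_def intro!: poly_mapping_eqI)

lemma clin_single: "clin (Poly_Mapping.single k :: 'v::complex_vector \<Rightarrow> _)"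
  by (simp add: clin_def single_add scaleC_single)

lemma clin_lookup: "clin (\<lambda>p :: 'k \<Rightarrow>\<^sub>0 'v::complex_vector. Poly_Mapping.lookup p k)"
  by (simp add: clin_def lookup_add lookup_scaleC)

lemma uea_deg_mult:
  fixes x :: "'a::lie_superalgebra"
  shows "u \<in> uea_deg t \<Longrightarrow> uea_of (monom x n) * u \<in> uea_deg (n + t)"
  unfolding uea_deg_def
proof (rule cspan_induct_clin[OF _ clin_uea_mult(1) cvs.subspace_span])
  fix b :: "'a poly uea" assume "b \<in> {prod_list (map (\<lambda>(x, m). uea_of (monom x m)) w) | w. sum_list (map snd w) = t}"
  then obtain w where "b = prod_list (map (\<lambda>(x, m). uea_of (monom x m)) w)" "sum_list (map snd w) = t"
    by blast
  then show "uea_of (monom x n) * b \<in> cspan {prod_list (map (\<lambda>(x, m). uea_of (monom x m)) w) | w.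
      sum_list (map snd w) = n + t}"
    by (intro cvs.span_base CollectI exI[of _ "(x, n) # w"]) simp
qed

lemma uea_deg_subspace: "cvs.subspace (uea_deg n)"
  unfolding uea_deg_def by (rule cvs.subspace_span)

lemma uea_deg_one: "1 \<in> uea_deg 0"
  unfolding uea_deg_def by (intro cvs.span_base CollectI exI[of _ "[]"]) simp

definition kac_dim :: "nat \<Rightarrow> nat" where "kac_dim n = (if n = 0 then 1 else 4 * n)"

context truncated_weyl
begin

abbreviation rc :: "sl12 \<Rightarrow> nat \<Rightarrow> sl12 poly uea" where "rc g \<equiv> rev_current N (mo g)"

definition "rees g i = shift_mult 1 (rc g i)"

text \<open>The Rees construction: the variable of the polynomial mapping records the length of words, so
that products which only anticommute or vanish modulo shorter words do so exactly modulo \<open>rees_zero\<close>.\<close>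

definition rees_zero :: "(nat \<Rightarrow>\<^sub>0 sl12 poly uea) set" where
  "rees_zero = {p. \<forall>d. Poly_Mapping.lookup p d \<in> (case d of 0 \<Rightarrow> L | Suc d' \<Rightarrow> pbw d')}"

definition rees_carrier :: "(nat \<Rightarrow>\<^sub>0 sl12 poly uea) set" where
  "rees_carrier = {p. \<forall>d. Poly_Mapping.lookup p d \<in> pbw d}"

lemma rc_cases: "(\<exists>n<N. rc g i = mo g n) \<or> rc g i = 0"
  using N by (cases "i < N") (auto simp: rev_current_def intro!: exI[of _ "N - Suc i"])

lemma rc_pbw: "g \<in> {x1, y2, y3} \<Longrightarrow> v \<in> pbw d \<Longrightarrow> rc g i * v \<in> pbw (Suc d)"
  using rc_cases[of g i] mo_low[of g v d] pbw_ops(5) by auto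

lemma rc_comm: "rc y2 i * rc y2 j = rc y2 j * rc y2 i" "rc x1 i * rc y2 j = rc y2 j * rc x1 i"
    "rc y3 i * rc y2 j = rc y2 j * rc y3 i"
    "rc x1 i * rc x1 j = - (rc x1 j * rc x1 i)" "rc y3 i * rc y3 j = - (rc y3 j * rc y3 i)"
  by (auto simp: rev_current_def zU_comm odd_anticomm(1,2)[of "N - Suc i" "N - Suc j"])

lemma rc_mixed: "(\<exists>n. rc x1 i * rc y3 j + rc y3 j * rc x1 i = zU n) \<or> rc x1 i * rc y3 j + rc y3 j * rc x1 i = 0"
  by (auto simp: rev_current_def odd_anticomm(3))

lemma rees_invariant:
  assumes "g \<in> {x1, y2, y3}"
  shows "p \<in> rees_zero \<Longrightarrow> rees g i p \<in> rees_zero" "p \<in> rees_carrier \<Longrightarrow> rees g i p \<in> rees_carrier"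
proof -
  assume p: "p \<in> rees_zero"
  have "rc g i * Poly_Mapping.lookup p d \<in> pbw d" for d
    using p rc_pbw[OF assms] L_pbw L_mult by (cases d) (auto simp: rees_zero_def dest: spec[of _ d])
  then show "rees g i p \<in> rees_zero"
    by (auto simp: rees_zero_def rees_def lookup_shift_mult L_ops split: nat.splits)
next
  assume "p \<in> rees_carrier"
  then have "(if 1 \<le> d then rc g i * Poly_Mapping.lookup p (d - 1) else 0) \<in> pbw d" for d
    using rc_pbw[OF assms] pbw_ops(5) by (cases d) (auto simp: rees_carrier_def)
  then show "rees g i p \<in> rees_carrier"
    unfolding rees_carrier_def rees_def mem_Collect_eq lookup_shift_mult by blast
qed

lemma rees_subspaces: "cvs.subspace rees_zero" "cvs.subspace rees_carrier"
proof -
  have "cvs.subspace (case d of 0 \<Rightarrow> L | Suc d' \<Rightarrow> pbw d')" for d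
    using L_subspace pbw_subspace by (cases d) auto
  then show "cvs.subspace rees_zero"
    unfolding rees_zero_def cvs.subspace_def by (auto simp: lookup_add lookup_scaleC)
  show "cvs.subspace rees_carrier"
    unfolding rees_carrier_def cvs.subspace_def by (auto simp: lookup_add lookup_scaleC pbw_ops)
qed

sublocale super_currents "rees y2" "rees x1" "rees y3" N rees_carrier rees_zero
proof
  show "clin (rees y2 i)" "clin (rees x1 i)" "clin (rees y3 i)" for i
    by (simp_all add: rees_def clin_shift_mult)
  show "rees y2 i (rees y2 j v) = rees y2 j (rees y2 i v)"
    "rees x1 i (rees y2 j v) = rees y2 j (rees x1 i v)" "rees y3 i (rees y2 j v) = rees y2 j (rees y3 i v)" for i j v
    by (simp_all add: rees_def shift_mult_comp rc_comm(1-3)[of i j])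
  show "rees x1 i (rees x1 j v) = - rees x1 j (rees x1 i v)"
    "rees y3 i (rees y3 j v) = - rees y3 j (rees y3 i v)" for i j v
    by (simp_all add: rees_def shift_mult_comp rc_comm(4,5)[of i j] shift_mult_minus)
  show "rees y2 i v = 0" "rees x1 i v = 0" "rees y3 i v = 0" if "i \<ge> N" for i v
    using that by (simp_all add: rees_def rev_current_def shift_mult_zero)
  show "invariant (range (rees y2) \<union> range (rees x1) \<union> range (rees y3)) rees_carrier"
    "invariant (range (rees y2) \<union> range (rees x1) \<union> range (rees y3)) rees_zero"
    using rees_subspaces rees_invariant by (auto simp: invariant_def)
  fix v i j assume v: "v \<in> rees_carrier"
  have "rees x1 i (rees y3 j v) + rees y3 j (rees x1 i v) = shift_mult 2 (rc x1 i * rc y3 j + rc y3 j * rc x1 i) v"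
    by (simp add: rees_def shift_mult_comp shift_mult_add numeral_2_eq_2)
  moreover have "shift_mult 2 (zU n) v \<in> rees_zero" for n
    unfolding rees_zero_def
  proof (intro CollectI allI)
    fix d
    have "zU n * Poly_Mapping.lookup v (d - 2) \<in> pbw (Suc (d - 2))"
      using v by (intro mo_low) (auto simp: rees_carrier_def)
    then show "Poly_Mapping.lookup (shift_mult 2 (zU n) v) d \<in> (case d of 0 \<Rightarrow> L | Suc d' \<Rightarrow> pbw d')"
      by (cases "d < 2") (auto simp: lookup_shift_mult L_ops pbw_ops numeral_2_eq_2 Suc_diff_Suc split: nat.splits)
  qed
  ultimately show "rees x1 i (rees y3 j v) + rees y3 j (rees x1 i v) \<in> rees_zero"
    using rc_mixed[of i j] cvs.subspace_0[OF rees_subspaces(1)] by (auto simp: shift_mult_zero)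
qed

definition rees_one :: "nat \<Rightarrow>\<^sub>0 sl12 poly uea" where "rees_one = Poly_Mapping.single 0 1"

lemma rees_single: "rees g i (Poly_Mapping.single d u) = Poly_Mapping.single (Suc d) (rc g i * u)"
  by (simp add: rees_def shift_mult_single)

lemma rees_cur: "cur (rees y2) r s rees_one
    = Poly_Mapping.single r (curs (map (rev_current N) (replicate r (mo y2))) s)"
proof (induction r arbitrary: s)
  case 0
  then show ?case by (simp add: rees_one_def)
next
  case (Suc r)
  then show ?case by (simp add: rees_single clin_sum[OF clin_single])
qed

lemma single_rees_zero: "u \<in> (case d of 0 \<Rightarrow> L | Suc d' \<Rightarrow> pbw d') \<Longrightarrow> Poly_Mapping.single d u \<in> rees_zero"
  unfolding rees_zero_def
  by (auto simp: lookup_single when_def L_ops pbw_ops split: nat.splits)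

lemma single_rees_zero_L: "u \<in> L \<Longrightarrow> Poly_Mapping.single d u \<in> rees_zero"
  using L_pbw by (intro single_rees_zero) (auto split: nat.splits)

text \<open>For \<open>\<eta>\<close> consisting of \<open>N - m\<close> times \<open>q\<close> and \<open>m\<close> times \<open>q + 1\<close>, the sum of the positive parts of
\<open>r - \<eta>\<^sub>j\<close> equals the positive part of \<open>N r - l\<close>: this balanced choice of exponents is what makes the
relations known so far sufficient.\<close>

lemma rees_bounded:
  assumes "l = q * N + m" "m < N"
  shows "bounded_mod Op rees_one rees_zero (kac_dim q ^ (N - m) * kac_dim (q + 1) ^ m)"
proof -
  (* The weight is spread over the N indices as evenly as possible. *)
  define \<eta> where "\<eta> = replicate (N - m) (int q) @ replicate m (int (q + 1))"
  have ord: "s + l < N * r" if "s < iorder \<eta> r" for r s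
  proof -
    have "iorder \<eta> r = (N - m) * (r - q) + m * (r - (q + 1))"
      by (simp add: \<eta>_def iorder_def sum_list_replicate nat_diff_distrib' flip: of_nat_Suc)
    moreover have "(N - m) * (r - q) + m * (r - (q + 1)) + l = N * r" if "q < r"
    proof -
      obtain k where k: "r = Suc (q + k)" using less_imp_Suc_add[OF \<open>q < r\<close>] by blast
      obtain n where n: "N = m + n" using assms(2) less_imp_add_positive by blast
      show ?thesis by (simp add: k n assms(1) algebra_simps)
    qed
    ultimately show ?thesis using that by (cases "q < r") auto
  qed
  have odd: "(\<Sum>i\<le>s. cur (rees y2) r (s - i) (rees g i rees_one))
      = Poly_Mapping.single (Suc r) (curs (map (rev_current N) (mo g # replicate r (mo y2))) s)"
    if "g \<in> {x1, y3}" for g r s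
  proof -
    have "cur (rees y2) r (s - i) (rees g i rees_one) = rees g i (cur (rees y2) r (s - i) rees_one)" for i
      using that by (intro cur_Op[symmetric]) auto
    then show ?thesis by (simp add: rees_cur rees_single clin_sum[OF clin_single])
  qed
  have mixed: "(\<Sum>i\<le>s. \<Sum>j\<le>s - i. cur (rees y2) r (s - i - j) (rees y3 j (rees x1 i rees_one)))
      = Poly_Mapping.single (Suc (Suc r)) (curs (map (rev_current N) (mo y3 # mo x1 # replicate r (mo y2))) s)"
    for r s
  proof -
    have "cur (rees y2) r t (rees y3 j (rees x1 i rees_one)) = rees y3 j (rees x1 i (cur (rees y2) r t rees_one))" for i j t
      by (simp add: cur_Op)
    then have "(\<Sum>i\<le>s. \<Sum>j\<le>s - i. cur (rees y2) r (s - i - j) (rees y3 j (rees x1 i rees_one)))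
      = Poly_Mapping.single (Suc (Suc r)) (\<Sum>i\<le>s. \<Sum>j\<le>s - i.
          rc y3 j * rc x1 i * curs (map (rev_current N) (replicate r (mo y2))) (s - i - j))"
      by (simp add: rees_cur rees_single clin_sum[OF clin_single] mult.assoc)
    then show ?thesis by (simp only: curs_swap curs.simps list.map)
  qed
  have "bounded_mod Op rees_one rees_zero (\<Prod>x\<leftarrow>\<eta>. dim_full x)"
  proof (rule bounded_full)
    show "invariant Op rees_zero" by (rule T0)
    show "rees_one \<in> rees_carrier"
      by (auto simp: rees_carrier_def rees_one_def lookup_single when_def pbw_one pbw_ops)
    show "length \<eta> = N" using assms(2) by (simp add: \<eta>_def)
    fix r s
    show "cur (rees y2) r s rees_one \<in> rees_zero" if "s < iorder \<eta> r"
      unfolding rees_cur by (rule single_rees_zero_L[OF garland_reversed(1)[OF ord[OF that]]])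
    show "(\<Sum>i\<le>s. cur (rees y2) r (s - i) (rees x1 i rees_one)) \<in> rees_zero" if "s < iorder \<eta> (Suc r)"
      unfolding odd[of x1, simplified] using garland_reversed(2)[OF ord[OF that]]
      by (intro single_rees_zero_L) simp
    show "(\<Sum>i\<le>s. cur (rees y2) r (s - i) (rees y3 i rees_one)) \<in> rees_zero" if "s < iorder \<eta> (Suc r)"
      unfolding odd[of y3, simplified] using garland_reversed(3)[OF ord[OF that]]
      by (intro single_rees_zero_L) simp
    show "(\<Sum>i\<le>s. \<Sum>j\<le>s - i. cur (rees y2) r (s - i - j) (rees y3 j (rees x1 i rees_one))) \<in> rees_zero"
      if "s < iorder \<eta> (Suc (Suc r))"
      unfolding mixed using garland_reversed(4)[OF ord[OF that]]
      by (intro single_rees_zero) (simp del: curs.simps)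
  qed simp
  moreover have "dim_full (int n) = kac_dim n" for n
    by (cases n; cases "n - 1") (auto simp: dim_full_def dim_odd_def dim_even_def kac_dim_def)
  ultimately show ?thesis
    by (simp add: \<eta>_def del: of_nat_Suc of_nat_add)
qed

lemma words_rees:
  "v \<in> words Op rees_one \<Longrightarrow> \<exists>d u t. v = Poly_Mapping.single d u \<and> u \<in> uea_deg t"
proof (induction rule: words.induct)
  case base
  then show ?case using uea_deg_one by (auto simp: rees_one_def)
next
  case (step f v)
  then obtain d u t where v: "v = Poly_Mapping.single d u" "u \<in> uea_deg t" by blast
  obtain g i where f: "f = rees g i" using step.hyps(1) by auto
  have "\<exists>t. rc g i * u \<in> uea_deg t"
    using rc_cases[of g i] uea_deg_mult[OF v(2)] cvs.subspace_0[OF uea_deg_subspace] by fastforce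
  then show ?case unfolding f v(1) rees_single by blast
qed

lemma rees_words:
  "set w \<subseteq> lowering \<Longrightarrow> Poly_Mapping.single (length w) (prod_list w) \<in> words Op rees_one"
proof (induction w)
  case Nil
  then show ?case using words.base[of rees_one Op] by (simp add: rees_one_def)
next
  case (Cons b w)
  then obtain g n where b: "b = mo g n" "g \<in> {x1, y2, y3}" "n < N" by (auto simp: lowering_def)
  then have "b = rc g (N - 1 - n)" by (simp add: rev_current_def)
  then have "Poly_Mapping.single (length (b # w)) (prod_list (b # w))
      = rees g (N - 1 - n) (Poly_Mapping.single (length w) (prod_list w))"
    by (simp add: rees_single)
  also have "\<dots> \<in> words Op rees_one"
    using Cons b(2) by (intro words.step[where f = "rees g (N - 1 - n)"]) auto
  finally show ?case .
qed

text \<open>Setting the Rees variable to one turns a spanning set of the associated graded space into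
a spanning set of the module itself.\<close>

theorem weyl_spanning_set:
  assumes "l = q * N + m" "m < N"
  shows "\<exists>F. finite F \<and> card F \<le> kac_dim q ^ (N - m) * kac_dim (q + 1) ^ m \<and>
    (\<forall>f\<in>F. \<exists>t. f \<in> uea_deg t) \<and> (\<forall>u. u \<in> cspan (F \<union> L))"
proof -
  obtain F' where F': "finite F'" "card F' \<le> kac_dim q ^ (N - m) * kac_dim (q + 1) ^ m"
      "F' \<subseteq> words Op rees_one" "orb Op rees_one \<subseteq> cspan (F' \<union> rees_zero)"
    using rees_bounded[OF assms] unfolding bounded_mod_def by blast
  define val :: "(nat \<Rightarrow>\<^sub>0 sl12 poly uea) \<Rightarrow> sl12 poly uea"
    where "val p = (\<Sum>d\<in>Poly_Mapping.keys p. Poly_Mapping.lookup p d)" for p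
  have val: "val (Poly_Mapping.single d u) = u" for d u
    by (cases "u = 0") (simp_all add: val_def)
  define F where "F = val ` F'"
  let ?S = "cspan (F \<union> L)"
  have pbw: "pbw d \<subseteq> ?S" for d
  proof (induction d rule: less_induct)
    case (less d)
    have "prod_list w \<in> ?S" if w: "set w \<subseteq> lowering" "length w \<le> d" for w
    proof -
      let ?k = "length w"
      have "Poly_Mapping.single ?k (prod_list w) \<in> cspan (F' \<union> rees_zero)"
        using rees_words[OF w(1)] F'(4) cvs.span_base by (auto simp: orb_def)
      then have "Poly_Mapping.lookup (Poly_Mapping.single ?k (prod_list w)) ?k \<in> ?S"
      proof (rule cspan_induct_clin[OF _ clin_lookup cvs.subspace_span])
        fix b assume "b \<in> F' \<union> rees_zero"
        then show "Poly_Mapping.lookup b ?k \<in> ?S"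
        proof
          assume b: "b \<in> F'"
          then obtain e u where e: "b = Poly_Mapping.single e u" using words_rees F'(3) by blast
          then have "u \<in> F" using b val[of e u] by (metis F_def imageI)
          then show ?thesis
            by (auto simp: e lookup_single when_def cvs.span_base cvs.span_zero)
        next
          assume b: "b \<in> rees_zero"
          then have b: "Poly_Mapping.lookup b ?k \<in> (case ?k of 0 \<Rightarrow> L | Suc d' \<Rightarrow> pbw d')"
            by (simp only: rees_zero_def mem_Collect_eq)
          show ?thesis
          proof (cases ?k)
            case 0
            then show ?thesis using b by (simp add: cvs.span_base)
          next
            case (Suc d')
            then show ?thesis using b less[of d'] w(2) by auto
          qed
        qed
      qed
      then show ?thesis by simp
    qed
    then show ?case
      unfolding pbw_def pbw_words_def by (intro cvs.span_minimal) (auto intro: cvs.span_base)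
  qed
  show ?thesis
  proof (intro exI[of _ F] conjI ballI allI)
    show "finite F" using F'(1) by (simp add: F_def)
    show "card F \<le> kac_dim q ^ (N - m) * kac_dim (q + 1) ^ m"
      using card_image_le[OF F'(1), of val] F'(2) by (simp add: F_def)
    show "\<exists>t. f \<in> uea_deg t" if "f \<in> F" for f
      using that words_rees F'(3) val unfolding F_def by (metis (no_types, lifting) imageE subsetD)
    show "u \<in> ?S" for u using pbw_exhaustive[of u] pbw by blast
  qed
qed

end

section \<open>Generalized Kac modules are large enough\<close>

lemma (in rep_mod) uact_diff: "v \<in> C \<Longrightarrow> uact (u - u') v - (uact u v - uact u' v) \<in> S"
  using cvs.subspace_neg[OF S uact_add[of v "u - u'" u']] by (simp add: algebra_simps)

subsection \<open>An explicit module\<close>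

text \<open>For \<open>n > 0\<close> the Kac module restricted to the even part consists of strings for the lowering operator
\<open>y\<^sub>2\<close>: \<open>KP\<close> is the string of the highest weight vector \<open>w\<close>, the strings \<open>KA\<close> and \<open>KB\<close> contain
\<open>x\<^sub>1 w\<close> and \<open>y\<^sub>3 w\<close>, and \<open>KS\<close> contains the part of \<open>y\<^sub>3 x\<^sub>1 w\<close> that generates a string of
its own, scaled by \<open>n\<close>. The strings are first taken to be infinite, which avoids case distinctions at their ends.\<close>

datatype kac_kind = KP | KA | KB | KS

type_synonym kac_vector = "kac_kind \<times> nat \<Rightarrow>\<^sub>0 complex"

abbreviation kv :: "kac_kind \<Rightarrow> nat \<Rightarrow> kac_vector" where "kv c i \<equiv> Poly_Mapping.single (c, i) 1"

context
  fixes k :: complex and n :: nat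
begin

fun kac_h1 :: "kac_kind \<times> nat \<Rightarrow> kac_vector" where
  "kac_h1 (KP, i) = (k - of_nat i) *\<^sub>C kv KP i"
| "kac_h1 (KA, i) = (k - of_nat i) *\<^sub>C kv KA i"
| "kac_h1 (KB, i) = (k - 1 - of_nat i) *\<^sub>C kv KB i"
| "kac_h1 (KS, i) = (k - 1 - of_nat i) *\<^sub>C kv KS i"

fun kac_h2 :: "kac_kind \<times> nat \<Rightarrow> kac_vector" where
  "kac_h2 (KP, i) = (of_nat n - 2 * of_nat i) *\<^sub>C kv KP i"
| "kac_h2 (KA, i) = (of_nat n - 1 - 2 * of_nat i) *\<^sub>C kv KA i"
| "kac_h2 (KB, i) = (of_nat n - 1 - 2 * of_nat i) *\<^sub>C kv KB i"
| "kac_h2 (KS, i) = (of_nat n - 2 - 2 * of_nat i) *\<^sub>C kv KS i"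

fun kac_y2 :: "kac_kind \<times> nat \<Rightarrow> kac_vector" where
  "kac_y2 (c, i) = kv c (Suc i)"

fun kac_x2 :: "kac_kind \<times> nat \<Rightarrow> kac_vector" where
  "kac_x2 (KP, i) = (of_nat i * (of_nat n - of_nat i + 1)) *\<^sub>C kv KP (i - 1)"
| "kac_x2 (KA, i) = (of_nat i * (of_nat n - of_nat i)) *\<^sub>C kv KA (i - 1)"
| "kac_x2 (KB, i) = (of_nat i * (of_nat n - of_nat i)) *\<^sub>C kv KB (i - 1)"
| "kac_x2 (KS, i) = (of_nat i * (of_nat n - of_nat i - 1)) *\<^sub>C kv KS (i - 1)"

fun kac_x1 :: "kac_kind \<times> nat \<Rightarrow> kac_vector" where
  "kac_x1 (KP, i) = kv KA i"
| "kac_x1 (KA, i) = 0"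
| "kac_x1 (KB, i) = (1 - k / of_nat n) *\<^sub>C kv KP (Suc i) - (1 / of_nat n) *\<^sub>C kv KS i"
| "kac_x1 (KS, i) = (of_nat n - k) *\<^sub>C kv KA (Suc i)"

fun kac_y3 :: "kac_kind \<times> nat \<Rightarrow> kac_vector" where
  "kac_y3 (KP, i) = kv KB i"
| "kac_y3 (KA, i) = (1 / of_nat n) *\<^sub>C kv KS i + (k / of_nat n) *\<^sub>C kv KP (Suc i)"
| "kac_y3 (KB, i) = 0"
| "kac_y3 (KS, i) = (- k) *\<^sub>C kv KB (Suc i)"

fun kac_x3 :: "kac_kind \<times> nat \<Rightarrow> kac_vector" where
  "kac_x3 (KP, i) = of_nat i *\<^sub>C kv KA (i - 1)"
| "kac_x3 (KA, i) = 0"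
| "kac_x3 (KB, i) = (k - of_nat n + of_nat i * (1 - k / of_nat n)) *\<^sub>C kv KP i
     - (of_nat i / of_nat n) *\<^sub>C kv KS (i - 1)"
| "kac_x3 (KS, i) = ((k - of_nat n) * (of_nat n - 1 - of_nat i)) *\<^sub>C kv KA i"

fun kac_y1 :: "kac_kind \<times> nat \<Rightarrow> kac_vector" where
  "kac_y1 (KP, i) = (- of_nat i) *\<^sub>C kv KB (i - 1)"
| "kac_y1 (KA, i) = (k - of_nat i * k / of_nat n) *\<^sub>C kv KP i - (of_nat i / of_nat n) *\<^sub>C kv KS (i - 1)"
| "kac_y1 (KB, i) = 0"
| "kac_y1 (KS, i) = (- k * (of_nat n - 1 - of_nat i)) *\<^sub>C kv KB i"

text \<open>The entries of a matrix are its coordinates with respect to the generators; those of the Cartan elements are the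
entry at \<open>(1,1)\<close> for \<open>h\<^sub>1\<close> and the negated entry at \<open>(3,3)\<close> for \<open>h\<^sub>2\<close>.\<close>

definition kac_op :: "sl12 \<Rightarrow> kac_vector \<Rightarrow> kac_vector" where
  "kac_op g v = linext (\<lambda>b.
      sl12_mat g $ 1 $ 1 *\<^sub>C kac_h1 b + (- sl12_mat g $ 3 $ 3) *\<^sub>C kac_h2 b
      + sl12_mat g $ 2 $ 3 *\<^sub>C kac_x2 b + sl12_mat g $ 1 $ 3 *\<^sub>C kac_x3 b + sl12_mat g $ 2 $ 1 *\<^sub>C kac_y1 b
      + sl12_mat g $ 1 $ 2 *\<^sub>C kac_x1 b + sl12_mat g $ 3 $ 2 *\<^sub>C kac_y2 b + sl12_mat g $ 3 $ 1 *\<^sub>C kac_y3 b) v"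

lemma clin_kac_op: "clin (kac_op g)"
  unfolding kac_op_def by (rule clin_linext)

lemma kac_op_add: "kac_op (g + h) v = kac_op g v + kac_op h v"
  by (simp add: kac_op_def linext_def plus_sl12.rep_eq scaleC_left_distrib scaleC_right_distrib
      sum.distrib flip: sum.distrib) (simp add: algebra_simps sum.distrib)

lemma kac_op_scaleC: "kac_op (c *\<^sub>C g) v = c *\<^sub>C kac_op g v"
  by (simp add: kac_op_def linext_def scaleC_sl12.rep_eq scaleC_mat_nth scaleC_right_distrib
      cvs.scale_right_diff_distrib cvs.scale_sum_right scaleC_scaleC mult_ac)

lemma kac_op_gens:
  "kac_op h1 (kv c i) = kac_h1 (c, i)" "kac_op h2 (kv c i) = kac_h2 (c, i)"
  "kac_op x2 (kv c i) = kac_x2 (c, i)" "kac_op x3 (kv c i) = kac_x3 (c, i)"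
  "kac_op y1 (kv c i) = kac_y1 (c, i)" "kac_op x1 (kv c i) = kac_x1 (c, i)"
  "kac_op y2 (kv c i) = kac_y2 (c, i)" "kac_op y3 (kv c i) = kac_y3 (c, i)"
  by (simp_all add: kac_op_def linext_single scaleC_one
      h1.rep_eq h2.rep_eq x1.rep_eq x2.rep_eq x3.rep_eq y1.rep_eq y2.rep_eq y3.rep_eq
      mat_unit_def transpose_def)

lemmas kac_op_lin = clin_add[OF clin_kac_op] clin_scale[OF clin_kac_op] clin_zero[OF clin_kac_op]
  clin_minus[OF clin_kac_op] clin_diff[OF clin_kac_op]

definition "kac_defect s g h v = kac_op g (kac_op h v) - s *\<^sub>C kac_op h (kac_op g v) - kac_op (bracket g h) v"

lemma sl12_all_brackets:
  "bracket h1 h1 = 0" "bracket h1 h2 = 0" "bracket h1 x2 = x2" "bracket h1 y2 = - y2"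
  "bracket h2 h2 = 0" "bracket h2 x2 = 2 *\<^sub>C x2" "bracket h2 y2 = - (2 *\<^sub>C y2)"
  "bracket x2 x2 = 0" "bracket x2 y2 = h2" "bracket y2 y2 = 0"
  "bracket h1 x1 = 0" "bracket h1 x3 = x3" "bracket h1 y1 = 0" "bracket h1 y3 = - y3"
  "bracket h2 x1 = - x1" "bracket h2 x3 = x3" "bracket h2 y1 = y1" "bracket h2 y3 = - y3"
  "bracket x2 x1 = - x3" "bracket x2 x3 = 0" "bracket x2 y1 = 0" "bracket x2 y3 = y1"
  "bracket y2 x1 = 0" "bracket y2 x3 = - x1" "bracket y2 y1 = y3" "bracket y2 y3 = 0"
  "bracket x1 x1 = 0" "bracket x1 x3 = 0" "bracket x1 y1 = h1" "bracket x1 y3 = y2"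
  "bracket x3 x3 = 0" "bracket x3 y1 = x2" "bracket x3 y3 = h1 - h2"
  "bracket y1 y1 = 0" "bracket y1 y3 = 0" "bracket y3 y3 = 0"
  by (transfer, simp add: sl12_calc)+

lemma kac_op_zero: "kac_op 0 v = 0" and kac_op_minus: "kac_op (- g) v = - kac_op g v"
  and kac_op_diff: "kac_op (g - h) v = kac_op g v - kac_op h v"
proof -
  show 0: "kac_op 0 v = 0" using kac_op_scaleC[of 0 0 v] by simp
  show m: "kac_op (- g) v = - kac_op g v" for g using kac_op_add[of g "- g" v] 0 by (simp add: eq_neg_iff_add_eq_0 add.commute)
  show "kac_op (g - h) v = kac_op g v - kac_op h v" using kac_op_add[of g "- h" v] m[of h] by simp
qed

lemma kac_defect_even:
  assumes n: "n > 0"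
  shows "kac_defect 1 h1 h1 (kv c i) = 0"
    "kac_defect 1 h1 h2 (kv c i) = 0"
    "kac_defect 1 h1 x2 (kv c i) = 0"
    "kac_defect 1 h1 y2 (kv c i) = 0"
    "kac_defect 1 h2 h2 (kv c i) = 0"
    "kac_defect 1 h2 x2 (kv c i) = 0"
    "kac_defect 1 h2 y2 (kv c i) = 0"
    "kac_defect 1 x2 x2 (kv c i) = 0"
    "kac_defect 1 x2 y2 (kv c i) = 0"
    "kac_defect 1 y2 y2 (kv c i) = 0"
  using n
  by (cases c; cases i; simp add: kac_defect_def sl12_all_brackets kac_op_gens kac_op_lin kac_op_zero
      kac_op_minus kac_op_diff kac_op_scaleC scaleC_one; (intro poly_mapping_eqI)?;
      simp add: lookup_add lookup_minus lookup_scaleC scaleC_complex_def field_simps)+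

lemma kac_defect_mixed:
  assumes n: "n > 0"
  shows "kac_defect 1 h1 x1 (kv c i) = 0"
    "kac_defect 1 h1 x3 (kv c i) = 0"
    "kac_defect 1 h1 y1 (kv c i) = 0"
    "kac_defect 1 h1 y3 (kv c i) = 0"
    "kac_defect 1 h2 x1 (kv c i) = 0"
    "kac_defect 1 h2 x3 (kv c i) = 0"
    "kac_defect 1 h2 y1 (kv c i) = 0"
    "kac_defect 1 h2 y3 (kv c i) = 0"
    "kac_defect 1 x2 x1 (kv c i) = 0"
    "kac_defect 1 x2 x3 (kv c i) = 0"
    "kac_defect 1 x2 y1 (kv c i) = 0"
    "kac_defect 1 x2 y3 (kv c i) = 0"
    "kac_defect 1 y2 x1 (kv c i) = 0"
    "kac_defect 1 y2 x3 (kv c i) = 0"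
    "kac_defect 1 y2 y1 (kv c i) = 0"
    "kac_defect 1 y2 y3 (kv c i) = 0"
  using n
  by (cases c; cases i; simp add: kac_defect_def sl12_all_brackets kac_op_gens kac_op_lin kac_op_zero
      kac_op_minus kac_op_diff kac_op_scaleC scaleC_one; (intro poly_mapping_eqI)?;
      simp add: lookup_add lookup_minus lookup_scaleC scaleC_complex_def field_simps)+

lemma kac_defect_odd:
  assumes n: "n > 0"
  shows "kac_defect (- 1) x1 x1 (kv c i) = 0"
    "kac_defect (- 1) x1 x3 (kv c i) = 0"
    "kac_defect (- 1) x1 y1 (kv c i) = 0"
    "kac_defect (- 1) x1 y3 (kv c i) = 0"
    "kac_defect (- 1) x3 x3 (kv c i) = 0"
    "kac_defect (- 1) x3 y1 (kv c i) = 0"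
    "kac_defect (- 1) x3 y3 (kv c i) = 0"
    "kac_defect (- 1) y1 y1 (kv c i) = 0"
    "kac_defect (- 1) y1 y3 (kv c i) = 0"
    "kac_defect (- 1) y3 y3 (kv c i) = 0"
  using n
  by (cases c; cases i; simp add: kac_defect_def sl12_all_brackets kac_op_gens kac_op_lin kac_op_zero
      kac_op_minus kac_op_diff kac_op_scaleC scaleC_one; (intro poly_mapping_eqI)?;
      simp add: lookup_add lookup_minus lookup_scaleC scaleC_complex_def field_simps)+


lemma clin_kac_defect:
  "clin (kac_defect s g h)" "clin (\<lambda>h. kac_defect s g h v)" "clin (\<lambda>g. kac_defect s g h v)"
  by (auto simp: clin_def kac_defect_def kac_op_lin kac_op_add kac_op_scaleC bracket_add_left
      bracket_add_right bracket_scaleC_left bracket_scaleC_right scaleC_right_distrib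
      cvs.scale_right_diff_distrib scaleC_scaleC mult.commute)

lemma kac_defect_basis_zero: "(\<And>c i. kac_defect s g h (kv c i) = 0) \<Longrightarrow> kac_defect s g h v = 0"
  using clin_eqI_single[where F = "kac_defect s g h" and G = "\<lambda>_. 0" and p = v]
  by (simp add: clin_kac_defect clin_def[of "\<lambda>_. 0"] split_paired_all)

lemma kac_defect_swap:
  assumes "hcomp i g = g" "hcomp j h = h"
  shows "kac_defect (ksign (i * j)) h g v = - ksign (i * j) *\<^sub>C kac_defect (ksign (i * j)) g h v"
proof -
  have br: "bracket h g = - (ksign (i * j) *\<^sub>C bracket g h)"
    using bracket_skew[of j h i g] by (simp add: assms mult.commute)
  have "ksign (i * j) * ksign (i * j) = 1" by (simp add: ksign_def)
  then show ?thesis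
    by (simp add: kac_defect_def br kac_op_minus kac_op_scaleC cvs.scale_right_diff_distrib
        scaleC_scaleC scaleC_one)
qed

abbreviation "even_gens \<equiv> {h1, h2, x2, y2}"
abbreviation "odd_gens \<equiv> {x1, x3, y1, y3}"

lemma hcomp_gens: "hcomp 0 g \<in> cspan even_gens" "hcomp 1 g \<in> cspan odd_gens"
proof -
  obtain b c1 c2 c3 where b: "b \<in> borel" "g = b + (c1 *\<^sub>C x1 + (c2 *\<^sub>C y2 + c3 *\<^sub>C y3))"
    using sl12_decomp by blast
  have split: "hcomp i g \<in> cspan B" if "\<And>t. t \<in> {h1, h2, x1, x2, x3, y1, y2, y3} \<Longrightarrow> hcomp i t \<in> cspan B" for i B
  proof -
    have hb: "hcomp i b \<in> cspan B"
      using b(1) clin_hcomp cvs.subspace_span unfolding borel_def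
      by (rule cspan_induct_clin) (rule that, auto)
    have t: "hcomp i x1 \<in> cspan B" "hcomp i y2 \<in> cspan B" "hcomp i y3 \<in> cspan B"
      by (rule that, simp)+
    show ?thesis
      unfolding b(2) clin_add[OF clin_hcomp] clin_scale[OF clin_hcomp]
      by (intro cvs.span_add cvs.span_scale hb t)
  qed
  show "hcomp 0 g \<in> cspan even_gens"
    by (rule split)
      (auto simp: sl12_parity hcomp_cross[OF sl12_parity(5)] hcomp_cross[OF sl12_parity(6)]
        hcomp_cross[OF sl12_parity(7)] hcomp_cross[OF sl12_parity(8)] cvs.span_zero intro: cvs.span_base)
  show "hcomp 1 g \<in> cspan odd_gens"
    by (rule split)
      (auto simp: sl12_parity hcomp_cross[OF sl12_parity(1)] hcomp_cross[OF sl12_parity(2)]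
        hcomp_cross[OF sl12_parity(3)] hcomp_cross[OF sl12_parity(4)] cvs.span_zero intro: cvs.span_base)
qed

lemma kac_op_bracket:
  assumes n: "n > 0"
  shows "kac_defect (ksign (i * j)) (hcomp i g) (hcomp j h) v = 0"
proof -
  have ext: "kac_defect s g h v = 0"
    if "g \<in> cspan A" "h \<in> cspan B" "\<And>a b. a \<in> A \<Longrightarrow> b \<in> B \<Longrightarrow> kac_defect s a b v = 0" for s g h A B
  proof -
    have 0: "cvs.subspace {0 :: kac_vector}" by (simp add: cvs.subspace_def)
    have "kac_defect s g b v \<in> {0}" if "b \<in> B" for b
      using \<open>g \<in> cspan A\<close> clin_kac_defect(3) 0 by (rule cspan_induct_clin) (use that(1) \<open>\<And>a b. a \<in> A \<Longrightarrow> b \<in> B \<Longrightarrow> kac_defect s a b v = 0\<close> in auto)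
    then have "kac_defect s g h v \<in> {0}"
      using cspan_induct_clin[OF \<open>h \<in> cspan B\<close> clin_kac_defect(2)[of s g v] 0] by blast
    then show ?thesis by simp
  qed
  have par: "hcomp 0 a = a" if "a \<in> even_gens" for a using that sl12_parity by auto
  have par1: "hcomp 1 a = a" if "a \<in> odd_gens" for a using that sl12_parity by auto
  have E: "kac_defect 1 h1 h1 v = 0"
    "kac_defect 1 h1 h2 v = 0"
    "kac_defect 1 h1 x2 v = 0"
    "kac_defect 1 h1 y2 v = 0"
    "kac_defect 1 h2 h2 v = 0"
    "kac_defect 1 h2 x2 v = 0"
    "kac_defect 1 h2 y2 v = 0"
    "kac_defect 1 x2 x2 v = 0"
    "kac_defect 1 x2 y2 v = 0"
    "kac_defect 1 y2 y2 v = 0"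
    by (rule kac_defect_basis_zero, rule kac_defect_even[OF n])+
  have D: "kac_defect (- 1) x1 x1 v = 0"
    "kac_defect (- 1) x1 x3 v = 0"
    "kac_defect (- 1) x1 y1 v = 0"
    "kac_defect (- 1) x1 y3 v = 0"
    "kac_defect (- 1) x3 x3 v = 0"
    "kac_defect (- 1) x3 y1 v = 0"
    "kac_defect (- 1) x3 y3 v = 0"
    "kac_defect (- 1) y1 y1 v = 0"
    "kac_defect (- 1) y1 y3 v = 0"
    "kac_defect (- 1) y3 y3 v = 0"
    by (rule kac_defect_basis_zero, rule kac_defect_odd[OF n])+
  have swE: "kac_defect 1 a b v = 0" if "kac_defect 1 b a v = 0" "a \<in> even_gens" "b \<in> even_gens" for a b
    using kac_defect_swap[OF par[OF that(3)] par[OF that(2)], of v] that(1) by (simp add: ksign_def)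
  have swD: "kac_defect (- 1) a b v = 0" if "kac_defect (- 1) b a v = 0" "a \<in> odd_gens" "b \<in> odd_gens" for a b
    using kac_defect_swap[OF par1[OF that(3)] par1[OF that(2)], of v] that(1) by (simp add: ksign_def)
  have ev: "a \<in> even_gens \<Longrightarrow> b \<in> even_gens \<Longrightarrow> kac_defect 1 a b v = 0" for a b
    by (elim insertE emptyE; hypsubst; (rule E | (rule swE, rule E, simp, simp)))
  have od: "a \<in> odd_gens \<Longrightarrow> b \<in> odd_gens \<Longrightarrow> kac_defect (- 1) a b v = 0" for a b
    by (elim insertE emptyE; hypsubst; (rule D | (rule swD, rule D, simp, simp)))
  have mi: "a \<in> even_gens \<Longrightarrow> b \<in> odd_gens \<Longrightarrow> kac_defect 1 a b v = 0" for a b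
    by (elim insertE emptyE; hypsubst; (rule kac_defect_basis_zero, rule kac_defect_mixed[OF n]))
  have mi': "kac_defect 1 b a v = 0" if "a \<in> even_gens" "b \<in> odd_gens" for a b
    using kac_defect_swap[OF par[OF that(1)] par1[OF that(2)], of v] mi[OF that] by (simp add: ksign_def)
  show ?thesis
  proof (cases i; cases j)
    assume "i = 0" "j = 0"
    then show ?thesis using ext[OF hcomp_gens(1) hcomp_gens(1) ev] by (simp add: ksign_def)
  next
    assume "i = 0" "j = 1"
    then show ?thesis using ext[OF hcomp_gens(1) hcomp_gens(2) mi] by (simp add: ksign_def)
  next
    assume "i = 1" "j = 0"
    then show ?thesis using ext[OF hcomp_gens(2) hcomp_gens(1) mi'] by (simp add: ksign_def)
  next
    assume "i = 1" "j = 1"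
    then show ?thesis using ext[OF hcomp_gens(2) hcomp_gens(2) od] by (simp add: ksign_def)
  qed
qed

definition kac_index :: "(kac_kind \<times> nat) set" where
  "kac_index = {KP} \<times> {..n} \<union> {KA, KB} \<times> {..<n} \<union> {KS} \<times> {..<n - 1}"

lemma card_kac_index: "n > 0 \<Longrightarrow> card kac_index = kac_dim n"
proof -
  assume "n > 0"
  have "card kac_index = card ({KP} \<times> {..n} \<union> {KA, KB} \<times> {..<n}) + card ({KS} \<times> {..<n - 1})"
    unfolding kac_index_def by (rule card_Un_disjoint) auto
  also have "card ({KP} \<times> {..n} \<union> {KA, KB} \<times> {..<n}) = card ({KP} \<times> {..n}) + card ({KA, KB} \<times> {..<n})"
    by (rule card_Un_disjoint) auto
  finally show ?thesis using \<open>n > 0\<close> by (simp add: card_cartesian_product kac_dim_def)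
qed

text \<open>The tails of the strings, which form a submodule because the operators that lead back from them have zero coefficients where
a string is cut off.\<close>

definition kac_null :: "kac_vector set" where
  "kac_null = {v. \<forall>b\<in>kac_index. Poly_Mapping.lookup v b = 0}"

lemma kac_null_subspace: "cvs.subspace kac_null"
  by (auto simp: cvs.subspace_def kac_null_def lookup_add lookup_scaleC scaleC_complex_def)

lemma scaled_null: "a = 0 \<or> (c, i) \<notin> kac_index \<Longrightarrow> a *\<^sub>C kv c i \<in> kac_null"
  by (auto simp: kac_null_def lookup_scaleC lookup_single when_def)

lemma kac_index_iff:
  "(KP, i) \<in> kac_index \<longleftrightarrow> i \<le> n" "(KA, i) \<in> kac_index \<longleftrightarrow> i < n"
  "(KB, i) \<in> kac_index \<longleftrightarrow> i < n" "(KS, i) \<in> kac_index \<longleftrightarrow> i < n - 1"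
  by (auto simp: kac_index_def)

lemma kac_gens_null:
  assumes b: "b \<notin> kac_index" and n: "n > 0"
  shows "kac_h1 b \<in> kac_null" "kac_h2 b \<in> kac_null" "kac_x2 b \<in> kac_null" "kac_x3 b \<in> kac_null"
    "kac_y1 b \<in> kac_null" "kac_x1 b \<in> kac_null" "kac_y2 b \<in> kac_null" "kac_y3 b \<in> kac_null"
proof -
  note ops = cvs.subspace_add[OF kac_null_subspace] cvs.subspace_diff[OF kac_null_subspace]
    cvs.subspace_0[OF kac_null_subspace]
  obtain c i where c: "b = (c, i)" by (cases b)
  have kv: "kv c' i' \<in> kac_null" if "(c', i') \<notin> kac_index" for c' i'
    using scaled_null[of 1 c' i'] that by (simp add: scaleC_one)
  have nz: "(of_nat n :: complex) \<noteq> 0" using n by simp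
  have edge: "i = n \<Longrightarrow> (k - of_nat n + of_nat i * (1 - k / of_nat n)) = 0"
     "i = n \<Longrightarrow> k - of_nat i * k / of_nat n = 0"
    using nz by (simp_all add: field_simps)
  have edge': "i = n - 1 \<Longrightarrow> of_nat n - 1 - of_nat i = (0 :: complex)"
    "i = n - 1 \<Longrightarrow> of_nat n - of_nat i - 1 = (0 :: complex)"
    using n by (simp_all add: of_nat_diff)
  have sc: "a = 0 \<Longrightarrow> a *\<^sub>C v \<in> kac_null" for a :: complex and v by (simp add: ops)
  have trich: "i < n \<Longrightarrow> i < n - 1 \<or> i = n - 1" by auto
  show "kac_h1 b \<in> kac_null" "kac_h2 b \<in> kac_null"
    using b unfolding c by (cases c; simp; intro scaled_null; simp)+
  show "kac_x1 b \<in> kac_null"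
  proof (cases c)
    case KP
    then show ?thesis using b unfolding c KP kac_x1.simps by (intro kv) (auto simp: kac_index_iff)
  next
    case KA
    then show ?thesis unfolding c KA kac_x1.simps by (simp only: ops)
  next
    case KB
    then have "n \<le> i" using b c by (auto simp: kac_index_iff)
    then show ?thesis unfolding c KB kac_x1.simps
      by (intro ops(2) scaled_null disjI2) (auto simp: kac_index_iff)
  next
    case KS
    then have "n - 1 \<le> i" using b c by (auto simp: kac_index_iff)
    then show ?thesis unfolding c KS kac_x1.simps
      by (intro scaled_null disjI2) (auto simp: kac_index_iff)
  qed
  show "kac_y2 b \<in> kac_null"
    using b unfolding c kac_y2.simps by (intro kv, cases c) (auto simp: kac_index_iff)
  show "kac_y3 b \<in> kac_null"
  proof (cases c)
    case KP
    then show ?thesis using b unfolding c KP kac_y3.simps by (intro kv) (auto simp: kac_index_iff)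
  next
    case KA
    then have "n \<le> i" using b c by (auto simp: kac_index_iff)
    then show ?thesis unfolding c KA kac_y3.simps
      by (intro ops(1) scaled_null disjI2) (auto simp: kac_index_iff)
  next
    case KB
    then show ?thesis unfolding c KB kac_y3.simps by (simp only: ops)
  next
    case KS
    then have "n - 1 \<le> i" using b c by (auto simp: kac_index_iff)
    then show ?thesis unfolding c KS kac_y3.simps
      by (intro scaled_null disjI2) (auto simp: kac_index_iff)
  qed
  show "kac_x2 b \<in> kac_null"
  proof (cases c)
    case KP
    then have "i = Suc n \<or> Suc n < i" using b c by (auto simp: kac_index_iff)
    then show ?thesis unfolding c KP kac_x2.simps by (intro scaled_null) (auto simp: kac_index_iff)
  next
    case KA
    then have "i = n \<or> n < i" using b c by (auto simp: kac_index_iff)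
    then show ?thesis unfolding c KA kac_x2.simps by (intro scaled_null) (auto simp: kac_index_iff)
  next
    case KB
    then have "i = n \<or> n < i" using b c by (auto simp: kac_index_iff)
    then show ?thesis unfolding c KB kac_x2.simps by (intro scaled_null) (auto simp: kac_index_iff)
  next
    case KS
    then have "i = n - 1 \<or> n \<le> i" using b c by (auto simp: kac_index_iff)
    then show ?thesis unfolding c KS kac_x2.simps using edge'(2)
      by (intro scaled_null) (auto simp: kac_index_iff)
  qed
  show "kac_x3 b \<in> kac_null"
  proof (cases c)
    case KP
    then show ?thesis using b unfolding c KP kac_x3.simps by (intro scaled_null) (auto simp: kac_index_iff)
  next
    case KA
    then show ?thesis unfolding c KA kac_x3.simps by (simp add: ops)
  next
    case KB
    then have i: "n \<le> i" using b c by (auto simp: kac_index_iff)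
    then have "(k - of_nat n + of_nat i * (1 - k / of_nat n)) = 0 \<or> n < i" using edge(1) by (cases "i = n") auto
    then show ?thesis using i unfolding c KB kac_x3.simps
      by (intro ops scaled_null) (auto simp: kac_index_iff)
  next
    case KS
    then have "i = n - 1 \<or> n \<le> i" using b c by (auto simp: kac_index_iff)
    then show ?thesis unfolding c KS kac_x3.simps using edge'(1)
      by (intro scaled_null) (auto simp: kac_index_iff)
  qed
  show "kac_y1 b \<in> kac_null"
  proof (cases c)
    case KP
    then show ?thesis using b unfolding c KP kac_y1.simps by (intro scaled_null) (auto simp: kac_index_iff)
  next
    case KA
    then have i: "n \<le> i" using b c by (auto simp: kac_index_iff)
    then have "k - of_nat i * k / of_nat n = 0 \<or> n < i" using edge(2) by (cases "i = n") auto
    then show ?thesis using i unfolding c KA kac_y1.simps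
      by (intro ops scaled_null) (auto simp: kac_index_iff)
  next
    case KB
    then show ?thesis unfolding c KB kac_y1.simps by (simp add: ops)
  next
    case KS
    then have "i = n - 1 \<or> n \<le> i" using b c by (auto simp: kac_index_iff)
    then show ?thesis unfolding c KS kac_y1.simps using edge'(1)
      by (intro scaled_null) (auto simp: kac_index_iff)
  qed
qed

lemma kac_op_null: "n > 0 \<Longrightarrow> v \<in> kac_null \<Longrightarrow> kac_op g v \<in> kac_null"
  unfolding kac_op_def linext_def
  by (rule cvs.subspace_sum[OF kac_null_subspace], rule cvs.subspace_scale[OF kac_null_subspace],
      intro cvs.subspace_add[OF kac_null_subspace] cvs.subspace_scale[OF kac_null_subspace] kac_gens_null)
    (auto simp: kac_null_def in_keys_iff)

lemma kac_rep: "n > 0 \<Longrightarrow> rep_mod kac_op UNIV kac_null"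
  by unfold_locales
    (use kac_op_bracket kac_op_null kac_null_subspace cvs.subspace_0[OF kac_null_subspace] in
      \<open>auto simp: clin_kac_op kac_op_add kac_op_scaleC kac_defect_def\<close>)

lemma kac_op_null_relators:
  assumes n: "n > 0" and s: "s \<in> kac_relators (k, of_nat n)"
  shows "rep_mod.uact kac_op s (kv KP 0) \<in> kac_null"
proof -
  interpret rep_mod kac_op UNIV kac_null by (rule kac_rep[OF n])
  note sub = kac_null_subspace
  have of: "uact (uea_of g) v \<in> kac_null \<longleftrightarrow> kac_op g v \<in> kac_null" for g v
    using uact_of[of v g] cvs.subspace_add[OF sub, of "uact (uea_of g) v - kac_op g v" "kac_op g v"]
      cvs.subspace_diff[OF sub, of "uact (uea_of g) v" "uact (uea_of g) v - kac_op g v"] by auto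
  consider (a) g where "g \<in> nplus" "s = uea_of g"
    | (b) a c where "s = uea_of (a *\<^sub>C h1 + c *\<^sub>C h2) - (a * k + c * of_nat n) *\<^sub>C 1"
    | (c) "s = uea_of y2 ^ (n + 1)"
    using s by (auto simp: kac_relators_def)
  then show ?thesis
  proof cases
    case a
    have "clin (\<lambda>g. kac_op g (kv KP 0))" by (simp add: clin_def kac_op_add kac_op_scaleC)
    with a(1)[unfolded nplus_def] have "kac_op g (kv KP 0) \<in> kac_null"
      using sub by (rule cspan_induct_clin) (auto simp: kac_op_gens cvs.subspace_0[OF sub])
    then show ?thesis by (simp add: a(2) of)
  next
    case b
    let ?h = "a *\<^sub>C h1 + c *\<^sub>C h2" and ?v = "kv KP 0" and ?m = "a * k + c * of_nat n"
    have h: "kac_op ?h ?v = ?m *\<^sub>C ?v"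
      by (simp add: kac_op_add kac_op_scaleC kac_op_gens scaleC_scaleC scaleC_left_distrib)
    have 1: "uact s ?v - (uact (uea_of ?h) ?v - uact (?m *\<^sub>C 1) ?v) \<in> kac_null"
      unfolding b by (rule uact_diff) simp
    have 2: "uact (uea_of ?h) ?v - ?m *\<^sub>C ?v \<in> kac_null" using uact_of[of ?v ?h] h by simp
    have 3: "uact (?m *\<^sub>C 1) ?v - ?m *\<^sub>C uact 1 ?v \<in> kac_null" by (rule uact_scaleC) simp
    have 4: "?m *\<^sub>C (uact 1 ?v - ?v) \<in> kac_null" by (intro cvs.subspace_scale[OF sub] uact_one) simp
    from cvs.subspace_add[OF sub 1 cvs.subspace_diff[OF sub 2 cvs.subspace_add[OF sub 3 4]]]
    show ?thesis by (simp add: cvs.scale_right_diff_distrib)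
  next
    case c
    have "uact (uea_of y2 ^ j) (kv KP 0) - kv KP j \<in> kac_null" for j
    proof (induction j)
      case 0
      then show ?case using uact_one by simp
    next
      case (Suc j)
      have "kac_op y2 (uact (uea_of y2 ^ j) (kv KP 0) - kv KP j) \<in> kac_null"
        by (rule kac_op_null[OF n Suc])
      then have "kac_op y2 (uact (uea_of y2 ^ j) (kv KP 0)) - kv KP (Suc j) \<in> kac_null"
        by (simp add: kac_op_lin kac_op_gens)
      from cvs.subspace_add[OF sub uact_of_mult[of "kv KP 0" y2 "uea_of y2 ^ j"] this]
      show ?case by simp
    qed
    from cvs.subspace_add[OF sub this[of "n + 1"], of "kv KP (n + 1)"]
    show ?thesis using scaled_null[of 1 KP "n + 1"] by (simp add: c kac_index_iff scaleC_one)
  qed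
qed

end

text \<open>A dual family: vectors of the Kac module together with linear functionals on the enveloping algebra that vanish on its defining left
ideal. In this form the independence of the vectors can be multiplied over tensor slots.\<close>

lemma kac_coordinates:
  assumes nk: "n = 0 \<Longrightarrow> k = 0"
  shows "\<exists>I (\<phi> :: sl12 uea \<Rightarrow> kac_kind \<times> nat \<Rightarrow> complex) e. finite I \<and> card I = kac_dim n \<and>
     (\<forall>b\<in>I. clin (\<lambda>u. \<phi> u b) \<and> (\<forall>u\<in>left_ideal (kac_relators (k, of_nat n)). \<phi> u b = 0)) \<and>
     (\<forall>a\<in>I. \<forall>b\<in>I. \<phi> (e a) b = (if a = b then 1 else 0))"
proof (cases "n = 0")
  case True
  interpret rep_mod "\<lambda>_ _. 0 :: kac_vector" UNIV "{0}" for g :: sl12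
    by unfold_locales (auto simp: clin_def cvs.subspace_def)
  let ?v = "kv KP 0"
  have ex: "uact (u + u') ?v = uact u ?v + uact u' ?v" "uact (c *\<^sub>C u) ?v = c *\<^sub>C uact u ?v"
    "uact (u * u') ?v = uact u (uact u' ?v)" "uact (uea_of g) v = 0" "uact 1 ?v = ?v" for u u' c g v
    using uact_add[of ?v u u'] uact_scaleC[of ?v c u] uact_mult[of ?v u u'] uact_of[of v g] uact_one[of ?v]
    by simp_all
  have rel: "uact s ?v = 0" if "s \<in> kac_relators (k, of_nat n)" for s
  proof -
    have d: "uact (u - c *\<^sub>C 1) ?v = uact u ?v - c *\<^sub>C ?v" for u c
      using ex(1)[of u "(- c) *\<^sub>C 1"] ex(2)[of "- c" 1] by (simp add: ex(5))
    have p: "uact (u ^ Suc 0) ?v = uact u ?v" for u by simp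
    show ?thesis using that True nk by (auto simp: kac_relators_def d ex(4))
  qed
  have "uact u ?v = 0" if "u \<in> left_ideal (kac_relators (k, of_nat n))" for u
  proof -
    have "uact u ?v \<in> {0}"
      using that unfolding left_ideal_def
      by (rule cspan_induct_clin[where f = "\<lambda>u. uact u ?v"])
        (auto simp: clin_def ex(1-3) rel cvs.subspace_def clin_zero[OF uact_clin])
    then show ?thesis by simp
  qed
  then show ?thesis
    by (intro exI[of _ "{(KP, 0)}"] exI[of _ "\<lambda>u b. Poly_Mapping.lookup (uact u ?v) b"] exI[of _ "\<lambda>_. 1"])
      (auto simp: True kac_dim_def clin_def ex lookup_add lookup_scaleC)
next
  case False
  then have n: "n > 0" by simp
  interpret rep_mod "kac_op k n" UNIV "kac_null n" by (rule kac_rep[OF n])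
  note sub = kac_null_subspace
  let ?v = "kv KP 0"
  define \<phi> where "\<phi> u b = Poly_Mapping.lookup (uact u ?v) b" for u b
  have null: "Poly_Mapping.lookup p b = Poly_Mapping.lookup p' b" if "p - p' \<in> kac_null n" "b \<in> kac_index n" for p p' b
    using that by (auto simp: kac_null_def lookup_minus)
  have lin: "clin (\<lambda>u. \<phi> u b)" if "b \<in> kac_index n" for b
    using null[OF uact_add that, of ?v] null[OF uact_scaleC that, of ?v]
    by (simp add: clin_def \<phi>_def lookup_add lookup_scaleC)
  have van: "\<phi> u b = 0" if "b \<in> kac_index n" "u \<in> left_ideal (kac_relators (k, of_nat n))" for u b
  proof -
    have "\<phi> u b \<in> {0}"
      using that(2) lin[OF that(1)] unfolding left_ideal_def
    proof (rule cspan_induct_clin)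
      fix c assume "c \<in> {u * s | u s. s \<in> kac_relators (k, of_nat n)}"
      then obtain u s where c: "c = u * s" and s: "s \<in> kac_relators (k, of_nat n)" by blast
      have "uact u (uact s ?v) \<in> kac_null n"
        by (rule uact_S[OF kac_op_null_relators[OF n s]])
      then show "\<phi> c b \<in> {0}"
        using null[OF uact_mult that(1), of ?v u s] that(1) by (simp add: \<phi>_def c kac_null_def)
    qed (simp add: cvs.subspace_def)
    then show ?thesis by simp
  qed
  have eqv: "uact (uea_of g * u) ?v - kac_op k n g p \<in> kac_null n" if "uact u ?v - p \<in> kac_null n" for g u p
    using cvs.subspace_add[OF sub uact_of_mult[of ?v g u] kac_op_null[OF n that, of k g]]
    by (simp add: clin_diff[OF clin_kac_op])
  have pow: "uact (uea_of y2 ^ i * u) ?v - kv c (i + j) \<in> kac_null n" if "uact u ?v - kv c j \<in> kac_null n" for i j u c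
  proof (induction i)
    case 0
    then show ?case using that by simp
  next
    case (Suc i)
    from eqv[OF this, of y2] show ?case by (simp add: kac_op_gens mult.assoc)
  qed
  have one: "uact 1 ?v - kv KP 0 \<in> kac_null n" using uact_one by simp
  have A: "uact (uea_of x1) ?v - kv KA 0 \<in> kac_null n" and B: "uact (uea_of y3) ?v - kv KB 0 \<in> kac_null n"
    using eqv[OF one, of x1] eqv[OF one, of y3] by (simp_all add: kac_op_gens)
  let ?s = "of_nat n *\<^sub>C (uea_of y3 * uea_of x1) - k *\<^sub>C uea_of y2"
  have S: "uact ?s ?v - kv KS 0 \<in> kac_null n"
  proof -
    have Y: "uact (uea_of y3 * uea_of x1) ?v - ((1 / of_nat n) *\<^sub>C kv KS 0 + (k / of_nat n) *\<^sub>C kv KP 1) \<in> kac_null n"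
      using eqv[OF A, of y3] by (simp add: kac_op_gens)
    have Z: "uact (uea_of y2) ?v - kv KP 1 \<in> kac_null n"
      using pow[OF one, of 1] by simp
    have "uact ?s ?v - (of_nat n *\<^sub>C uact (uea_of y3 * uea_of x1) ?v - k *\<^sub>C uact (uea_of y2) ?v) \<in> kac_null n"
      using cvs.subspace_add[OF sub uact_diff[of ?v "of_nat n *\<^sub>C (uea_of y3 * uea_of x1)" "k *\<^sub>C uea_of y2"]
          cvs.subspace_diff[OF sub uact_scaleC[of ?v "of_nat n" "uea_of y3 * uea_of x1"]
            uact_scaleC[of ?v k "uea_of y2"]]]
      by (simp add: algebra_simps)
    from cvs.subspace_add[OF sub this cvs.subspace_diff[OF sub
        cvs.subspace_scale[OF sub Y, of "of_nat n"] cvs.subspace_scale[OF sub Z, of k]]]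
    show ?thesis using n
      by (simp add: cvs.scale_right_diff_distrib scaleC_right_distrib scaleC_scaleC scaleC_one)
  qed
  define e where "e b = uea_of y2 ^ snd b * (case fst b of KP \<Rightarrow> 1 | KA \<Rightarrow> uea_of x1 | KB \<Rightarrow> uea_of y3 | KS \<Rightarrow> ?s)" for b
  have "uact (e b) ?v - kv (fst b) (snd b) \<in> kac_null n" for b
    using pow[OF one, of "snd b"] pow[OF A, of "snd b"] pow[OF B, of "snd b"] pow[OF S, of "snd b"]
    by (cases "fst b") (simp_all add: e_def)
  then have "\<phi> (e a) b = (if a = b then 1 else 0)" if "b \<in> kac_index n" for a b
    using null[OF _ that, of "uact (e a) ?v" "kv (fst a) (snd a)"] by (simp add: \<phi>_def lookup_single when_def)
  moreover have "finite (kac_index n)" by (simp add: kac_index_def)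
  ultimately show ?thesis
    using lin van card_kac_index[OF n]
    by (intro exI[of _ "kac_index n"] exI[of _ \<phi>] exI[of _ e]) auto
qed

section \<open>Parity and degree on the enveloping algebra\<close>

subsection \<open>Exact representations\<close>

locale rep =
  fixes A :: "'a::lie_superalgebra \<Rightarrow> 'v::complex_vector \<Rightarrow> 'v"
  assumes act_clin: "clin (A x)" and act_clin_left: "clin (\<lambda>x. A x v)"
    and act_bracket: "A (hcomp i x) (A (hcomp j y) v)
        = ksign (i * j) *\<^sub>C A (hcomp j y) (A (hcomp i x) v) + A (bracket (hcomp i x) (hcomp j y)) v"
begin

sublocale rep_mod A UNIV "{0}"
proof
  show "A (hcomp i x) (A (hcomp j y) v) - ksign (i * j) *\<^sub>C A (hcomp j y) (A (hcomp i x) v)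
      - A (bracket (hcomp i x) (hcomp j y)) v \<in> {0}" for i j x y v
    unfolding act_bracket[of i x j y v] by simp
qed (auto simp: act_clin clin_add[OF act_clin_left] clin_scale[OF act_clin_left]
    clin_zero[OF act_clin] cvs.subspace_def)

lemma uact_exact:
  "uact (u + u') v = uact u v + uact u' v" "uact (c *\<^sub>C u) v = c *\<^sub>C uact u v"
  "uact (u * u') v = uact u (uact u' v)" "uact (uea_of x) v = A x v" "uact 1 v = v"
  using uact_add[of v u u'] uact_scaleC[of v c u] uact_mult[of v u u'] uact_of[of v x] uact_one[of v]
  by simp_all

lemma clin_uact_left: "clin (\<lambda>u. uact u v)"
  by (simp add: clin_def uact_exact)

end

subsection \<open>The parity automorphism\<close>

definition par :: "'a::lie_superalgebra \<Rightarrow> 'a" where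
  "par x = hcomp 0 x - hcomp 1 x"

lemma clin_par: "clin (par :: 'a::lie_superalgebra \<Rightarrow> 'a)"
  by (simp add: clin_def par_def hcomp_add hcomp_scaleC cvs.scale_right_diff_distrib)

lemma par_hom: "hcomp i x = x \<Longrightarrow> par x = ksign i *\<^sub>C x"
  using hcomp_cross[of i x 0] hcomp_cross[of i x 1]
  by (cases i) (simp_all add: par_def ksign_def scaleC_one neg_one_scaleC)

lemma ksign_add: "ksign (i + j) = ksign i * ksign j"
  by (cases i; cases j) (simp_all add: ksign_def)

lemma ksign_sq: "ksign i * ksign i = 1"
  by (simp add: ksign_def)

interpretation parity: rep "\<lambda>x u. uea_of (par x) * (u :: 'a::lie_superalgebra uea)"
proof
  show "clin (\<lambda>u. uea_of (par x) * u)" for x :: 'a by (rule clin_uea_mult)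
  show "clin (\<lambda>x. uea_of (par x) * u)" for u :: "'a uea"
    by (rule clin_comp[OF clin_uea_mult(2) clin_comp[OF clin_uea_of clin_par]])
  fix i j and x y :: 'a and u :: "'a uea"
  have p: "par (hcomp i x) = ksign i *\<^sub>C hcomp i x" "par (hcomp j y) = ksign j *\<^sub>C hcomp j y"
    by (auto intro!: par_hom simp: hcomp_hcomp)
  have b: "par (bracket (hcomp i x) (hcomp j y)) = (ksign i * ksign j) *\<^sub>C bracket (hcomp i x) (hcomp j y)"
    using par_hom[OF bracket_parity[of i j x y]] unfolding ksign_add .
  show "uea_of (par (hcomp i x)) * (uea_of (par (hcomp j y)) * u) =
      ksign (i * j) *\<^sub>C (uea_of (par (hcomp j y)) * (uea_of (par (hcomp i x)) * u))
      + uea_of (par (bracket (hcomp i x) (hcomp j y))) * u"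
    unfolding p b uea_of_scaleC uea_scaleC_mult
    unfolding mult.assoc[symmetric] uea_of_bracket[of i x j y]
    by (simp add: distrib_right uea_scaleC_mult scaleC_scaleC scaleC_right_distrib mult_ac)
qed

text \<open>The automorphism that multiplies an element of parity \<open>i\<close> by \<open>(-1)\<^sup>i\<close>. It computes Koszul signs on
vectors that need not be homogeneous.\<close>

definition upar :: "'a::lie_superalgebra uea \<Rightarrow> 'a uea" where
  "upar u = parity.uact u 1"

lemma clin_upar: "clin (upar :: 'a::lie_superalgebra uea \<Rightarrow> 'a uea)"
  unfolding upar_def by (rule parity.clin_uact_left)

lemma upar_one: "upar 1 = 1" and upar_of_mult: "upar (uea_of x * u) = uea_of (par x) * upar u"
  by (simp_all add: upar_def parity.uact_exact)

lemma upar_mult: "upar (u * v) = upar u * upar (v :: 'a::lie_superalgebra uea)"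
proof -
  let ?S = "{u. upar (u * v) = upar u * upar v}"
  have "u \<in> ?S"
    by (rule uea_left_induct)
      (auto simp: cvs.subspace_def upar_one upar_of_mult mult.assoc clin_zero[OF clin_upar]
        clin_add[OF clin_upar] clin_scale[OF clin_upar] distrib_right uea_scaleC_mult)
  then show ?thesis by simp
qed

lemma upar_of: "upar (uea_of x) = uea_of (par x)"
  using upar_of_mult[of x 1] by (simp add: upar_one)

lemma upar_power: "upar (u ^ n) = upar (u :: 'a::lie_superalgebra uea) ^ n"
  by (induction n) (simp_all add: upar_one upar_mult)

lemma upar_hpart: "u \<in> uea_hpart b \<Longrightarrow> upar u = ksign b *\<^sub>C u"
proof -
  assume u: "u \<in> uea_hpart b"
  have "upar u - ksign b *\<^sub>C u \<in> {0}"
    using u unfolding uea_hpart_def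
  proof (rule cspan_induct_clin[where f = "\<lambda>u. upar u - ksign b *\<^sub>C u"])
    show "clin (\<lambda>u :: 'a uea. upar u - ksign b *\<^sub>C u)"
      by (simp add: clin_def clin_add[OF clin_upar] clin_scale[OF clin_upar] scaleC_right_distrib
          cvs.scale_right_diff_distrib scaleC_scaleC mult.commute)
    fix c :: "'a uea" assume "c \<in> {prod_list (map (\<lambda>(i, x). uea_of (hcomp i x)) w) | w. sum_list (map fst w) = b}"
    then obtain w where w: "c = prod_list (map (\<lambda>(i, x). uea_of (hcomp i x)) w)" "sum_list (map fst w) = b" by blast
    have "upar (prod_list (map (\<lambda>(i, x). uea_of (hcomp i x)) w))
        = ksign (sum_list (map fst w)) *\<^sub>C prod_list (map (\<lambda>(i, x :: 'a). uea_of (hcomp i x)) w)" for w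
    proof (induction w)
      case Nil
      then show ?case by (simp add: upar_one ksign_def scaleC_one)
    next
      case (Cons p w)
      obtain i x where p: "p = (i, x)" by (cases p)
      have "par (hcomp i x) = ksign i *\<^sub>C hcomp i x" by (rule par_hom) (simp add: hcomp_hcomp)
      moreover have "ksign (sum_list (map fst (p # w))) = ksign i * ksign (sum_list (map fst w))"
        unfolding p list.map sum_list.Cons fst_conv by (rule ksign_add)
      ultimately show ?case using Cons
        by (simp only: p list.map prod_list.Cons prod.case upar_of_mult uea_of_scaleC uea_scaleC_mult
            scaleC_scaleC mult.commute[of _ "ksign i"])
    qed
    then show "upar c - ksign b *\<^sub>C c \<in> {0}" using w by simp
  qed (simp add: cvs.subspace_def)
  then show ?thesis by simp
qed

lemma uea_hpart_subspace: "cvs.subspace (uea_hpart b)"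
  unfolding uea_hpart_def by (rule cvs.subspace_span)

lemma uea_hpart_mult:
  fixes x :: "'a::lie_superalgebra"
  shows "u \<in> uea_hpart b \<Longrightarrow> uea_of (hcomp i x) * u \<in> uea_hpart (i + b)"
  unfolding uea_hpart_def
proof (rule cspan_induct_clin[OF _ clin_uea_mult(1) cvs.subspace_span])
  fix c :: "'a uea" assume "c \<in> {prod_list (map (\<lambda>(i, x). uea_of (hcomp i x)) w) | w. sum_list (map fst w) = b}"
  then obtain w where w: "c = prod_list (map (\<lambda>(i, x). uea_of (hcomp i x)) w)" "sum_list (map fst w) = b" by blast
  then show "uea_of (hcomp i x) * c \<in> cspan {prod_list (map (\<lambda>(i, x). uea_of (hcomp i x)) w) | w.
      sum_list (map fst w) = i + b}"
    by (intro cvs.span_base CollectI exI[of _ "(i, x) # w"]) simp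
qed

lemma uea_hpart_one: "1 \<in> uea_hpart 0"
  unfolding uea_hpart_def by (intro cvs.span_base CollectI exI[of _ "[]"]) simp

lemma uea_hpart_decomp: "\<exists>u0\<in>uea_hpart 0. \<exists>u1\<in>uea_hpart 1. u = u0 + (u1 :: 'a::lie_superalgebra uea)"
proof -
  let ?S = "{u. \<exists>u0\<in>uea_hpart 0. \<exists>u1\<in>uea_hpart 1. u = u0 + (u1 :: 'a uea)}"
  have sub: "cvs.subspace ?S"
  proof (unfold cvs.subspace_def, intro conjI ballI allI)
    show "0 \<in> ?S" using cvs.subspace_0[OF uea_hpart_subspace] by force
  next
    fix u v :: "'a uea" assume "u \<in> ?S" "v \<in> ?S"
    then obtain u0 u1 v0 v1 where "u0 \<in> uea_hpart 0" "u1 \<in> uea_hpart 1" "u = u0 + u1"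
      "v0 \<in> uea_hpart 0" "v1 \<in> uea_hpart 1" "v = v0 + v1" by blast
    then show "u + v \<in> ?S"
      by (intro CollectI bexI[of _ "u0 + v0"] bexI[of _ "u1 + v1"])
        (auto intro: cvs.subspace_add[OF uea_hpart_subspace])
  next
    fix c and u :: "'a uea" assume "u \<in> ?S"
    then obtain u0 u1 where "u0 \<in> uea_hpart 0" "u1 \<in> uea_hpart 1" "u = u0 + u1" by blast
    then show "c *\<^sub>C u \<in> ?S"
      by (intro CollectI bexI[of _ "c *\<^sub>C u0"] bexI[of _ "c *\<^sub>C u1"])
        (auto intro: cvs.subspace_scale[OF uea_hpart_subspace] simp: scaleC_right_distrib)
  qed
  have step: "uea_of (hcomp i x) * u \<in> ?S" if "u \<in> ?S" for i x u
  proof -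
    obtain u0 u1 where u: "u0 \<in> uea_hpart 0" "u1 \<in> uea_hpart 1" "u = u0 + u1" using \<open>u \<in> ?S\<close> by blast
    have m: "uea_of (hcomp i x) * u0 \<in> uea_hpart (i + 0)" "uea_of (hcomp i x) * u1 \<in> uea_hpart (i + 1)"
      using uea_hpart_mult[OF u(1), of i x] uea_hpart_mult[OF u(2), of i x] by blast+
    show ?thesis
    proof (cases "i = 0")
      case True
      then show ?thesis using m by (force simp: u(3) distrib_left)
    next
      case False
      then have "i = 1" by (cases i) auto
      moreover have "(1 :: bit) + 1 = 0" by simp
      ultimately have "uea_of (hcomp i x) * u1 \<in> uea_hpart 0" "uea_of (hcomp i x) * u0 \<in> uea_hpart 1"
        using m by simp_all
      moreover have "uea_of (hcomp i x) * u = uea_of (hcomp i x) * u1 + uea_of (hcomp i x) * u0"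
        by (simp add: u(3) distrib_left add.commute)
      ultimately show ?thesis by blast
    qed
  qed
  have "u \<in> ?S"
  proof (rule uea_left_induct[OF sub])
    show "1 \<in> ?S" using uea_hpart_one cvs.subspace_0[OF uea_hpart_subspace] by force
    fix x and u :: "'a uea" assume "u \<in> ?S"
    have "uea_of x * u = uea_of (hcomp 0 x) * u + uea_of (hcomp 1 x) * u"
      by (simp add: hcomp_decomp flip: distrib_right uea_of_add)
    then show "uea_of x * u \<in> ?S"
      using cvs.subspace_add[OF sub step[OF \<open>u \<in> ?S\<close>] step[OF \<open>u \<in> ?S\<close>]] by simp
  qed
  then show ?thesis by simp
qed

subsection \<open>The grading by degree in \<open>t\<close>\<close>

text \<open>Letting \<open>x t\<^sup>k\<close> act on polynomial mappings by left multiplication and a shift by \<open>k\<close> is a representation. Applied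
to \<open>1\<close> in position \<open>0\<close>, it splits every element into its components.\<close>

definition graded_op :: "'a::lie_superalgebra poly \<Rightarrow> (nat \<Rightarrow>\<^sub>0 'a poly uea) \<Rightarrow> (nat \<Rightarrow>\<^sub>0 'a poly uea)" where
  "graded_op p P = (\<Sum>k\<le>degree p. shift_mult k (uea_of (monom (coeff p k) k)) P)"

lemma graded_op_bound:
  "degree p \<le> n \<Longrightarrow> graded_op p P = (\<Sum>k\<le>n. shift_mult k (uea_of (monom (coeff p k) k)) P)"
  unfolding graded_op_def
  by (rule sum.mono_neutral_left) (auto simp: coeff_eq_0 uea_of_zero shift_mult_zero)

lemma clin_graded_op_left: "clin (\<lambda>p. graded_op p P)"
proof (rule clinI)
  fix p q :: "'a poly" and c
  let ?n = "max (degree p) (degree q)"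
  have "graded_op (p + q) P = (\<Sum>k\<le>?n. shift_mult k (uea_of (monom (coeff (p + q) k) k)) P)"
    by (rule graded_op_bound) (rule degree_add_le, auto)
  also have "\<dots> = graded_op p P + graded_op q P"
    by (simp add: graded_op_bound[of p ?n] graded_op_bound[of q ?n] add_monom[symmetric] uea_of_add
        shift_mult_add sum.distrib)
  finally show "graded_op (p + q) P = graded_op p P + graded_op q P" .
  have "degree (c *\<^sub>C p) \<le> degree p"
    by (rule degree_le) (simp add: scaleC_poly.rep_eq coeff_eq_0)
  then have "graded_op (c *\<^sub>C p) P
      = (\<Sum>k\<le>degree p. shift_mult k (uea_of (monom (coeff (c *\<^sub>C p) k) k)) P)"
    by (rule graded_op_bound)
  then show "graded_op (c *\<^sub>C p) P = c *\<^sub>C graded_op p P"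
    by (simp add: graded_op_def[of p] scaleC_poly.rep_eq
        uea_of_scaleC shift_mult_scaleC cvs.scale_sum_right flip: scaleC_monom)
qed

lemma graded_op_monom: "graded_op (monom a n) P = shift_mult n (uea_of (monom a n)) P"
proof -
  have "graded_op (monom a n) P = (\<Sum>k\<le>n. shift_mult k (uea_of (monom (coeff (monom a n) k) k)) P)"
    by (rule graded_op_bound) (rule degree_monom_le)
  also have "\<dots> = (\<Sum>k\<le>n. if k = n then shift_mult n (uea_of (monom a n)) P else 0)"
    by (intro sum.cong) (auto simp: uea_of_zero shift_mult_zero)
  finally show ?thesis by simp
qed

interpretation grading: rep graded_op
proof
  show "clin (graded_op p)" for p :: "'a poly"
    unfolding graded_op_def by (rule clin_sum_fun) (rule clin_shift_mult)
  show "clin (\<lambda>p. graded_op p P)" for P :: "nat \<Rightarrow>\<^sub>0 'a poly uea"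
    by (rule clin_graded_op_left)
  note lin = clin_add[OF clin_graded_op_left]
  fix i j and x y :: "'a poly" and P :: "nat \<Rightarrow>\<^sub>0 'a poly uea"
  have linP: "graded_op p (P + Q) = graded_op p P + graded_op p Q" for p :: "'a poly" and P Q
    unfolding graded_op_def by (simp add: clin_add[OF clin_shift_mult] sum.distrib)
  show "graded_op (hcomp i x) (graded_op (hcomp j y) P) =
      ksign (i * j) *\<^sub>C graded_op (hcomp j y) (graded_op (hcomp i x) P)
      + graded_op (bracket (hcomp i x) (hcomp j y)) P"
  proof (induction x rule: poly_monom_induct)
    case (add p q)
    then show ?case by (simp add: hcomp_add lin linP bracket_add_left scaleC_right_distrib)
  next
    case (monom a m)
    show ?case
    proof (induction y rule: poly_monom_induct)
      case (add p q)
      then show ?case by (simp add: hcomp_add lin linP bracket_add_right scaleC_right_distrib)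
    next
      case (monom b n)
      have "uea_of (monom (hcomp i a) m) * uea_of (monom (hcomp j b) n)
          = ksign (i * j) *\<^sub>C (uea_of (monom (hcomp j b) n) * uea_of (monom (hcomp i a) m))
            + uea_of (monom (bracket (hcomp i a) (hcomp j b)) (m + n))"
        using uea_of_bracket[of i "monom a m" j "monom b n"] by (simp add: hcomp_monom bracket_monom)
      then show ?case
        by (simp add: hcomp_monom graded_op_monom bracket_monom shift_mult_comp shift_mult_add
            shift_mult_scaleC add.commute[of n m])
    qed
  qed
qed

definition deg_part :: "nat \<Rightarrow> 'a::lie_superalgebra poly uea \<Rightarrow> 'a poly uea" where
  "deg_part n u = Poly_Mapping.lookup (grading.uact u (Poly_Mapping.single 0 1)) n"

lemma clin_comp_uea: "clin (deg_part n)"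
  unfolding deg_part_def by (rule clin_comp[OF clin_lookup grading.clin_uact_left])

lemma comp_one: "deg_part n 1 = (if n = 0 then 1 else 0)"
  by (simp add: deg_part_def grading.uact_exact lookup_single when_def)

lemma comp_monom_mult: "deg_part n (uea_of (monom a m) * u) = (if m \<le> n then uea_of (monom a m) * deg_part (n - m) u else 0)"
  by (simp add: deg_part_def grading.uact_exact graded_op_monom lookup_shift_mult)

lemma comp_deg:
  assumes "u \<in> uea_deg d"
  shows "deg_part n u = (if n = d then u else (0 :: 'a::lie_superalgebra poly uea))"
proof -
  have "deg_part n u - (if n = d then 1 else 0) *\<^sub>C u \<in> {0}"
    using assms unfolding uea_deg_def
  proof (rule cspan_induct_clin[where f = "\<lambda>u. deg_part n u - (if n = d then 1 else 0) *\<^sub>C u"])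
    show "clin (\<lambda>u :: 'a poly uea. deg_part n u - (if n = d then 1 else 0) *\<^sub>C u)"
      by (simp add: clin_def clin_add[OF clin_comp_uea] clin_scale[OF clin_comp_uea] scaleC_one
          cvs.scale_right_diff_distrib)
    fix c :: "'a poly uea" assume "c \<in> {prod_list (map (\<lambda>(x, m). uea_of (monom x m)) w) | w. sum_list (map snd w) = d}"
    then obtain w :: "('a \<times> nat) list" where w: "c = prod_list (map (\<lambda>(x, m). uea_of (monom x m)) w)" "sum_list (map snd w) = d"
      by blast
    have "deg_part n (prod_list (map (\<lambda>(x, m). uea_of (monom x m)) w))
        = (if n = sum_list (map snd w) then prod_list (map (\<lambda>(x :: 'a, m). uea_of (monom x m)) w) else 0)" for w n
    proof (induction w arbitrary: n)
      case Nil
      then show ?case by (simp add: comp_one)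
    next
      case (Cons p w)
      then show ?case by (cases p) (auto simp: comp_monom_mult)
    qed
    then show "deg_part n c - (if n = d then 1 else 0) *\<^sub>C c \<in> {0}"
      using w by (simp add: scaleC_one)
  qed (simp add: cvs.subspace_def)
  then show ?thesis by (auto simp: scaleC_one split: if_splits)
qed

text \<open>Every element is the finite sum of its homogeneous components.\<close>

lemma comp_total:
  "\<exists>M. (\<forall>n>M. deg_part n u = 0) \<and> u = (\<Sum>n\<le>M. deg_part n u) \<and> (\<forall>n. deg_part n u \<in> uea_deg n)"
proof -
  let ?P = "\<lambda>u M. (\<forall>n>M. deg_part n u = 0) \<and> u = (\<Sum>n\<le>M. deg_part n u) \<and> (\<forall>n. deg_part n (u :: 'a poly uea) \<in> uea_deg n)"
  have ext: "?P u M'" if "?P u M" "M \<le> M'" for u M M'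
  proof -
    have "(\<Sum>n\<le>M'. deg_part n u) = (\<Sum>n\<le>M. deg_part n u)"
      using that by (intro sum.mono_neutral_right) auto
    then show ?thesis using that by auto
  qed
  have plus: "?P (u + v) (max M M')" if "?P u M" "?P v M'" for u v M M'
    using ext[OF that(1), of "max M M'"] ext[OF that(2), of "max M M'"]
    by (auto simp: clin_add[OF clin_comp_uea] sum.distrib cvs.subspace_add[OF uea_deg_subspace])
  have "u \<in> {u. \<exists>M. ?P u M}"
  proof (rule uea_left_induct)
    show "cvs.subspace {u. \<exists>M. ?P u M}"
    proof (unfold cvs.subspace_def, intro conjI ballI allI)
      show "0 \<in> {u. \<exists>M. ?P u M}"
        by (auto simp: clin_zero[OF clin_comp_uea] cvs.subspace_0[OF uea_deg_subspace])
      show "u + v \<in> {u. \<exists>M. ?P u M}" if "u \<in> {u. \<exists>M. ?P u M}" "v \<in> {u. \<exists>M. ?P u M}" for u v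
        using that plus by blast
      show "c *\<^sub>C u \<in> {u. \<exists>M. ?P u M}" if uu: "u \<in> {u. \<exists>M. ?P u M}" for c u
      proof -
        obtain M where M: "?P u M" using uu by blast
        then have s: "c *\<^sub>C u = (\<Sum>n\<le>M. c *\<^sub>C deg_part n u)" by (metis cvs.scale_sum_right)
        from M have "\<forall>n>M. deg_part n u = 0" "\<forall>n. deg_part n u \<in> uea_deg n" by blast+
        then have "?P (c *\<^sub>C u) M"
          unfolding clin_scale[OF clin_comp_uea]
          by (intro conjI s) (simp_all add: cvs.subspace_scale[OF uea_deg_subspace])
        then show ?thesis by blast
      qed
    qed
    show "1 \<in> {u. \<exists>M. ?P u M}"
      using uea_deg_one cvs.subspace_0[OF uea_deg_subspace] by (auto simp: comp_one intro!: exI[of _ 0])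
    fix p :: "'a poly" and u assume "u \<in> {u. \<exists>M. ?P u M}"
    then obtain M where M: "?P u M" by blast
    have mono: "?P (uea_of (monom a m) * u) (m + M)" for a m
    proof (intro conjI allI impI)
      show "deg_part n (uea_of (monom a m) * u) = 0" if "n > m + M" for n
        using M that by (simp add: comp_monom_mult)
      show "deg_part n (uea_of (monom a m) * u) \<in> uea_deg n" for n
        using M uea_deg_mult[of "deg_part (n - m) u" "n - m" a m] cvs.subspace_0[OF uea_deg_subspace]
        by (auto simp: comp_monom_mult)
      have "(\<Sum>n\<le>m + M. deg_part n (uea_of (monom a m) * u)) = (\<Sum>n\<in>{m..m + M}. uea_of (monom a m) * deg_part (n - m) u)"
        by (intro sum.mono_neutral_cong_right) (auto simp: comp_monom_mult)
      also have "\<dots> = (\<Sum>n\<le>M. uea_of (monom a m) * deg_part n u)"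
        by (rule sum.reindex_bij_witness[of _ "\<lambda>n. n + m" "\<lambda>n. n - m"]) auto
      also have "\<dots> = uea_of (monom a m) * u"
        using M by (simp flip: sum_distrib_left)
      finally show "uea_of (monom a m) * u = (\<Sum>n\<le>m + M. deg_part n (uea_of (monom a m) * u))" by simp
    qed
    have "\<exists>M. ?P (uea_of p * u) M"
    proof (induction p rule: poly_monom_induct)
      case (add p q)
      then obtain M1 M2 where "?P (uea_of p * u) M1" "?P (uea_of q * u) M2" by blast
      from plus[OF this] show ?case unfolding uea_of_add distrib_right by blast
    next
      case (monom a n)
      then show ?case using mono by blast
    qed
    then show "uea_of p * u \<in> {u. \<exists>M. ?P u M}" by blast
  qed
  then show ?thesis by simp
qed

lemma comp_in_deg: "deg_part n u \<in> uea_deg n"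
  using comp_total[of u] by blast

section \<open>Evaluation modules and dual families\<close>

subsection \<open>Evaluation at a point\<close>

definition peval :: "complex \<Rightarrow> 'a::lie_superalgebra poly \<Rightarrow> 'a" where
  "peval z p = (\<Sum>k\<le>degree p. z ^ k *\<^sub>C coeff p k)"

lemma peval_bound: "degree p \<le> n \<Longrightarrow> peval z p = (\<Sum>k\<le>n. z ^ k *\<^sub>C coeff p k)"
  unfolding peval_def by (rule sum.mono_neutral_left) (auto simp: coeff_eq_0)

lemma clin_peval: "clin (peval z :: 'a::lie_superalgebra poly \<Rightarrow> 'a)"
proof (rule clinI)
  fix p q :: "'a poly" and c
  let ?n = "max (degree p) (degree q)"
  have "peval z (p + q) = (\<Sum>k\<le>?n. z ^ k *\<^sub>C coeff (p + q) k)"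
    by (rule peval_bound) (rule degree_add_le, auto)
  then show "peval z (p + q) = peval z p + peval z q"
    by (simp add: peval_bound[of p ?n] peval_bound[of q ?n] scaleC_right_distrib sum.distrib)
  have "degree (c *\<^sub>C p) \<le> degree p"
    by (rule degree_le) (simp add: scaleC_poly.rep_eq coeff_eq_0)
  then have "peval z (c *\<^sub>C p) = (\<Sum>k\<le>degree p. z ^ k *\<^sub>C coeff (c *\<^sub>C p) k)"
    by (rule peval_bound)
  then show "peval z (c *\<^sub>C p) = c *\<^sub>C peval z p"
    by (simp add: peval_def[of z p] scaleC_poly.rep_eq cvs.scale_sum_right scaleC_scaleC mult.commute)
qed

lemmas peval_add = clin_add[OF clin_peval] and peval_zero = clin_zero[OF clin_peval]

lemma peval_monom: "peval z (monom a k) = z ^ k *\<^sub>C (a :: 'a::lie_superalgebra)"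
proof -
  have "peval z (monom a k) = (\<Sum>j\<le>k. z ^ j *\<^sub>C coeff (monom a k) j)"
    by (rule peval_bound) (rule degree_monom_le)
  also have "\<dots> = (\<Sum>j\<le>k. if j = k then z ^ k *\<^sub>C a else 0)"
    by (intro sum.cong) auto
  finally show ?thesis by simp
qed

lemma peval_hcomp: "peval z (hcomp i p) = hcomp i (peval z p)"
  by (induction p rule: poly_monom_induct) (simp_all add: hcomp_add peval_add hcomp_monom peval_monom hcomp_scaleC)

lemma peval_bracket: "peval z (bracket p q) = bracket (peval z p) (peval z q)"
proof (induction p rule: poly_monom_induct)
  case (monom a m)
  show ?case
  proof (induction q rule: poly_monom_induct)
    case (monom b n)
    then show ?case
      by (simp add: bracket_monom peval_monom bracket_scaleC_left bracket_scaleC_right scaleC_scaleC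
          power_add)
  qed (simp add: bracket_add_right peval_add)
qed (simp add: bracket_add_left peval_add)

text \<open>The element \<open>a \<otimes> f\<close>.\<close>

definition tmul :: "complex poly \<Rightarrow> 'a::lie_superalgebra \<Rightarrow> 'a poly" where
  "tmul f a = (\<Sum>k\<le>degree f. monom (coeff f k *\<^sub>C a) k)"

lemma peval_tmul: "peval z (tmul f a) = poly f z *\<^sub>C a"
  by (simp add: tmul_def clin_sum[OF clin_peval] peval_monom scaleC_scaleC poly_altdef mult.commute
      flip: cvs.scale_sum_left)

lemma hcomp_tmul: "hcomp b (tmul f a) = tmul f (hcomp b a)"
proof -
  have "clin (hcomp b :: 'a poly \<Rightarrow> 'a poly)" by (simp add: clin_def hcomp_add hcomp_scaleC)
  then show ?thesis by (simp add: tmul_def clin_sum hcomp_monom hcomp_scaleC)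
qed

subsection \<open>Quotients of the enveloping algebra by left ideals\<close>

definition cls :: "'a::lie_superalgebra uea set \<Rightarrow> 'a uea \<Rightarrow> 'a uea set" where
  "cls R u = left_ideal R +>\<^bsub>regular_smodule\<^esub> u"

lemma regular_param: "lin_param regular_smodule UNIV {0} (\<lambda>u. u)"
  by unfold_locales (auto simp: regular_smodule_def cvs.subspace_def)

lemma uea_quot_param: "lin_param (uea_quot R) UNIV (left_ideal R) (cls R)"
proof -
  interpret lin_param regular_smodule UNIV "{0}" "\<lambda>u. u" by (rule regular_param)
  show ?thesis
    using quotient[of "left_ideal R"] left_ideal_subspace[of R] cvs.subspace_0[OF left_ideal_subspace[of R]]
    by (simp add: cls_def[abs_def])
qed

lemma uea_quot_act: "act (uea_quot R) x (cls R u) = cls R (uea_of x * u)"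
proof -
  interpret lin_param regular_smodule UNIV "{0}" "\<lambda>u. u" by (rule regular_param)
  have "act regular_smodule x b = uea_of x * b" for b by (simp add: regular_smodule_def)
  then have "act (quot_smodule regular_smodule ((\<lambda>u. u) ` left_ideal R)) x ((\<lambda>u. u) ` left_ideal R +>\<^bsub>regular_smodule\<^esub> u)
      = (\<lambda>u. u) ` left_ideal R +>\<^bsub>regular_smodule\<^esub> (uea_of x * u)"
    by (intro quotient_act[of "left_ideal R" u "\<lambda>u. uea_of x * u" x])
      (simp_all add: left_ideal_subspace cvs.subspace_0[OF left_ideal_subspace[of R]] clin_uea_mult(1) left_ideal_mult)
  then show ?thesis by (simp only: image_ident cls_def)
qed

lemma eval_param: "lin_param M C S \<pi> \<Longrightarrow> lin_param (eval_smodule z M) C S \<pi>"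
  unfolding lin_param_def eval_smodule_def by simp

lemma eval_act: "act (eval_smodule z (uea_quot R)) p (cls R u) = cls R (uea_of (peval z p) * u)"
proof -
  interpret lin_param "uea_quot R" UNIV "left_ideal R" "cls R" by (rule uea_quot_param)
  have "act (eval_smodule z (uea_quot R)) p (cls R u)
      = (\<Oplus>\<^bsub>uea_quot R\<^esub>k\<in>{..degree p}. z ^ k \<odot>\<^bsub>uea_quot R\<^esub> cls R (uea_of (coeff p k) * u))"
    by (simp add: eval_smodule_def uea_quot_act)
  also have "\<dots> = cls R (\<Sum>k\<le>degree p. z ^ k *\<^sub>C (uea_of (coeff p k) * u))"
    by (rule finsum_cong') (simp_all add: smult)
  also have "(\<Sum>k\<le>degree p. z ^ k *\<^sub>C (uea_of (coeff p k) * u)) = uea_of (peval z p) * u"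
    by (simp add: peval_def uea_of_sum uea_of_scaleC uea_scaleC_mult sum_distrib_right)
  finally show ?thesis .
qed

definition kos :: "bit \<Rightarrow> 'a::lie_superalgebra uea \<Rightarrow> 'a uea" where
  "kos b u = (if b = 0 then u else upar u)"

lemma clin_kos: "clin (kos b)"
  using clin_upar by (auto simp: kos_def[abs_def] clin_def)

lemma upar_hsum: "u0 \<in> uea_hpart 0 \<Longrightarrow> u1 \<in> uea_hpart 1 \<Longrightarrow> kos b (u0 + u1) = u0 + ksign b *\<^sub>C u1"
  using upar_hpart[of u0 0] upar_hpart[of u1 1]
  by (auto simp: kos_def clin_add[OF clin_upar] ksign_def scaleC_one)

lemma upar_left_ideal:
  assumes "\<And>r. r \<in> R \<Longrightarrow> upar r \<in> left_ideal R" and "u \<in> left_ideal R"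
  shows "upar u \<in> left_ideal R"
  using assms(2) unfolding left_ideal_def[of R]
proof (rule cspan_induct_clin[OF _ clin_upar])
  show "cvs.subspace (cspan {u * s |u s. s \<in> R})" by (rule cvs.subspace_span)
  fix b assume "b \<in> {u * s |u s. s \<in> R}"
  then show "upar b \<in> cspan {u * s |u s. s \<in> R}"
    using assms(1) left_ideal_mult[of _ R] unfolding left_ideal_def[of R] by (auto simp: upar_mult)
qed

text \<open>The defining left ideal has to be stable under the parity automorphism: then two decompositions of a vector
into an even and an odd part differ by elements of the ideal.\<close>

lemma koszul_uea_quot:
  assumes R: "\<And>r. r \<in> R \<Longrightarrow> upar r \<in> left_ideal R"
  shows "koszul (eval_smodule z (uea_quot R)) b (cls R u) = cls R (kos b u)"
proof -
  interpret lin_param "uea_quot R" UNIV "left_ideal R" "cls R" by (rule uea_quot_param)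
  have h: "hpart (uea_quot R) c = cls R ` uea_hpart c" for c
    by (simp add: quot_smodule_def regular_smodule_def cls_def[abs_def])
  have kosR: "kos b d \<in> left_ideal R" if "d \<in> left_ideal R" for d
    using that upar_left_ideal[OF R] by (auto simp: kos_def)
  obtain u0 u1 where u: "u0 \<in> uea_hpart 0" "u1 \<in> uea_hpart 1" "u = u0 + u1"
    using uea_hpart_decomp[of u] by blast
  have "(THE w. \<exists>v0\<in>hpart (uea_quot R) 0. \<exists>v1\<in>hpart (uea_quot R) 1.
      cls R u = v0 \<oplus>\<^bsub>uea_quot R\<^esub> v1 \<and> w = v0 \<oplus>\<^bsub>uea_quot R\<^esub> (ksign b \<odot>\<^bsub>uea_quot R\<^esub> v1)) = cls R (kos b u)"
  proof (rule the_equality)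
    show "\<exists>v0\<in>hpart (uea_quot R) 0. \<exists>v1\<in>hpart (uea_quot R) 1. cls R u = v0 \<oplus>\<^bsub>uea_quot R\<^esub> v1
        \<and> cls R (kos b u) = v0 \<oplus>\<^bsub>uea_quot R\<^esub> (ksign b \<odot>\<^bsub>uea_quot R\<^esub> v1)"
      unfolding h using u by (intro bexI[of _ "cls R u0"] bexI[of _ "cls R u1"]) (simp_all add: add smult upar_hsum)
  next
    fix w assume "\<exists>v0\<in>hpart (uea_quot R) 0. \<exists>v1\<in>hpart (uea_quot R) 1. cls R u = v0 \<oplus>\<^bsub>uea_quot R\<^esub> v1
        \<and> w = v0 \<oplus>\<^bsub>uea_quot R\<^esub> (ksign b \<odot>\<^bsub>uea_quot R\<^esub> v1)"
    then obtain w0 w1 where w: "w0 \<in> uea_hpart 0" "w1 \<in> uea_hpart 1" "cls R u = cls R (w0 + w1)"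
        "w = cls R (w0 + ksign b *\<^sub>C w1)"
      unfolding h by (auto simp: add smult)
    have "u - (w0 + w1) \<in> left_ideal R" using w(3) by (simp add: eq)
    from kosR[OF this] have "kos b u - (w0 + ksign b *\<^sub>C w1) \<in> left_ideal R"
      using w(1,2) by (simp add: clin_diff[OF clin_kos] upar_hsum)
    then have "cls R (kos b u) = w" unfolding w(4) by (simp add: eq)
    then show "w = cls R (kos b u)" by simp
  qed
  then show ?thesis by (simp add: koszul_def eval_smodule_def)
qed

lemma kac_relators_upar: "r \<in> kac_relators mu \<Longrightarrow> upar r \<in> left_ideal (kac_relators mu)"
proof -
  assume "r \<in> kac_relators mu"
  then consider (n) a where "a \<in> nplus" "r = uea_of a"
    | (h) a b where "r = uea_of (a *\<^sub>C h1 + b *\<^sub>C h2) - (a * fst mu + b * snd mu) *\<^sub>C 1"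
    | (y) n where "of_nat n = snd mu" "r = uea_of y2 ^ (n + 1)"
    unfolding kac_relators_def by blast
  then show ?thesis
  proof cases
    case n
    have "par a \<in> nplus" unfolding par_def
      using cvs.span_diff[OF hcomp_nplus[OF n(1), of 0, unfolded nplus_def] hcomp_nplus[OF n(1), of 1, unfolded nplus_def]]
      unfolding nplus_def .
    then have "upar r \<in> kac_relators mu" by (auto simp: n(2) upar_of kac_relators_def)
    then show ?thesis by (rule left_ideal_base)
  next
    case h
    have "par (a *\<^sub>C h1 + b *\<^sub>C h2) = a *\<^sub>C h1 + b *\<^sub>C h2"
      using par_hom[of 0 "a *\<^sub>C h1 + b *\<^sub>C h2"]
      by (simp add: hcomp_add hcomp_scaleC sl12_parity ksign_def scaleC_one)
    then have "upar r = r"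
      by (simp add: h clin_diff[OF clin_upar] clin_scale[OF clin_upar] upar_one upar_of)
    then show ?thesis using \<open>r \<in> kac_relators mu\<close> by (simp add: left_ideal_base)
  next
    case y
    have "par y2 = y2"
      using par_hom[of 0 y2] by (simp add: sl12_parity ksign_def scaleC_one)
    then have "upar r = r" unfolding y(2) by (simp add: upar_mult upar_power upar_of)
    then show ?thesis using \<open>r \<in> kac_relators mu\<close> by (simp add: left_ideal_base)
  qed
qed

subsection \<open>Linear algebra\<close>

lemma independent_singles: "cvs.independent (range (\<lambda>i :: 'j. Poly_Mapping.single i (1 :: complex)))"
proof
  let ?S = "range (\<lambda>i :: 'j. Poly_Mapping.single i (1 :: complex))"
  assume "cvs.dependent ?S"
  then obtain a where "a \<in> ?S" "a \<in> cspan (?S - {a})"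
    unfolding cvs.dependent_def by blast
  then obtain i :: 'j where i: "Poly_Mapping.single i (1 :: complex) \<in> cspan (?S - {Poly_Mapping.single i 1})"
    by blast
  have "cspan (?S - {Poly_Mapping.single i 1}) \<subseteq> {p. Poly_Mapping.lookup p i = 0}"
    by (rule cvs.span_minimal)
      (auto simp: cvs.subspace_def lookup_add lookup_scaleC scaleC_complex_def lookup_single when_def)
  then show False using i by (auto simp: lookup_single)
qed

text \<open>The functionals map onto a space of dimension \<open>card J\<close>. A linear relation among the elements of \<open>F\<close> modulo
\<open>K\<close> would let fewer than \<open>card J\<close> vectors span that space.\<close>

lemma dual_independent:
  fixes F :: "'u::complex_vector set" and \<Psi> :: "'j \<Rightarrow> 'u \<Rightarrow> complex"
  assumes F: "finite F" "card F \<le> card J" and J: "finite J"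
    and K: "cvs.subspace K" and \<Psi>: "\<And>j. j \<in> J \<Longrightarrow> clin (\<Psi> j)" "\<And>j u. j \<in> J \<Longrightarrow> u \<in> K \<Longrightarrow> \<Psi> j u = 0"
    and E: "\<And>i j. i \<in> J \<Longrightarrow> j \<in> J \<Longrightarrow> \<Psi> j (E i) = (if i = j then 1 else 0)"
    and span: "\<And>u. u \<in> cspan (F \<union> K)"
    and c: "(\<Sum>f\<in>F. c f *\<^sub>C f) \<in> K" and f0: "f0 \<in> F"
  shows "c f0 = 0"
proof (rule ccontr)
  assume c0: "c f0 \<noteq> 0"
  let ?P = "\<lambda>u. \<Sum>j\<in>J. Poly_Mapping.single j (\<Psi> j u)"
  have P: "clin ?P"
    by (rule clin_sum_fun, rule clinI)
      (simp_all add: clin_add[OF \<Psi>(1)] clin_scale[OF \<Psi>(1)] single_add scaleC_single)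
  have PK: "?P u = 0" if "u \<in> K" for u
    by (rule sum.neutral) (simp add: \<Psi>(2)[OF _ that])
  let ?W = "cspan (?P ` (F - {f0}))"
  have "?P (\<Sum>f\<in>F. c f *\<^sub>C f) = (\<Sum>f\<in>F. c f *\<^sub>C ?P f)"
    by (simp only: clin_sum[OF P] clin_scale[OF P])
  also have "\<dots> = c f0 *\<^sub>C ?P f0 + (\<Sum>f\<in>F - {f0}. c f *\<^sub>C ?P f)"
    by (rule sum.remove[OF F(1) f0])
  finally have "c f0 *\<^sub>C ?P f0 = - (\<Sum>f\<in>F - {f0}. c f *\<^sub>C ?P f)"
    using PK[OF c] by (simp add: eq_neg_iff_add_eq_0)
  moreover have "- (\<Sum>f\<in>F - {f0}. c f *\<^sub>C ?P f) \<in> ?W"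
    by (intro cvs.span_neg cvs.span_sum cvs.span_scale cvs.span_base imageI)
  ultimately have "c f0 *\<^sub>C ?P f0 \<in> ?W" by (simp only:)
  then have "inverse (c f0) *\<^sub>C c f0 *\<^sub>C ?P f0 \<in> ?W" by (rule cvs.span_scale)
  then have Pf0: "?P f0 \<in> ?W" using c0 by (simp add: scaleC_scaleC scaleC_one)
  have all: "?P u \<in> ?W" for u
  proof (rule cspan_induct_clin[OF span P cvs.subspace_span])
    fix b assume "b \<in> F \<union> K"
    then show "?P b \<in> ?W"
      using Pf0 PK[of b] cvs.span_zero[of "?P ` (F - {f0})"] cvs.span_base[of "?P b" "?P ` (F - {f0})"] by (cases "b = f0") auto
  qed
  have PE: "?P (E i) = Poly_Mapping.single i 1" if "i \<in> J" for i
  proof -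
    have "?P (E i) = (\<Sum>j\<in>J. if j = i then Poly_Mapping.single i 1 else 0)"
      by (intro sum.cong) (auto simp: E[OF that])
    then show ?thesis using J that by simp
  qed
  have "Poly_Mapping.single i 1 \<in> ?W" if "i \<in> J" for i
    using all[of "E i"] unfolding PE[OF that] .
  then have "(\<lambda>i. Poly_Mapping.single i (1 :: complex)) ` J \<subseteq> ?W" by blast
  moreover have "cvs.independent ((\<lambda>i. Poly_Mapping.single i (1 :: complex)) ` J)"
    by (rule cvs.independent_mono[OF independent_singles]) auto
  ultimately have "card ((\<lambda>i. Poly_Mapping.single i (1 :: complex)) ` J) \<le> card (?P ` (F - {f0}))"
    using cvs.independent_span_bound[of "?P ` (F - {f0})"] F(1) by blast
  moreover have "card ((\<lambda>i. Poly_Mapping.single i (1 :: complex)) ` J) = card J"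
    by (rule card_image) (auto simp: inj_on_def poly_mapping_eq_iff fun_eq_iff lookup_single when_def split: if_splits)
  moreover have "card (?P ` (F - {f0})) < card F"
    using card_image_le[of "F - {f0}" ?P] card_Diff1_less[OF F(1) f0] F(1) by simp
  ultimately show False using F(2) by simp
qed

section \<open>Tensor products\<close>

subsection \<open>Modules with a typed parametrization\<close>

locale param_module = lin_param M C S \<pi> + rep_mod A C S
  for M :: "('a::lie_superalgebra, 'v) smodule" and C S :: "'e::complex_vector set"
    and \<pi> :: "'e \<Rightarrow> 'v" and A :: "'a \<Rightarrow> 'e \<Rightarrow> 'e" +
  assumes act_param: "v \<in> C \<Longrightarrow> act M x (\<pi> v) = \<pi> (A x v)"
begin

lemma foldr_act: "v \<in> C \<Longrightarrow> foldr A w v \<in> C \<and> foldr (act M) w (\<pi> v) = \<pi> (foldr A w v)"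
  by (induction w) (auto simp: act_param A_C)

lemma uea_act_param: "v \<in> C \<Longrightarrow> uea_act M u (\<pi> v) = \<pi> (uact u v)"
  unfolding uea_act_def Let_def uact_def free_act_def linext_def
  using foldr_act by (intro finsum_cong') (auto simp: smult C_ops)

end

subsection \<open>Tensor products\<close>

text \<open>Each factor is parametrized by the same typed vector space, with the action and the Koszul sign lifted to maps \<open>A k\<close> and \<open>\<kappa>\<close>
that satisfy the relations of the superalgebra exactly and not just modulo \<open>S k\<close>.\<close>

locale tensor_param =
  fixes Ms :: "('a::lie_superalgebra, 'v) smodule list" and S :: "nat \<Rightarrow> 'e::complex_vector set"
    and \<pi> :: "nat \<Rightarrow> 'e \<Rightarrow> 'v" and A :: "nat \<Rightarrow> 'a \<Rightarrow> 'e \<Rightarrow> 'e" and \<kappa> :: "bit \<Rightarrow> 'e \<Rightarrow> 'e"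
  assumes param: "k < length Ms \<Longrightarrow> lin_param (Ms ! k) UNIV (S k) (\<pi> k)"
    and act_slot: "k < length Ms \<Longrightarrow> act (Ms ! k) x (\<pi> k u) = \<pi> k (A k x u)"
    and koszul_slot: "k < length Ms \<Longrightarrow> koszul (Ms ! k) b (\<pi> k u) = \<pi> k (\<kappa> b u)"
    and A_lin: "clin (A k x)" "clin (\<lambda>x. A k x u)"
    and A_rel: "A k (hcomp i x) (A k (hcomp j y) u)
        = ksign (i * j) *\<^sub>C A k (hcomp j y) (A k (hcomp i x) u) + A k (bracket (hcomp i x) (hcomp j y)) u"
    and \<kappa>_lin: "clin (\<kappa> b)" and \<kappa>_0: "\<kappa> 0 u = u" and \<kappa>_add: "\<kappa> b (\<kappa> c u) = \<kappa> (b + c) u"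
    and \<kappa>_A: "\<kappa> c (A k (hcomp b x) u) = ksign (b * c) *\<^sub>C A k (hcomp b x) (\<kappa> c u)"
begin

abbreviation n where "n \<equiv> length Ms"

definition tuple :: "(nat \<Rightarrow> 'e) \<Rightarrow> 'v list" where "tuple us = map (\<lambda>k. \<pi> k (us k)) [0..<n]"
definition tens :: "(nat \<Rightarrow> 'e) \<Rightarrow> ('v list \<Rightarrow>\<^sub>0 complex)" where "tens us = Poly_Mapping.single (tuple us) 1"
definition null where "null = cspan (tensor_relators Ms)"
definition carr :: "('v list \<Rightarrow>\<^sub>0 complex) set" where "carr = {p. Poly_Mapping.keys p \<subseteq> tensor_tuples Ms}"

definition slots :: "bit \<Rightarrow> nat \<Rightarrow> 'a \<Rightarrow> (nat \<Rightarrow> 'e) \<Rightarrow> nat \<Rightarrow> 'e" where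
  "slots b i x us = (\<lambda>k. if k < i then \<kappa> b (us k) else if k = i then A i (hcomp b x) (us i) else us k)"

definition top :: "'a \<Rightarrow> ('v list \<Rightarrow>\<^sub>0 complex) \<Rightarrow> ('v list \<Rightarrow>\<^sub>0 complex)" where
  "top x = linext (tensor_tuple_act Ms x)"

lemma null_subspace: "cvs.subspace null"
  unfolding null_def by (rule cvs.subspace_span)

lemmas null_ops = cvs.subspace_add[OF null_subspace] cvs.subspace_diff[OF null_subspace]
  cvs.subspace_scale[OF null_subspace] cvs.subspace_neg[OF null_subspace] cvs.subspace_0[OF null_subspace]
lemmas null_sum = cvs.subspace_sum[OF null_subspace]

lemma tuple_update: "i < n \<Longrightarrow> (tuple us)[i := \<pi> i u] = tuple (us(i := u))"
  by (rule nth_equalityI) (auto simp: tuple_def nth_list_update)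

lemma tuple_in: "tuple us \<in> tensor_tuples Ms"
  using lin_param.carrier[OF param] by (auto simp: tensor_tuples_def tuple_def)

lemma tuple_surj: "vs \<in> tensor_tuples Ms \<Longrightarrow> \<exists>us. vs = tuple us"
proof -
  assume vs: "vs \<in> tensor_tuples Ms"
  then have "\<forall>k. k < n \<longrightarrow> (\<exists>u. vs ! k = \<pi> k u)"
    using lin_param.carrier[OF param] by (auto simp: tensor_tuples_def)
  then obtain us where "\<And>k. k < n \<Longrightarrow> vs ! k = \<pi> k (us k)" by metis
  then have "vs = tuple us" using vs by (intro nth_equalityI) (auto simp: tensor_tuples_def tuple_def)
  then show "\<exists>us. vs = tuple us" by blast
qed

lemma tens_cong: "(\<And>k. k < n \<Longrightarrow> us k - us' k \<in> S k) \<Longrightarrow> tens us = tens us'"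
  unfolding tens_def tuple_def using lin_param.eq[OF param] by (auto intro!: arg_cong2[of _ _ _ _ Poly_Mapping.single])

lemma tens_cong_slot: "u - w \<in> S i \<Longrightarrow> tens (us(i := u)) = tens (us(i := w))"
  using cvs.subspace_0[OF lin_param.S[OF param]] by (intro tens_cong) auto

lemma tens_add: "i < n \<Longrightarrow> tens (us(i := u + w)) - tens (us(i := u)) - tens (us(i := w)) \<in> null"
  and tens_scale: "i < n \<Longrightarrow> tens (us(i := c *\<^sub>C u)) - c *\<^sub>C tens (us(i := u)) \<in> null"
proof -
  assume i: "i < n"
  interpret lin_param "Ms ! i" UNIV "S i" "\<pi> i" by (rule param[OF i])
  have "tens (us(i := u + w)) - tens (us(i := u)) - tens (us(i := w)) \<in> tensor_relators Ms"
    unfolding tensor_relators_def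
    using i tuple_in by (intro UnI1 CollectI exI[of _ "tuple us"] exI[of _ i] exI[of _ "\<pi> i u"] exI[of _ "\<pi> i w"])
      (simp add: add carrier tuple_update tens_def)
  then show "tens (us(i := u + w)) - tens (us(i := u)) - tens (us(i := w)) \<in> null"
    unfolding null_def by (rule cvs.span_base)
  have "tens (us(i := c *\<^sub>C u)) - c *\<^sub>C tens (us(i := u)) \<in> tensor_relators Ms"
    unfolding tensor_relators_def
    using i tuple_in by (intro UnI2 CollectI exI[of _ "tuple us"] exI[of _ i] exI[of _ c] exI[of _ "\<pi> i u"])
      (simp add: smult carrier tuple_update tens_def)
  then show "tens (us(i := c *\<^sub>C u)) - c *\<^sub>C tens (us(i := u)) \<in> null"
    unfolding null_def by (rule cvs.span_base)
qed

lemma tens_zero: "i < n \<Longrightarrow> tens (us(i := 0)) \<in> null"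
  using tens_scale[of i us 0 0] by simp

lemma relators_induct:
  assumes "clin F" "cvs.subspace W"
    and "\<And>us i u w. i < n \<Longrightarrow> F (tens (us(i := u + w)) - tens (us(i := u)) - tens (us(i := w))) \<in> W"
    and "\<And>us i c u. i < n \<Longrightarrow> F (tens (us(i := c *\<^sub>C u)) - c *\<^sub>C tens (us(i := u))) \<in> W"
    and "p \<in> null"
  shows "F p \<in> W"
  using assms(5) unfolding null_def
proof (rule cspan_induct_clin[OF _ assms(1,2)])
  fix r assume "r \<in> tensor_relators Ms"
  then consider (plus) vs i x y where "vs \<in> tensor_tuples Ms" "i < n" "x \<in> carrier (Ms ! i)" "y \<in> carrier (Ms ! i)"
      "r = Poly_Mapping.single (vs[i := x \<oplus>\<^bsub>Ms ! i\<^esub> y]) 1 - Poly_Mapping.single (vs[i := x]) 1 - Poly_Mapping.single (vs[i := y]) 1"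
    | (scale) vs i c x where "vs \<in> tensor_tuples Ms" "i < n" "x \<in> carrier (Ms ! i)"
      "r = Poly_Mapping.single (vs[i := c \<odot>\<^bsub>Ms ! i\<^esub> x]) 1 - c *\<^sub>C Poly_Mapping.single (vs[i := x]) 1"
    unfolding tensor_relators_def by blast
  then show "F r \<in> W"
  proof cases
    case plus
    have \<pi>i_add: "\<pi> i u \<oplus>\<^bsub>Ms ! i\<^esub> \<pi> i w = \<pi> i (u + w)" for u w
      using lin_param.add[OF param[OF plus(2)]] by simp
    interpret lin_param "Ms ! i" UNIV "S i" "\<pi> i" by (rule param[OF plus(2)])
    obtain us u w where u: "vs = tuple us" "x = \<pi> i u" "y = \<pi> i w"
      using tuple_surj[OF plus(1)] plus(3,4) unfolding carrier by blast
    have "r = tens (us(i := u + w)) - tens (us(i := u)) - tens (us(i := w))"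
      unfolding plus(5) u using plus(2) by (simp add: \<pi>i_add tuple_update tens_def)
    then show ?thesis using assms(3)[OF plus(2)] by simp
  next
    case scale
    interpret lin_param "Ms ! i" UNIV "S i" "\<pi> i" by (rule param[OF scale(2)])
    obtain us u where u: "vs = tuple us" "x = \<pi> i u"
      using tuple_surj[OF scale(1)] scale(3) unfolding carrier by blast
    have "r = tens (us(i := c *\<^sub>C u)) - c *\<^sub>C tens (us(i := u))"
      unfolding scale(4) u using scale(2) by (simp add: smult tuple_update tens_def)
    then show ?thesis using assms(4)[OF scale(2)] by simp
  qed
qed

lemma carr_subspace: "cvs.subspace carr"
proof -
  have carr: "p \<in> carr \<longleftrightarrow> (\<forall>vs. vs \<notin> tensor_tuples Ms \<longrightarrow> Poly_Mapping.lookup p vs = 0)" for p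
    by (auto simp: carr_def in_keys_iff)
  show ?thesis unfolding cvs.subspace_def by (auto simp: carr lookup_add lookup_scaleC scaleC_complex_def)
qed

lemma tens_carr: "tens us \<in> carr"
  using tuple_in by (auto simp: carr_def tens_def)

lemma carr_induct:
  assumes "clin F" "cvs.subspace W" "\<And>us. F (tens us) \<in> W" "p \<in> carr"
  shows "F p \<in> W"
proof -
  have "F p = F (linext (\<lambda>k. Poly_Mapping.single k 1) p)" by (simp add: linext_basis)
  also have "\<dots> = (\<Sum>vs\<in>Poly_Mapping.keys p. Poly_Mapping.lookup p vs *\<^sub>C F (Poly_Mapping.single vs 1))"
    by (simp add: linext_def clin_sum[OF assms(1)] clin_scale[OF assms(1)])
  also have "\<dots> \<in> W"
  proof (rule cvs.subspace_sum[OF assms(2)], rule cvs.subspace_scale[OF assms(2)])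
    fix vs assume "vs \<in> Poly_Mapping.keys p"
    then obtain us where "vs = tuple us" using assms(4) tuple_surj by (auto simp: carr_def)
    then show "F (Poly_Mapping.single vs 1) \<in> W" using assms(3)[of us] by (simp add: tens_def)
  qed
  finally show ?thesis .
qed

lemma null_carr: "p \<in> null \<Longrightarrow> p \<in> carr"
  using relators_induct[of "\<lambda>p. p" carr p] carr_subspace
  by (auto simp: clin_def tens_carr cvs.subspace_diff cvs.subspace_scale)

lemma clin_top: "clin (top x)"
  unfolding top_def by (rule clin_linext)

lemma top_tens: "top x (tens us) = (\<Sum>b\<in>{0, 1}. \<Sum>i<n. tens (slots b i x us))"
proof -
  have "tensor_tuple_act Ms x (tuple us) = (\<Sum>b\<in>{0, 1}. \<Sum>i<n. tens (slots b i x us))"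
    unfolding tensor_tuple_act_def tens_def
  proof (intro sum.cong refl arg_cong2[of _ _ _ _ Poly_Mapping.single])
    fix b i assume "i \<in> {..<n}"
    then show "map (\<lambda>k. if k < i then koszul (Ms ! k) b (tuple us ! k)
        else if k = i then act (Ms ! i) (hcomp b x) (tuple us ! i) else tuple us ! k) [0..<n] = tuple (slots b i x us)"
      unfolding tuple_def slots_def by (intro nth_equalityI) (auto simp: act_slot koszul_slot)
  qed
  then show ?thesis by (simp add: top_def tens_def linext_single scaleC_one)
qed

text \<open>Acting in one slot is linear in the entry of every slot, so that the action preserves multilinearity.\<close>

lemma slots_update:
  "\<exists>f. clin f \<and> (\<forall>u. slots b i x (us(j := u)) = (slots b i x us)(j := f u))"
proof -
  let ?f = "if j < i then \<kappa> b else if j = i then A i (hcomp b x) else (\<lambda>u. u)"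
  have "clin ?f" using \<kappa>_lin A_lin by (auto simp: clin_def)
  moreover have "slots b i x (us(j := u)) = (slots b i x us)(j := ?f u)" for u
    by (auto simp: slots_def fun_eq_iff)
  ultimately show ?thesis by blast
qed

lemma top_null: "p \<in> null \<Longrightarrow> top x p \<in> null"
proof (rule relators_induct[OF clin_top null_subspace])
  fix us j u w assume j: "j < n"
  have "tens (slots b i x (us(j := u + w))) - tens (slots b i x (us(j := u))) - tens (slots b i x (us(j := w))) \<in> null" for b i
    using slots_update[of b i x us j] tens_add[OF j] by (auto simp: clin_add)
  then have "(\<Sum>b\<in>{0, 1}. \<Sum>i<n. tens (slots b i x (us(j := u + w))) - tens (slots b i x (us(j := u)))
      - tens (slots b i x (us(j := w)))) \<in> null"
    by (intro null_sum)
  then show "top x (tens (us(j := u + w)) - tens (us(j := u)) - tens (us(j := w))) \<in> null"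
    by (simp only: clin_diff[OF clin_top] top_tens sum_subtractf)
next
  fix us j c u assume j: "j < n"
  have "tens (slots b i x (us(j := c *\<^sub>C u))) - c *\<^sub>C tens (slots b i x (us(j := u))) \<in> null" for b i
    using slots_update[of b i x us j] tens_scale[OF j] by (auto simp: clin_scale)
  then have "(\<Sum>b\<in>{0, 1}. \<Sum>i<n. tens (slots b i x (us(j := c *\<^sub>C u))) - c *\<^sub>C tens (slots b i x (us(j := u)))) \<in> null"
    by (intro null_sum)
  then show "top x (tens (us(j := c *\<^sub>C u)) - c *\<^sub>C tens (us(j := u))) \<in> null"
    by (simp only: clin_diff[OF clin_top] clin_scale[OF clin_top] top_tens sum_subtractf cvs.scale_sum_right)
qed

lemma top_carr: "p \<in> carr \<Longrightarrow> top x p \<in> carr"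
  by (rule carr_induct[OF clin_top carr_subspace])
    (auto simp: top_tens intro!: cvs.subspace_sum[OF carr_subspace] cvs.subspace_add[OF carr_subspace] tens_carr)

lemma slots_self: "slots b i x us = (slots b i x us)(i := A i (hcomp b x) (us i))"
  by (auto simp: slots_def)

lemma slots_x: "slots b i (x :: 'a) us = (slots b i y us)(i := A i (hcomp b x) (us i))"
  by (auto simp: slots_def)

lemma top_hom: "top (hcomp b x) (tens us) - (\<Sum>i<n. tens (slots b i (hcomp b x) us)) \<in> null"
proof -
  have z: "tens (slots c i (hcomp b x) us) \<in> null" if "i < n" "c \<noteq> b" for c i
  proof -
    have "slots c i (hcomp b x) us = (slots c i (hcomp b x) us)(i := 0)"
      using that slots_self[of c i "hcomp b x" us] by (simp add: hcomp_hcomp clin_zero[OF A_lin(2)])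
    then show ?thesis using tens_zero[OF that(1)] by metis
  qed
  have "top (hcomp b x) (tens us) - (\<Sum>i<n. tens (slots b i (hcomp b x) us))
      = (\<Sum>i<n. tens (slots (b + 1) i (hcomp b x) us))"
    by (cases b) (simp_all add: top_tens)
  also have "\<dots> \<in> null" by (intro null_sum z) (cases b; simp)+
  finally show ?thesis .
qed

lemma slots_commute:
  assumes "i < n" "j < n" "i < j"
  shows "tens (slots c j (hcomp c y) (slots b i (hcomp b x) us))
     - ksign (b * c) *\<^sub>C tens (slots b i (hcomp b x) (slots c j (hcomp c y) us)) \<in> null"
proof -
  let ?G = "slots b i (hcomp b x) (slots c j (hcomp c y) us)"
  have "slots c j (hcomp c y) (slots b i (hcomp b x) us) = ?G(i := ksign (b * c) *\<^sub>C ?G i)"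
    using assms by (auto simp: slots_def fun_eq_iff hcomp_hcomp \<kappa>_A \<kappa>_add add.commute)
  then show ?thesis using tens_scale[OF assms(1), of ?G "ksign (b * c)" "?G i"] by simp
qed

text \<open>In the product of two actions the terms in different slots cancel against the terms in the other order, by the Koszul
signs; the terms in equal slots give the bracket in that slot.\<close>

lemma top_bracket:
  "top (hcomp b x) (top (hcomp c y) (tens us))
     - ksign (b * c) *\<^sub>C top (hcomp c y) (top (hcomp b x) (tens us))
     - top (bracket (hcomp b x) (hcomp c y)) (tens us) \<in> null"
proof -
  define X where "X = hcomp b x"
  define Y where "Y = hcomp c y"
  define B where "B = bracket X Y"
  have hX: "hcomp b X = X" and hY: "hcomp c Y = Y" 
    by (simp_all add: X_def Y_def hcomp_hcomp)
  have hB: "hcomp (b + c) B = B"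
    unfolding X_def Y_def B_def by (rule bracket_parity)
  have hom: "top Z (tens us) - (\<Sum>i<n. tens (slots d i Z us)) \<in> null" if "hcomp d Z = Z" for d Z us
    using top_hom[of d Z us] that by simp
  have two: "top Z (top Z' (tens us)) - (\<Sum>i<n. \<Sum>j<n. tens (slots d i Z (slots d' j Z' us))) \<in> null"
    if "hcomp d Z = Z" "hcomp d' Z' = Z'" for d d' Z Z'
  proof -
    have 1: "top Z (top Z' (tens us) - (\<Sum>j<n. tens (slots d' j Z' us))) \<in> null"
      by (intro top_null hom that)
    have 2: "(\<Sum>j<n. top Z (tens (slots d' j Z' us)) - (\<Sum>i<n. tens (slots d i Z (slots d' j Z' us)))) \<in> null"
      by (intro null_sum hom that)
    show ?thesis
      using null_ops(1)[OF 1 2] sum.swap[of "\<lambda>i j. tens (slots d i Z (slots d' j Z' us))" "{..<n}" "{..<n}"]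
      by (simp add: clin_diff[OF clin_top] clin_sum[OF clin_top] sum_subtractf)
  qed
  let ?s = "ksign (b * c)"
  have pair: "tens (slots b i X (slots c j Y us)) - ?s *\<^sub>C tens (slots c j Y (slots b i X us))
      - (if i = j then tens (slots (b + c) i B us) else 0) \<in> null" if ij: "i < n" "j < n" for i j
  proof (cases i j rule: linorder_cases)
    case less
    let ?P = "tens (slots b i X (slots c j Y us))" and ?Q = "tens (slots c j Y (slots b i X us))"
    have "(- ?s) *\<^sub>C (?Q - ?s *\<^sub>C ?P) \<in> null"
      using slots_commute[OF ij less, of c y b x us] by (intro null_ops(3)) (simp add: X_def Y_def)
    moreover have "(- ?s) *\<^sub>C (?Q - ?s *\<^sub>C ?P) = ?P - ?s *\<^sub>C ?Q"
      by (simp add: cvs.scale_right_diff_distrib scaleC_scaleC ksign_sq scaleC_one)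
    ultimately show ?thesis using less by simp
  next
    case greater
    then have "(if i = j then tens (slots (b + c) i B us) else 0) = 0" by simp
    with slots_commute[OF ij(2,1) greater, of b x c y us] show ?thesis
      unfolding X_def[symmetric] Y_def[symmetric] mult.commute[of c b] by simp
  next
    case equal
    let ?G = "\<lambda>k. if k < i then \<kappa> (b + c) (us k) else us k"
    have G: "slots b i X (slots c i Y us) = ?G(i := A i X (A i Y (us i)))"
      "slots c i Y (slots b i X us) = ?G(i := A i Y (A i X (us i)))"
      by (auto simp: slots_def fun_eq_iff hX hY \<kappa>_add add.commute)
    have G': "slots (b + c) i B us = ?G(i := A i B (us i))"
      unfolding slots_def hB by (rule ext) simp
    have rel: "A i X (A i Y (us i)) = ?s *\<^sub>C A i Y (A i X (us i)) + A i B (us i)"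
      using A_rel[of i b x c y "us i"] by (simp add: X_def Y_def B_def)
    have "tens (?G(i := A i X (A i Y (us i)))) - tens (?G(i := ?s *\<^sub>C A i Y (A i X (us i)))) - tens (?G(i := A i B (us i))) \<in> null"
      unfolding rel by (rule tens_add[OF ij(1)])
    from null_ops(1)[OF this tens_scale[OF ij(1), of ?G ?s "A i Y (A i X (us i))"]]
    show ?thesis unfolding equal[symmetric] G G' by (simp add: algebra_simps)
  qed
  have "(\<Sum>i<n. \<Sum>j<n. tens (slots b i X (slots c j Y us)) - ?s *\<^sub>C tens (slots c j Y (slots b i X us))
      - (if i = j then tens (slots (b + c) i B us) else 0)) \<in> null"
    by (intro null_sum pair) auto
  then have P: "(\<Sum>i<n. \<Sum>j<n. tens (slots b i X (slots c j Y us)))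
      - ?s *\<^sub>C (\<Sum>i<n. \<Sum>j<n. tens (slots c j Y (slots b i X us))) - (\<Sum>i<n. tens (slots (b + c) i B us)) \<in> null"
    by (simp add: sum_subtractf cvs.scale_sum_right)
  have sw: "(\<Sum>i<n. \<Sum>j<n. tens (slots c j Y (slots b i X us))) = (\<Sum>i<n. \<Sum>j<n. tens (slots c i Y (slots b j X us)))"
    by (rule sum.swap)
  have "(top X (top Y (tens us)) - (\<Sum>i<n. \<Sum>j<n. tens (slots b i X (slots c j Y us))))
      - ?s *\<^sub>C (top Y (top X (tens us)) - (\<Sum>i<n. \<Sum>j<n. tens (slots c i Y (slots b j X us))))
      - (top B (tens us) - (\<Sum>i<n. tens (slots (b + c) i B us))) \<in> null"
    by (intro null_ops(2,3) two hom hX hY hB)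
  from null_ops(1)[OF this P] show ?thesis
    unfolding X_def[symmetric] Y_def[symmetric] B_def[symmetric] sw
    by (simp add: cvs.scale_right_diff_distrib)
qed

lemma top_lin: "top (x + y) (tens us) - top x (tens us) - top y (tens us) \<in> null"
  "top (c *\<^sub>C x) (tens us) - c *\<^sub>C top x (tens us) \<in> null"
proof -
  have "tens (slots b i (x + y) us) - tens (slots b i x us) - tens (slots b i y us) \<in> null" if "i < n" for b i
  proof -
    have e: "slots b i (x + y) us = (slots b i x us)(i := A i (hcomp b x) (us i) + A i (hcomp b y) (us i))"
      using slots_x[of b i "x + y" us x] by (simp add: hcomp_add clin_add[OF A_lin(2)])
    show ?thesis
      using tens_add[OF that, of "slots b i x us" "A i (hcomp b x) (us i)" "A i (hcomp b y) (us i)"]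
      unfolding e[symmetric] slots_self[symmetric] slots_x[of b i y us x, symmetric] .
  qed
  then have "(\<Sum>b\<in>{0, 1}. \<Sum>i<n. tens (slots b i (x + y) us) - tens (slots b i x us) - tens (slots b i y us)) \<in> null"
    by (intro null_sum) auto
  then show "top (x + y) (tens us) - top x (tens us) - top y (tens us) \<in> null"
    by (simp only: top_tens sum_subtractf)
  have "tens (slots b i (c *\<^sub>C x) us) - c *\<^sub>C tens (slots b i x us) \<in> null" if "i < n" for b i
  proof -
    have e: "slots b i (c *\<^sub>C x) us = (slots b i x us)(i := c *\<^sub>C A i (hcomp b x) (us i))"
      using slots_x[of b i "c *\<^sub>C x" us x] by (simp add: hcomp_scaleC clin_scale[OF A_lin(2)])
    show ?thesis
      using tens_scale[OF that, of "slots b i x us" c "A i (hcomp b x) (us i)"]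
      unfolding e[symmetric] slots_self[symmetric] .
  qed
  then have "(\<Sum>b\<in>{0, 1}. \<Sum>i<n. tens (slots b i (c *\<^sub>C x) us) - c *\<^sub>C tens (slots b i x us)) \<in> null"
    by (intro null_sum) auto
  then show "top (c *\<^sub>C x) (tens us) - c *\<^sub>C top x (tens us) \<in> null"
    by (simp only: top_tens sum_subtractf cvs.scale_sum_right)
qed

abbreviation V where "V \<equiv> tensor_smodule Ms"
definition proj where "proj p = null +>\<^bsub>free_tensor Ms\<^esub> p"

lemma free_param: "lin_param (free_tensor Ms) carr {0} (\<lambda>p. p)"
proof unfold_locales
  show "cvs.subspace carr" by (rule carr_subspace)
qed (auto simp: carr_def free_tensor_def cvs.subspace_def)

sublocale V: param_module V carr null proj top
proof -
  interpret free: lin_param "free_tensor Ms" carr "{0}" "\<lambda>p. p" by (rule free_param)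
  have T: "cvs.subspace null" "{0} \<subseteq> null" "null \<subseteq> carr"
    using null_ops null_carr by (auto simp: null_subspace)
  have q: "lin_param V carr null proj"
    using free.quotient[OF T] by (simp add: tensor_smodule_def null_def proj_def[abs_def])
  have lin: "clin (\<lambda>p. top (x + y) p - top x p - top y p)" "clin (\<lambda>p. top (c *\<^sub>C x) p - c *\<^sub>C top x p)"
     "clin (\<lambda>p. top u (top v p) - s *\<^sub>C top v (top u p) - top t p)" for x y c u v s t
    by (auto simp: clin_def clin_add[OF clin_top] clin_scale[OF clin_top] scaleC_right_distrib
        cvs.scale_right_diff_distrib scaleC_scaleC mult.commute)
  show "param_module V carr null proj top"
  proof (intro param_module.intro q param_module_axioms.intro rep_mod.intro)
    show "top (x + y) p - top x p - top y p \<in> null" if "p \<in> carr" for x y p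
      by (rule carr_induct[OF lin(1) null_subspace top_lin(1) that])
    show "top (c *\<^sub>C x) p - c *\<^sub>C top x p \<in> null" if "p \<in> carr" for x c p
      by (rule carr_induct[OF lin(2) null_subspace top_lin(2) that])
    show "top (hcomp i x) (top (hcomp j y) p) - ksign (i * j) *\<^sub>C top (hcomp j y) (top (hcomp i x) p)
        - top (bracket (hcomp i x) (hcomp j y)) p \<in> null" if "p \<in> carr" for i x j y p
      by (rule carr_induct[OF lin(3) null_subspace top_bracket that])
    show "act V x (proj p) = proj (top x p)" if "p \<in> carr" for x p
    proof -
      have fa: "act (free_tensor Ms) x b = top x b" for b
        by (simp add: free_tensor_def top_def linext_def)
      show ?thesis
        using free.quotient_act[OF T that clin_top top_carr top_null fa]
        by (simp only: image_ident tensor_smodule_def null_def proj_def)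
    qed
  qed (simp_all only: clin_top carr_subspace null_subspace top_carr top_null)
qed

lemma pure_tensor_tens: "pure_tensor Ms (tuple us) = proj (tens us)"
  by (simp add: pure_tensor_def proj_def tens_def null_def)

lemma top_even: "hcomp 0 x = x \<Longrightarrow> top x (tens us) - (\<Sum>i<n. tens (us(i := A i x (us i)))) \<in> null"
proof -
  assume x: "hcomp 0 x = x"
  have "slots 0 i x us = us(i := A i x (us i))" for i
    by (auto simp: slots_def \<kappa>_0 x)
  then show ?thesis using top_hom[of 0 x us] by (simp add: x)
qed

end

section \<open>The associated graded module\<close>

subsection \<open>The filtration of the enveloping algebra by degree in \<open>t\<close>\<close>

definition uea_le :: "nat \<Rightarrow> 'a::lie_superalgebra poly uea set" where
  "uea_le n = {\<Sum>i\<le>n. u i | u. \<forall>i\<le>n. u i \<in> uea_deg i}"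

definition uea_lt :: "nat \<Rightarrow> 'a::lie_superalgebra poly uea set" where
  "uea_lt n = (case n of 0 \<Rightarrow> {0} | Suc k \<Rightarrow> uea_le k)"

lemma uea_le_subspace: "cvs.subspace (uea_le n :: 'a::lie_superalgebra poly uea set)"
proof (unfold cvs.subspace_def, intro conjI ballI allI)
  show "0 \<in> (uea_le n :: 'a poly uea set)"
    unfolding uea_le_def by (intro CollectI exI[of _ "\<lambda>_. 0"]) (simp add: cvs.subspace_0[OF uea_deg_subspace])
next
  fix x y :: "'a poly uea" assume "x \<in> uea_le n" "y \<in> (uea_le n :: 'a poly uea set)"
  then obtain u v where "\<forall>i\<le>n. u i \<in> uea_deg i" "x = (\<Sum>i\<le>n. u i)" "\<forall>i\<le>n. v i \<in> uea_deg i" "y = (\<Sum>i\<le>n. v i)"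
    unfolding uea_le_def by blast
  then show "x + y \<in> uea_le n" unfolding uea_le_def
    by (intro CollectI exI[of _ "\<lambda>i. u i + v i"]) (simp add: sum.distrib cvs.subspace_add[OF uea_deg_subspace])
next
  fix c and x assume "x \<in> (uea_le n :: 'a poly uea set)"
  then obtain u where "\<forall>i\<le>n. u i \<in> uea_deg i" "x = (\<Sum>i\<le>n. u i)"
    unfolding uea_le_def by blast
  then show "c *\<^sub>C x \<in> uea_le n" unfolding uea_le_def
    by (intro CollectI exI[of _ "\<lambda>i. c *\<^sub>C u i"]) (simp add: cvs.scale_sum_right cvs.subspace_scale[OF uea_deg_subspace])
qed

lemma uea_lt_subspace: "cvs.subspace (uea_lt n)"
  using uea_le_subspace by (cases n) (simp_all add: uea_lt_def cvs.subspace_def)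

lemma uea_le_split: "u \<in> uea_le n \<longleftrightarrow> (\<exists>a\<in>uea_deg n. u - a \<in> uea_lt n)"
proof
  assume "u \<in> uea_le n"
  then obtain v where v: "\<forall>i\<le>n. v i \<in> uea_deg i" "u = (\<Sum>i\<le>n. v i)" unfolding uea_le_def by blast
  have "u - v n \<in> uea_lt n"
  proof (cases n)
    case 0
    then show ?thesis using v by (simp add: uea_lt_def)
  next
    case (Suc k)
    have "\<forall>i\<le>k. v i \<in> uea_deg i" "u - v n = (\<Sum>i\<le>k. v i)" using v Suc by auto
    then show ?thesis unfolding Suc uea_lt_def uea_le_def by auto
  qed
  then show "\<exists>a\<in>uea_deg n. u - a \<in> uea_lt n" using v by blast
next
  assume "\<exists>a\<in>uea_deg n. u - a \<in> uea_lt n"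
  then obtain a where a: "a \<in> uea_deg n" "u - a \<in> uea_lt n" by blast
  show "u \<in> uea_le n"
  proof (cases n)
    case 0
    then have "u = a" using a by (simp add: uea_lt_def)
    then show ?thesis using a 0 unfolding uea_le_def by (intro CollectI exI[of _ "\<lambda>_. a"]) simp
  next
    case (Suc k)
    then obtain v where v: "\<forall>i\<le>k. v i \<in> uea_deg i" "u - a = (\<Sum>i\<le>k. v i)"
      using a(2) by (auto simp: uea_lt_def uea_le_def)
    have "u = (\<Sum>i\<le>n. (v(n := a)) i)" using v(2) Suc by (simp add: algebra_simps)
    then show ?thesis using v(1) a(1) Suc unfolding uea_le_def
      by (intro CollectI exI[of _ "v(n := a)"]) (auto simp: le_Suc_eq)
  qed
qed

lemma uea_deg_le: "u \<in> uea_deg n \<Longrightarrow> u \<in> uea_le n"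
  unfolding uea_le_split using cvs.subspace_0[OF uea_lt_subspace] by (intro bexI[of _ u]) auto

lemma uea_lt_le: "u \<in> uea_lt n \<Longrightarrow> u \<in> uea_le n"
  unfolding uea_le_split using cvs.subspace_0[OF uea_deg_subspace] by (intro bexI[of _ 0]) auto

lemma uea_le_lt: "m < n \<Longrightarrow> u \<in> uea_le m \<Longrightarrow> u \<in> uea_lt n"
proof (induction n)
  case (Suc n)
  then show ?case using uea_lt_le[of u n] by (cases "m = n") (auto simp: uea_lt_def)
qed simp

lemma uea_le_mult: "u \<in> uea_le n \<Longrightarrow> uea_of (monom a m) * u \<in> uea_le (m + n)"
  and uea_lt_mult: "u \<in> uea_lt n \<Longrightarrow> uea_of (monom (a :: 'a::lie_superalgebra) m) * u \<in> uea_lt (m + n)"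
proof (induction n arbitrary: u)
  case 0
  {
    case 1
    then have "u \<in> uea_deg 0" by (auto simp: uea_le_split[of u 0] uea_lt_def)
    then show ?case using uea_deg_le[OF uea_deg_mult[of u 0 a m]] by simp
  next
    case 2
    then show ?case using cvs.subspace_0[OF uea_lt_subspace] by (simp add: uea_lt_def[of 0])
  }
next
  case (Suc n)
  have lt: "uea_of (monom a m) * u \<in> uea_lt (m + Suc n)" if "u \<in> uea_lt (Suc n)" for u
    using Suc(1)[of u] that by (simp add: uea_lt_def)
  {
    case 1
    then obtain b where b: "b \<in> uea_deg (Suc n)" "u - b \<in> uea_lt (Suc n)" by (auto simp: uea_le_split)
    show ?case unfolding uea_le_split
      using lt[OF b(2)] uea_deg_mult[OF b(1), of a m]
      by (intro bexI[of _ "uea_of (monom a m) * b"]) (simp_all add: right_diff_distrib)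
  next
    case 2
    then show ?case by (rule lt)
  }
qed

lemma comp_poly_mult: "deg_part n (uea_of p * u) = (\<Sum>s\<le>n. uea_of (monom (coeff p s) s) * deg_part (n - s) u)"
proof (induction p rule: poly_monom_induct)
  case (add p q)
  then show ?case
    by (simp add: uea_of_add distrib_right clin_add[OF clin_comp_uea] sum.distrib flip: add_monom)
next
  case (monom a m)
  have "(\<Sum>s\<le>n. uea_of (monom (coeff (monom a m) s) s) * deg_part (n - s) u)
      = (\<Sum>s\<le>n. if s = m then uea_of (monom a m) * deg_part (n - m) u else 0)"
    by (intro sum.cong) (auto simp: uea_of_zero)
  then show ?case by (simp add: comp_monom_mult)
qed

subsection \<open>The associated graded module of a cyclic module\<close>

locale cyclic_param = param_module M C S \<pi> A
  for M :: "('a::lie_superalgebra poly, 'v) smodule" and C S :: "'e::complex_vector set" and \<pi> A +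
  fixes v0 :: 'e
  assumes v0: "v0 \<in> C"
begin

lemmas S_ops = cvs.subspace_0[OF S] cvs.subspace_add[OF S] cvs.subspace_diff[OF S] cvs.subspace_scale[OF S]

definition ann :: "'a poly uea set" where "ann = {u. uact u v0 \<in> S}"
text \<open>The annihilator of the cyclic vector of the associated graded module.\<close>

definition gann :: "'a poly uea set" where "gann = {u. \<forall>n. \<exists>w\<in>uea_lt n. deg_part n u - w \<in> ann}"
definition orbit :: "'a poly uea \<Rightarrow> 'v" where "orbit u = \<pi> (uact u v0)"

lemma orbit_lin:
  "uact (u + u') v0 - (uact u v0 + uact u' v0) \<in> S" "uact (c *\<^sub>C u) v0 - c *\<^sub>C uact u v0 \<in> S"
  "uact (uea_of x * u) v0 - A x (uact u v0) \<in> S"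
  by (auto intro: uact_add uact_scaleC uact_of_mult v0)

lemma ann_subspace: "cvs.subspace ann"
proof (unfold cvs.subspace_def, intro conjI ballI allI)
  show "0 \<in> ann" using orbit_lin(2)[of 0 0] by (simp add: ann_def)
next
  fix u u' assume "u \<in> ann" "u' \<in> ann"
  then show "u + u' \<in> ann"
    using S_ops(2)[OF orbit_lin(1)[of u u'], of "uact u v0 + uact u' v0"] S_ops(2)[of "uact u v0" "uact u' v0"]
    by (simp add: ann_def)
next
  fix c u assume "u \<in> ann"
  then show "c *\<^sub>C u \<in> ann"
    using S_ops(2)[OF orbit_lin(2)[of c u], of "c *\<^sub>C uact u v0"] S_ops(4)[of "uact u v0" c]
    by (simp add: ann_def)
qed

lemma ann_mult: "u \<in> ann \<Longrightarrow> uea_of x * u \<in> ann"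
  using S_ops(2)[OF orbit_lin(3)[of x u], of "A x (uact u v0)"] A_S[of "uact u v0" x] by (simp add: ann_def)

lemma uact_of_ann:
  assumes "A x v0 - (\<Sum>i\<in>I. c i *\<^sub>C v0) \<in> S"
  shows "uea_of x - (\<Sum>i\<in>I. c i) *\<^sub>C 1 \<in> ann"
proof -
  let ?c = "\<Sum>i\<in>I. c i"
  have 1: "uact (uea_of x - ?c *\<^sub>C 1) v0 - (uact (uea_of x) v0 - uact (?c *\<^sub>C 1) v0) \<in> S"
    by (rule uact_diff[OF v0])
  have 2: "uact (uea_of x) v0 - A x v0 \<in> S" by (rule uact_of[OF v0])
  have 3: "uact (?c *\<^sub>C 1) v0 - ?c *\<^sub>C uact 1 v0 \<in> S" by (rule uact_scaleC[OF v0])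
  have 4: "?c *\<^sub>C (uact 1 v0 - v0) \<in> S" by (intro S_ops(4) uact_one[OF v0])
  have "(\<Sum>i\<in>I. c i *\<^sub>C v0) = ?c *\<^sub>C v0" by (simp add: cvs.scale_sum_left)
  then have 5: "A x v0 - ?c *\<^sub>C v0 \<in> S" using assms by simp
  have "uact (uea_of x - ?c *\<^sub>C 1) v0 = (uact (uea_of x - ?c *\<^sub>C 1) v0 - (uact (uea_of x) v0 - uact (?c *\<^sub>C 1) v0))
      + ((uact (uea_of x) v0 - A x v0) + (A x v0 - ?c *\<^sub>C v0)
        - ((uact (?c *\<^sub>C 1) v0 - ?c *\<^sub>C uact 1 v0) + ?c *\<^sub>C (uact 1 v0 - v0)))"
    by (simp add: cvs.scale_right_diff_distrib)
  also have "\<dots> \<in> S" by (intro S_ops(2,3) 1 2 3 4 5)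
  finally show ?thesis by (simp add: ann_def)
qed

lemma gann_subspace: "cvs.subspace gann"
proof (unfold cvs.subspace_def, intro conjI ballI allI)
  show "0 \<in> gann" unfolding gann_def
    using cvs.subspace_0[OF uea_lt_subspace] cvs.subspace_0[OF ann_subspace]
    by (auto simp: clin_zero[OF clin_comp_uea] intro!: bexI[of _ 0])
next
  fix u u' assume uu: "u \<in> gann" "u' \<in> gann"
  show "u + u' \<in> gann" unfolding gann_def
  proof (intro CollectI allI)
    fix n
    obtain w w' where "w \<in> uea_lt n" "deg_part n u - w \<in> ann" "w' \<in> uea_lt n" "deg_part n u' - w' \<in> ann"
      using uu unfolding gann_def by blast
    then show "\<exists>w\<in>uea_lt n. deg_part n (u + u') - w \<in> ann"
      using cvs.subspace_add[OF ann_subspace, of "deg_part n u - w" "deg_part n u' - w'"]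
      by (intro bexI[of _ "w + w'"] cvs.subspace_add[OF uea_lt_subspace])
        (simp_all add: clin_add[OF clin_comp_uea] algebra_simps)
  qed
next
  fix c u assume uu: "u \<in> gann"
  show "c *\<^sub>C u \<in> gann" unfolding gann_def
  proof (intro CollectI allI)
    fix n
    obtain w where "w \<in> uea_lt n" "deg_part n u - w \<in> ann" using uu unfolding gann_def by blast
    then show "\<exists>w\<in>uea_lt n. deg_part n (c *\<^sub>C u) - w \<in> ann"
      using cvs.subspace_scale[OF ann_subspace, of "deg_part n u - w" c]
      by (intro bexI[of _ "c *\<^sub>C w"] cvs.subspace_scale[OF uea_lt_subspace])
        (simp_all add: clin_scale[OF clin_comp_uea] cvs.scale_right_diff_distrib)
  qed
qed

lemma gann_mult: "u \<in> gann \<Longrightarrow> uea_of p * u \<in> gann"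
proof (induction p rule: poly_monom_induct)
  case (add p q)
  then show ?case by (simp add: uea_of_add distrib_right cvs.subspace_add[OF gann_subspace])
next
  case (monom a m)
  show ?case unfolding gann_def
  proof (intro CollectI allI)
    fix n
    show "\<exists>w\<in>uea_lt n. deg_part n (uea_of (monom a m) * u) - w \<in> ann"
    proof (cases "m \<le> n")
      case True
      obtain w where w: "w \<in> uea_lt (n - m)" "deg_part (n - m) u - w \<in> ann"
        using monom unfolding gann_def by blast
      then show ?thesis
        using uea_lt_mult[OF w(1), of a m] ann_mult[OF w(2), of "monom a m"] True
        by (intro bexI[of _ "uea_of (monom a m) * w"]) (simp_all add: comp_monom_mult right_diff_distrib)
    next
      case False
      then show ?thesis using cvs.subspace_0[OF uea_lt_subspace] cvs.subspace_0[OF ann_subspace]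
        by (intro bexI[of _ 0]) (simp_all add: comp_monom_mult)
    qed
  qed
qed

lemma gann_left_ideal: "R \<subseteq> gann \<Longrightarrow> left_ideal R \<subseteq> gann"
proof -
  assume R: "R \<subseteq> gann"
  have "u * s \<in> gann" if s: "s \<in> R" for u s
  proof -
    have "u \<in> {u. u * s \<in> gann}"
      by (rule uea_left_induct)
        (use R s gann_mult clin_vimage_subspace[OF clin_uea_mult(2) gann_subspace] in \<open>auto simp: mult.assoc\<close>)
    then show ?thesis by simp
  qed
  then show ?thesis unfolding left_ideal_def by (intro cvs.span_minimal gann_subspace) auto
qed

lemma gann_hom: "u \<in> uea_deg n \<Longrightarrow> w \<in> uea_lt n \<Longrightarrow> u - w \<in> ann \<Longrightarrow> u \<in> gann"
  unfolding gann_def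
  using cvs.subspace_0[OF uea_lt_subspace] cvs.subspace_0[OF ann_subspace]
  by (auto simp: comp_deg intro: bexI[of _ w] bexI[of _ 0])

text \<open>The vectors of degree at most \<open>n\<close> that vanish in the component of degree \<open>n\<close>.\<close>

definition gnull :: "nat \<Rightarrow> 'a poly uea set" where
  "gnull n = {u \<in> uea_le n. \<exists>w\<in>uea_lt n. u - w \<in> ann}"

lemma orbit_eq: "orbit u = orbit u' \<longleftrightarrow> u - u' \<in> ann"
proof -
  have "uact (u - u') v0 - (uact u v0 - uact u' v0) \<in> S" by (rule uact_diff[OF v0])
  then have "uact u v0 - uact u' v0 \<in> S \<longleftrightarrow> uact (u - u') v0 \<in> S"
    using S_ops(2)[of "uact (u - u') v0 - (uact u v0 - uact u' v0)" "uact u v0 - uact u' v0"]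
      S_ops(3)[of "uact (u - u') v0" "uact (u - u') v0 - (uact u v0 - uact u' v0)"] by auto
  then show ?thesis unfolding orbit_def ann_def by (subst eq) (auto simp: uact_C v0)
qed

lemma filt_orbit: "filt M (\<pi> v0) n = orbit ` uea_le n"
proof -
  have sum: "(\<Oplus>\<^bsub>M\<^esub>i\<in>{..n}. uea_act M (u i) (\<pi> v0)) = orbit (\<Sum>i\<le>n. u i)" for u
  proof -
    have "(\<Oplus>\<^bsub>M\<^esub>i\<in>{..n}. uea_act M (u i) (\<pi> v0)) = \<pi> (\<Sum>i\<le>n. uact (u i) v0)"
      by (rule finsum_cong') (simp_all add: uact_C v0 uea_act_param)
    also have "\<dots> = orbit (\<Sum>i\<le>n. u i)"
    proof -
      have "uact (\<Sum>i\<le>n. u i) v0 - (\<Sum>i\<le>n. uact (u i) v0) \<in> S"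
      proof (induction n)
        case (Suc n)
        have e: "uact (\<Sum>i\<le>Suc n. u i) v0 - (\<Sum>i\<le>Suc n. uact (u i) v0)
          = (uact ((\<Sum>i\<le>n. u i) + u (Suc n)) v0 - (uact (\<Sum>i\<le>n. u i) v0 + uact (u (Suc n)) v0))
            + (uact (\<Sum>i\<le>n. u i) v0 - (\<Sum>i\<le>n. uact (u i) v0))" by simp
        show ?case unfolding e by (rule S_ops(2)[OF orbit_lin(1) Suc])
      qed (simp add: S_ops)
      then have "\<pi> (uact (\<Sum>i\<le>n. u i) v0) = \<pi> (\<Sum>i\<le>n. uact (u i) v0)"
        by (subst eq) (auto simp: uact_C v0 intro: C_ops)
      then show ?thesis by (simp add: orbit_def)
    qed
    finally show ?thesis .
  qed
  show ?thesis unfolding filt_def sum uea_le_def by blast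
qed

lemma filt_prev_orbit: "filt_prev M (\<pi> v0) n = orbit ` uea_lt n"
proof (cases n)
  case 0
  have "\<pi> 0 = orbit 0"
    using orbit_lin(2)[of 0 0] unfolding orbit_def
    by (subst eq) (auto simp: C_ops uact_C v0 intro: cvs.subspace_neg[OF S])
  then show ?thesis using 0 by (simp add: filt_prev_def uea_lt_def zero)
next
  case (Suc k)
  then show ?thesis by (simp add: filt_prev_def uea_lt_def filt_orbit)
qed

lemma prev_gnull: "orbit ` uea_lt n = orbit ` gnull n"
proof
  show "orbit ` uea_lt n \<subseteq> orbit ` gnull n"
  proof (rule image_mono, rule subsetI)
    fix u :: "'a poly uea" assume "u \<in> uea_lt n"
    then show "u \<in> gnull n"
      using cvs.subspace_0[OF ann_subspace] uea_lt_le[of u n] unfolding gnull_def by (auto intro!: bexI[of _ u])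
  qed
  show "orbit ` gnull n \<subseteq> orbit ` uea_lt n" unfolding gnull_def using orbit_eq by blast
qed

lemma gnull_subspace: "cvs.subspace (gnull n)"
proof (unfold cvs.subspace_def, intro conjI ballI allI)
  show "0 \<in> gnull n" unfolding gnull_def
    using cvs.subspace_0[OF uea_lt_subspace] cvs.subspace_0[OF uea_le_subspace] cvs.subspace_0[OF ann_subspace]
    by (auto intro!: bexI[of _ 0])
next
  fix u u' assume "u \<in> gnull n" "u' \<in> gnull n"
  then obtain w w' where w: "u \<in> uea_le n" "w \<in> uea_lt n" "u - w \<in> ann" "u' \<in> uea_le n" "w' \<in> uea_lt n" "u' - w' \<in> ann"
    unfolding gnull_def by blast
  have "(u + u') - (w + w') \<in> ann"
    using cvs.subspace_add[OF ann_subspace w(3,6)] by (simp add: algebra_simps)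
  then show "u + u' \<in> gnull n" unfolding gnull_def
    using cvs.subspace_add[OF uea_le_subspace w(1,4)] cvs.subspace_add[OF uea_lt_subspace w(2,5)] by blast
next
  fix c u assume "u \<in> gnull n"
  then obtain w where w: "u \<in> uea_le n" "w \<in> uea_lt n" "u - w \<in> ann" unfolding gnull_def by blast
  have "c *\<^sub>C u - c *\<^sub>C w \<in> ann"
    using cvs.subspace_scale[OF ann_subspace w(3), of c] by (simp add: cvs.scale_right_diff_distrib)
  then show "c *\<^sub>C u \<in> gnull n" unfolding gnull_def
    using cvs.subspace_scale[OF uea_le_subspace w(1)] cvs.subspace_scale[OF uea_lt_subspace w(2)] by blast
qed

lemma gnull_mult: "u \<in> gnull n \<Longrightarrow> uea_of (monom a m) * u \<in> gnull (m + n)"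
proof -
  assume "u \<in> gnull n"
  then obtain w where w: "u \<in> uea_le n" "w \<in> uea_lt n" "u - w \<in> ann" unfolding gnull_def by blast
  then show ?thesis unfolding gnull_def
    using uea_le_mult[OF w(1), of a m] uea_lt_mult[OF w(2), of a m] ann_mult[OF w(3), of "monom a m"]
    by (auto simp: right_diff_distrib intro!: bexI[of _ "uea_of (monom a m) * w"])
qed

definition gcls :: "nat \<Rightarrow> 'a poly uea \<Rightarrow> 'v set" where
  "gcls n u = orbit ` uea_lt n +>\<^bsub>M\<^esub> orbit u"

lemma coset_update: "X +>\<^bsub>M\<lparr>carrier := Y, hpart := h\<rparr>\<^esub> x = X +>\<^bsub>M\<^esub> x"
  by (simp add: a_r_coset_def r_coset_def)

lemma filt_param:
  "lin_param (M\<lparr>carrier := orbit ` uea_le n, hpart := h\<rparr>) (uea_le n) {u \<in> uea_le n. u \<in> ann} orbit"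
  using pullback[of "\<lambda>u. uact u v0" "uea_le n" h, OF uact_C[OF v0] orbit_lin(1,2) uea_le_subspace]
  by (simp add: orbit_def[abs_def] ann_def)

lemma gnull_props: "cvs.subspace (gnull n)" "{u \<in> uea_le n. u \<in> ann} \<subseteq> gnull n" "gnull n \<subseteq> uea_le n"
  using gnull_subspace cvs.subspace_0[OF uea_lt_subspace] by (auto simp: gnull_def intro!: bexI[of _ 0])

lemma gr_param: "lin_param (gr_part M (\<pi> v0) n) (uea_le n) (gnull n) (gcls n)"
proof -
  interpret f: lin_param "M\<lparr>carrier := orbit ` uea_le n, hpart := \<lambda>b. hpart M b \<inter> orbit ` uea_le n\<rparr>"
    "uea_le n" "{u \<in> uea_le n. u \<in> ann}" orbit by (rule filt_param)
  show ?thesis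
    using f.quotient[OF gnull_props]
    unfolding gr_part_def filt_orbit filt_prev_orbit prev_gnull[symmetric] coset_update gcls_def[abs_def] .
qed

lemma gr_act_summand:
  assumes u: "u \<in> uea_le k" and n: "n = s + k"
  shows "(\<Union>w\<in>gcls k u. filt_prev M (\<pi> v0) n +>\<^bsub>M\<^esub> act M (monom a s) w) = gcls n (uea_of (monom a s) * u)"
proof -
  interpret f: lin_param "M\<lparr>carrier := orbit ` uea_le k, hpart := undefined\<rparr>"
    "uea_le k" "{u \<in> uea_le k. u \<in> ann}" orbit by (rule filt_param)
  interpret g: lin_param "gr_part M (\<pi> v0) n" "uea_le n" "gnull n" "gcls n" by (rule gr_param)
  have "filt_prev M (\<pi> v0) n +>\<^bsub>M\<^esub> act M (monom a s) (orbit b) = gcls n (uea_of (monom a s) * u)"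
    if b: "b \<in> uea_le k" "b - u \<in> gnull k" for b
  proof -
    have "act M (monom a s) (orbit b) = orbit (uea_of (monom a s) * b)"
    proof -
      have "\<pi> (A (monom a s) (uact b v0)) = \<pi> (uact (uea_of (monom a s) * b) v0)"
        using cvs.subspace_neg[OF S orbit_lin(3)[of "monom a s" b]]
        by (subst eq) (auto simp: A_C uact_C v0)
      then show ?thesis by (simp add: orbit_def act_param uact_C v0)
    qed
    then have "filt_prev M (\<pi> v0) n +>\<^bsub>M\<^esub> act M (monom a s) (orbit b) = gcls n (uea_of (monom a s) * b)"
      by (simp add: filt_prev_orbit gcls_def)
    also have "\<dots> = gcls n (uea_of (monom a s) * u)"
      using gnull_mult[OF b(2), of a s] uea_le_mult[OF b(1), of a s] uea_le_mult[OF u, of a s]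
      by (subst g.eq) (simp_all add: n right_diff_distrib)
    finally show ?thesis .
  qed
  from f.union_coset[where F = "\<lambda>w. filt_prev M (\<pi> v0) n +>\<^bsub>M\<^esub> act M (monom a s) w", OF gnull_props u this]
  show ?thesis
    unfolding prev_gnull[symmetric] coset_update gcls_def[symmetric] .
qed

lemma gr_act:
  assumes "\<And>n. u n \<in> uea_le n"
  shows "act (gr_smodule M (\<pi> v0)) p (\<lambda>n. gcls n (u n)) = (\<lambda>n. gcls n (\<Sum>s\<le>n. uea_of (monom (coeff p s) s) * u (n - s)))"
proof
  fix n
  interpret g: lin_param "gr_part M (\<pi> v0) n" "uea_le n" "gnull n" "gcls n" by (rule gr_param)
  show "act (gr_smodule M (\<pi> v0)) p (\<lambda>n. gcls n (u n)) n = gcls n (\<Sum>s\<le>n. uea_of (monom (coeff p s) s) * u (n - s))"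
    unfolding gr_smodule_def Let_def smodule.simps
  proof (rule g.finsum_cong')
    fix s assume s: "s \<in> {..n}"
    show "uea_of (monom (coeff p s) s) * u (n - s) \<in> uea_le n"
      using uea_le_mult[OF assms[of "n - s"], of "coeff p s" s] s by simp
    show "(\<Union>w\<in>gcls (n - s) (u (n - s)). filt_prev M (\<pi> v0) n +>\<^bsub>M\<^esub> act M (monom (coeff p s) s) w)
        = gcls n (uea_of (monom (coeff p s) s) * u (n - s))"
      using s by (intro gr_act_summand assms) simp
  qed simp
qed

text \<open>Sending \<open>u\<close> to the classes of its homogeneous components identifies the quotient by \<open>gann\<close>
  with the associated graded module.\<close>

lemma gr_iso:
  assumes R: "left_ideal R = gann"
  shows "uea_quot R \<cong>\<^sub>s gr_smodule M (\<pi> v0)"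
proof -
  interpret q: lin_param "uea_quot R" UNIV "left_ideal R" "cls R" by (rule uea_quot_param)
  let ?G = "gr_smodule M (\<pi> v0)"
  let ?h = "\<lambda>u n. gcls n (deg_part n u)"
  have le: "deg_part n u \<in> uea_le n" for n u by (intro uea_deg_le comp_in_deg)
  have g_eq: "gcls n a = gcls n b \<longleftrightarrow> a - b \<in> gnull n" if "a \<in> uea_le n" "b \<in> uea_le n" for n a b
    using lin_param.eq[OF gr_param that] .
  have mem: "u \<in> gann \<longleftrightarrow> (\<forall>n. deg_part n u \<in> gnull n)" for u
    by (simp add: gann_def gnull_def le)
  have h_eq: "?h u = ?h u' \<longleftrightarrow> cls R u = cls R u'" for u u'
    unfolding q.eq[OF UNIV_I UNIV_I] R mem
    by (auto simp: fun_eq_iff g_eq[OF le le] clin_diff[OF clin_comp_uea])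
  define f where "f X = ?h (SOME u. cls R u = X)" for X
  have f: "f (cls R u) = ?h u" for u
    unfolding f_def h_eq by (rule someI) (rule refl)
  have gzero: "\<zero>\<^bsub>gr_part M (\<pi> v0) n\<^esub> = gcls n 0" for n by (rule lin_param.zero[OF gr_param])
  have gadd: "gcls n a \<oplus>\<^bsub>gr_part M (\<pi> v0) n\<^esub> gcls n b = gcls n (a + b)" if "a \<in> uea_le n" "b \<in> uea_le n" for n a b
    using lin_param.add[OF gr_param that] .
  have gsm: "c \<odot>\<^bsub>gr_part M (\<pi> v0) n\<^esub> gcls n a = gcls n (c *\<^sub>C a)" if "a \<in> uea_le n" for n a c
    using lin_param.smult[OF gr_param that] .
  have gcar: "carrier (gr_part M (\<pi> v0) n) = gcls n ` uea_le n" for n by (rule lin_param.carrier[OF gr_param])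
  have carG: "carrier ?G = {f. (\<forall>n. f n \<in> gcls n ` uea_le n) \<and> finite {n. f n \<noteq> gcls n 0}}"
    unfolding gr_smodule_def Let_def smodule.simps gcar gzero by simp
  have addG: "x \<oplus>\<^bsub>?G\<^esub> y = (\<lambda>n. x n \<oplus>\<^bsub>gr_part M (\<pi> v0) n\<^esub> y n)" for x y
    by (simp add: gr_smodule_def Let_def)
  have smG: "c \<odot>\<^bsub>?G\<^esub> x = (\<lambda>n. c \<odot>\<^bsub>gr_part M (\<pi> v0) n\<^esub> x n)" for c x
    by (simp add: gr_smodule_def Let_def)
  have h_car: "?h u \<in> carrier ?G" for u
  proof -
    obtain k where "\<forall>n>k. deg_part n u = 0" using comp_total[of u] by blast
    then have "{n. ?h u n \<noteq> gcls n 0} \<subseteq> {..k}" by (auto simp: not_less[symmetric])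
    then show ?thesis unfolding carG using le finite_subset by blast
  qed
  have surj: "\<exists>u. x = ?h u" if x: "x \<in> carrier ?G" for x
  proof -
    have "\<exists>a\<in>uea_deg n. x n = gcls n a \<and> (x n = gcls n 0 \<longrightarrow> a = 0)" for n
    proof (cases "x n = gcls n 0")
      case True
      then show ?thesis using cvs.subspace_0[OF uea_deg_subspace] by auto
    next
      case False
      obtain u where u: "u \<in> uea_le n" "x n = gcls n u" using x unfolding carG by blast
      obtain a where a: "a \<in> uea_deg n" "u - a \<in> uea_lt n" using u(1) uea_le_split by blast
      have "u - a \<in> gnull n" using a(2) uea_lt_le[OF a(2)] cvs.subspace_0[OF ann_subspace]
        by (auto simp: gnull_def intro!: bexI[of _ "u - a"])
      then have "x n = gcls n a" using u g_eq[OF u(1) uea_deg_le[OF a(1)]] by simp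
      then show ?thesis using a(1) False by blast
    qed
    then obtain a where a: "\<And>n. a n \<in> uea_deg n" "\<And>n. x n = gcls n (a n)" "\<And>n. x n = gcls n 0 \<Longrightarrow> a n = 0"
      by metis
    let ?F = "{n. x n \<noteq> gcls n 0}"
    have fin: "finite ?F" using x unfolding carG by blast
    have "deg_part n (\<Sum>m\<in>?F. a m) = a n" for n
    proof -
      have "deg_part n (\<Sum>m\<in>?F. a m) = (\<Sum>m\<in>?F. if m = n then a n else 0)"
        unfolding clin_sum[OF clin_comp_uea] by (intro sum.cong) (auto simp: comp_deg[OF a(1)])
      also have "\<dots> = a n" using a(3) fin by (cases "n \<in> ?F") (auto simp del: mem_Collect_eq)
      finally show ?thesis .
    qed
    then have "x = ?h (\<Sum>m\<in>?F. a m)" by (simp add: fun_eq_iff a(2))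
    then show ?thesis by blast
  qed
  have "f \<in> smodule_iso (uea_quot R) ?G"
    unfolding smodule_iso_def iso_def hom_def
  proof (intro CollectI conjI)
    have qc: "carrier (uea_quot R) = range (cls R)" by (rule q.carrier)
    show "f \<in> carrier (add_monoid (uea_quot R)) \<rightarrow> carrier (add_monoid ?G)"
      using h_car by (auto simp: qc f)
    show "\<forall>x\<in>carrier (add_monoid (uea_quot R)). \<forall>y\<in>carrier (add_monoid (uea_quot R)).
        f (x \<otimes>\<^bsub>add_monoid (uea_quot R)\<^esub> y) = f x \<otimes>\<^bsub>add_monoid ?G\<^esub> f y"
      by (auto simp: qc q.add f addG gadd le clin_add[OF clin_comp_uea])
    show "\<forall>c. \<forall>v\<in>carrier (uea_quot R). f (c \<odot>\<^bsub>uea_quot R\<^esub> v) = c \<odot>\<^bsub>?G\<^esub> f v"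
      by (auto simp: qc q.smult f smG gsm le clin_scale[OF clin_comp_uea])
    show "\<forall>x. \<forall>v\<in>carrier (uea_quot R). f (act (uea_quot R) x v) = act ?G x (f v)"
      by (auto simp: qc f uea_quot_act gr_act le comp_poly_mult)
    show "bij_betw f (carrier (add_monoid (uea_quot R))) (carrier (add_monoid ?G))"
      unfolding bij_betw_def inj_on_def using h_car surj by (auto simp: qc f h_eq image_iff)
  qed
  then show ?thesis unfolding smodule_isomorphic_def by blast
qed

text \<open>Counting dimensions: a spanning family of the quotient by a smaller left ideal that is not
  longer than a family separated by functionals on the cyclic module forces equality.\<close>

lemma gann_eqI:
  fixes \<Psi> :: "'j \<Rightarrow> 'a poly uea \<Rightarrow> complex"
  assumes L: "cvs.subspace L" "L \<subseteq> gann"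
    and F: "finite F" "card F \<le> card J" "\<And>f. f \<in> F \<Longrightarrow> \<exists>t. f \<in> uea_deg t" "\<And>u. u \<in> cspan (F \<union> L)"
    and J: "finite J" and \<Psi>: "\<And>j. j \<in> J \<Longrightarrow> clin (\<Psi> j)" "\<And>j u. j \<in> J \<Longrightarrow> u \<in> ann \<Longrightarrow> \<Psi> j u = 0"
    and E: "\<And>i j. i \<in> J \<Longrightarrow> j \<in> J \<Longrightarrow> \<Psi> j (E i) = (if i = j then 1 else 0)"
  shows "L = gann"
proof
  (* The degree of a member of F; the choice matters only if 0 lies in F. *)
  obtain dg where dg: "\<And>f. f \<in> F \<Longrightarrow> f \<in> uea_deg (dg f)" using F(3) by metis
  have rep: "\<exists>c. u - (\<Sum>f\<in>F. c f *\<^sub>C f) \<in> L" for u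
  proof -
    have "u \<in> {a + b | a b. a \<in> cspan F \<and> b \<in> cspan L}"
      using F(4)[of u] unfolding cvs.span_Un by blast
    then obtain a b where ab: "a \<in> cspan F" "b \<in> L" "u = a + b"
      using cvs.span_eq_iff[THEN iffD2, OF L(1)] by blast
    then obtain c where "a = (\<Sum>f\<in>F. c f *\<^sub>C f)" using cvs.span_finite[OF F(1)] by auto
    then show ?thesis using ab by (intro exI[of _ c]) simp
  qed
  let ?T = "\<lambda>n. {a + b | a b. a \<in> cspan {f \<in> F. dg f < n} \<and> b \<in> ann}"
  have T_sub: "cvs.subspace (?T n)" for n
    using cvs.subspace_sums[OF cvs.subspace_span ann_subspace] .
  have comp_sum: "deg_part n (\<Sum>f\<in>F. c f *\<^sub>C f) = (\<Sum>f\<in>{f \<in> F. dg f = n}. c f *\<^sub>C f)" for c n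
  proof -
    have "deg_part n (\<Sum>f\<in>F. c f *\<^sub>C f) = (\<Sum>f\<in>F. if dg f = n then c f *\<^sub>C f else 0)"
      unfolding clin_sum[OF clin_comp_uea] clin_scale[OF clin_comp_uea]
      by (intro sum.cong) (auto simp: comp_deg[OF dg])
    then show ?thesis using F(1) by (simp add: sum.inter_filter)
  qed
  have lt: "uea_lt n \<subseteq> ?T n" for n
  proof (induction n)
    case 0
    then show ?case using cvs.subspace_0[OF T_sub[of 0]] by (simp add: uea_lt_def)
  next
    case (Suc n)
    show ?case
    proof
      fix u :: "'a poly uea" assume "u \<in> uea_lt (Suc n)"
      then obtain a where a: "a \<in> uea_deg n" "u - a \<in> uea_lt n" by (auto simp: uea_lt_def uea_le_split)
      have mono: "?T n \<subseteq> ?T (Suc n)"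
      proof -
        have "cspan {f \<in> F. dg f < n} \<subseteq> cspan {f \<in> F. dg f < Suc n}" by (rule cvs.span_mono) auto
        then show ?thesis by blast
      qed
      obtain c where c: "a - (\<Sum>f\<in>F. c f *\<^sub>C f) \<in> L" using rep by blast
      then obtain w where w: "w \<in> uea_lt n" "deg_part n (a - (\<Sum>f\<in>F. c f *\<^sub>C f)) - w \<in> ann"
        using L(2) unfolding gann_def by blast
      let ?s = "\<Sum>f\<in>{f \<in> F. dg f = n}. c f *\<^sub>C f"
      have "deg_part n (a - (\<Sum>f\<in>F. c f *\<^sub>C f)) = a - ?s"
        by (simp only: clin_diff[OF clin_comp_uea] comp_sum comp_deg[OF a(1)] if_True simp_thms)
      with w(2) have "a - ?s - w \<in> ann" by simp
      moreover have "?s \<in> cspan {f \<in> F. dg f < Suc n}"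
        by (intro cvs.span_sum cvs.span_scale cvs.span_base) auto
      ultimately have "?s + (a - ?s - w) \<in> ?T (Suc n)" by blast
      then have 1: "a - w \<in> ?T (Suc n)" by simp
      have "w \<in> ?T (Suc n)" "u - a \<in> ?T (Suc n)" using Suc w(1) a(2) mono by blast+
      from cvs.subspace_add[OF T_sub cvs.subspace_add[OF T_sub 1 this(1)] this(2)]
      show "u \<in> ?T (Suc n)" by simp
    qed
  qed
  have indep: "c f = 0" if "(\<Sum>f\<in>F. c f *\<^sub>C f) \<in> ann" "f \<in> F" for c f
  proof (rule dual_independent[OF F(1,2) J ann_subspace \<Psi> E _ that])
    fix u :: "'a poly uea"
    obtain k where k: "u = (\<Sum>n\<le>k. deg_part n u)" using comp_total[of u] by blast
    have "deg_part n u \<in> cspan (F \<union> ann)" for n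
    proof -
      have "deg_part n u \<in> uea_lt (Suc n)" by (rule uea_le_lt[of n]) (auto intro: uea_deg_le comp_in_deg)
      then obtain a b where ab: "a \<in> cspan {f \<in> F. dg f < Suc n}" "b \<in> ann" "deg_part n u = a + b" using lt by blast
      have "a \<in> cspan (F \<union> ann)" using ab(1) cvs.span_mono[of "{f \<in> F. dg f < Suc n}" "F \<union> ann"] by auto
      moreover have "b \<in> cspan (F \<union> ann)" using ab(2) by (simp add: cvs.span_base)
      ultimately show ?thesis unfolding ab(3) by (rule cvs.span_add)
    qed
    then show "u \<in> cspan (F \<union> ann)" by (subst k) (intro cvs.span_sum)
  qed
  show "gann \<subseteq> L"
  proof
    fix g assume g: "g \<in> gann"
    obtain c where c: "g - (\<Sum>f\<in>F. c f *\<^sub>C f) \<in> L" using rep by blast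
    let ?s = "\<Sum>f\<in>F. c f *\<^sub>C f"
    have "g - ?s \<in> gann" using c L(2) by blast
    from cvs.subspace_diff[OF gann_subspace g this] have "g - (g - ?s) \<in> gann" .
    then have sg: "?s \<in> gann" by simp
    have "c f0 = 0" if f0: "f0 \<in> F" for f0
    proof -
      let ?n = "dg f0"
      obtain w where w: "w \<in> uea_lt ?n" "deg_part ?n ?s - w \<in> ann" using sg unfolding gann_def by blast
      obtain a b where ab: "a \<in> cspan {f \<in> F. dg f < ?n}" "b \<in> ann" "w = a + b" using lt w(1) by blast
      have fin: "finite {f \<in> F. dg f < ?n}" using F(1) by simp
      obtain d where d: "a = (\<Sum>f\<in>{f \<in> F. dg f < ?n}. d f *\<^sub>C f)"
        using ab(1) cvs.span_finite[OF fin] by auto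
      let ?e = "\<lambda>f. if dg f = ?n then c f else if dg f < ?n then - d f else 0"
      have "(\<Sum>f\<in>F. ?e f *\<^sub>C f) = (\<Sum>f\<in>F. (if dg f = ?n then c f *\<^sub>C f else 0) - (if dg f < ?n then d f *\<^sub>C f else 0))"
        by (intro sum.cong) auto
      also have "\<dots> = deg_part ?n ?s - a"
        unfolding sum_subtractf comp_sum d using F(1) by (simp add: sum.inter_filter)
      also have "\<dots> = (deg_part ?n ?s - w) + b" unfolding ab(3) by simp
      also have "\<dots> \<in> ann" by (rule cvs.subspace_add[OF ann_subspace w(2) ab(2)])
      finally have "?e f0 = 0" using f0 by (rule indep)
      then show ?thesis by simp
    qed
    then have "?s = 0" by simp
    then show "g \<in> L" using c by simp
  qed
qed (rule L(2))

end

section \<open>Fusion products of Kac modules\<close>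

subsection \<open>Tensor products of evaluated Kac modules\<close>

locale kac_fusion =
  fixes N :: nat and kp :: "nat \<Rightarrow> complex" and nu :: "nat \<Rightarrow> nat" and zz :: "nat \<Rightarrow> complex"
  assumes distinct: "inj_on zz {..<N}" and nondeg: "k < N \<Longrightarrow> nu k = 0 \<Longrightarrow> kp k = 0"
begin

abbreviation rels :: "nat \<Rightarrow> sl12 uea set" where "rels k \<equiv> kac_relators (kp k, of_nat (nu k))"

definition factors :: "(sl12 poly, sl12 uea set) smodule list" where
  "factors = map (\<lambda>k. eval_smodule (zz k) (uea_quot (rels k))) [0..<N]"

definition slot_act :: "nat \<Rightarrow> sl12 poly \<Rightarrow> sl12 uea \<Rightarrow> sl12 uea" where
  "slot_act k p u = uea_of (peval (zz k) p) * u"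

lemma length_factors: "length factors = N" by (simp add: factors_def)

sublocale tensor_param factors "\<lambda>k. left_ideal (rels k)" "\<lambda>k. cls (rels k)" slot_act kos
proof (rule tensor_param.intro)
  show "lin_param (factors ! k) UNIV (left_ideal (rels k)) (cls (rels k))" if "k < length factors" for k
    using that by (simp add: factors_def eval_param uea_quot_param)
  show "act (factors ! k) x (cls (rels k) u) = cls (rels k) (slot_act k x u)" if "k < length factors" for k x u
    using that by (simp add: factors_def eval_act slot_act_def)
  show "koszul (factors ! k) b (cls (rels k) u) = cls (rels k) (kos b u)" if "k < length factors" for k b u
    using that koszul_uea_quot[OF kac_relators_upar] by (simp add: factors_def)
  show "clin (slot_act k x)" for k x
    unfolding slot_act_def[abs_def] by (rule clin_uea_mult)
  show "clin (\<lambda>x. slot_act k x u)" for k u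
    unfolding slot_act_def by (rule clin_comp[OF clin_uea_mult(2) clin_comp[OF clin_uea_of clin_peval]])
  show "slot_act k (hcomp i x) (slot_act k (hcomp j y) u) =
      ksign (i * j) *\<^sub>C slot_act k (hcomp j y) (slot_act k (hcomp i x) u)
      + slot_act k (bracket (hcomp i x) (hcomp j y)) u" for k i x j y u
    unfolding slot_act_def peval_hcomp peval_bracket mult.assoc[symmetric]
      uea_of_bracket[of i "peval (zz k) x" j "peval (zz k) y"]
    by (simp only: distrib_right uea_scaleC_mult mult.assoc)
  show "clin (kos b)" for b by (rule clin_kos)
  show "kos 0 u = u" for u by (simp add: kos_def)
  show "kos c (slot_act k (hcomp b x) u) = ksign (b * c) *\<^sub>C slot_act k (hcomp b x) (kos c u)" for c k b x u
  proof (cases "c = 0")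
    case True
    then show ?thesis by (simp add: kos_def ksign_def scaleC_one)
  next
    case False
    then have "c = 1" by (cases c) auto
    have "par (hcomp b (peval (zz k) x)) = ksign b *\<^sub>C hcomp b (peval (zz k) x)"
      by (rule par_hom) (simp add: hcomp_hcomp)
    then show ?thesis
      by (simp only: \<open>c = 1\<close> kos_def slot_act_def peval_hcomp upar_of_mult uea_of_scaleC uea_scaleC_mult
          mult_1_right if_False one_neq_zero)
  qed
  show "kos b (kos c u) = kos (b + c) u" for b c u
  proof -
    obtain u0 u1 where u: "u0 \<in> uea_hpart 0" "u1 \<in> uea_hpart 1" "u = u0 + u1" using uea_hpart_decomp[of u] by blast
    have "kos b (u0 + ksign c *\<^sub>C u1) = u0 + ksign b *\<^sub>C ksign c *\<^sub>C u1"
      by (rule upar_hsum[OF u(1) cvs.subspace_scale[OF uea_hpart_subspace u(2)]])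
    then show ?thesis
      by (simp only: u(3) upar_hsum[OF u(1,2)] ksign_add scaleC_scaleC)
  qed
qed

definition vac :: "sl12 uea set list \<Rightarrow>\<^sub>0 complex" where "vac = tens (\<lambda>_. 1)"

sublocale cyclic_param V carr null proj top vac
  by unfold_locales (simp add: vac_def tens_carr)

lemma proj_vac: "proj vac = pure_tensor factors (map (\<lambda>k. cls (rels k) 1) [0..<N])"
  using pure_tensor_tens[of "\<lambda>_. 1"] by (simp add: vac_def tuple_def length_factors)

lemma slot_zero: "i < N \<Longrightarrow> us i \<in> left_ideal (rels i) \<Longrightarrow> tens us \<in> null"
proof -
  assume i: "i < N" and us: "us i \<in> left_ideal (rels i)"
  have "tens (us(i := us i)) = tens (us(i := 0))"
    by (rule tens_cong) (use us cvs.subspace_0[OF left_ideal_subspace] in auto)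
  then show ?thesis using tens_zero[of i us] i by (simp add: length_factors)
qed

lemma top_killed:
  assumes "\<And>i b. i < N \<Longrightarrow> slot_act i (hcomp b x) (us i) \<in> left_ideal (rels i)"
  shows "top x (tens us) \<in> null"
  unfolding top_tens
  by (intro null_sum slot_zero) (auto simp: slots_def length_factors intro: assms)

lemma ann_of: "top x vac \<in> null \<Longrightarrow> uea_of x \<in> ann"
proof -
  assume x: "top x vac \<in> null"
  have "V.uact (uea_of x) vac - top x vac \<in> null" by (rule V.uact_of) (simp add: v0)
  from null_ops(1)[OF this x] show ?thesis by (simp add: ann_def)
qed

subsection \<open>The defining relations of the truncated Weyl module in the fusion product\<close>

lemma gann_poly:
  assumes "\<And>r. uea_of (monom (coeff p r) r) \<in> gann"
  shows "uea_of p \<in> gann"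
proof -
  have "uea_of p = (\<Sum>r\<le>degree p. uea_of (monom (coeff p r) r))"
    by (simp add: poly_as_sum_of_monoms flip: uea_of_sum)
  then show ?thesis using cvs.subspace_sum[OF gann_subspace assms] by simp
qed

lemma uea_deg_of: "uea_of (monom a r) \<in> uea_deg r"
  using uea_deg_mult[OF uea_deg_one, of a r] by simp

lemma gann_nplus: "a \<in> nplus \<Longrightarrow> uea_of (monom a r) \<in> gann"
proof (rule gann_hom[OF uea_deg_of])
  assume a: "a \<in> nplus"
  have "top (monom a r) vac \<in> null" unfolding vac_def
  proof (rule top_killed)
    fix i b
    have "uea_of (hcomp b a) \<in> left_ideal (rels i)"
      by (rule left_ideal_base) (simp add: kac_relators_def hcomp_nplus[OF a])
    then show "slot_act i (hcomp b (monom a r)) 1 \<in> left_ideal (rels i)"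
      by (simp add: slot_act_def hcomp_monom peval_monom uea_of_scaleC cvs.subspace_scale[OF left_ideal_subspace])
  qed
  then show "uea_of (monom a r) - 0 \<in> ann" by (simp add: ann_of)
qed (rule cvs.subspace_0[OF uea_lt_subspace])

text \<open>On the tensor product of highest weight vectors \<open>h t\<^sup>r\<close> acts by \<open>\<Sum>\<^sub>k z\<^sub>k\<^sup>r \<mu>\<^sub>k(h)\<close>, a
scalar, which has degree \<open>0 < r\<close> unless \<open>r = 0\<close>.\<close>

lemma gann_cartan:
  assumes l: "l1 = (\<Sum>k<N. kp k)" "l2 = (\<Sum>k<N. of_nat (nu k))"
  shows "uea_of (monom (a *\<^sub>C h1 + b *\<^sub>C h2) r) - (if r = 0 then a * l1 + b * l2 else 0) *\<^sub>C 1 \<in> gann"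
proof -
  let ?h = "a *\<^sub>C h1 + b *\<^sub>C h2"
  let ?m = "\<lambda>k. a * kp k + b * of_nat (nu k)"
  let ?c = "\<Sum>k<N. zz k ^ r * ?m k"
  have h: "hcomp 0 (monom ?h r) = monom ?h r"
    by (simp add: hcomp_monom hcomp_add hcomp_scaleC sl12_parity)
  have e: "tens ((\<lambda>_. 1)(i := slot_act i (monom ?h r) 1)) - (zz i ^ r * ?m i) *\<^sub>C vac \<in> null" if i: "i < N" for i
  proof -
    have "uea_of ?h - ?m i *\<^sub>C 1 \<in> left_ideal (rels i)"
      by (rule left_ideal_base) (auto simp: kac_relators_def)
    from cvs.subspace_scale[OF left_ideal_subspace this, of "zz i ^ r"]
    have "slot_act i (monom ?h r) 1 - (zz i ^ r * ?m i) *\<^sub>C 1 \<in> left_ideal (rels i)"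
      by (simp only: slot_act_def peval_monom uea_of_scaleC cvs.scale_right_diff_distrib scaleC_scaleC mult_1_right)
    then have "tens ((\<lambda>_. 1)(i := slot_act i (monom ?h r) 1)) = tens ((\<lambda>_. 1)(i := (zz i ^ r * ?m i) *\<^sub>C 1))"
      by (rule tens_cong_slot)
    then show ?thesis
      using tens_scale[of i "\<lambda>_. 1" "zz i ^ r * ?m i" 1] i by (simp add: vac_def length_factors fun_upd_idem)
  qed
  have "(top (monom ?h r) vac - (\<Sum>i<N. tens ((\<lambda>_. 1)(i := slot_act i (monom ?h r) 1))))
      + (\<Sum>i<N. tens ((\<lambda>_. 1)(i := slot_act i (monom ?h r) 1)) - (zz i ^ r * ?m i) *\<^sub>C vac) \<in> null"
    using top_even[OF h, of "\<lambda>_. 1"] e unfolding vac_def[symmetric] length_factors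
    by (intro null_ops(1) null_sum) auto
  then have "top (monom ?h r) vac - (\<Sum>i<N. (zz i ^ r * ?m i) *\<^sub>C vac) \<in> null"
    by (simp add: sum_subtractf)
  then have K: "uea_of (monom ?h r) - ?c *\<^sub>C 1 \<in> ann" by (rule uact_of_ann)
  show ?thesis
  proof (cases "r = 0")
    case True
    have c: "?c = a * l1 + b * l2" using True
      by (simp add: l sum.distrib sum_distrib_left)
    have "uea_of (monom ?h r) - ?c *\<^sub>C 1 \<in> uea_deg r"
      using True uea_deg_of[of ?h r] uea_deg_one
      by (intro cvs.subspace_diff[OF uea_deg_subspace] cvs.subspace_scale[OF uea_deg_subspace]) auto
    from gann_hom[OF this cvs.subspace_0[OF uea_lt_subspace]] K show ?thesis
      unfolding c using True by simp
  next
    case False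
    have "?c *\<^sub>C (1 :: sl12 poly uea) \<in> uea_le 0"
      by (intro uea_deg_le cvs.subspace_scale[OF uea_deg_subspace] uea_deg_one)
    then have "?c *\<^sub>C (1 :: sl12 poly uea) \<in> uea_lt r" using uea_le_lt[of 0 r] False by simp
    from gann_hom[OF uea_deg_of this K] show ?thesis using False by simp
  qed
qed

text \<open>The even element \<open>y\<^sub>2\<close> acts on a tensor product of powers by the Leibniz rule.\<close>

lemma top_y2: 
  "top (monom y2 0) (tens (\<lambda>k. uea_of y2 ^ c k)) - (\<Sum>i<N. tens (\<lambda>k. uea_of y2 ^ (c(i := Suc (c i))) k)) \<in> null"
proof -
  have "hcomp 0 (monom y2 0) = monom y2 0" by (simp add: hcomp_monom sl12_parity)
  moreover have "(\<lambda>k. uea_of y2 ^ c k)(i := slot_act i (monom y2 0) (uea_of y2 ^ c i)) = (\<lambda>k. uea_of y2 ^ (c(i := Suc (c i))) k)" for i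
    by (auto simp: slot_act_def peval_monom scaleC_one fun_eq_iff)
  ultimately show ?thesis using top_even[of "monom y2 0" "\<lambda>k. uea_of y2 ^ c k"] by (simp add: length_factors)
qed

text \<open>Each application of \<open>y\<^sub>2\<close> raises one exponent, and once the sum of the exponents exceeds the sum of the \<open>nu k\<close>, some
exponent exceeds its own bound.\<close>

lemma y2_power_tens:
  assumes "(\<Sum>k<N. nu k) < d + (\<Sum>k<N. c k)"
  shows "(top (monom y2 0) ^^ d) (tens (\<lambda>k. uea_of y2 ^ c k)) \<in> null"
  using assms
proof (induction d arbitrary: c)
  case 0
  have "\<exists>k<N. nu k < c k"
  proof (rule ccontr)
    assume "\<not> (\<exists>k<N. nu k < c k)"
    then have "c k \<le> nu k" if "k < N" for k using that not_less by blast
    then have "(\<Sum>k<N. c k) \<le> (\<Sum>k<N. nu k)" by (intro sum_mono) simp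
    then show False using 0 by simp
  qed
  then obtain k where k: "k < N" "nu k < c k" by blast
  then obtain j where "c k = j + (nu k + 1)" by (metis Suc_eq_plus1 add.commute less_eq_Suc_le le_Suc_ex)
  then have "uea_of y2 ^ c k = uea_of y2 ^ j * uea_of y2 ^ (nu k + 1)" by (simp only: power_add)
  moreover have "uea_of y2 ^ (nu k + 1) \<in> left_ideal (rels k)"
    by (rule left_ideal_base) (auto simp: kac_relators_def)
  ultimately have "uea_of y2 ^ c k \<in> left_ideal (rels k)" using left_ideal_mult by metis
  then show ?case using slot_zero[OF k(1), of "\<lambda>k. uea_of y2 ^ c k"] by simp
next
  case (Suc d)
  let ?T = "top (monom y2 0) ^^ d"
  have lin: "clin ?T" by (induction d) (auto simp: clin_def clin_add[OF clin_top] clin_scale[OF clin_top])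
  have inv: "p \<in> null \<Longrightarrow> ?T p \<in> null" for p by (induction d) (auto intro: top_null)
  have 1: "?T (top (monom y2 0) (tens (\<lambda>k. uea_of y2 ^ c k))) - (\<Sum>i<N. ?T (tens (\<lambda>k. uea_of y2 ^ (c(i := Suc (c i))) k))) \<in> null"
    using inv[OF top_y2[of c]] by (simp only: clin_diff[OF lin] clin_sum[OF lin])
  have 2: "(\<Sum>i<N. ?T (tens (\<lambda>k. uea_of y2 ^ (c(i := Suc (c i))) k))) \<in> null"
  proof (rule null_sum, rule Suc.IH)
    fix i assume i: "i \<in> {..<N}"
    have "(\<Sum>k<N. (c(i := Suc (c i))) k) = Suc (c i) + (\<Sum>k\<in>{..<N} - {i}. c k)"
      using i by (subst sum.remove[of _ i]) auto
    moreover have "(\<Sum>k<N. c k) = c i + (\<Sum>k\<in>{..<N} - {i}. c k)"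
      using i by (subst sum.remove[of _ i]) auto
    ultimately show "(\<Sum>k<N. nu k) < d + (\<Sum>k<N. (c(i := Suc (c i))) k)" using Suc.prems by simp
  qed
  show ?case unfolding funpow_Suc_right o_def using null_ops(1)[OF 1 2] by simp
qed

lemma uact_power:
  "p \<in> carr \<Longrightarrow> V.uact (uea_of x ^ d) p - (top x ^^ d) p \<in> null"
proof (induction d)
  case 0
  then show ?case using V.uact_one[of p] by simp
next
  case (Suc d)
  have 1: "V.uact (uea_of x * uea_of x ^ d) p - top x (V.uact (uea_of x ^ d) p) \<in> null"
    by (rule V.uact_of_mult[OF Suc.prems])
  have 2: "top x (V.uact (uea_of x ^ d) p - (top x ^^ d) p) \<in> null"
    by (rule top_null[OF Suc.IH[OF Suc.prems]])
  from null_ops(1)[OF 1 2] show ?case by (simp add: clin_diff[OF clin_top])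
qed

lemma gann_y2: "uea_of (monom y2 0) ^ Suc (\<Sum>k<N. nu k) \<in> gann"
proof -
  let ?d = "Suc (\<Sum>k<N. nu k)"
  have deg: "uea_of (monom y2 0) ^ d \<in> uea_deg 0" for d
    by (induction d) (use uea_deg_one uea_deg_mult[of _ 0 y2 0] in auto)
  have "(top (monom y2 0) ^^ ?d) vac \<in> null"
    using y2_power_tens[of ?d "\<lambda>_. 0"] by (simp add: vac_def del: funpow.simps)
  from null_ops(1)[OF uact_power[OF v0, of "monom y2 0" ?d] this]
  have "uea_of (monom y2 0) ^ ?d - 0 \<in> ann" by (simp only: ann_def mem_Collect_eq diff_0_right diff_add_cancel)
  then show ?thesis by (rule gann_hom[OF deg cvs.subspace_0[OF uea_lt_subspace]])
qed

lemma ann_tmul: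
  assumes "\<And>i. i < N \<Longrightarrow> poly f (zz i) = 0"
  shows "uea_of (tmul f a) \<in> ann"
proof (rule ann_of, unfold vac_def, rule top_killed)
  fix i b assume "i < N"
  then show "slot_act i (hcomp b (tmul f a)) 1 \<in> left_ideal (rels i)"
    by (simp add: slot_act_def hcomp_tmul peval_tmul assms uea_of_zero cvs.subspace_0[OF left_ideal_subspace])
qed

text \<open>The monic polynomial \<open>t\<^sup>r\<^sup>-\<^sup>N \<Prod>\<^sub>k (t - z\<^sub>k)\<close> vanishes at all evaluation points, so that
\<open>a t\<^sup>r\<close> equals a combination of \<open>a t\<^sup>k\<close> with \<open>k < r\<close> on the cyclic vector.\<close>

lemma gann_truncation: "N \<le> r \<Longrightarrow> uea_of (monom a r) \<in> gann"
proof -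
  assume r: "N \<le> r"
  let ?f = "monom 1 (r - N) * (\<Prod>k<N. [:- zz k, 1:])"
  have deg: "degree ?f = r"
    using r by (subst degree_mult_eq) (auto simp: degree_monom_eq degree_prod_eq_sum_degree prod_zero_iff)
  have lc: "coeff ?f r = 1"
    using lead_coeff_mult[of "monom 1 (r - N)" "\<Prod>k<N. [:- zz k, 1:]"] deg
    by (simp add: lead_coeff_prod degree_monom_eq)
  have K: "uea_of (tmul ?f a) \<in> ann"
    by (rule ann_tmul) (auto simp: poly_prod)
  have split: "uea_of (tmul ?f a) = uea_of (monom a r) + (\<Sum>k<r. uea_of (monom (coeff ?f k *\<^sub>C a) k))"
    unfolding tmul_def deg
    by (simp only: uea_of_add uea_of_sum lessThan_Suc_atMost[symmetric] sum.lessThan_Suc lc scaleC_one add.commute)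
  (* The lower terms of the polynomial, moved to the other side. *)
  let ?w = "- (\<Sum>k<r. uea_of (monom (coeff ?f k *\<^sub>C a) k))"
  have "?w \<in> uea_lt r"
    by (intro cvs.subspace_neg[OF uea_lt_subspace] cvs.subspace_sum[OF uea_lt_subspace])
      (auto intro: uea_le_lt uea_deg_le uea_deg_of)
  moreover have "uea_of (monom a r) - ?w \<in> ann" using K unfolding split by simp
  ultimately show ?thesis by (rule gann_hom[OF uea_deg_of])
qed

lemma weyl_relators_gann:
  assumes "fst la = (\<Sum>k<N. kp k)" "snd la = of_nat (\<Sum>k<N. nu k)"
  shows "weyl_relators la N \<subseteq> gann"
proof
  fix u assume "u \<in> weyl_relators la N"
  then consider (n) p where "u = uea_of p" "\<forall>r. coeff p r \<in> nplus"
    | (h) a b r where "u = uea_of (monom (a *\<^sub>C h1 + b *\<^sub>C h2) r) - (if r = 0 then a * fst la + b * snd la else 0) *\<^sub>C 1"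
    | (y) n where "u = uea_of (monom y2 0) ^ (n + 1)" "of_nat n = snd la"
    | (t) p where "u = uea_of p" "\<forall>r<N. coeff p r = 0"
    unfolding weyl_relators_def by blast
  then show "u \<in> gann"
  proof cases
    case n
    then show ?thesis using gann_poly gann_nplus by blast
  next
    case h
    have "snd la = (\<Sum>k<N. of_nat (nu k))" using assms(2) by simp
    from gann_cartan[OF assms(1) this] show ?thesis unfolding h .
  next
    case y
    then have "n = (\<Sum>k<N. nu k)" using assms(2) by (simp only: of_nat_eq_iff)
    then show ?thesis using gann_y2 y(1) by simp
  next
    case t
    have "uea_of (monom (coeff p r) r) \<in> gann" for r
    proof (cases "r < N")
      case True
      then show ?thesis using t(2) cvs.subspace_0[OF gann_subspace] by (simp add: uea_of_zero)
    qed (simp add: gann_truncation)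
    then show ?thesis unfolding t(1) by (rule gann_poly)
  qed
qed

subsection \<open>Cyclicity and independent vectors\<close>

definition reach :: "(sl12 uea set list \<Rightarrow>\<^sub>0 complex) set" where
  "reach = {p. \<exists>U. V.uact U vac - p \<in> null}"

lemma reach_null: "p \<in> reach \<Longrightarrow> p - q \<in> null \<Longrightarrow> q \<in> reach"
proof -
  assume "p \<in> reach" and d: "p - q \<in> null"
  then obtain U where "V.uact U vac - p \<in> null" unfolding reach_def by blast
  from null_ops(1)[OF this d] show ?thesis unfolding reach_def by auto
qed

lemma reach_subspace: "cvs.subspace reach"
proof (unfold cvs.subspace_def, intro conjI ballI allI)
  show "0 \<in> reach" using orbit_lin(2)[of 0 0] unfolding reach_def by (auto intro!: exI[of _ 0])
next
  fix p q assume "p \<in> reach" "q \<in> reach"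
  then obtain U W where UW: "V.uact U vac - p \<in> null" "V.uact W vac - q \<in> null" unfolding reach_def by blast
  have "V.uact (U + W) vac - (p + q) \<in> null"
    using null_ops(1)[OF orbit_lin(1)[of U W] null_ops(1)[OF UW]] by (simp add: algebra_simps)
  then show "p + q \<in> reach" unfolding reach_def by blast
next
  fix c p assume "p \<in> reach"
  then obtain U where U: "V.uact U vac - p \<in> null" unfolding reach_def by blast
  have "V.uact (c *\<^sub>C U) vac - c *\<^sub>C p \<in> null"
    using null_ops(1)[OF orbit_lin(2)[of c U] null_ops(3)[OF U, of c]]
    by (simp add: cvs.scale_right_diff_distrib)
  then show "c *\<^sub>C p \<in> reach" unfolding reach_def by blast
qed

lemma reach_top: "p \<in> reach \<Longrightarrow> top x p \<in> reach"
proof -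
  assume "p \<in> reach"
  then obtain U where U: "V.uact U vac - p \<in> null" unfolding reach_def by blast
  have "V.uact (uea_of x * U) vac - top x p \<in> null"
    using null_ops(1)[OF orbit_lin(3)[of x U] top_null[OF U, of x]] by (simp add: clin_diff[OF clin_top])
  then show ?thesis unfolding reach_def by blast
qed

text \<open>Multiply by the Lagrange polynomial that is \<open>1\<close> at \<open>z\<^sub>j\<close> and \<open>0\<close> at the other points: the action is
concentrated in slot \<open>j\<close>. The slots before \<open>j\<close> still hold the even highest weight vectors, so that no sign arises.\<close>

lemma reach_slot:
  assumes j: "j < N" and us: "\<And>k. k < j \<Longrightarrow> us k = 1" and r: "tens us \<in> reach"
  shows "tens (us(j := uea_of (hcomp b a) * us j)) \<in> reach"
proof -
  (* Lagrange interpolation at the point with index j, up to normalization. *)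
  let ?g = "\<Prod>k\<in>{..<N} - {j}. [:- zz k, 1:]"
  let ?c = "poly ?g (zz j)"
  have c: "?c \<noteq> 0" using distinct j by (auto simp: poly_prod inj_on_def)
  have "poly (Polynomial.smult (inverse ?c) ?g) (zz j) = 1" using c by simp
  moreover have "poly (Polynomial.smult (inverse ?c) ?g) (zz k) = 0" if "k < N" "k \<noteq> j" for k
    using that by (auto simp: poly_prod)
  ultimately obtain f where fj: "poly f (zz j) = 1"
    and fk: "\<And>k. k < N \<Longrightarrow> k \<noteq> j \<Longrightarrow> poly f (zz k) = 0" by blast
  let ?x = "tmul f (hcomp b a)"
  have hx: "hcomp b ?x = ?x" by (simp add: hcomp_tmul hcomp_hcomp)
  have others: "tens (slots b i ?x us) \<in> null" if i: "i < N" "i \<noteq> j" for i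
    by (rule slot_zero[OF i(1)])
      (simp add: slots_def hx slot_act_def peval_tmul fk[OF i] uea_of_zero cvs.subspace_0[OF left_ideal_subspace])
  have self: "slots b j ?x us = us(j := uea_of (hcomp b a) * us j)"
    using us by (auto simp: slots_def hx slot_act_def peval_tmul fj scaleC_one kos_def upar_one fun_eq_iff)
  have "(\<Sum>i<N. tens (slots b i ?x us)) = tens (slots b j ?x us) + (\<Sum>i\<in>{..<N} - {j}. tens (slots b i ?x us))"
    using j by (intro sum.remove) auto
  moreover have "top ?x (tens us) - (\<Sum>i<N. tens (slots b i ?x us)) \<in> null"
    using top_hom[of b ?x us] by (simp only: hx length_factors)
  moreover have "(\<Sum>i\<in>{..<N} - {j}. tens (slots b i ?x us)) \<in> null"
    by (rule null_sum) (use others in auto)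
  ultimately have "top ?x (tens us) - tens (us(j := uea_of (hcomp b a) * us j)) \<in> null"
    using null_ops(1) unfolding self by fastforce
  with reach_top[OF r] show ?thesis by (rule reach_null)
qed

text \<open>The slots are filled from the last one to the first.\<close>

lemma reach_tens: "j \<le> N \<Longrightarrow> (\<And>k. k < j \<Longrightarrow> us k = 1) \<Longrightarrow> tens us \<in> reach"
proof (induction "N - j" arbitrary: j us)
  case 0
  have us1: "us k = 1" if "k < N" for k using 0 that by simp
  have "tens us = vac"
    unfolding vac_def by (rule tens_cong) (simp add: length_factors us1 cvs.subspace_0[OF left_ideal_subspace])
  moreover have "V.uact 1 vac - vac \<in> null" by (rule V.uact_one) (rule v0)
  ultimately show ?case unfolding reach_def by auto
next
  case (Suc d)
  then have j: "j < N" by simp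
  let ?W = "{w. tens (us(j := w)) \<in> reach}"
  have sub: "cvs.subspace ?W"
  proof (unfold cvs.subspace_def, intro conjI ballI allI)
    show "0 \<in> ?W"
      using reach_null[OF cvs.subspace_0[OF reach_subspace], of "tens (us(j := 0))"]
        null_ops(4)[OF tens_zero[of j us]] j by (simp add: length_factors)
  next
    fix u w assume "u \<in> ?W" "w \<in> ?W"
    then have "tens (us(j := u)) + tens (us(j := w)) \<in> reach" by (simp add: cvs.subspace_add[OF reach_subspace])
    then show "u + w \<in> ?W"
      using reach_null[of _ "tens (us(j := u + w))"] null_ops(4)[OF tens_add[of j us u w]] j
      by (force simp: length_factors algebra_simps)
  next
    fix c u assume "u \<in> ?W"
    then have "c *\<^sub>C tens (us(j := u)) \<in> reach" by (simp add: cvs.subspace_scale[OF reach_subspace])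
    then show "c *\<^sub>C u \<in> ?W"
      using reach_null[of _ "tens (us(j := c *\<^sub>C u))"] null_ops(4)[OF tens_scale[of j us c u]] j
      by (force simp: length_factors)
  qed
  have "us j \<in> ?W"
  proof (rule uea_left_induct[OF sub])
    show "1 \<in> ?W" using Suc by (auto intro!: Suc.hyps(1)[of "Suc j"] simp: less_Suc_eq)
    fix a w assume w: "w \<in> ?W"
    have "uea_of (hcomp b a) * w \<in> ?W" for b
      using reach_slot[OF j, of "us(j := w)" b a] w Suc.prems by simp
    then have "uea_of (hcomp 0 a) * w + uea_of (hcomp 1 a) * w \<in> ?W" by (intro cvs.subspace_add[OF sub])
    then show "uea_of a * w \<in> ?W"
      by (simp add: hcomp_decomp flip: distrib_right uea_of_add)
  qed
  then show ?case by simp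
qed

text \<open>The dual family of a tensor product consists of products of the functionals of the factors; these are multilinear and
hence vanish on the relators of the tensor product.\<close>

lemma tensor_coordinates:
  "\<exists>J (\<Psi> :: (nat \<Rightarrow> kac_kind \<times> nat) \<Rightarrow> sl12 poly uea \<Rightarrow> complex) E. finite J \<and> card J = (\<Prod>k<N. kac_dim (nu k)) \<and>
     (\<forall>j\<in>J. clin (\<Psi> j) \<and> (\<forall>u\<in>ann. \<Psi> j u = 0)) \<and> (\<forall>i\<in>J. \<forall>j\<in>J. \<Psi> j (E i) = (if i = j then 1 else 0))"
proof -
  have "\<forall>k. \<exists>I (\<phi> :: sl12 uea \<Rightarrow> kac_kind \<times> nat \<Rightarrow> complex) e. k < N \<longrightarrow> finite I \<and> card I = kac_dim (nu k) \<and>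
     (\<forall>b\<in>I. clin (\<lambda>u. \<phi> u b) \<and> (\<forall>u\<in>left_ideal (rels k). \<phi> u b = 0)) \<and>
     (\<forall>a\<in>I. \<forall>b\<in>I. \<phi> (e a) b = (if a = b then 1 else 0))"
  proof
    fix k
    show "\<exists>I (\<phi> :: sl12 uea \<Rightarrow> kac_kind \<times> nat \<Rightarrow> complex) e. k < N \<longrightarrow> finite I \<and> card I = kac_dim (nu k) \<and>
     (\<forall>b\<in>I. clin (\<lambda>u. \<phi> u b) \<and> (\<forall>u\<in>left_ideal (rels k). \<phi> u b = 0)) \<and>
     (\<forall>a\<in>I. \<forall>b\<in>I. \<phi> (e a) b = (if a = b then 1 else 0))"
      using kac_coordinates[of "nu k" "kp k"] nondeg[of k] by (cases "k < N") auto
  qed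
  from this[unfolded choice_iff] obtain I and \<phi> :: "nat \<Rightarrow> sl12 uea \<Rightarrow> kac_kind \<times> nat \<Rightarrow> complex" and e where
    coord: "\<forall>k. k < N \<longrightarrow> finite (I k) \<and> card (I k) = kac_dim (nu k) \<and>
     (\<forall>b\<in>I k. clin (\<lambda>u. \<phi> k u b) \<and> (\<forall>u\<in>left_ideal (rels k). \<phi> k u b = 0)) \<and>
     (\<forall>a\<in>I k. \<forall>b\<in>I k. \<phi> k (e k a) b = (if a = b then 1 else 0))"
    by blast
  have I: "\<And>k. k < N \<Longrightarrow> finite (I k)" "\<And>k. k < N \<Longrightarrow> card (I k) = kac_dim (nu k)"
    and \<phi>: "\<And>k b. k < N \<Longrightarrow> b \<in> I k \<Longrightarrow> clin (\<lambda>u. \<phi> k u b)"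
      "\<And>k b u. k < N \<Longrightarrow> b \<in> I k \<Longrightarrow> u \<in> left_ideal (rels k) \<Longrightarrow> \<phi> k u b = 0"
    and e: "\<And>k a b. k < N \<Longrightarrow> a \<in> I k \<Longrightarrow> b \<in> I k \<Longrightarrow> \<phi> k (e k a) b = (if a = b then 1 else 0)"
    using coord by blast+
  define J where "J = PiE {..<N} I"
  define rep where "rep k v = (SOME u. cls (rels k) u = v)" for k v
  have \<phi>_rep: "\<phi> k (rep k (cls (rels k) u)) b = \<phi> k u b" if k: "k < N" "b \<in> I k" for k b u
  proof -
    have "cls (rels k) (rep k (cls (rels k) u)) = cls (rels k) u" unfolding rep_def by (rule someI) (rule refl)
    then have "rep k (cls (rels k) u) - u \<in> left_ideal (rels k)"
      using lin_param.eq[OF uea_quot_param, of "rep k (cls (rels k) u)" u "rels k"] by simp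
    from \<phi>(2)[OF k this] show ?thesis using clin_diff[OF \<phi>(1)[OF k]] by simp
  qed
  define \<Phi> where "\<Phi> j = linext (\<lambda>vs. \<Prod>k<N. \<phi> k (rep k (vs ! k)) (j k))" for j
  have \<Phi>_lin: "clin (\<Phi> j)" for j unfolding \<Phi>_def by (rule clin_linext)
  have \<Phi>_tens: "\<Phi> j (tens us) = (\<Prod>k<N. \<phi> k (us k) (j k))" if j: "j \<in> J" for j us
  proof -
    have "\<Phi> j (tens us) = (\<Prod>k<N. \<phi> k (rep k (tuple us ! k)) (j k))"
      by (simp add: \<Phi>_def tens_def linext_single scaleC_one)
    also have "\<dots> = (\<Prod>k<N. \<phi> k (us k) (j k))"
      using j by (intro prod.cong) (auto simp: tuple_def length_factors \<phi>_rep J_def PiE_iff)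
    finally show ?thesis .
  qed
  have split: "(\<Prod>k<N. \<phi> k ((us(i := u)) k) (j k)) = \<phi> i u (j i) * (\<Prod>k\<in>{..<N} - {i}. \<phi> k (us k) (j k))"
    if "i < N" for i us u j
    using that by (subst prod.remove[of _ i]) (auto intro!: prod.cong)
  have \<Phi>_null: "\<Phi> j p = 0" if j: "j \<in> J" and p: "p \<in> null" for j p
  proof -
    have "\<Phi> j p \<in> {0}"
    proof (rule relators_induct[OF \<Phi>_lin _ _ _ p])
      show "cvs.subspace {0 :: complex}" by (simp add: cvs.subspace_def)
      fix us i c and u w :: "sl12 uea" assume "i < length factors"
      then have i: "i < N" by (simp add: length_factors)
      then have ji: "j i \<in> I i" using j by (auto simp: J_def PiE_iff)
      note lin = clin_add[OF \<phi>(1)[OF i ji]] clin_scale[OF \<phi>(1)[OF i ji]]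
      show "\<Phi> j (tens (us(i := u + w)) - tens (us(i := u)) - tens (us(i := w))) \<in> {0}"
        by (simp add: clin_diff[OF \<Phi>_lin] \<Phi>_tens[OF j] split[OF i] lin distrib_right del: fun_upd_apply)
      show "\<Phi> j (tens (us(i := c *\<^sub>C u)) - c *\<^sub>C tens (us(i := u))) \<in> {0}"
        by (simp add: clin_diff[OF \<Phi>_lin] clin_scale[OF \<Phi>_lin] \<Phi>_tens[OF j] split[OF i] lin scaleC_complex_def
            del: fun_upd_apply)
    qed
    then show ?thesis by simp
  qed
  have "\<forall>j. \<exists>U. V.uact U vac - tens (\<lambda>k. e k (j k)) \<in> null"
    using reach_tens[of 0] unfolding reach_def by simp
  from this[unfolded choice_iff]
  obtain E where E: "\<And>j. V.uact (E j) vac - tens (\<lambda>k. e k (j k)) \<in> null" by blast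
  define \<Psi> where "\<Psi> j u = \<Phi> j (V.uact u vac)" for j u
  have fin: "finite J" unfolding J_def by (rule finite_PiE) (auto simp: I)
  have card: "card J = (\<Prod>k<N. kac_dim (nu k))" by (simp add: J_def card_PiE I)
  have lin: "clin (\<Psi> j)" if j: "j \<in> J" for j
  proof (rule clinI)
    show "\<Psi> j (u + w) = \<Psi> j u + \<Psi> j w" for u w
      using \<Phi>_null[OF j orbit_lin(1)[of u w]] by (simp add: \<Psi>_def clin_diff[OF \<Phi>_lin] clin_add[OF \<Phi>_lin])
    show "\<Psi> j (c *\<^sub>C u) = c *\<^sub>C \<Psi> j u" for c u
      using \<Phi>_null[OF j orbit_lin(2)[of c u]] by (simp add: \<Psi>_def clin_diff[OF \<Phi>_lin] clin_scale[OF \<Phi>_lin])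
  qed
  have zero: "\<Psi> j u = 0" if "j \<in> J" "u \<in> ann" for j u
    using \<Phi>_null[OF that(1), of "V.uact u vac"] that(2) by (simp add: \<Psi>_def ann_def)
  have dual: "\<Psi> j (E i) = (if i = j then 1 else 0)" if ij: "i \<in> J" "j \<in> J" for i j
  proof -
    have "\<Psi> j (E i) = (\<Prod>k<N. \<phi> k (e k (i k)) (j k))"
      using \<Phi>_null[OF ij(2) E[of i]] by (simp add: \<Psi>_def clin_diff[OF \<Phi>_lin] \<Phi>_tens[OF ij(2)])
    also have "\<dots> = (\<Prod>k<N. if i k = j k then 1 else 0)"
      using ij by (intro prod.cong) (auto simp: e J_def PiE_iff)
    also have "\<dots> = (if i = j then 1 else 0)"
    proof (cases "i = j")
      case False
      then obtain k where "k < N" "i k \<noteq> j k" using ij PiE_ext[of i "{..<N}" I j] unfolding J_def by auto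
      then have "(\<Prod>k<N. if i k = j k then 1 else 0 :: complex) = 0" by (intro prod_zero) auto
      then show ?thesis using False by simp
    qed simp
    finally show ?thesis .
  qed
  show ?thesis
    using fin card lin zero dual
    by (intro exI[of _ J] exI[of _ \<Psi>] exI[of _ E] conjI ballI) simp_all
qed

end

section \<open>The isomorphism\<close>

text \<open>Used to cut the family of factors where the exponent changes from \<open>q\<close> to \<open>q + 1\<close>.\<close>

lemma (in comm_monoid_set) split_at:
  assumes "m \<le> N"
  shows "F g {..<N} = f (F g {..<N - m}) (F g {N - m..<(N :: nat)})"
proof -
  have "F g ({..<N - m} \<union> {N - m..<N}) = f (F g {..<N - m}) (F g {N - m..<N})"
    by (rule union_disjoint) auto
  moreover have "{..<N - m} \<union> {N - m..<N} = {..<N}" by auto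
  ultimately show ?thesis by (simp only:)
qed

lemma (in kac_fusion) fusion_product_eq:
  "fusion_product (map (\<lambda>k. kac_factor (kp k, of_nat (nu k)) (zz k)) [0..<N]) = gr_smodule V (proj vac)"
proof -
  let ?Vs = "map (\<lambda>k. kac_factor (kp k, of_nat (nu k)) (zz k)) [0..<N]"
  have 1: "map (\<lambda>(V, v, z). eval_smodule z V) ?Vs = factors"
    by (simp only: map_map o_def factors_def kac_factor_def kac_def prod.case)
  have 2: "map (\<lambda>(V, v, z). v) ?Vs = map (\<lambda>k. cls (rels k) 1) [0..<N]"
    by (simp only: map_map o_def kac_factor_def kac_vec_def cls_def prod.case)
  have "fusion_product ?Vs = gr_smodule (tensor_smodule (map (\<lambda>(V, v, z). eval_smodule z V) ?Vs))
      (pure_tensor (map (\<lambda>(V, v, z). eval_smodule z V) ?Vs) (map (\<lambda>(V, v, z). v) ?Vs))"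
    by (simp only: fusion_product_def Let_def)
  also have "\<dots> = gr_smodule V (pure_tensor factors (map (\<lambda>k. cls (rels k) 1) [0..<N]))"
    by (simp only: 1 2)
  finally show ?thesis by (simp only: proj_vac)
qed

lemma weyl_spanning_family:
  assumes "snd la = of_nat (q * N + m)" "m < N"
  shows "\<exists>F. finite F \<and> card F \<le> kac_dim q ^ (N - m) * kac_dim (q + 1) ^ m \<and>
    (\<forall>f\<in>F. \<exists>t. f \<in> uea_deg t) \<and> (\<forall>u. u \<in> cspan (F \<union> left_ideal (weyl_relators la N)))"
proof -
  have w: "truncated_weyl la N (q * N + m)"
    by (rule truncated_weyl.intro) (use assms in auto)
  show ?thesis
    using truncated_weyl.weyl_spanning_set[OF w refl assms(2)] unfolding truncated_weyl.L_def[OF w] .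
qed

lemma (in kac_fusion) weyl_iso_fusion:
  assumes "m < N" and la: "fst la = (\<Sum>k<N. kp k)" "snd la = of_nat (q * N + m)"
    and sum_nu: "(\<Sum>k<N. nu k) = q * N + m"
    and prod_nu: "(\<Prod>k<N. kac_dim (nu k)) = kac_dim q ^ (N - m) * kac_dim (q + 1) ^ m"
  shows "weyl la N \<cong>\<^sub>s fusion_product (map (\<lambda>k. kac_factor (kp k, of_nat (nu k)) (zz k)) [0..<N])"
proof -
  let ?L = "left_ideal (weyl_relators la N)"
  obtain F where F: "finite F" "card F \<le> kac_dim q ^ (N - m) * kac_dim (q + 1) ^ m"
      "\<And>f. f \<in> F \<Longrightarrow> \<exists>t. f \<in> uea_deg t" "\<And>u. u \<in> cspan (F \<union> ?L)"
    using weyl_spanning_family[OF la(2) assms(1)] by blast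
  obtain J and \<Psi> :: "(nat \<Rightarrow> kac_kind \<times> nat) \<Rightarrow> sl12 poly uea \<Rightarrow> complex" and E where
    coord: "finite J \<and> card J = (\<Prod>k<N. kac_dim (nu k)) \<and>
     (\<forall>j\<in>J. clin (\<Psi> j) \<and> (\<forall>u\<in>ann. \<Psi> j u = 0)) \<and> (\<forall>i\<in>J. \<forall>j\<in>J. \<Psi> j (E i) = (if i = j then 1 else 0))"
    using tensor_coordinates by blast
  have J: "finite J" "card J = (\<Prod>k<N. kac_dim (nu k))"
    and \<Psi>: "\<And>j. j \<in> J \<Longrightarrow> clin (\<Psi> j)" "\<And>j u. j \<in> J \<Longrightarrow> u \<in> ann \<Longrightarrow> \<Psi> j u = 0"
      "\<And>i j. i \<in> J \<Longrightarrow> j \<in> J \<Longrightarrow> \<Psi> j (E i) = (if i = j then 1 else 0)"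
    using coord by blast+
  have "?L = gann"
  proof (rule gann_eqI[OF left_ideal_subspace _ F(1) _ F(3,4) J(1) \<Psi>])
    show "?L \<subseteq> gann"
      by (rule gann_left_ideal, rule weyl_relators_gann[OF la(1)]) (simp only: la(2) sum_nu)
    show "card F \<le> card J" using F(2) by (simp only: J(2) prod_nu)
  qed
  then show ?thesis
    unfolding weyl_def fusion_product_eq by (rule gr_iso)
qed

theorem proposition5p6:
  fixes la :: weight and N q m :: nat and kap z :: "nat \<Rightarrow> complex"
  assumes "la \<in> Pplus"
    and "N > 0"
    and "snd la = of_nat (q * N + m)" and "m < N"
    and "(\<Sum>i = 1..N. kap i) = fst la"
    and "q = 0 \<Longrightarrow> \<forall>i\<in>{1..N - m}. kap i = 0"
    and "inj_on z {1..N}"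
  shows "weyl la N \<cong>\<^sub>s fusion_product
    (map (\<lambda>i. kac_factor (kap i, of_nat q) (z i)) [1..<N - m + 1] @
     map (\<lambda>i. kac_factor (kap i, of_nat (q + 1)) (z i)) [N - m + 1..<N + 1])"
proof -
  define kp where "kp k = kap (Suc k)" for k
  define zz where "zz k = z (Suc k)" for k
  define nu where "nu k = (if k < N - m then q else q + 1)" for k
  have fusion: "kac_fusion N kp nu zz"
  proof (rule kac_fusion.intro)
    show "inj_on zz {..<N}"
    proof (rule inj_onI)
      fix x y assume "x \<in> {..<N}" "y \<in> {..<N}" "zz x = zz y"
      then have "Suc x = Suc y"
        using inj_onD[OF assms(7), of "Suc x" "Suc y"] by (simp add: zz_def)
      then show "x = y" by simp
    qed
    show "kp k = 0" if "k < N" "nu k = 0" for k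
    proof -
      have "q = 0 \<and> k < N - m" using that(2) by (simp add: nu_def split: if_splits)
      then show ?thesis using assms(6) by (simp add: kp_def)
    qed
  qed
  have nu_low: "(\<Sum>k<N - m. nu k) = (N - m) * q" "(\<Prod>k<N - m. kac_dim (nu k)) = kac_dim q ^ (N - m)"
    by (simp_all add: nu_def)
  have high: "nu k = q + 1" if "k \<in> {N - m..<N}" for k using that by (simp add: nu_def)
  have nu_high: "(\<Sum>k\<in>{N - m..<N}. nu k) = m * (q + 1)" "(\<Prod>k\<in>{N - m..<N}. kac_dim (nu k)) = kac_dim (q + 1) ^ m"
    using assms(4) by (simp_all only: high sum_constant prod_constant cong: sum.cong prod.cong) simp_all
  have "(N - m) * q + m * (q + 1) = ((N - m) + m) * q + m" by (simp only: distrib_left distrib_right mult_1_right add.assoc)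
  then have sum_nu: "(\<Sum>k<N. nu k) = q * N + m"
    using assms(4) sum.split_at[OF less_imp_le[OF assms(4)], of nu] nu_low(1) nu_high(1) by (simp add: mult.commute)
  have prod_nu: "(\<Prod>k<N. kac_dim (nu k)) = kac_dim q ^ (N - m) * kac_dim (q + 1) ^ m"
    unfolding prod.split_at[OF less_imp_le[OF assms(4)]] nu_low(2) nu_high(2) ..
  have sum_kp: "fst la = (\<Sum>k<N. kp k)"
    using assms(5) by (simp add: kp_def sum.atLeast1_atMost_eq)
  have iso: "weyl la N \<cong>\<^sub>s fusion_product (map (\<lambda>k. kac_factor (kp k, of_nat (nu k)) (zz k)) [0..<N])"
    by (rule kac_fusion.weyl_iso_fusion[OF fusion assms(4) sum_kp assms(3) sum_nu prod_nu])
  let ?g = "\<lambda>i. kac_factor (kap i, of_nat (if i \<le> N - m then q else q + 1)) (z i)"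
  have "map (\<lambda>i. kac_factor (kap i, of_nat q) (z i)) [1..<N - m + 1] @
      map (\<lambda>i. kac_factor (kap i, of_nat (q + 1)) (z i)) [N - m + 1..<N + 1]
    = map ?g [1..<N - m + 1] @ map ?g [N - m + 1..<N + 1]"
    by (intro arg_cong2[of _ _ _ _ "(@)"] map_cong) auto
  also have "\<dots> = map ?g [1..<N + 1]"
    using upt_add_eq_append[of 1 "N - m + 1" m] assms(4) by (simp only: map_append[symmetric]) simp
  also have "\<dots> = map (\<lambda>k. ?g (Suc k)) [0..<N]"
    by (simp add: map_Suc_upt[symmetric] del: upt_Suc)
  also have "\<dots> = map (\<lambda>k. kac_factor (kp k, of_nat (nu k)) (zz k)) [0..<N]"
    by (simp add: kp_def zz_def nu_def Suc_le_eq)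
  finally show ?thesis using iso by (simp only:)
qed

end
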